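(* Let $n\ge2$ and let $(q,\eta)$ satisfy the boundary value problem \[ \Delta\phi=0\ \text{ in }\Omega,\qquad \nabla\phi\cdot N_{\mathcal B}=0\ \text{ on }\mathcal B_0,\qquad \nabla\phi\cdot N_{\mathcal S}=\eta_t\ \text{ on }\mathcal S_\eta,\qquad q(x,t)=\phi(x,\eta(x,t),t), \] for the flat bottom $\mathcal B_0=\{y=-h_0\}$. Let $s_1\ge\frac n2$, $s_2>n-\frac12$, and let the norms $\|\nabla\phi\|_{H^{s_1}(\Omega)}$ and $\|\eta\|_{H^{s_2}(\mathbf R^{n-1})}$ be (finite and) such that \[ \max\{\|\eta_t\|_{L^1},\ \|\eta\|_{L^\infty},\ \|\nabla_xq\|_{L^1}\}<\epsilon . \] Then \[ \hat\eta_t-\kappa\tanh[\kappa h_0]\,\hat q=O(\epsilon^2) \] for $\kappa<O(1/\epsilon)$, where $\kappa=|k|$.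
   Context: Irrotational water waves in $n$ spatial dimensions. Coordinates are $(x,y)\in\mathbf R^{n-1}\times\mathbf R$, $\nabla_x$ is the gradient in $x$, $\nabla=(\nabla_x,\partial_y)$; $h_0>0$ is constant; the free surface is $\mathcal S_\eta=\{y=\eta(x,t)\}$ with $\eta>-h_0$; $\Omega$ is the region between $\mathcal B_0$ and $\mathcal S_\eta$; $N_{\mathcal B}=(0,-1)$ and $N_{\mathcal S}=(-\nabla_x\eta,1)$. $L^p$ norms are over $\mathbf R^{n-1}$ at a given time $t$. The Fourier transform on $\mathcal S'(\mathbf R^{n-1})$ is $\hat f(k)=\int e^{-\mathrm ik\cdot x}f(x)\,\mathrm dx$, $k\in\mathbf R^{n-1}$ (defined by duality), $\hat\eta_t$ is the Fourier transform of $\eta_t$, and $\kappa=\sqrt{k_1^2+\cdots+k_{n-1}^2}$. $O(\epsilon^2)$ is understood for small $\epsilon$; the estimate is pointwise in $k$ and is not claimed to be uniform in $\kappa$; "$\kappa<O(1/\epsilon)$" means that $\kappa$ is restricted to be below order $1/\epsilon$ (sufficiently long wavelengths). *)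

theory Defs
  imports "HOL-Probability.Probability"
begin

section \<open>Partial derivatives\<close>

definition partial :: "'a::euclidean_space \<Rightarrow> ('a \<Rightarrow> 'b::real_normed_vector) \<Rightarrow> 'a \<Rightarrow> 'b" where
  "partial b f = (\<lambda>x. frechet_derivative f (at x) b)"

fun partials :: "'a::euclidean_space list \<Rightarrow> ('a \<Rightarrow> 'b::real_normed_vector) \<Rightarrow> 'a \<Rightarrow> 'b" where
  "partials [] f = f"
| "partials (b # bs) f = partial b (partials bs f)"

text \<open>The set \<open>U\<close> is meant to be open; \<open>differentiable_on\<close> guarantees that the Frechet derivatives
  used in \<open>partials\<close> are genuine.\<close>

definition Ck_on :: "nat \<Rightarrow> 'a::euclidean_space set \<Rightarrow> ('a \<Rightarrow> 'b::real_normed_vector) \<Rightarrow> bool" where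
  "Ck_on k U f \<longleftrightarrow>
     (\<forall>bs. set bs \<subseteq> Basis \<longrightarrow>
        (length bs < k \<longrightarrow> partials bs f differentiable_on U) \<and>
        (length bs \<le> k \<longrightarrow> continuous_on U (partials bs f)))"

definition grad :: "('a::euclidean_space \<Rightarrow> real) \<Rightarrow> 'a \<Rightarrow> 'a" where
  "grad f x = (\<Sum>b\<in>Basis. partial b f x *\<^sub>R b)"

definition harmonic_on :: "'a::euclidean_space set \<Rightarrow> ('a \<Rightarrow> real) \<Rightarrow> bool" where
  "harmonic_on U f \<longleftrightarrow> Ck_on 2 U f \<and> (\<forall>x\<in>U. (\<Sum>b\<in>Basis. partials [b, b] f x) = 0)"


section \<open>Schwartz functions and tempered distributions\<close>

definition schwartz :: "('a::euclidean_space \<Rightarrow> complex) \<Rightarrow> bool" where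
  "schwartz f \<longleftrightarrow> (\<forall>k. Ck_on k UNIV f) \<and>
     (\<forall>N bs. set bs \<subseteq> Basis \<longrightarrow> bounded (range (\<lambda>x. (1 + norm x) ^ N *\<^sub>R partials bs f x)))"

text \<open>A distribution is a functional on all functions, of which only the values at Schwartz functions
  matter.\<close>

type_synonym 'a distr = "('a \<Rightarrow> complex) \<Rightarrow> complex"

text \<open>Linearity, and continuity in the Schwartz seminorms: if all seminorms of order at most \<open>N\<close> of
  \<open>f\<close> are bounded by \<open>B\<close>, then \<open>T f\<close> is bounded by \<open>C * B\<close>.\<close>

definition tempered :: "'a::euclidean_space distr \<Rightarrow> bool" where
  "tempered T \<longleftrightarrow>
     (\<forall>f g. schwartz f \<longrightarrow> schwartz g \<longrightarrow> T (\<lambda>x. f x + g x) = T f + T g) \<and>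
     (\<forall>c f. schwartz f \<longrightarrow> T (\<lambda>x. c * f x) = c * T f) \<and>
     (\<exists>C N. \<forall>f B. schwartz f \<longrightarrow>
        (\<forall>bs x. set bs \<subseteq> Basis \<longrightarrow> length bs \<le> N \<longrightarrow> (1 + norm x) ^ N * norm (partials bs f x) \<le> B) \<longrightarrow>
        norm (T f) \<le> C * B)"

definition fun_distr :: "('a::euclidean_space \<Rightarrow> complex) \<Rightarrow> 'a distr" where
  "fun_distr u = (\<lambda>f. \<integral>x. u x * f x \<partial>lborel)"

definition represented_by :: "'a::euclidean_space distr \<Rightarrow> ('a \<Rightarrow> complex) \<Rightarrow> bool" where
  "represented_by T u \<longleftrightarrow> u \<in> borel_measurable lborel \<and>
     (\<forall>f. schwartz f \<longrightarrow> has_bochner_integral lborel (\<lambda>x. u x * f x) (T f))"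

definition tempered_function :: "('a::euclidean_space \<Rightarrow> complex) \<Rightarrow> bool" where
  "tempered_function u \<longleftrightarrow> represented_by (fun_distr u) u \<and> tempered (fun_distr u)"

definition fourier :: "('a::euclidean_space \<Rightarrow> complex) \<Rightarrow> 'a \<Rightarrow> complex" where
  "fourier f k = (\<integral>x. exp (- (\<i> * complex_of_real (k \<bullet> x))) * f x \<partial>lborel)"

definition fourier_distr :: "'a::euclidean_space distr \<Rightarrow> 'a distr" where
  "fourier_distr T = (\<lambda>f. T (fourier f))"

definition partial_distr :: "'a::euclidean_space \<Rightarrow> 'a distr \<Rightarrow> 'a distr" where
  "partial_distr b T = (\<lambda>f. - T (partial b f))"

text \<open>Meaningful for smooth \<open>m\<close> all of whose derivatives grow at most polynomially, such as
  \<open>m k = norm k * tanh (norm k * h)\<close>, which is a smooth function of \<open>(norm k)\<^sup>2\<close>.\<close>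

definition mult_distr :: "('a::euclidean_space \<Rightarrow> real) \<Rightarrow> 'a distr \<Rightarrow> 'a distr" where
  "mult_distr m T = (\<lambda>f. T (\<lambda>k. complex_of_real (m k) * f k))"

definition distr_gradient :: "('a::euclidean_space \<Rightarrow> real) \<Rightarrow> ('a \<Rightarrow> 'a) \<Rightarrow> bool" where
  "distr_gradient u g \<longleftrightarrow> (\<forall>b\<in>Basis.
     represented_by (partial_distr b (fun_distr (\<lambda>x. complex_of_real (u x))))
       (\<lambda>x. complex_of_real (g x \<bullet> b)))"


section \<open>Function spaces\<close>

definition L1_norm :: "('a::euclidean_space \<Rightarrow> 'b::real_normed_vector) \<Rightarrow> ennreal" where
  "L1_norm f = (\<integral>\<^sup>+x. ennreal (norm (f x)) \<partial>lborel)"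

definition Linf_norm :: "('a::euclidean_space \<Rightarrow> 'b::real_normed_vector) \<Rightarrow> ennreal" where
  "Linf_norm f = esssup lborel (\<lambda>x. ennreal (norm (f x)))"

text \<open>Membership in the (fractional) Sobolev space of order \<open>s \<ge> 0\<close>, i.e. finiteness of its norm: on the
  whole space the norm is the weighted square norm of the Fourier transform; on an open set it is the
  quotient (restriction) norm, finite iff there is an extension of finite norm.\<close>

definition in_sobolev :: "real \<Rightarrow> ('a::euclidean_space \<Rightarrow> complex) \<Rightarrow> bool" where
  "in_sobolev s f \<longleftrightarrow> tempered_function f \<and>
     (\<exists>F. represented_by (fourier_distr (fun_distr f)) F \<and>
          integrable lborel (\<lambda>k. (1 + (norm k)\<^sup>2) powr s * (norm (F k))\<^sup>2))"

definition in_sobolev_on :: "real \<Rightarrow> 'a::euclidean_space set \<Rightarrow> ('a \<Rightarrow> complex) \<Rightarrow> bool" where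
  "in_sobolev_on s U f \<longleftrightarrow>
     (\<exists>F. in_sobolev s F \<and> (AE x in lborel. x \<in> U \<longrightarrow> F x = f x))"


section \<open>The fluid domain and the boundary value problem\<close>

text \<open>Everything in this section is at a frozen time. Points of the fluid are pairs \<open>(x, y)\<close> of a
  horizontal and a vertical coordinate.\<close>

definition fluid_domain :: "real \<Rightarrow> ('a \<Rightarrow> real) \<Rightarrow> ('a \<times> real) set" where
  "fluid_domain h0 \<eta> = {(x, y). - h0 < y \<and> y < \<eta> x}"

text \<open>Boundary values are traces. For a function that is smooth inside the domain and locally
  \<open>H\<^sup>1\<close> up to the boundary (such as a harmonic potential whose gradient is \<open>H\<^sup>1\<close>, and the components of
  that gradient), the trace on a Lipschitz graph is the limit along almost every vertical line.\<close>

definition surface_trace ::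
    "('a::euclidean_space \<Rightarrow> real) \<Rightarrow> ('a \<times> real \<Rightarrow> real) \<Rightarrow> ('a \<Rightarrow> real) \<Rightarrow> bool" where
  "surface_trace \<eta> u g \<longleftrightarrow> (AE x in lborel. ((\<lambda>y. u (x, y)) \<longlongrightarrow> g x) (at_left (\<eta> x)))"

definition bottom_trace ::
    "real \<Rightarrow> ('a::euclidean_space \<times> real \<Rightarrow> real) \<Rightarrow> ('a \<Rightarrow> real) \<Rightarrow> bool" where
  "bottom_trace h0 u g \<longleftrightarrow> (AE x in lborel. ((\<lambda>y. u (x, y)) \<longlongrightarrow> g x) (at_right (- h0)))"

definition normal_bottom :: "'a::euclidean_space \<times> real" where
  "normal_bottom = (0, -1)"

text \<open>The surface normal needs a differentiable elevation. An elevation in \<open>H\<^sup>s\<close> on a \<open>d\<close>-dimensional space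
  with \<open>s > 1 + d / 2\<close> has a unique \<open>C\<^sup>1\<close> representative, by Sobolev embedding; this one is meant.\<close>

definition normal_surface :: "('a::euclidean_space \<Rightarrow> real) \<Rightarrow> 'a \<Rightarrow> 'a \<times> real" where
  "normal_surface \<eta> x = (- grad \<eta> x, 1)"

definition water_wave_bvp ::
    "real \<Rightarrow> ('a::euclidean_space \<Rightarrow> real) \<Rightarrow> ('a \<Rightarrow> real) \<Rightarrow> ('a \<times> real \<Rightarrow> real) \<Rightarrow> ('a \<Rightarrow> real) \<Rightarrow> bool" where
  "water_wave_bvp h0 \<eta> \<eta>t \<phi> q \<longleftrightarrow>
     harmonic_on (fluid_domain h0 \<eta>) \<phi> \<and>
     bottom_trace h0 (\<lambda>z. grad \<phi> z \<bullet> normal_bottom) (\<lambda>x. 0) \<and>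
     surface_trace \<eta> (\<lambda>z. grad \<phi> z \<bullet> normal_surface \<eta> (fst z)) \<eta>t \<and>
     surface_trace \<eta> \<phi> q"

end

theory Submission
  imports Defs "HOL-Complex_Analysis.Complex_Analysis" "HOL-Real_Asymp.Real_Asymp"
begin

text \<open>For a wave vector \<open>k \<noteq> 0\<close>, pair \<open>\<phi>\<close> by Green's identity with the harmonic function
  \<open>exp (- i k x) cosh (|k| (y + h0))\<close>, whose normal derivative vanishes at the bottom. The boundary terms at the surface
  combine into the nonlocal equation: the integral over \<open>x\<close> of
  \<open>exp (- i k x) (cosh (|k| (\<eta> + h0)) \<eta>t + i sinh (|k| (\<eta> + h0)) (k \<bullet> \<nabla>q) / |k|)\<close> vanishes. Replacing \<open>\<eta> + h0\<close> by
  \<open>h0\<close> costs \<open>O (|k| \<epsilon>)\<close> times the \<open>L\<^sup>1\<close> norms of \<open>\<eta>t\<close> and \<open>\<nabla>q\<close>, hence \<open>O (\<epsilon>\<^sup>2)\<close>, and division by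
  \<open>cosh (|k| h0)\<close> gives the claim.

  The fluid is horizontally unbounded and \<open>\<nabla>\<phi>\<close> is only square integrable, whereas the mode does not decay. The
  identity is therefore first proved with a cutoff in \<open>x\<close>; averaging the error over a bounded set of wave vectors turns the
  mode into a Fourier transform, which is square integrable by Plancherel, so that the error vanishes as the cutoff is
  removed. The nonlocal equation follows for almost every \<open>k\<close>, and the estimate for every \<open>k\<close> by continuity.\<close>


section \<open>Schwartz functions\<close>

text \<open>Two obstacles shape the details. Boundary values exist only as limits along almost every
  vertical line. The fluid is therefore flattened into levels at height \<open>s * rho\<close> above
  the bottom, and Green's identity is written between interior levels. Along each line the gradient
  is bounded by its mean plus its variation, a one-dimensional Sobolev bound, and this dominates the
  passage to surface and bottom; the regularity of the gradient serves this purpose. Moreover, the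
  potential itself is not controlled globally. On a level the normal derivative of the mode is a
  tangential divergence, so the term with the undifferentiated potential can be integrated by parts;
  only derivatives of \<open>\<phi>\<close> and, on the surface, the weak gradient of
  \<open>q\<close> remain. In the same spirit the symbol of the flat interface is
  \<open>(norm k)^2\<close> times a smooth function, and one factor \<open>k\<close> turns the
  transform of \<open>q\<close>, a mere distribution, into that of its integrable gradient. Finally,
  the average vanishes over every bounded measurable set of nonzero wave vectors, so the set may be
  chosen where the amplitude has a sign.\<close>

lemma partial_eq: "(f has_derivative f') (at x) \<Longrightarrow> partial b f x = f' b"
  unfolding partial_def by (metis frechet_derivative_at)

lemma partials_append: "partials (as @ bs) f = partials as (partials bs f)"
  by (induction as) auto

section \<open>Rapid decay and polynomial growth\<close>

definition rapid :: "('a::euclidean_space \<Rightarrow> complex) \<Rightarrow> bool" where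
  "rapid u \<longleftrightarrow> (\<forall>N. \<exists>C. \<forall>x. (1 + norm x) ^ N * norm (u x) \<le> C)"

definition poly_bounded :: "('a::euclidean_space \<Rightarrow> complex) \<Rightarrow> bool" where
  "poly_bounded u \<longleftrightarrow> (\<exists>C N. \<forall>x. norm (u x) \<le> C * (1 + norm x) ^ N)"

lemma rapidD:
  fixes u :: "'a::euclidean_space \<Rightarrow> complex"
  assumes "rapid u"
  obtains C where "C \<ge> 0" "\<And>x. (1 + norm x) ^ N * norm (u x) \<le> C"
proof -
  obtain C where C: "\<And>x. (1 + norm x) ^ N * norm (u x) \<le> C"
    using assms unfolding rapid_def by blast
  have "0 \<le> (1 + norm (0::'a)) ^ N * norm (u 0)" by simp
  also have "\<dots> \<le> C" by (rule C)
  finally show thesis using that C by blast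
qed

lemma rapid_poly_mult:
  assumes "poly_bounded m" "rapid u"
  shows "rapid (\<lambda>x. m x * u x)"
  unfolding rapid_def
proof
  fix N
  obtain C M where CM: "\<And>x. norm (m x) \<le> C * (1 + norm x) ^ M"
    using assms(1) unfolding poly_bounded_def by blast
  obtain D where D: "\<And>x. (1 + norm x) ^ (N + M) * norm (u x) \<le> D" "D \<ge> 0"
    using rapidD[OF assms(2)] by metis
  have C: "C \<ge> 0" using order_trans[OF norm_ge_zero CM, of 0] by simp
  show "\<exists>C. \<forall>x. (1 + norm x) ^ N * norm (m x * u x) \<le> C"
  proof (intro exI allI)
    fix x
    have "(1 + norm x) ^ N * norm (m x * u x) = norm (m x) * ((1 + norm x) ^ N * norm (u x))"
      by (simp add: norm_mult)
    also have "\<dots> \<le> (C * (1 + norm x) ^ M) * ((1 + norm x) ^ N * norm (u x))"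
      by (intro mult_right_mono CM) simp
    also have "\<dots> = C * ((1 + norm x) ^ (N + M) * norm (u x))"
      by (simp add: power_add mult_ac)
    also have "\<dots> \<le> C * D" by (intro mult_left_mono D C)
    finally show "(1 + norm x) ^ N * norm (m x * u x) \<le> C * D" .
  qed
qed

lemma poly_bounded_coord: "b \<in> Basis \<Longrightarrow> poly_bounded (\<lambda>x. complex_of_real (x \<bullet> b))"
  unfolding poly_bounded_def
  by (rule exI[of _ 1], rule exI[of _ 1]) (auto intro: order_trans[OF Basis_le_norm])

lemma poly_bounded_const: "poly_bounded (\<lambda>x. c)"
  unfolding poly_bounded_def by (rule exI[of _ "norm c"], rule exI[of _ 0]) auto

lemma poly_bounded_mult:
  assumes "poly_bounded u" "poly_bounded v"
  shows "poly_bounded (\<lambda>x. u x * v x)"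
proof -
  obtain C M where 1: "\<And>x. norm (u x) \<le> C * (1 + norm x) ^ M"
    using assms(1) unfolding poly_bounded_def by blast
  obtain D N where 2: "\<And>x. norm (v x) \<le> D * (1 + norm x) ^ N"
    using assms(2) unfolding poly_bounded_def by blast
  have "norm (u x * v x) \<le> (C * D) * (1 + norm x) ^ (M + N)" for x
    using mult_mono[OF 1[of x] 2[of x]] order_trans[OF norm_ge_zero 1[of x]]
    by (simp add: norm_mult power_add mult_ac)
  then show ?thesis unfolding poly_bounded_def by blast
qed

lemma poly_bounded_add:
  assumes "poly_bounded u" "poly_bounded v"
  shows "poly_bounded (\<lambda>x. u x + v x)"
proof -
  obtain C M where 1: "\<And>x. norm (u x) \<le> C * (1 + norm x) ^ M"
    using assms(1) unfolding poly_bounded_def by blast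
  obtain D N where 2: "\<And>x. norm (v x) \<le> D * (1 + norm x) ^ N"
    using assms(2) unfolding poly_bounded_def by blast
  have C: "C \<ge> 0" "D \<ge> 0"
    using order_trans[OF norm_ge_zero 1, of 0] order_trans[OF norm_ge_zero 2, of 0] by auto
  have "norm (u x + v x) \<le> (C + D) * (1 + norm x) ^ (M + N)" for x
  proof -
    have "norm (u x + v x) \<le> C * (1 + norm x) ^ M + D * (1 + norm x) ^ N"
      using norm_triangle_mono[OF 1 2] .
    also have "\<dots> \<le> C * (1 + norm x) ^ (M + N) + D * (1 + norm x) ^ (M + N)"
      using C by (intro add_mono mult_left_mono power_increasing) auto
    finally show ?thesis by (simp add: algebra_simps)
  qed
  then show ?thesis unfolding poly_bounded_def by blast
qed

lemma rapid_add:
  assumes "rapid u" "rapid v"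
  shows "rapid (\<lambda>x. u x + v x)"
  unfolding rapid_def
proof
  fix N
  obtain C D where C: "\<And>x. (1 + norm x) ^ N * norm (u x) \<le> C"
    and D: "\<And>x. (1 + norm x) ^ N * norm (v x) \<le> D"
    using assms unfolding rapid_def by blast
  have "(1 + norm x) ^ N * norm (u x + v x) \<le> C + D" for x
  proof -
    have "(1 + norm x) ^ N * norm (u x + v x) \<le> (1 + norm x) ^ N * (norm (u x) + norm (v x))"
      by (intro mult_left_mono norm_triangle_ineq) auto
    also have "\<dots> \<le> C + D" using C[of x] D[of x] by (simp add: algebra_simps)
    finally show ?thesis .
  qed
  then show "\<exists>C. \<forall>x. (1 + norm x) ^ N * norm (u x + v x) \<le> C" by blast
qed

lemma differentiable_imp_continuous_UNIV:
  "(\<And>x. u differentiable (at x)) \<Longrightarrow> continuous_on UNIV u"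
  by (simp add: continuous_at_imp_continuous_on differentiable_imp_continuous_within)

text \<open>Decay comes from boundedness: \<open>norm x\<close> is at most the sum of the absolute
  coordinates, so bounds of order \<open>N\<close> for all products of a member with a coordinate
  yield a bound of order \<open>Suc N\<close> for the member itself. Closure under
  \<open>partial\<close> carries this to every derivative. A class thus only has to be stable and
  bounded, and no seminorm is ever estimated directly.\<close>

lemma schwartz_class:
  fixes C :: "('a::euclidean_space \<Rightarrow> complex) set"
  assumes diff: "\<And>u x. u \<in> C \<Longrightarrow> u differentiable (at x)"
    and bd: "\<And>u. u \<in> C \<Longrightarrow> bounded (range u)"
    and part: "\<And>u b. u \<in> C \<Longrightarrow> b \<in> Basis \<Longrightarrow> partial b u \<in> C"
    and coord: "\<And>u b. u \<in> C \<Longrightarrow> b \<in> Basis \<Longrightarrow> (\<lambda>x. complex_of_real (x \<bullet> b) * u x) \<in> C"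
    and u: "u \<in> C"
  shows "schwartz u"
proof -
  have parts: "partials bs u \<in> C" if "set bs \<subseteq> Basis" for bs
    using that by (induction bs) (auto intro: u part)
  have decay: "\<exists>K. \<forall>x. (1 + norm x) ^ N * norm (v x) \<le> K" if "v \<in> C" for v N
    using that
  proof (induction N arbitrary: v)
    case 0
    then show ?case using bd[OF 0] by (auto simp: bounded_iff)
  next
    case (Suc N)
    obtain K0 where K0: "\<And>x. (1 + norm x) ^ N * norm (v x) \<le> K0"
      using Suc by blast
    have "\<forall>b\<in>Basis. \<exists>K. \<forall>x. (1 + norm x) ^ N * norm (complex_of_real (x \<bullet> b) * v x) \<le> K"
      using Suc coord by blast
    then obtain K where K: "\<And>b x. b \<in> Basis \<Longrightarrow> (1 + norm x) ^ N * norm (complex_of_real (x \<bullet> b) * v x) \<le> K b"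
      by metis
    have "(1 + norm x) ^ Suc N * norm (v x) \<le> K0 + (\<Sum>b\<in>Basis. K b)" for x
    proof -
      have "(1 + norm x) ^ Suc N * norm (v x) = (1 + norm x) * ((1 + norm x) ^ N * norm (v x))"
        by simp
      also have "\<dots> \<le> (1 + (\<Sum>b\<in>Basis. \<bar>x \<bullet> b\<bar>)) * ((1 + norm x) ^ N * norm (v x))"
        by (intro mult_right_mono add_left_mono norm_le_l1) auto
      also have "\<dots> = (1 + norm x) ^ N * norm (v x)
          + (\<Sum>b\<in>Basis. (1 + norm x) ^ N * norm (complex_of_real (x \<bullet> b) * v x))"
        by (simp add: distrib_right sum_distrib_right norm_mult) (simp add: mult_ac)
      also have "\<dots> \<le> K0 + (\<Sum>b\<in>Basis. K b)"
        by (intro add_mono sum_mono K0 K)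
      finally show ?thesis .
    qed
    then show ?case by blast
  qed
  show ?thesis
    unfolding schwartz_def Ck_on_def
  proof (intro conjI allI impI)
    fix k bs assume bs: "set bs \<subseteq> (Basis::'a set)"
    show "partials bs u differentiable_on UNIV"
      using diff[OF parts[OF bs]] by (simp add: differentiable_on_def)
    show "continuous_on UNIV (partials bs u)"
      using diff[OF parts[OF bs]] by (rule differentiable_imp_continuous_UNIV)
  next
    fix N and bs :: "'a list" assume bs: "set bs \<subseteq> Basis"
    show "bounded (range (\<lambda>x. (1 + norm x) ^ N *\<^sub>R partials bs u x))"
      using decay[OF parts[OF bs], of N] by (auto simp: bounded_iff)
  qed
qed

lemma schwartz_differentiable: "schwartz f \<Longrightarrow> f differentiable (at x)"
proof -
  assume "schwartz f"
  then have "Ck_on 1 UNIV f" unfolding schwartz_def by blast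
  then have "partials [] f differentiable_on UNIV" unfolding Ck_on_def by force
  then show ?thesis by (simp add: differentiable_on_def)
qed

lemma schwartz_partial:
  assumes "schwartz f" "b \<in> Basis"
  shows "schwartz (partial b f)"
proof -
  have p: "partials bs (partial b f) = partials (bs @ [b]) f" for bs
    by (simp add: partials_append)
  have "Ck_on k UNIV (partial b f)" for k
  proof -
    have "Ck_on (Suc k) UNIV f" using assms unfolding schwartz_def by blast
    then show ?thesis unfolding Ck_on_def p
      using assms(2) by auto
  qed
  moreover have "bounded (range (\<lambda>x. (1 + norm x) ^ N *\<^sub>R partials bs (partial b f) x))"
    if "set bs \<subseteq> Basis" for N bs
    using assms that unfolding p schwartz_def by auto
  ultimately show ?thesis unfolding schwartz_def by blast
qed

lemma schwartz_rapid: "schwartz f \<Longrightarrow> rapid f"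
proof -
  assume f: "schwartz f"
  have "bounded (range (\<lambda>x. (1 + norm x) ^ N *\<^sub>R partials [] f x))" for N
    using f unfolding schwartz_def by (metis empty_subsetI list.set(1))
  then show "rapid f" unfolding rapid_def bounded_iff by auto
qed

lemma schwartz_continuous: "schwartz f \<Longrightarrow> continuous_on UNIV f"
  by (intro differentiable_imp_continuous_UNIV schwartz_differentiable)

lemma schwartz_measurable [measurable_dest]: "schwartz f \<Longrightarrow> f \<in> borel_measurable borel"
  by (intro borel_measurable_continuous_onI schwartz_continuous)

lemma partial_mult:
  fixes u v :: "'a::euclidean_space \<Rightarrow> complex"
  assumes "u differentiable (at x)" "v differentiable (at x)"
  shows "partial b (\<lambda>x. u x * v x) x = u x * partial b v x + partial b u x * v x"
  using has_derivative_mult[OF assms[unfolded frechet_derivative_works]]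
  by (subst partial_eq, assumption) (simp add: partial_def)

lemma partial_add:
  assumes "u differentiable (at x)" "v differentiable (at x)"
  shows "partial b (\<lambda>x. u x + v x) x = partial b u x + partial b v x"
  using has_derivative_add[OF assms[unfolded frechet_derivative_works]]
  by (subst partial_eq, assumption) (simp add: partial_def)

lemma has_derivative_coord: "((\<lambda>x. complex_of_real (x \<bullet> b)) has_derivative (\<lambda>h. complex_of_real (h \<bullet> b))) (at x)"
  by (auto intro!: derivative_eq_intros)

lemma partial_coord: "partial c (\<lambda>x. complex_of_real (x \<bullet> b)) x = complex_of_real (c \<bullet> b)"
  by (rule partial_eq[OF has_derivative_coord])

lemma differentiable_coord: "(\<lambda>x. complex_of_real (x \<bullet> b)) differentiable (at x)"
  using has_derivative_coord unfolding differentiable_def by blast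

lemma partial_const: "partial b (\<lambda>x. c) x = 0"
  by (rule partial_eq[where f' = "\<lambda>h. 0"]) simp

text \<open>Being Schwartz is proved coinductively: a class of rapidly decreasing functions that is closed under
  partial derivatives consists of Schwartz functions.\<close>

inductive_set product_class :: "('a::euclidean_space \<Rightarrow> complex) set \<Rightarrow> ('a \<Rightarrow> complex) set" for M where
  base: "m \<in> M \<Longrightarrow> schwartz f \<Longrightarrow> (\<lambda>x. m x * f x) \<in> product_class M"
| coord: "u \<in> product_class M \<Longrightarrow> b \<in> Basis \<Longrightarrow> (\<lambda>x. complex_of_real (x \<bullet> b) * u x) \<in> product_class M"
| scale: "u \<in> product_class M \<Longrightarrow> (\<lambda>x. c * u x) \<in> product_class M"
| add: "u \<in> product_class M \<Longrightarrow> v \<in> product_class M \<Longrightarrow> (\<lambda>x. u x + v x) \<in> product_class M"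

text \<open>Smooth functions all of whose derivatives grow at most polynomially, encoded by a family
  stable under \<open>partial\<close>, so that smoothness need not be stated order by order. The
  degree of growth may change from one member to the next.\<close>

definition multiplier_class :: "('a::euclidean_space \<Rightarrow> complex) set \<Rightarrow> bool" where
  "multiplier_class M \<longleftrightarrow> (\<forall>m\<in>M. (\<forall>x. m differentiable (at x)) \<and> poly_bounded m \<and> (\<forall>b\<in>Basis. partial b m \<in> M))"

lemma product_class_properties:
  fixes M :: "('a::euclidean_space \<Rightarrow> complex) set"
  assumes M: "multiplier_class M" and u: "u \<in> product_class M"
  shows "(\<forall>x. u differentiable (at x)) \<and> rapid u \<and> (\<forall>b\<in>Basis. partial b u \<in> product_class M)"
  using u
proof induction
  case (base m f)
  have d: "m differentiable (at x)" "f differentiable (at x)" for x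
    using base M schwartz_differentiable unfolding multiplier_class_def by auto
  have "partial b (\<lambda>x. m x * f x) = (\<lambda>x. m x * partial b f x + partial b m x * f x)" for b
    by (rule ext) (rule partial_mult[OF d])
  moreover have "(\<lambda>x. m x * partial b f x + partial b m x * f x) \<in> product_class M" if "b \<in> Basis" for b
    using base M that unfolding multiplier_class_def
    by (intro product_class.add product_class.base schwartz_partial) auto
  moreover have "rapid (\<lambda>x. m x * f x)"
    using base M unfolding multiplier_class_def by (intro rapid_poly_mult schwartz_rapid) auto
  ultimately show ?case using d by (auto intro!: differentiable_mult)
next
  case (coord u c)
  then have d: "u differentiable (at x)" for x by blast
  have "partial b (\<lambda>x. complex_of_real (x \<bullet> c) * u x) = (\<lambda>x. complex_of_real (x \<bullet> c) * partial b u x + complex_of_real (b \<bullet> c) * u x)" for b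
    by (rule ext) (simp add: partial_mult[OF differentiable_coord d] partial_coord)
  moreover have "(\<lambda>x. complex_of_real (x \<bullet> c) * partial b u x + complex_of_real (b \<bullet> c) * u x) \<in> product_class M"
    if "b \<in> Basis" for b
    using coord that by (intro product_class.add product_class.coord product_class.scale) auto
  moreover have "rapid (\<lambda>x. complex_of_real (x \<bullet> c) * u x)"
    using coord by (intro rapid_poly_mult poly_bounded_coord) auto
  ultimately show ?case using d by (auto intro!: differentiable_mult differentiable_coord)
next
  case (scale u c)
  then have d: "u differentiable (at x)" for x by blast
  have "partial b (\<lambda>x. c * u x) = (\<lambda>x. c * partial b u x)" for b
    by (rule ext) (simp add: partial_mult[OF differentiable_const d] partial_const)
  moreover have "(\<lambda>x. c * partial b u x) \<in> product_class M" if "b \<in> Basis" for b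
    using scale that by (intro product_class.scale) auto
  moreover have "rapid (\<lambda>x. c * u x)"
    using scale by (intro rapid_poly_mult poly_bounded_const) auto
  ultimately show ?case using d by (auto intro!: differentiable_mult)
next
  case (add u v)
  then have d: "u differentiable (at x)" "v differentiable (at x)" for x by blast+
  have "partial b (\<lambda>x. u x + v x) = (\<lambda>x. partial b u x + partial b v x)" for b
    by (rule ext) (simp add: partial_add[OF d])
  moreover have "(\<lambda>x. partial b u x + partial b v x) \<in> product_class M" if "b \<in> Basis" for b
    using add that by (intro product_class.add) auto
  moreover have "rapid (\<lambda>x. u x + v x)"
    using add by (intro rapid_add) auto
  ultimately show ?case using d by (auto intro!: differentiable_add)
qed

lemma rapid_bounded: "rapid u \<Longrightarrow> bounded (range u)"
  unfolding rapid_def bounded_iff by (drule spec[of _ 0]) auto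

lemma schwartz_product_class:
  assumes M: "multiplier_class M" and u: "u \<in> product_class M"
  shows "schwartz u"
  by (rule schwartz_class[of "product_class M"])
     (use product_class_properties[OF M] rapid_bounded u in \<open>auto intro: product_class.coord\<close>)

lemma schwartz_mult:
  assumes "multiplier_class M" "m \<in> M" "schwartz f"
  shows "schwartz (\<lambda>x. m x * f x)"
  by (intro schwartz_product_class[OF assms(1)] product_class.base assms)

text \<open>With constants as multipliers, \<open>product_class\<close> contains every Schwartz
  function, and its closure under coordinates and scalars passes to the Schwartz functions without
  further estimates.\<close>

lemma multiplier_class_const: "multiplier_class (range (\<lambda>c x. c))"
proof -
  have "partial b (\<lambda>x. c) = (\<lambda>x. 0)" for b :: "'a::euclidean_space" and c :: complex
    by (rule ext) (rule partial_const)
  then show ?thesis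
    unfolding multiplier_class_def using poly_bounded_const by auto
qed

lemma schwartz_in_const_class: "schwartz f \<Longrightarrow> f \<in> product_class (range (\<lambda>c x. c))"
  using product_class.base[of "\<lambda>x. 1" "range (\<lambda>c x. c)" f] by auto

lemma schwartz_coord:
  assumes "schwartz f" "b \<in> Basis"
  shows "schwartz (\<lambda>x. complex_of_real (x \<bullet> b) * f x)"
  using schwartz_product_class[OF multiplier_class_const product_class.coord[OF schwartz_in_const_class]] assms by blast

lemma schwartz_scale: "schwartz f \<Longrightarrow> schwartz (\<lambda>x. c * f x)"
  using schwartz_product_class[OF multiplier_class_const product_class.scale[OF schwartz_in_const_class]] by blast

text \<open>The Frechet derivative of a modulated Gaussian stays in the class of polynomial multiples of it.\<close>

inductive_set hermite_class :: "('a::euclidean_space \<Rightarrow> complex) \<Rightarrow> ('a \<Rightarrow> complex) set" for G where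
  base: "G \<in> hermite_class G"
| coord: "u \<in> hermite_class G \<Longrightarrow> b \<in> Basis \<Longrightarrow> (\<lambda>x. complex_of_real (x \<bullet> b) * u x) \<in> hermite_class G"
| scale: "u \<in> hermite_class G \<Longrightarrow> (\<lambda>x. c * u x) \<in> hermite_class G"
| add: "u \<in> hermite_class G \<Longrightarrow> v \<in> hermite_class G \<Longrightarrow> (\<lambda>x. u x + v x) \<in> hermite_class G"

text \<open>The frequency \<open>z\<close> modulates the Gaussian. By
  \<open>fourier_gaussian\<close> the transform is a multiple of the heat kernel at time
  \<open>d\<close> centred at \<open>z\<close>, so testing a distribution's transform against such
  Gaussians amounts to convolving the distribution with heat kernels.\<close>

definition gaussian :: "'a::euclidean_space \<Rightarrow> real \<Rightarrow> 'a \<Rightarrow> complex" where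
  "gaussian z d x = exp (\<i> * complex_of_real (x \<bullet> z) - complex_of_real (d * (norm x)\<^sup>2))"

lemma norm_gaussian: "norm (gaussian z d x) = exp (- d * (norm x)\<^sup>2)"
  by (simp add: gaussian_def)

lemma gaussian_rapid:
  assumes "d > 0"
  shows "rapid (gaussian z d)"
  unfolding rapid_def
proof
  fix N
  have "((\<lambda>r. (1 + r) ^ N * exp (- d * r\<^sup>2)) \<longlongrightarrow> 0) at_top"
    using assms by real_asymp
  then have "eventually (\<lambda>r. (1 + r) ^ N * exp (- d * r\<^sup>2) < 1) at_top"
    by (rule order_tendstoD) simp
  then obtain R where R: "\<And>r. r \<ge> R \<Longrightarrow> (1 + r) ^ N * exp (- d * r\<^sup>2) < 1"
    by (auto simp: eventually_at_top_linorder)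
  have "(1 + norm x) ^ N * norm (gaussian z d x) \<le> max 1 ((1 + \<bar>R\<bar>) ^ N)" for x
  proof (cases "norm x \<ge> R")
    case True
    then show ?thesis using R[of "norm x"] by (intro max.coboundedI1) (simp add: norm_gaussian)
  next
    case False
    have "(1 + norm x) ^ N * norm (gaussian z d x) \<le> (1 + \<bar>R\<bar>) ^ N * 1"
      using False assms by (intro mult_mono power_mono) (auto simp: norm_gaussian)
    then show ?thesis by auto
  qed
  then show "\<exists>C. \<forall>x. (1 + norm x) ^ N * norm (gaussian z d x) \<le> C" by blast
qed

lemma has_derivative_gaussian:
  "(gaussian z d has_derivative (\<lambda>h. (\<i> * complex_of_real (h \<bullet> z) + complex_of_real (- 2 * d * (x \<bullet> h))) * gaussian z d x)) (at x)"
proof -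
  have 1: "((\<lambda>x. \<i> * complex_of_real (x \<bullet> z) - complex_of_real (d * (norm x)\<^sup>2)) has_derivative
      (\<lambda>h. \<i> * complex_of_real (h \<bullet> z) + complex_of_real (- 2 * d * (x \<bullet> h)))) (at x)"
    unfolding power2_norm_eq_inner
    by (auto intro!: derivative_eq_intros simp: inner_commute algebra_simps)
  have 2: "(exp has_derivative (*) (exp y)) (at y)" for y :: complex
    using DERIV_exp[of y] unfolding has_field_derivative_def .
  show ?thesis
    using has_derivative_compose[OF 1 2] unfolding gaussian_def by (simp add: mult.commute)
qed

lemma hermite_class_properties:
  assumes "d > 0" "u \<in> hermite_class (gaussian z d)"
  shows "(\<forall>x. u differentiable (at x)) \<and> rapid u \<and> (\<forall>b\<in>Basis. partial b u \<in> hermite_class (gaussian z d))"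
  using assms(2)
proof induction
  case base
  have "partial b (gaussian z d) = (\<lambda>x. (\<i> * complex_of_real (b \<bullet> z)) * gaussian z d x + complex_of_real (- 2 * d) * (complex_of_real (x \<bullet> b) * gaussian z d x))" for b
    by (rule ext) (simp add: partial_eq[OF has_derivative_gaussian] algebra_simps)
  moreover have "gaussian z d differentiable (at x)" for x
    using has_derivative_gaussian unfolding differentiable_def by blast
  moreover have "(\<lambda>x. (\<i> * complex_of_real (b \<bullet> z)) * gaussian z d x + complex_of_real (- 2 * d) * (complex_of_real (x \<bullet> b) * gaussian z d x)) \<in> hermite_class (gaussian z d)"
    if "b \<in> Basis" for b
    using that by (intro hermite_class.intros)
  ultimately show ?case using gaussian_rapid[OF assms(1)] by simp
next
  case (coord u c)
  then have d: "u differentiable (at x)" for x by blast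
  have "partial b (\<lambda>x. complex_of_real (x \<bullet> c) * u x) = (\<lambda>x. complex_of_real (x \<bullet> c) * partial b u x + complex_of_real (b \<bullet> c) * u x)" for b
    by (rule ext) (simp add: partial_mult[OF differentiable_coord d] partial_coord)
  then show ?case using d coord by (auto intro!: differentiable_mult differentiable_coord
    hermite_class.add hermite_class.coord hermite_class.scale rapid_poly_mult poly_bounded_coord)
next
  case (scale u c)
  then have d: "u differentiable (at x)" for x by blast
  have "partial b (\<lambda>x. c * u x) = (\<lambda>x. c * partial b u x)" for b
    by (rule ext) (simp add: partial_mult[OF differentiable_const d] partial_const)
  then show ?case using d scale by (auto intro!: differentiable_mult
    hermite_class.scale rapid_poly_mult poly_bounded_const)
next
  case (add u v)
  then have d: "u differentiable (at x)" "v differentiable (at x)" for x by blast+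
  have "partial b (\<lambda>x. u x + v x) = (\<lambda>x. partial b u x + partial b v x)" for b
    by (rule ext) (simp add: partial_add[OF d])
  then show ?case using d add by (auto intro!: differentiable_add hermite_class.add rapid_add)
qed

lemma schwartz_gaussian:
  assumes "d > 0"
  shows "schwartz (gaussian z d)"
  by (rule schwartz_class[of "hermite_class (gaussian z d)"])
     (use hermite_class_properties[OF assms, of _ z] rapid_bounded in \<open>auto intro: hermite_class.intros\<close>)


section \<open>Fourier transform of integrable functions\<close>

lemma
  fixes f :: "'a::euclidean_space \<Rightarrow> 'b::{banach, second_countable_topology}"
  assumes [measurable]: "f \<in> borel_measurable borel"
  shows integral_shift: "(\<integral>x. f (c + x) \<partial>lborel) = (\<integral>x. f x \<partial>lborel)"
    and integrable_shift_iff: "integrable lborel (\<lambda>x. f (c + x)) \<longleftrightarrow> integrable lborel f"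
  using integral_distr[of "(+) c" lborel borel f] integrable_distr_eq[of "(+) c" lborel borel f]
  by (simp_all add: lborel_distr_plus)

lemma lborel_distr_reflect: "distr lborel borel (uminus :: 'a \<Rightarrow> 'a::euclidean_space) = lborel"
  using lborel_affine[of "-1" "0::'a"] by (simp add: density_1)

lemma
  fixes f :: "'a::euclidean_space \<Rightarrow> 'b::{banach, second_countable_topology}"
  assumes [measurable]: "f \<in> borel_measurable borel"
  shows integral_reflect: "(\<integral>x. f (- x) \<partial>lborel) = (\<integral>x. f x \<partial>lborel)"
    and integrable_reflect_iff: "integrable lborel (\<lambda>x. f (- x)) \<longleftrightarrow> integrable lborel f"
  using integral_distr[of "uminus" lborel borel f] integrable_distr_eq[of "uminus" lborel borel f]
  by (simp_all add: lborel_distr_reflect)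

lemma nn_integral_shift:
  assumes [measurable]: "f \<in> borel_measurable borel"
  shows "(\<integral>\<^sup>+x. f (c + x) \<partial>lborel) = (\<integral>\<^sup>+(x::'a::euclidean_space). f x \<partial>lborel)"
  using nn_integral_distr[of "(+) c" lborel borel f] by (simp add: lborel_distr_plus)

lemma nn_integral_reflect:
  assumes [measurable]: "f \<in> borel_measurable borel"
  shows "(\<integral>\<^sup>+x. f (- x) \<partial>lborel) = (\<integral>\<^sup>+(x::'a::euclidean_space). f x \<partial>lborel)"
  using nn_integral_distr[of uminus lborel borel f] by (simp add: lborel_distr_reflect)

text \<open>The weight is dominated by a product of one-dimensional functions
  \<open>inverse (1 + t^2)\<close>, each of which absorbs two of the \<open>2 * DIM('a)\<close>
  powers; such a product is integrated coordinate by coordinate.\<close>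

lemma integrable_decay:
  "integrable lborel (\<lambda>x::'a::euclidean_space. inverse ((1 + norm x) ^ (2 * DIM('a))))"
proof -
  have "integrable lborel (\<lambda>x::real. inverse (1 + x\<^sup>2))"
    using integrable_inverse_1_plus_square by (simp add: set_integrable_def einterval_eq)
  then have fin: "(\<integral>\<^sup>+t. ennreal (inverse (1 + t\<^sup>2)) \<partial>(lborel::real measure)) < \<infinity>"
    by (simp add: integrable_iff_bounded power2_eq_square)
  have "(\<integral>\<^sup>+(x::'a). ennreal (norm (inverse ((1 + norm x) ^ (2 * DIM('a))))) \<partial>lborel) \<le>
      (\<integral>\<^sup>+(x::'a). (\<Prod>b\<in>Basis. ennreal (inverse (1 + (x \<bullet> b)\<^sup>2))) \<partial>lborel)"
  proof (rule nn_integral_mono)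
    fix x :: 'a
    have "inverse ((1 + norm x) ^ (2 * DIM('a))) = (\<Prod>b\<in>(Basis::'a set). inverse ((1 + norm x)\<^sup>2))"
      by (simp add: power_mult power_inverse)
    also have "\<dots> \<le> (\<Prod>b\<in>(Basis::'a set). inverse (1 + (x \<bullet> b)\<^sup>2))"
    proof (rule prod_mono, safe)
      fix b :: 'a assume b: "b \<in> Basis"
      have "(x \<bullet> b)\<^sup>2 \<le> (norm x)\<^sup>2"
        using Basis_le_norm[OF b, of x] by (metis abs_ge_zero power2_abs power_mono)
      then have "1 + (x \<bullet> b)\<^sup>2 \<le> 1 + (norm x)\<^sup>2 + 2 * norm x"
        using norm_ge_zero[of x] by linarith
      then have "1 + (x \<bullet> b)\<^sup>2 \<le> (1 + norm x)\<^sup>2"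
        by (simp add: power2_sum)
      then show "inverse ((1 + norm x)\<^sup>2) \<le> inverse (1 + (x \<bullet> b)\<^sup>2)"
        by (rule le_imp_inverse_le) (simp add: add_pos_nonneg)
    qed simp
    finally show "ennreal (norm (inverse ((1 + norm x) ^ (2 * DIM('a))))) \<le>
        (\<Prod>b\<in>Basis. ennreal (inverse (1 + (x \<bullet> b)\<^sup>2)))"
      by (subst prod_ennreal) (auto intro!: ennreal_leI)
  qed
  also have "\<dots> = (\<Prod>b\<in>(Basis::'a set). \<integral>\<^sup>+t. ennreal (inverse (1 + t\<^sup>2)) \<partial>lborel)"
    by (rule nn_integral_lborel_prod) auto
  also have "\<dots> < \<infinity>"
    using fin by (simp add: power_less_top_ennreal)
  finally show ?thesis by (simp add: integrable_iff_bounded)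
qed

lemma rapid_integrable_weight:
  fixes f :: "'a::euclidean_space \<Rightarrow> complex"
  assumes "rapid f" and [measurable]: "f \<in> borel_measurable borel"
  shows "integrable lborel (\<lambda>x. (1 + norm x) ^ N *\<^sub>R f x)"
proof -
  obtain C where C: "C \<ge> 0" "\<And>x. (1 + norm x) ^ (N + 2 * DIM('a)) * norm (f x) \<le> C"
    using rapidD[OF assms(1)] by metis
  show ?thesis
  proof (rule Bochner_Integration.integrable_bound)
    show "integrable lborel (\<lambda>x::'a. C * inverse ((1 + norm x) ^ (2 * DIM('a))))"
      by (intro integrable_mult_right integrable_decay)
    show "AE x in lborel. norm ((1 + norm x) ^ N *\<^sub>R f x) \<le> norm (C * inverse ((1 + norm x) ^ (2 * DIM('a))))"
    proof (rule AE_I2)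
      fix x :: 'a
      have p: "(1 + norm x) ^ (2 * DIM('a)) > 0" by (simp add: add_pos_nonneg)
      have "(1 + norm x) ^ N * norm (f x) \<le> C / (1 + norm x) ^ (2 * DIM('a))"
        using C(2)[of x] p by (simp add: pos_le_divide_eq power_add mult_ac)
      then show "norm ((1 + norm x) ^ N *\<^sub>R f x) \<le> norm (C * inverse ((1 + norm x) ^ (2 * DIM('a))))"
        using C(1) by (simp add: divide_inverse)
    qed
  qed measurable
qed

lemma rapid_integrable:
  fixes f :: "'a::euclidean_space \<Rightarrow> complex"
  assumes "rapid f" "f \<in> borel_measurable borel"
  shows "integrable lborel f"
  using rapid_integrable_weight[OF assms, of 0] by simp

lemma schwartz_integrable: "schwartz f \<Longrightarrow> integrable lborel f"
  by (intro rapid_integrable schwartz_rapid schwartz_measurable)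

section \<open>Differentiability of transforms and the exchange of derivatives with
  coordinates\<close>

lemma integrable_fourier:
  fixes f :: "'a::euclidean_space \<Rightarrow> complex"
  assumes "integrable lborel f"
  shows "integrable lborel (\<lambda>x. exp (- (\<i> * complex_of_real (k \<bullet> x))) * f x)"
  by (rule Bochner_Integration.integrable_bound[OF assms]) (use assms in \<open>auto simp: norm_mult\<close>)

lemma norm_fourier_le:
  assumes "integrable lborel f"
  shows "norm (fourier f k) \<le> (\<integral>x. norm (f x) \<partial>lborel)"
  unfolding fourier_def
  by (rule order_trans[OF integral_norm_bound]) (simp add: norm_mult)

lemma iexp_second_order: "norm (exp (- (\<i> * complex_of_real t)) - 1 + \<i> * complex_of_real t) \<le> t\<^sup>2 / 2"
  using iexp_approx1[of "- t" 1] by (simp add: lessThan_Suc_atMost[symmetric] numeral_2_eq_2 atMost_Suc algebra_simps)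

text \<open>The second moment of \<open>f\<close> bounds the second-order Taylor remainder of the
  exponential, so the difference quotient converges at the explicit rate
  \<open>norm (y - k) * I\<close>.\<close>

lemma fourier_has_derivative:
  fixes f :: "'a::euclidean_space \<Rightarrow> complex"
  assumes f: "integrable lborel f" and f2: "integrable lborel (\<lambda>x. (1 + norm x) ^ 2 *\<^sub>R f x)"
  shows "(fourier f has_derivative (\<lambda>h. \<integral>x. exp (- (\<i> * complex_of_real (k \<bullet> x))) * (- \<i> * complex_of_real (x \<bullet> h) * f x) \<partial>lborel)) (at k)"
proof -
  have [measurable]: "f \<in> borel_measurable borel" using f by auto
  let ?e = "\<lambda>x. exp (- (\<i> * complex_of_real (k \<bullet> x)))"
  let ?D = "\<lambda>h x. ?e x * (- \<i> * complex_of_real (x \<bullet> h) * f x)"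
  define I where "I = (\<integral>x. norm ((1 + norm x) ^ 2 *\<^sub>R f x) \<partial>lborel)"
  have n2: "integrable lborel (\<lambda>x. norm ((1 + norm x) ^ 2 *\<^sub>R f x))" using f2 by (rule integrable_norm)
  have Dbound: "norm (?D h x) \<le> norm h * norm ((1 + norm x) ^ 2 *\<^sub>R f x)" for h x
  proof -
    have "norm (?D h x) = \<bar>x \<bullet> h\<bar> * norm (f x)" by (simp add: norm_mult)
    also have "\<dots> \<le> (norm h * (1 + norm x)\<^sup>2) * norm (f x)"
    proof (rule mult_right_mono)
      have "\<bar>x \<bullet> h\<bar> \<le> norm h * norm x" by (metis Cauchy_Schwarz_ineq2 mult.commute)
      also have "\<dots> \<le> norm h * (1 + norm x)\<^sup>2"
        by (intro mult_left_mono) (auto simp: power2_eq_square algebra_simps)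
      finally show "\<bar>x \<bullet> h\<bar> \<le> norm h * (1 + norm x)\<^sup>2" .
    qed simp
    finally show ?thesis by (simp add: mult_ac)
  qed
  have Dint: "integrable lborel (?D h)" for h
  proof (rule Bochner_Integration.integrable_bound[OF integrable_mult_right[OF n2, of "norm h"]])
    show "AE x in lborel. norm (?D h x) \<le> norm (norm h * norm ((1 + norm x) ^ 2 *\<^sub>R f x))"
      by (rule AE_I2, rule order_trans[OF Dbound]) simp
  qed measurable
  show ?thesis
  proof (rule has_derivativeI_sandwich[where e = 1 and H = "\<lambda>y. norm (y - k) * I"])
    show "bounded_linear (\<lambda>h. integral\<^sup>L lborel (?D h))"
    proof (rule bounded_linear_intro[where K = I])
      fix h h' :: 'a and r :: real
      show "integral\<^sup>L lborel (?D (h + h')) = integral\<^sup>L lborel (?D h) + integral\<^sup>L lborel (?D h')"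
        by (subst Bochner_Integration.integral_add[symmetric, OF Dint Dint])
           (simp add: inner_add_right algebra_simps)
      show "integral\<^sup>L lborel (?D (r *\<^sub>R h)) = r *\<^sub>R integral\<^sup>L lborel (?D h)"
        by (subst integral_scaleR_right[symmetric], rule Bochner_Integration.integral_cong)
           (auto simp: scaleR_conv_of_real mult_ac)
      have "norm (integral\<^sup>L lborel (?D h)) \<le> (\<integral>x. norm h * norm ((1 + norm x) ^ 2 *\<^sub>R f x) \<partial>lborel)"
        by (rule order_trans[OF integral_norm_bound])
           (intro integral_mono integrable_norm Dint integrable_mult_right n2 Dbound)
      then show "norm (integral\<^sup>L lborel (?D h)) \<le> norm h * I" unfolding I_def by simp
    qed
    show "((\<lambda>y. norm (y - k) * I) \<longlongrightarrow> 0) (at k within UNIV)"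
      by (intro tendsto_eq_intros | simp)+
    fix y assume y: "y \<noteq> k"
    let ?h = "y - k"
    have eq: "fourier f y - fourier f k - integral\<^sup>L lborel (?D ?h) =
        (\<integral>x. ?e x * (exp (- (\<i> * complex_of_real (x \<bullet> ?h))) - 1 + \<i> * complex_of_real (x \<bullet> ?h)) * f x \<partial>lborel)"
      (is "_ = (\<integral>x. ?R x \<partial>lborel)")
    proof -
      have e: "exp (- (\<i> * complex_of_real (y \<bullet> x))) = ?e x * exp (- (\<i> * complex_of_real (x \<bullet> ?h)))" for x
        unfolding exp_add[symmetric] by (rule arg_cong[of _ _ exp]) (simp add: inner_diff_right inner_commute algebra_simps)
      show ?thesis
        unfolding fourier_def
        apply (subst Bochner_Integration.integral_diff[symmetric, OF integrable_fourier[OF f] integrable_fourier[OF f]])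
        apply (subst Bochner_Integration.integral_diff[symmetric, OF Bochner_Integration.integrable_diff[OF integrable_fourier[OF f] integrable_fourier[OF f]] Dint])
        unfolding e
        apply (rule Bochner_Integration.integral_cong[OF refl])
        by (simp add: algebra_simps)
    qed
    have Rb: "norm (?R x) \<le> (norm ?h)\<^sup>2 * norm ((1 + norm x) ^ 2 *\<^sub>R f x)" for x
    proof -
      have "norm (?R x) = norm (exp (- (\<i> * complex_of_real (x \<bullet> ?h))) - 1 + \<i> * complex_of_real (x \<bullet> ?h)) * norm (f x)"
        by (simp add: norm_mult)
      also have "\<dots> \<le> ((norm ?h)\<^sup>2 * (1 + norm x)\<^sup>2) * norm (f x)"
      proof (rule mult_right_mono)
        have "norm (exp (- (\<i> * complex_of_real (x \<bullet> ?h))) - 1 + \<i> * complex_of_real (x \<bullet> ?h)) \<le> (x \<bullet> ?h)\<^sup>2 / 2"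
          by (rule iexp_second_order)
        also have "\<dots> \<le> (x \<bullet> ?h)\<^sup>2" by simp
        also have "\<dots> \<le> (norm x * norm ?h)\<^sup>2"
          using Cauchy_Schwarz_ineq2[of x ?h] by (metis abs_ge_zero power2_abs power_mono)
        also have "\<dots> \<le> ((1 + norm x) * norm ?h)\<^sup>2"
          by (intro power_mono mult_right_mono) auto
        also have "\<dots> = (norm ?h)\<^sup>2 * (1 + norm x)\<^sup>2" by (simp add: power_mult_distrib)
        finally show "norm (exp (- (\<i> * complex_of_real (x \<bullet> ?h))) - 1 + \<i> * complex_of_real (x \<bullet> ?h)) \<le> (norm ?h)\<^sup>2 * (1 + norm x)\<^sup>2" .
      qed simp
      finally show ?thesis by (simp add: mult_ac)
    qed
    have Rint: "integrable lborel ?R"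
    proof (rule Bochner_Integration.integrable_bound[OF integrable_mult_right[OF n2, of "(norm ?h)\<^sup>2"]])
      show "AE x in lborel. norm (?R x) \<le> norm ((norm ?h)\<^sup>2 * norm ((1 + norm x) ^ 2 *\<^sub>R f x))"
        by (rule AE_I2, rule order_trans[OF Rb]) simp
    qed measurable
    have "norm (fourier f y - fourier f k - integral\<^sup>L lborel (?D ?h)) \<le> (\<integral>x. (norm ?h)\<^sup>2 * norm ((1 + norm x) ^ 2 *\<^sub>R f x) \<partial>lborel)"
      unfolding eq
      by (rule order_trans[OF integral_norm_bound])
         (intro integral_mono integrable_norm Rint integrable_mult_right n2 Rb)
    also have "\<dots> = (norm ?h * I) * norm ?h" unfolding I_def
      by (subst integral_mult_right_zero) (simp add: power2_eq_square mult_ac)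
    finally show "norm (fourier f y - fourier f k - integral\<^sup>L lborel (?D ?h)) / norm ?h \<le> norm ?h * I"
      using y by (simp add: divide_le_eq)
  qed auto
qed

lemma partial_fourier:
  assumes "integrable lborel f" "integrable lborel (\<lambda>x. (1 + norm x) ^ 2 *\<^sub>R f x)"
  shows "partial b (fourier f) = fourier (\<lambda>x. - \<i> * complex_of_real (x \<bullet> b) * f x)"
  by (rule ext) (simp add: partial_eq[OF fourier_has_derivative[OF assms]] fourier_def)

text \<open>The derivative is averaged over the unit segment in the direction \<open>b\<close>. By
  the fundamental theorem the average at \<open>x\<close> is \<open>u (b + x) - u x\<close>, whose
  integral vanishes by translation invariance; by Fubini and translation invariance the integral of
  the average is that of the derivative. Integrability replaces any discussion of limits at
  infinity.\<close>

lemma integral_partial_eq_0: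
  fixes u :: "'a::euclidean_space \<Rightarrow> complex"
  assumes diff: "\<And>x. u differentiable (at x)" and cont: "continuous_on UNIV (partial b u)"
    and u: "integrable lborel u" and du: "integrable lborel (partial b u)"
  shows "(\<integral>x. partial b u x \<partial>lborel) = 0"
proof -
  have [measurable]: "u \<in> borel_measurable borel" "partial b u \<in> borel_measurable borel"
    using u du by auto
  let ?f = "\<lambda>(s::real) x. indicator {0..1} s *\<^sub>R partial b u (s *\<^sub>R b + x)"
  have FTC: "(\<integral>s. ?f s x \<partial>lborel) = u (b + x) - u x" for x
  proof -
    have vd: "((\<lambda>s. u (s *\<^sub>R b + x)) has_vector_derivative partial b u (s *\<^sub>R b + x)) (at s within {0..1})" for s
    proof -
      have "(u has_derivative frechet_derivative u (at (s *\<^sub>R b + x))) (at (s *\<^sub>R b + x))"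
        using diff by (simp add: frechet_derivative_works)
      moreover have "((\<lambda>s. s *\<^sub>R b + x) has_vector_derivative b) (at s within {0..1})"
        by (auto intro!: derivative_eq_intros)
      ultimately show ?thesis unfolding partial_def
        using vector_derivative_diff_chain_within[of "\<lambda>s. s *\<^sub>R b + x" b s "{0..1}" u]
        by (auto simp: o_def intro: has_derivative_at_withinI)
    qed
    have "continuous_on {0..1} (\<lambda>s. partial b u (s *\<^sub>R b + x))"
      by (rule continuous_on_compose2[OF cont]) (auto intro!: continuous_intros)
    from integral_FTC_Icc[OF _ vd this] show ?thesis by simp
  qed
  have shift_int: "integrable lborel (\<lambda>x. partial b u (s *\<^sub>R b + x))" for s
    using du by (subst integrable_shift_iff) auto
  have norm_int: "(\<integral>x. norm (?f s x) \<partial>lborel) = indicator {0..1} s * (\<integral>x. norm (partial b u x) \<partial>lborel)" for s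
    using integral_shift[of "\<lambda>x. norm (partial b u x)" "s *\<^sub>R b"] by (simp add: norm_scaleR)
  have int: "integrable (lborel \<Otimes>\<^sub>M lborel) (\<lambda>(s, x). ?f s x)"
  proof (rule lborel_pair.Fubini_integrable)
    show "integrable lborel (\<lambda>s::real. \<integral>x. norm (case (s, x) of (s, x) \<Rightarrow> ?f s x) \<partial>lborel)"
      unfolding prod.case norm_int by (intro integrable_mult_left integrable_real_indicator) auto
  qed (use shift_int in \<open>auto intro!: AE_I2\<close>)
  have "(\<integral>x. (\<integral>s. ?f s x \<partial>lborel) \<partial>lborel) = (\<integral>s. (\<integral>x. ?f s x \<partial>lborel) \<partial>lborel)"
    using lborel_pair.Fubini_integral[OF int] .
  also have "\<dots> = (\<integral>s. indicator {0..1} s *\<^sub>R (\<integral>x. partial b u x \<partial>lborel) \<partial>(lborel::real measure))"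
    using integral_shift[of "partial b u"] by (simp add: integral_scaleR_right)
  also have "\<dots> = (\<integral>x. partial b u x \<partial>lborel)" by (simp)
  finally have "(\<integral>x. partial b u x \<partial>lborel) = (\<integral>x. u (b + x) - u x \<partial>lborel)" unfolding FTC by simp
  also have "\<dots> = 0"
    using u integrable_shift_iff[of u b] integral_shift[of u b] by simp
  finally show ?thesis .
qed

lemma has_derivative_iexp_inner:
  fixes k :: "'a::euclidean_space"
  shows "((\<lambda>x. exp (- (\<i> * complex_of_real (k \<bullet> x)))) has_derivative
    (\<lambda>h. - \<i> * complex_of_real (k \<bullet> h) * exp (- (\<i> * complex_of_real (k \<bullet> x))))) (at x)"
proof -
  have 1: "((\<lambda>x. - (\<i> * complex_of_real (k \<bullet> x))) has_derivative (\<lambda>h. - (\<i> * complex_of_real (k \<bullet> h)))) (at x)"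
    by (auto intro!: derivative_eq_intros)
  have 2: "(exp has_derivative (*) (exp y)) (at y)" for y :: complex
    using DERIV_exp[of y] unfolding has_field_derivative_def .
  show ?thesis
    using has_derivative_compose[OF 1 2] by (simp add: mult.commute)
qed

lemma differentiable_iexp_inner:
  fixes k :: "'a::euclidean_space"
  shows "(\<lambda>x. exp (- (\<i> * complex_of_real (k \<bullet> x)))) differentiable (at x)"
  using has_derivative_iexp_inner unfolding differentiable_def by blast

lemma fourier_partial:
  fixes f :: "'a::euclidean_space \<Rightarrow> complex"
  assumes diff: "\<And>x. f differentiable (at x)" and cont: "continuous_on UNIV (partial b f)"
    and f: "integrable lborel f" and df: "integrable lborel (partial b f)"
  shows "fourier (partial b f) k = \<i> * complex_of_real (k \<bullet> b) * fourier f k"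
proof -
  let ?e = "\<lambda>x. exp (- (\<i> * complex_of_real (k \<bullet> x)))"
  have p: "partial b (\<lambda>x. ?e x * f x) = (\<lambda>x. ?e x * partial b f x + (- \<i> * complex_of_real (k \<bullet> b)) * (?e x * f x))"
    by (rule ext) (simp add: partial_mult[OF differentiable_iexp_inner diff] partial_eq[OF has_derivative_iexp_inner])
  have "continuous_on UNIV f" using diff by (rule differentiable_imp_continuous_UNIV)
  then have c: "continuous_on UNIV (\<lambda>x. ?e x * partial b f x + (- \<i> * complex_of_real (k \<bullet> b)) * (?e x * f x))"
    by (intro continuous_intros cont)
  have i: "integrable lborel (\<lambda>x. ?e x * partial b f x)" "integrable lborel (\<lambda>x. ?e x * f x)"
    by (intro integrable_fourier f df)+
  have "0 = (\<integral>x. partial b (\<lambda>x. ?e x * f x) x \<partial>lborel)"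
  proof (rule integral_partial_eq_0[symmetric])
    show "(\<lambda>x. ?e x * f x) differentiable at x" for x
      by (intro differentiable_mult differentiable_iexp_inner diff)
    show "integrable lborel (partial b (\<lambda>x. ?e x * f x))"
      unfolding p by (intro Bochner_Integration.integrable_add integrable_mult_right i)
  qed (use c i p in auto)
  also have "\<dots> = fourier (partial b f) k + (- \<i> * complex_of_real (k \<bullet> b)) * fourier f k"
    unfolding p fourier_def using i by (subst Bochner_Integration.integral_add) auto
  finally show ?thesis by (simp add: algebra_simps)
qed

lemma fourier_coord:
  assumes "schwartz f" "b \<in> Basis"
  shows "complex_of_real (k \<bullet> b) * fourier f k = fourier (\<lambda>x. - \<i> * partial b f x) k"
proof -
  have "fourier (\<lambda>x. - \<i> * partial b f x) k = - \<i> * fourier (partial b f) k"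
    unfolding fourier_def by (subst integral_mult_right_zero[symmetric]) (simp add: mult_ac)
  also have "\<dots> = - \<i> * (\<i> * complex_of_real (k \<bullet> b) * fourier f k)"
    using assms
    by (subst fourier_partial) (auto intro: schwartz_differentiable schwartz_continuous schwartz_partial schwartz_integrable)
  also have "\<dots> = complex_of_real (k \<bullet> b) * fourier f k"
    by (simp add: mult.assoc[symmetric])
  finally show ?thesis ..
qed

lemma schwartz_integrable_weight: "schwartz f \<Longrightarrow> integrable lborel (\<lambda>x. (1 + norm x) ^ N *\<^sub>R f x)"
  by (intro rapid_integrable_weight schwartz_rapid schwartz_measurable)

lemma partial_fourier_schwartz:
  "schwartz f \<Longrightarrow> partial b (fourier f) = fourier (\<lambda>x. - \<i> * complex_of_real (x \<bullet> b) * f x)"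
  by (intro partial_fourier schwartz_integrable schwartz_integrable_weight)

lemma fourier_bounded: "integrable lborel f \<Longrightarrow> bounded (range (fourier f))"
  unfolding bounded_iff using norm_fourier_le by blast

lemma fourier_differentiable:
  assumes "integrable lborel f" "integrable lborel (\<lambda>x. (1 + norm x) ^ 2 *\<^sub>R f x)"
  shows "fourier f differentiable (at k)"
  using fourier_has_derivative[OF assms] unfolding differentiable_def by blast

text \<open>The stable class is the image of the Schwartz functions under \<open>fourier\<close>
  itself: derivatives of a transform are transforms of coordinate multiples, and coordinate
  multiples of a transform are transforms of derivatives.\<close>

lemma schwartz_fourier:
  assumes "schwartz f"
  shows "schwartz (fourier f)"
proof (rule schwartz_class[of "fourier ` {f. schwartz f}"])
  fix u :: "'a \<Rightarrow> complex" and b :: 'a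
  assume "u \<in> fourier ` {f. schwartz f}"
  then obtain g where g: "schwartz g" and u: "u = fourier g" by auto
  show "u differentiable (at x)" for x
    unfolding u using g by (intro fourier_differentiable schwartz_integrable schwartz_integrable_weight)
  show "bounded (range u)" unfolding u using g by (intro fourier_bounded schwartz_integrable)
  assume b: "b \<in> Basis"
  have "schwartz (\<lambda>x. - \<i> * complex_of_real (x \<bullet> b) * g x)"
    using schwartz_scale[OF schwartz_coord[OF g b], of "- \<i>"] by (simp add: mult_ac)
  then show "partial b u \<in> fourier ` {f. schwartz f}"
    unfolding u using partial_fourier_schwartz[OF g] by auto
  show "(\<lambda>x. complex_of_real (x \<bullet> b) * u x) \<in> fourier ` {f. schwartz f}"
    unfolding u fourier_coord[OF g b]
    using schwartz_scale[OF schwartz_partial[OF g b], of "- \<i>"] by auto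
qed (use assms in auto)

lemma fourier_measurable [measurable]:
  fixes f :: "'a::euclidean_space \<Rightarrow> complex"
  assumes [measurable]: "f \<in> borel_measurable borel"
  shows "fourier f \<in> borel_measurable borel"
proof -
  have "(\<lambda>k. \<integral>x. exp (- (\<i> * complex_of_real (k \<bullet> x))) * f x \<partial>lborel) \<in> borel_measurable borel"
    by (rule lborel.borel_measurable_lebesgue_integral) measurable
  then show ?thesis unfolding fourier_def[abs_def] .
qed

text \<open>Self-adjointness of the transform, by Fubini on the product of the two integrable
  functions. It is the duality behind \<open>fourier_distr\<close>, and with a Gaussian as one
  factor it takes the place of an inversion formula.\<close>

lemma integral_fourier_swap:
  fixes f g :: "'a::euclidean_space \<Rightarrow> complex"
  assumes f: "integrable lborel f" and g: "integrable lborel g"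
  shows "(\<integral>k. fourier f k * g k \<partial>lborel) = (\<integral>x. f x * fourier g x \<partial>lborel)"
proof -
  have [measurable]: "f \<in> borel_measurable borel" "g \<in> borel_measurable borel"
    using f g by auto
  let ?F = "\<lambda>k x. exp (- (\<i> * complex_of_real (k \<bullet> x))) * f x * g k"
  have "(\<integral>y. norm (case (k, y) of (k, x) \<Rightarrow> ?F k x) \<partial>lborel) = (\<integral>y. norm (f y) \<partial>lborel) * norm (g k)" for k
    by (simp add: norm_mult)
  moreover have "integrable lborel (\<lambda>x. ?F k x)" for k
    using integrable_fourier[OF f, of k] by (intro integrable_mult_left)
  ultimately have int: "integrable (lborel \<Otimes>\<^sub>M lborel) (\<lambda>(k, x). ?F k x)"
    using g by (intro lborel_pair.Fubini_integrable) (auto intro!: integrable_mult_right)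
  have "(\<integral>k. fourier f k * g k \<partial>lborel) = (\<integral>k. (\<integral>x. ?F k x \<partial>lborel) \<partial>lborel)"
    unfolding fourier_def by (simp only: integral_mult_left_zero)
  also have "\<dots> = (\<integral>x. (\<integral>k. ?F k x \<partial>lborel) \<partial>lborel)"
    using lborel_pair.Fubini_integral[OF int] by simp
  also have "(\<lambda>x. \<integral>k. ?F k x \<partial>lborel) = (\<lambda>x. f x * fourier g x)"
    unfolding fourier_def by (subst integral_mult_right_zero[symmetric]) (simp add: mult_ac inner_commute)
  finally show ?thesis .
qed

section \<open>Gaussian integrals and the heat kernel\<close>

lemma gaussian_integral_real:
  assumes d: "d > 0"
  shows "(\<integral>x. exp (\<i> * complex_of_real (t * x) - complex_of_real (d * x\<^sup>2)) \<partial>lborel) =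
    complex_of_real (sqrt (pi / d) * exp (- t\<^sup>2 / (4 * d)))"
proof -
  \<comment> \<open>The scale is fixed by \<open>d * (c * x)^2 = x^2 / 2\<close>: the integrand
    becomes a multiple of the standard normal density, and the integral its characteristic function
    at \<open>t * c\<close>.\<close>
  define c where "c = 1 / sqrt (2 * d)"
  have c: "c > 0" "c\<^sup>2 = 1 / (2 * d)" using d by (auto simp: c_def power_divide)
  have "(\<integral>x. exp (\<i> * complex_of_real (t * x) - complex_of_real (d * x\<^sup>2)) \<partial>lborel) =
     c *\<^sub>R (\<integral>x. exp (\<i> * complex_of_real (t * (0 + c * x)) - complex_of_real (d * (0 + c * x)\<^sup>2)) \<partial>lborel)"
    using lborel_integral_real_affine[of c "\<lambda>x. exp (\<i> * complex_of_real (t * x) - complex_of_real (d * x\<^sup>2))" 0] c by simp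
  also have "(\<lambda>x. exp (\<i> * complex_of_real (t * (0 + c * x)) - complex_of_real (d * (0 + c * x)\<^sup>2))) =
     (\<lambda>x. sqrt (2 * pi) *\<^sub>R (std_normal_density x *\<^sub>R iexp ((t * c) * x)))"
  proof
    fix x :: real
    have e: "d * (c * x)\<^sup>2 = x\<^sup>2 / 2" using c(2) d by (simp add: power_mult_distrib)
    have "exp (\<i> * complex_of_real (t * (0 + c * x)) - complex_of_real (d * (0 + c * x)\<^sup>2)) =
        exp (complex_of_real (- (x\<^sup>2 / 2))) * iexp ((t * c) * x)"
      unfolding exp_add[symmetric] add_0_left e by (simp add: mult_ac)
    also have "exp (complex_of_real (- (x\<^sup>2 / 2))) = complex_of_real (exp (- (x\<^sup>2 / 2)))"
      by (rule exp_of_real)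
    also have "exp (- (x\<^sup>2 / 2)) = sqrt (2 * pi) * std_normal_density x"
      by (simp add: std_normal_density_def)
    finally show "exp (\<i> * complex_of_real (t * (0 + c * x)) - complex_of_real (d * (0 + c * x)\<^sup>2)) =
       sqrt (2 * pi) *\<^sub>R (std_normal_density x *\<^sub>R iexp ((t * c) * x))"
      by (simp add: scaleR_conv_of_real)
  qed
  also have "(\<integral>x. sqrt (2 * pi) *\<^sub>R (std_normal_density x *\<^sub>R iexp ((t * c) * x)) \<partial>lborel) =
     sqrt (2 * pi) *\<^sub>R char std_normal_distribution (t * c)"
    unfolding char_def integral_scaleR_right by (subst integral_density) (auto simp: normal_density_nonneg)
  also have "\<dots> = sqrt (2 * pi) *\<^sub>R complex_of_real (exp (- ((t * c)\<^sup>2) / 2))"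
    by (simp add: char_std_normal_distribution)
  also have "(t * c)\<^sup>2 = t\<^sup>2 / (2 * d)" using c(2) by (simp add: power_mult_distrib)
  also have "c *\<^sub>R (sqrt (2 * pi) *\<^sub>R complex_of_real (exp (- (t\<^sup>2 / (2 * d)) / 2))) =
      complex_of_real ((c * sqrt (2 * pi)) * exp (- t\<^sup>2 / (4 * d)))"
    by (simp add: scaleR_conv_of_real)
  also have "c * sqrt (2 * pi) = sqrt (pi / d)"
    using d by (simp add: c_def real_sqrt_mult real_sqrt_divide field_simps)
  finally show ?thesis .
qed

lemma integral_gaussian:
  fixes t :: "'a::euclidean_space"
  assumes d: "d > 0"
  shows "(\<integral>x. gaussian t d x \<partial>lborel) = complex_of_real (sqrt (pi / d) ^ DIM('a) * exp (- (norm t)\<^sup>2 / (4 * d)))"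
proof -
  let ?g = "\<lambda>b s. exp (\<i> * complex_of_real ((t \<bullet> b) * s) - complex_of_real (d * s\<^sup>2))"
  have split: "gaussian t d x = (\<Prod>b\<in>Basis. ?g b (x \<bullet> b))" for x
  proof -
    have "\<i> * complex_of_real (x \<bullet> t) - complex_of_real (d * (norm x)\<^sup>2) =
        (\<Sum>b\<in>Basis. \<i> * complex_of_real ((t \<bullet> b) * (x \<bullet> b)) - complex_of_real (d * (x \<bullet> b)\<^sup>2))"
      unfolding power2_norm_eq_inner
      by (subst (1 2) euclidean_inner)
         (simp add: sum_subtractf sum_distrib_left power2_eq_square mult_ac)
    then show ?thesis unfolding gaussian_def by (simp add: exp_sum)
  qed
  interpret product_sigma_finite "\<lambda>_::'a. lborel :: real measure" by standard
  have int: "integrable lborel (?g b)" for b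
  proof -
    have "?g b = gaussian (t \<bullet> b) d" by (auto simp: gaussian_def fun_eq_iff mult_ac)
    then show ?thesis using schwartz_integrable[OF schwartz_gaussian[OF d, of "t \<bullet> b"]] by simp
  qed
  have m: "gaussian t d \<in> borel_measurable borel"
    using schwartz_gaussian[OF d] by (rule schwartz_measurable)
  have "(\<integral>x. gaussian t d x \<partial>lborel) = (\<integral>x. gaussian t d (\<Sum>b\<in>Basis. x b *\<^sub>R b) \<partial>(\<Pi>\<^sub>M b\<in>Basis. lborel))"
    by (subst lborel_eq, subst integral_distr) (use m in auto)
  also have "\<dots> = (\<integral>x. (\<Prod>b\<in>Basis. ?g b (x b)) \<partial>(\<Pi>\<^sub>M b\<in>Basis. lborel))"
    unfolding split by (intro Bochner_Integration.integral_cong refl prod.cong) simp_all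
  also have "\<dots> = (\<Prod>b\<in>Basis. integral\<^sup>L lborel (?g b))"
    by (rule product_integral_prod) (rule finite_Basis, rule int)
  also have "\<dots> = (\<Prod>b\<in>(Basis::'a set). complex_of_real (sqrt (pi / d) * exp (- (t \<bullet> b)\<^sup>2 / (4 * d))))"
    using gaussian_integral_real[OF d] by simp
  also have "\<dots> = complex_of_real (sqrt (pi / d) ^ DIM('a) * (\<Prod>b\<in>(Basis::'a set). exp (- (t \<bullet> b)\<^sup>2 / (4 * d))))"
    by (simp add: prod.distrib)
  also have "(\<Prod>b\<in>(Basis::'a set). exp (- (t \<bullet> b)\<^sup>2 / (4 * d))) = exp (\<Sum>b\<in>(Basis::'a set). - (t \<bullet> b)\<^sup>2 / (4 * d))"
    by (simp add: exp_sum)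
  also have "(\<Sum>b\<in>(Basis::'a set). - (t \<bullet> b)\<^sup>2 / (4 * d)) = - (norm t)\<^sup>2 / (4 * d)"
    unfolding power2_norm_eq_inner by (subst (2) euclidean_inner)
      (simp add: power2_eq_square sum_negf sum_divide_distrib)
  finally show ?thesis .
qed

text \<open>The heat kernel at time \<open>d\<close>, normalised to integral one.\<close>

definition heat :: "real \<Rightarrow> 'a::euclidean_space \<Rightarrow> real" where
  "heat d v = exp (- (norm v)\<^sup>2 / (4 * d)) / sqrt (4 * pi * d) ^ DIM('a)"

lemma fourier_gaussian:
  fixes z :: "'a::euclidean_space"
  assumes d: "d > 0"
  shows "fourier (gaussian z d) w = complex_of_real ((2 * pi) ^ DIM('a) * heat d (z - w))"
proof -
  have "fourier (gaussian z d) w = (\<integral>x. gaussian (z - w) d x \<partial>lborel)"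
    unfolding fourier_def gaussian_def exp_add[symmetric]
    by (simp add: inner_diff_right inner_commute algebra_simps)
  also have "\<dots> = complex_of_real (sqrt (pi / d) ^ DIM('a) * exp (- (norm (z - w))\<^sup>2 / (4 * d)))"
    by (rule integral_gaussian[OF d])
  also have "sqrt (pi / d) = 2 * pi / sqrt (4 * pi * d)"
    using d by (simp add: real_sqrt_divide real_sqrt_mult field_simps)
  finally show ?thesis by (simp add: heat_def power_divide)
qed


section \<open>Plancherel's inequality\<close>

text \<open>Fatou's lemma. The Gaussian weight in Plancherel's inequality, the heat regularization
  and the step of the difference quotients are all removed by it, so that uniform bounds suffice and
  no domination is sought.\<close>

lemma nn_integral_le_of_tendsto:
  fixes g :: "nat \<Rightarrow> 'a \<Rightarrow> ennreal"
  assumes [measurable]: "\<And>n. g n \<in> borel_measurable M"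
    and le: "\<And>n. (\<integral>\<^sup>+x. g n x \<partial>M) \<le> C"
    and lim: "AE x in M. (\<lambda>n. g n x) \<longlonglongrightarrow> h x"
  shows "(\<integral>\<^sup>+x. h x \<partial>M) \<le> C"
proof -
  have "(\<integral>\<^sup>+x. h x \<partial>M) = (\<integral>\<^sup>+x. liminf (\<lambda>n. g n x) \<partial>M)"
    by (rule nn_integral_cong_AE) (use lim in \<open>auto elim!: eventually_mono simp: lim_imp_Liminf\<close>)
  also have "\<dots> \<le> liminf (\<lambda>n. \<integral>\<^sup>+x. g n x \<partial>M)"
    by (rule nn_integral_liminf) measurable
  also have "\<dots> \<le> limsup (\<lambda>n. \<integral>\<^sup>+x. g n x \<partial>M)"
    by (rule Liminf_le_Limsup) simp
  also have "\<dots> \<le> C" by (rule Limsup_bounded) (simp add: le)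
  finally show ?thesis .
qed

lemma cnj_measurable [measurable]: "cnj \<in> borel_measurable borel"
  by (intro borel_measurable_continuous_onI continuous_intros)

lemma heat_nonneg [simp]: "d > 0 \<Longrightarrow> 0 \<le> heat d v"
  by (simp add: heat_def)

lemma heat_minus [simp]: "heat d (- v) = heat d v"
  by (simp add: heat_def)

lemma heat_measurable [measurable]: "heat d \<in> borel_measurable borel"
  unfolding heat_def[abs_def] by measurable

lemma gaussian_0: "gaussian 0 d x = complex_of_real (exp (- d * (norm x)\<^sup>2))"
  by (simp add: gaussian_def exp_of_real[symmetric])

lemma has_bochner_integral_heat:
  assumes d: "d > 0"
  shows "has_bochner_integral lborel (heat d :: 'a::euclidean_space \<Rightarrow> real) 1"
proof -
  have d': "1 / (4 * d) > 0" using d by simp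
  have eq: "heat d v = Re (gaussian 0 (1 / (4 * d)) v) / sqrt (4 * pi * d) ^ DIM('a)" for v :: 'a
    by (simp add: heat_def gaussian_0 del: of_real_exp)
  have int: "integrable lborel (gaussian (0::'a) (1 / (4 * d)))"
    by (intro schwartz_integrable schwartz_gaussian d')
  have "(\<integral>(v::'a). heat d v \<partial>lborel) = Re (\<integral>v. gaussian (0::'a) (1 / (4 * d)) v \<partial>lborel) / sqrt (4 * pi * d) ^ DIM('a)"
    unfolding eq by (simp add: integral_Re[OF int])
  also have "\<dots> = 1"
    using d by (subst integral_gaussian[OF d']) (simp add: mult_ac)
  finally have "(\<integral>(v::'a). heat d v \<partial>lborel) = 1" .
  moreover have "integrable lborel (heat d :: 'a \<Rightarrow> real)"
    unfolding eq[abs_def] by (intro integrable_divide integrable_Re int)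
  ultimately show ?thesis by (simp add: has_bochner_integral_iff)
qed

lemma nn_integral_heat_diff:
  fixes z :: "'a::euclidean_space"
  assumes d: "d > 0"
  shows "(\<integral>\<^sup>+w. ennreal (heat d (z - w)) \<partial>lborel) = 1"
proof -
  have "(\<integral>\<^sup>+w. ennreal (heat d (z - w)) \<partial>lborel) = (\<integral>\<^sup>+w. ennreal (heat d (z + w)) \<partial>lborel)"
    using nn_integral_reflect[of "\<lambda>w. ennreal (heat d (z - w))"] by simp
  also have "\<dots> = (\<integral>\<^sup>+(w::'a). ennreal (heat d w) \<partial>lborel)"
    by (rule nn_integral_shift) measurable
  also have "\<dots> = 1"
    using has_bochner_integral_heat[OF d, where 'a='a] d
    by (subst nn_integral_eq_integral) (auto simp: has_bochner_integral_iff)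
  finally show ?thesis .
qed

lemma has_bochner_integral_heat_diff:
  fixes z :: "'a::euclidean_space"
  assumes d: "d > 0"
  shows "has_bochner_integral lborel (\<lambda>w. heat d (z - w)) 1"
  using has_bochner_integral_nn_integral[of "\<lambda>w. heat d (z - w)" lborel 1] nn_integral_heat_diff[OF d, of z] d
  by simp

text \<open>The Gaussian weight makes the Fubini exchanges absolutely convergent; the Schur test bounds the
  resulting convolution by the \<open>L\<^sup>2\<close> norm uniformly in the weight.\<close>

lemma plancherel_weighted:
  fixes f :: "'a::euclidean_space \<Rightarrow> complex"
  assumes f: "integrable lborel f" and d: "d > 0"
  shows "(\<integral>\<^sup>+x. ennreal ((norm (fourier f x))\<^sup>2 * exp (- d * (norm x)\<^sup>2)) \<partial>lborel) \<le>
    ennreal ((2 * pi) ^ DIM('a)) * (\<integral>\<^sup>+x. ennreal ((norm (f x))\<^sup>2) \<partial>lborel)"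
proof -
  have [measurable]: "f \<in> borel_measurable borel" using f by auto
  \<comment> \<open>The reflected conjugate has transform \<open>cnj (fourier f x)\<close>. The
    squared modulus is thus a product of two transforms, and one of them can be moved across by
    \<open>integral_fourier_swap\<close>.\<close>
  define f' where "f' = (\<lambda>x. cnj (f (- x)))"
  have [measurable]: "f' \<in> borel_measurable borel" unfolding f'_def by measurable
  have f': "integrable lborel f'"
    unfolding f'_def using f by (simp add: integrable_reflect_iff)
  have cnj: "fourier f' x = cnj (fourier f x)" for x
  proof -
    have "cnj (fourier f x) = (\<integral>y. cnj (exp (- (\<i> * complex_of_real (x \<bullet> y))) * f y) \<partial>lborel)"
      unfolding fourier_def by (rule Bochner_Integration.integral_cnj[symmetric])
    also have "\<dots> = (\<integral>y. cnj (exp (- (\<i> * complex_of_real (x \<bullet> (- y)))) * f (- y)) \<partial>lborel)"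
      by (rule integral_reflect[symmetric]) measurable
    finally show ?thesis unfolding fourier_def f'_def by (simp add: exp_cnj)
  qed
  let ?g = "gaussian (0::'a) d"
  have g_real: "?g x = complex_of_real (exp (- d * (norm x)\<^sup>2))" for x
    by (rule gaussian_0)
  define G where "G = (\<lambda>x. fourier f' x * ?g x)"
  have gint: "integrable lborel (gaussian z d)" for z :: 'a
    by (intro schwartz_integrable schwartz_gaussian d)
  have Gint: "integrable lborel (\<lambda>x. fourier h x * (fourier f' x * ?g x))" if h: "integrable lborel h" for h
  proof (rule Bochner_Integration.integrable_bound)
    let ?B = "(\<integral>x. norm (h x) \<partial>lborel) * (\<integral>x. norm (f' x) \<partial>lborel)"
    show "integrable lborel (\<lambda>x. ?B * norm (?g x))" by (intro integrable_mult_right integrable_norm gint)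
    have "norm (fourier h x * (fourier f' x * ?g x)) \<le> ?B * norm (?g x)" for x
      using mult_mono[OF norm_fourier_le[OF h, of x] norm_fourier_le[OF f', of x]]
      by (simp add: norm_mult mult.assoc[symmetric] mult_right_mono)
    then show "AE x in lborel. norm (fourier h x * (fourier f' x * ?g x)) \<le> norm (?B * norm (?g x))"
      by (intro AE_I2) (metis abs_ge_self order_trans real_norm_def)
    have [measurable]: "h \<in> borel_measurable borel" "?g \<in> borel_measurable borel"
      using h schwartz_gaussian[OF d] by (auto intro: schwartz_measurable)
    show "(\<lambda>x. fourier h x * (fourier f' x * ?g x)) \<in> borel_measurable lborel" by measurable
  qed
  have G: "integrable lborel G"
  proof (rule Bochner_Integration.integrable_bound)
    let ?B = "(\<integral>x. norm (f' x) \<partial>lborel)"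
    show "integrable lborel (\<lambda>x. ?B * norm (?g x))" by (intro integrable_mult_right integrable_norm gint)
    have "norm (G x) \<le> ?B * norm (?g x)" for x
      unfolding G_def using norm_fourier_le[OF f', of x] by (simp add: norm_mult mult_right_mono)
    then show "AE x in lborel. norm (G x) \<le> norm (?B * norm (?g x))"
      by (intro AE_I2) (metis abs_ge_self order_trans real_norm_def)
    have [measurable]: "?g \<in> borel_measurable borel"
      using schwartz_gaussian[OF d] by (auto intro: schwartz_measurable)
    show "G \<in> borel_measurable lborel" unfolding G_def by measurable
  qed
  \<comment> \<open>Up to the factor \<open>(2 * pi) ^ DIM('a)\<close> this is \<open>f'\<close>
    convolved with a heat kernel of mass one, at the reflected point.\<close>
  have FG: "fourier G k = (\<integral>l. f' l * complex_of_real ((2 * pi) ^ DIM('a) * heat d (- k - l)) \<partial>lborel)" for k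
  proof -
    have "fourier G k = (\<integral>x. exp (- (\<i> * complex_of_real (k \<bullet> x))) * G x \<partial>lborel)"
      unfolding fourier_def ..
    also have "\<dots> = (\<integral>x. fourier f' x * gaussian (- k) d x \<partial>lborel)"
      unfolding G_def
      by (rule Bochner_Integration.integral_cong[OF refl])
         (simp add: gaussian_def exp_diff exp_minus inner_commute field_simps)
    also have "\<dots> = (\<integral>l. f' l * fourier (gaussian (- k) d) l \<partial>lborel)"
      by (rule integral_fourier_swap[OF f' gint])
    finally show ?thesis unfolding fourier_gaussian[OF d] .
  qed
  have "(\<integral>\<^sup>+x. ennreal ((norm (fourier f x))\<^sup>2 * exp (- d * (norm x)\<^sup>2)) \<partial>lborel) =
      (\<integral>\<^sup>+x. ennreal (norm (fourier f x * (fourier f' x * ?g x))) \<partial>lborel)"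
    by (simp add: cnj norm_mult norm_gaussian power2_eq_square mult_ac)
  also have "\<dots> = ennreal (\<integral>x. norm (fourier f x * (fourier f' x * ?g x)) \<partial>lborel)"
    by (intro nn_integral_eq_integral integrable_norm Gint f) auto
  also have "(\<integral>x. norm (fourier f x * (fourier f' x * ?g x)) \<partial>lborel) = norm (\<integral>x. fourier f x * (fourier f' x * ?g x) \<partial>lborel)"
  proof -
    have r: "fourier f x * (fourier f' x * ?g x) = complex_of_real (norm (fourier f x * (fourier f' x * ?g x)))" for x
    proof -
      have "fourier f x * (fourier f' x * ?g x) = (fourier f x * cnj (fourier f x)) * ?g x"
        by (simp add: cnj)
      also have "\<dots> = complex_of_real ((norm (fourier f x))\<^sup>2 * exp (- d * (norm x)\<^sup>2))"
        using complex_norm_square[of "fourier f x"] by (simp add: g_real del: of_real_exp)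
      finally have z: "fourier f x * (fourier f' x * ?g x) = complex_of_real ((norm (fourier f x))\<^sup>2 * exp (- d * (norm x)\<^sup>2))" .
      have r0: "0 \<le> (norm (fourier f x))\<^sup>2 * exp (- d * (norm x)\<^sup>2)" by simp
      show ?thesis unfolding z by (simp only: norm_of_real abs_of_nonneg[OF r0])
    qed
    have "(\<integral>x. fourier f x * (fourier f' x * ?g x) \<partial>lborel) = complex_of_real (\<integral>x. norm (fourier f x * (fourier f' x * ?g x)) \<partial>lborel)"
      by (subst r) (rule integral_complex_of_real)
    then show ?thesis by (simp add: integral_nonneg_AE)
  qed
  also have "(\<integral>x. fourier f x * (fourier f' x * ?g x) \<partial>lborel) = (\<integral>k. f k * fourier G k \<partial>lborel)"
    using integral_fourier_swap[OF f G] unfolding G_def .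
  also have "ennreal (norm (\<integral>k. f k * fourier G k \<partial>lborel)) \<le> (\<integral>\<^sup>+k. ennreal (norm (f k * fourier G k)) \<partial>lborel)"
  proof (rule integral_norm_bound_ennreal)
    have [measurable]: "G \<in> borel_measurable borel" using G by auto
    show "integrable lborel (\<lambda>k. f k * fourier G k)"
    proof (rule Bochner_Integration.integrable_bound)
      let ?B = "\<integral>x. norm (G x) \<partial>lborel"
      show "integrable lborel (\<lambda>k. norm (f k) * ?B)" by (intro integrable_mult_left integrable_norm f)
      show "AE k in lborel. norm (f k * fourier G k) \<le> norm (norm (f k) * ?B)"
      proof (rule AE_I2)
        fix k
        have "norm (f k * fourier G k) \<le> norm (f k) * ?B"
          unfolding norm_mult by (intro mult_left_mono norm_fourier_le G) simp
        also have "\<dots> \<le> norm (norm (f k) * ?B)" by (simp only: real_norm_def abs_ge_self)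
        finally show "norm (f k * fourier G k) \<le> norm (norm (f k) * ?B)" .
      qed
    qed measurable
  qed
  also have "\<dots> \<le> (\<integral>\<^sup>+k. \<integral>\<^sup>+l. (ennreal ((2 * pi) ^ DIM('a)) * (ennreal ((norm (f k))\<^sup>2 / 2) * ennreal (heat d (- k - l))
      + ennreal ((norm (f' l))\<^sup>2 / 2) * ennreal (heat d (- k - l)))) \<partial>lborel \<partial>lborel)"
  proof (rule nn_integral_mono)
    fix k :: 'a
    let ?H = "\<lambda>l. f' l * complex_of_real ((2 * pi) ^ DIM('a) * heat d (- k - l))"
    have "ennreal (norm (fourier G k)) \<le> (\<integral>\<^sup>+l. ennreal (norm (?H l)) \<partial>lborel)"
      unfolding FG by (cases "integrable lborel ?H") (auto simp: integral_norm_bound_ennreal not_integrable_integral_eq)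
    then have "ennreal (norm (f k * fourier G k)) \<le> ennreal (norm (f k)) * (\<integral>\<^sup>+l. ennreal (norm (?H l)) \<partial>lborel)"
      by (simp add: norm_mult ennreal_mult mult_left_mono)
    also have "\<dots> = (\<integral>\<^sup>+l. ennreal (norm (f k)) * ennreal (norm (?H l)) \<partial>lborel)"
      by (rule nn_integral_cmult[symmetric]) measurable
    also have "\<dots> \<le> (\<integral>\<^sup>+l. ennreal ((2 * pi) ^ DIM('a)) * (ennreal ((norm (f k))\<^sup>2 / 2) * ennreal (heat d (- k - l))
      + ennreal ((norm (f' l))\<^sup>2 / 2) * ennreal (heat d (- k - l))) \<partial>lborel)"
    proof (rule nn_integral_mono)
      fix l :: 'a
      \<comment> \<open>The Schur test: after the product is split into two half squares, each term
        leaves a heat kernel which integrates to one in the other variable.\<close>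
      have "0 \<le> (norm (f k) - norm (f' l))\<^sup>2" by simp
      then have am: "norm (f k) * norm (f' l) \<le> (norm (f k))\<^sup>2 / 2 + (norm (f' l))\<^sup>2 / 2"
        by (simp add: power2_diff)
      have "norm (f k) * norm (?H l) = (norm (f k) * norm (f' l)) * ((2 * pi) ^ DIM('a) * heat d (- k - l))"
        using d by (simp add: norm_mult norm_power)
      also have "\<dots> \<le> ((norm (f k))\<^sup>2 / 2 + (norm (f' l))\<^sup>2 / 2) * ((2 * pi) ^ DIM('a) * heat d (- k - l))"
        using d by (intro mult_right_mono am) auto
      finally have "norm (f k) * norm (?H l) \<le> (2 * pi) ^ DIM('a) * ((norm (f k))\<^sup>2 / 2 * heat d (- k - l) + (norm (f' l))\<^sup>2 / 2 * heat d (- k - l))"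
        by (simp add: algebra_simps)
      then show "ennreal (norm (f k)) * ennreal (norm (?H l)) \<le> ennreal ((2 * pi) ^ DIM('a)) * (ennreal ((norm (f k))\<^sup>2 / 2) * ennreal (heat d (- k - l))
      + ennreal ((norm (f' l))\<^sup>2 / 2) * ennreal (heat d (- k - l)))"
        using d by (simp add: ennreal_mult[symmetric] ennreal_plus[symmetric] ennreal_leI del: ennreal_plus)
    qed
    finally show "ennreal (norm (f k * fourier G k)) \<le> \<dots>" .
  qed
  also have "\<dots> = ennreal ((2 * pi) ^ DIM('a)) * ((\<integral>\<^sup>+k. \<integral>\<^sup>+l. ennreal ((norm (f k))\<^sup>2 / 2) * ennreal (heat d (- k - l)) \<partial>lborel \<partial>lborel)
      + (\<integral>\<^sup>+k. \<integral>\<^sup>+l. ennreal ((norm (f' l))\<^sup>2 / 2) * ennreal (heat d (- k - l)) \<partial>lborel \<partial>lborel))"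
    by (simp add: nn_integral_cmult nn_integral_add)
  also have "(\<integral>\<^sup>+k. \<integral>\<^sup>+l. ennreal ((norm (f k))\<^sup>2 / 2) * ennreal (heat d (- k - l)) \<partial>lborel \<partial>lborel) = (\<integral>\<^sup>+k. ennreal ((norm (f k))\<^sup>2 / 2) \<partial>lborel)"
    by (simp add: nn_integral_cmult nn_integral_heat_diff[OF d])
  also have "(\<integral>\<^sup>+k. \<integral>\<^sup>+l. ennreal ((norm (f' l))\<^sup>2 / 2) * ennreal (heat d (- k - l)) \<partial>lborel \<partial>lborel) =
      (\<integral>\<^sup>+l. \<integral>\<^sup>+k. ennreal ((norm (f' l))\<^sup>2 / 2) * ennreal (heat d (- k - l)) \<partial>lborel \<partial>lborel)"
    by (rule lborel_pair.Fubini'[symmetric]) measurable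
  also have "\<dots> = (\<integral>\<^sup>+l. ennreal ((norm (f' l))\<^sup>2 / 2) * (\<integral>\<^sup>+k. ennreal (heat d (- l - k)) \<partial>lborel) \<partial>lborel)"
    by (simp add: nn_integral_cmult minus_diff_commute)
  also have "\<dots> = (\<integral>\<^sup>+l. ennreal ((norm (f' l))\<^sup>2 / 2) \<partial>lborel)"
    by (simp add: nn_integral_heat_diff[OF d])
  also have "\<dots> = (\<integral>\<^sup>+l. ennreal ((norm (f l))\<^sup>2 / 2) \<partial>lborel)"
    unfolding f'_def using nn_integral_reflect[of "\<lambda>l. ennreal ((norm (f l))\<^sup>2 / 2)"] by simp
  also have "(\<integral>\<^sup>+l. ennreal ((norm (f l))\<^sup>2 / 2) \<partial>lborel) + (\<integral>\<^sup>+l. ennreal ((norm (f l))\<^sup>2 / 2) \<partial>lborel) = (\<integral>\<^sup>+x. ennreal ((norm (f x))\<^sup>2) \<partial>lborel)"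
    by (subst nn_integral_add[symmetric]) (auto simp: ennreal_plus[symmetric] simp del: ennreal_plus)
  finally show ?thesis .
qed

text \<open>The weights tend to one and Fatou removes them. The right-hand side may be infinite, so
  \<open>f\<close> need not be square integrable.\<close>

lemma plancherel_le:
  fixes f :: "'a::euclidean_space \<Rightarrow> complex"
  assumes f: "integrable lborel f"
  shows "(\<integral>\<^sup>+x. ennreal ((norm (fourier f x))\<^sup>2) \<partial>lborel) \<le>
    ennreal ((2 * pi) ^ DIM('a)) * (\<integral>\<^sup>+x. ennreal ((norm (f x))\<^sup>2) \<partial>lborel)"
proof (rule nn_integral_le_of_tendsto)
  have [measurable]: "f \<in> borel_measurable borel" using f by auto
  let ?g = "\<lambda>n x. ennreal ((norm (fourier f x))\<^sup>2 * exp (- inverse (real (Suc n)) * (norm x)\<^sup>2))"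
  show "?g n \<in> borel_measurable lborel" for n by measurable
  show "integral\<^sup>N lborel (?g n) \<le> ennreal ((2 * pi) ^ DIM('a)) * (\<integral>\<^sup>+x. ennreal ((norm (f x))\<^sup>2) \<partial>lborel)" for n
    by (rule plancherel_weighted[OF f]) simp
  have "(\<lambda>n. ?g n x) \<longlonglongrightarrow> ennreal ((norm (fourier f x))\<^sup>2 * exp (- 0 * (norm x)\<^sup>2))" for x
    by (intro tendsto_intros tendsto_ennrealI LIMSEQ_inverse_real_of_nat)
  then show "AE x in lborel. (\<lambda>n. ?g n x) \<longlonglongrightarrow> ennreal ((norm (fourier f x))\<^sup>2)" by simp
qed


section \<open>Interior regularity of Sobolev functions\<close>

definition width :: "nat \<Rightarrow> real" where "width j = inverse (real j + 32)"

lemma width_pos [simp]: "width j > 0" and width_nonneg [simp]: "0 \<le> width j" and width_le: "width j \<le> 1 / 32"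
  by (auto simp: width_def field_simps)

text \<open>The exponent is halved. One half, taken at the radius \<open>r\<close>, supplies a
  factor which vanishes as \<open>d\<close> tends to zero. The other half is at least
  \<open>4 * (norm v)^2\<close> once \<open>d \<le> 1 / 32\<close>, whence the offset 32 in
  \<open>width\<close>; the Gaussian that survives does not depend on \<open>d\<close> and can serve
  as a majorant.\<close>

lemma heat_tail:
  fixes v :: "'a::euclidean_space"
  assumes d: "0 < d" "d \<le> 1 / 32" and r: "0 \<le> r" "r \<le> norm v"
  shows "heat d v \<le> exp (- r\<^sup>2 / (8 * d)) / sqrt (4 * pi * d) ^ DIM('a) * exp (- 4 * (norm v)\<^sup>2)"
proof -
  have r2: "r\<^sup>2 \<le> (norm v)\<^sup>2" using r by (intro power_mono)
  have "4 * (norm v)\<^sup>2 * (8 * d) \<le> (norm v)\<^sup>2 * 1"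
    using mult_left_mono[of "32 * d" 1 "(norm v)\<^sup>2"] d by (simp add: algebra_simps)
  then have "4 * (norm v)\<^sup>2 \<le> (norm v)\<^sup>2 / (8 * d)"
    using d by (simp add: pos_le_divide_eq)
  moreover have "r\<^sup>2 / (8 * d) \<le> (norm v)\<^sup>2 / (8 * d)" using d r2 by (intro divide_right_mono) auto
  moreover have "(norm v)\<^sup>2 / (4 * d) = (norm v)\<^sup>2 / (8 * d) + (norm v)\<^sup>2 / (8 * d)" using d by (simp add: field_simps)
  ultimately have "- (norm v)\<^sup>2 / (4 * d) \<le> - r\<^sup>2 / (8 * d) + (- 4 * (norm v)\<^sup>2)" by simp
  then have "exp (- (norm v)\<^sup>2 / (4 * d)) \<le> exp (- r\<^sup>2 / (8 * d)) * exp (- 4 * (norm v)\<^sup>2)"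
    unfolding exp_add[symmetric] by simp
  then show ?thesis unfolding heat_def using d by (simp add: divide_right_mono)
qed

lemma tail_tendsto:
  assumes r: "r > 0"
  shows "(\<lambda>j. exp (- r\<^sup>2 / (8 * width j)) / sqrt (4 * pi * width j) ^ m) \<longlonglongrightarrow> 0"
proof -
  define c where "c = r\<^sup>2 / 8"
  have c: "c > 0" using r by (simp add: c_def)
  have lim: "(\<lambda>j. exp (- c * (real j + 32)) * (real j + 32) ^ m) \<longlonglongrightarrow> 0"
    using c by real_asymp
  show ?thesis
  proof (rule tendsto_sandwich[OF _ _ tendsto_const lim])
    show "\<forall>\<^sub>F j in sequentially. 0 \<le> exp (- r\<^sup>2 / (8 * width j)) / sqrt (4 * pi * width j) ^ m"
      by (intro always_eventually allI divide_nonneg_nonneg zero_le_power) auto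
    show "\<forall>\<^sub>F j in sequentially. exp (- r\<^sup>2 / (8 * width j)) / sqrt (4 * pi * width j) ^ m \<le>
        exp (- c * (real j + 32)) * (real j + 32) ^ m"
    proof (intro always_eventually allI)
      fix j
      let ?X = "real j + 32"
      have w: "width j = 1 / ?X" by (simp add: width_def field_simps)
      have e: "- r\<^sup>2 / (8 * width j) = - c * ?X" unfolding w c_def by simp
      have "1 / ?X\<^sup>2 \<le> 4 * pi * width j"
      proof -
        have "1 / ?X\<^sup>2 \<le> 1 / ?X" by (rule divide_left_mono) (auto simp: power2_eq_square)
        also have "\<dots> \<le> 4 * pi * (1 / ?X)" using pi_gt3 by (simp add: divide_right_mono)
        finally show ?thesis unfolding w .
      qed
      then have "1 / ?X \<le> sqrt (4 * pi * width j)"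
        by (intro real_le_rsqrt) (simp add: power_divide)
      then have "(1 / ?X) ^ m \<le> sqrt (4 * pi * width j) ^ m" by (rule power_mono) simp
      then have "1 / sqrt (4 * pi * width j) ^ m \<le> 1 / (1 / ?X) ^ m"
        by (intro divide_left_mono mult_pos_pos) auto
      also have "\<dots> = ?X ^ m" by (simp add: power_divide)
      finally have "exp (- c * ?X) * (1 / sqrt (4 * pi * width j) ^ m) \<le> exp (- c * ?X) * ?X ^ m"
        by (rule mult_left_mono) simp
      then show "exp (- r\<^sup>2 / (8 * width j)) / sqrt (4 * pi * width j) ^ m \<le> exp (- c * ?X) * ?X ^ m"
        unfolding e by simp
    qed
  qed
qed

lemma heat_le:
  fixes v :: "'a::euclidean_space"
  shows "heat (width j) v \<le> 1 / sqrt (4 * pi * width j) ^ DIM('a) * exp (- (norm v)\<^sup>2)"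
proof -
  have "heat (width j) v \<le> exp (- 0\<^sup>2 / (8 * width j)) / sqrt (4 * pi * width j) ^ DIM('a) * exp (- 4 * (norm v)\<^sup>2)"
    by (rule heat_tail[OF width_pos width_le]) auto
  also have "\<dots> \<le> 1 / sqrt (4 * pi * width j) ^ DIM('a) * exp (- (norm v)\<^sup>2)"
    by (intro mult_mono) auto
  finally show ?thesis .
qed

lemma integrable_heat_mult:
  fixes u :: "'a::euclidean_space \<Rightarrow> complex"
  assumes [measurable]: "u \<in> borel_measurable borel"
    and int: "integrable lborel (\<lambda>w. exp (- (norm (z - w))\<^sup>2) *\<^sub>R u w)"
  shows "integrable lborel (\<lambda>w. heat (width j) (z - w) *\<^sub>R u w)"
proof (rule Bochner_Integration.integrable_bound)
  let ?K = "1 / sqrt (4 * pi * width j) ^ DIM('a)"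
  show "integrable lborel (\<lambda>w. ?K * norm (exp (- (norm (z - w))\<^sup>2) *\<^sub>R u w))"
    by (intro integrable_mult_right integrable_norm int)
  show "AE w in lborel. norm (heat (width j) (z - w) *\<^sub>R u w) \<le> norm (?K * norm (exp (- (norm (z - w))\<^sup>2) *\<^sub>R u w))"
  proof (rule AE_I2)
    fix w
    have "norm (heat (width j) (z - w) *\<^sub>R u w) = heat (width j) (z - w) * norm (u w)" by simp
    also have "\<dots> \<le> (?K * exp (- (norm (z - w))\<^sup>2)) * norm (u w)"
      by (intro mult_right_mono heat_le) auto
    also have "\<dots> = ?K * norm (exp (- (norm (z - w))\<^sup>2) *\<^sub>R u w)" by simp
    also have "\<dots> \<le> norm (?K * norm (exp (- (norm (z - w))\<^sup>2) *\<^sub>R u w))" by (simp only: real_norm_def abs_ge_self)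
    finally show "norm (heat (width j) (z - w) *\<^sub>R u w) \<le> norm (?K * norm (exp (- (norm (z - w))\<^sup>2) *\<^sub>R u w))" .
  qed
qed measurable

text \<open>On a small ball around \<open>z\<close> the continuity of \<open>g\<close> contributes
  at most \<open>e / 2\<close>, the kernel having mass one. Outside, \<open>heat_tail\<close> bounds
  the kernel by a vanishing factor times a fixed Gaussian, against which \<open>u\<close> is
  integrable. Thus agreement with \<open>g\<close> matters only near \<open>z\<close>.\<close>

lemma heat_approx:
  fixes u :: "'a::euclidean_space \<Rightarrow> complex"
  assumes [measurable]: "u \<in> borel_measurable borel"
    and int: "integrable lborel (\<lambda>w. exp (- (norm (z - w))\<^sup>2) *\<^sub>R u w)"
    and ae: "AE w in lborel. w \<in> ball z r \<longrightarrow> u w = g w" and r: "r > 0" and cont: "isCont g z"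
  shows "(\<lambda>j. \<integral>w. heat (width j) (z - w) *\<^sub>R u w \<partial>lborel) \<longlonglongrightarrow> g z"
proof (rule tendstoI)
  fix e :: real assume e: "e > 0"
  obtain r' where r': "r' > 0" "\<And>w. dist w z < r' \<Longrightarrow> dist (g w) (g z) < e / 2"
    using cont e unfolding continuous_at_eps_delta by (meson half_gt_zero)
  define R where "R = min r r'"
  have R: "R > 0" "R \<le> r" "R \<le> r'" using r r' by (auto simp: R_def)
  define T where "T = (\<lambda>j. exp (- R\<^sup>2 / (8 * width j)) / sqrt (4 * pi * width j) ^ DIM('a))"
  have T0: "T j \<ge> 0" for j unfolding T_def by simp
  have gz: "integrable lborel (\<lambda>w. exp (- (norm (z - w))\<^sup>2) *\<^sub>R g z)"
  proof -
    have "integrable lborel (\<lambda>w. norm (gaussian (0::'a) 1 w))"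
      by (intro integrable_norm schwartz_integrable schwartz_gaussian) simp
    then have "integrable lborel (\<lambda>w::'a. exp (- (norm w)\<^sup>2))" by (simp add: norm_gaussian)
    then have "integrable lborel (\<lambda>w::'a. exp (- (norm (z + w))\<^sup>2))"
      using integrable_shift_iff[of "\<lambda>w::'a. exp (- (norm w)\<^sup>2)" z] by simp
    then have "integrable lborel (\<lambda>w::'a. exp (- (norm (z - w))\<^sup>2))"
      using integrable_reflect_iff[of "\<lambda>w::'a. exp (- (norm (z + w))\<^sup>2)"] by simp
    then show ?thesis by (rule integrable_scaleR_left)
  qed
  define K where "K = (\<integral>w. norm (exp (- (norm (z - w))\<^sup>2) *\<^sub>R (u w - g z)) \<partial>lborel)"
  have diff: "integrable lborel (\<lambda>w. exp (- (norm (z - w))\<^sup>2) *\<^sub>R (u w - g z))"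
    unfolding scaleR_diff_right by (intro Bochner_Integration.integrable_diff int gz)
  have main: "norm ((\<integral>w. heat (width j) (z - w) *\<^sub>R u w \<partial>lborel) - g z) \<le> e / 2 + T j * K" for j
  proof -
    have h: "integrable lborel (\<lambda>w. heat (width j) (z - w))" "(\<integral>w. heat (width j) (z - w) \<partial>lborel) = 1"
      using has_bochner_integral_heat_diff[of "width j" z] by (auto simp: has_bochner_integral_iff)
    have h2: "integrable lborel (\<lambda>w. heat (width j) (z - w) *\<^sub>R g z)"
      by (rule integrable_scaleR_left) (rule h)
    have iu: "integrable lborel (\<lambda>w. heat (width j) (z - w) *\<^sub>R u w)"
      by (rule integrable_heat_mult) (use int in auto)
    have id: "integrable lborel (\<lambda>w. heat (width j) (z - w) *\<^sub>R (u w - g z))"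
      unfolding scaleR_diff_right by (intro Bochner_Integration.integrable_diff iu h2)
    have "(\<integral>w. heat (width j) (z - w) *\<^sub>R u w \<partial>lborel) - g z = (\<integral>w. heat (width j) (z - w) *\<^sub>R (u w - g z) \<partial>lborel)"
      unfolding scaleR_diff_right by (subst Bochner_Integration.integral_diff[OF iu h2]) (simp add: h)
    also have "norm \<dots> \<le> (\<integral>w. norm (heat (width j) (z - w) *\<^sub>R (u w - g z)) \<partial>lborel)"
      by (rule integral_norm_bound)
    also have "\<dots> \<le> (\<integral>w. e / 2 * heat (width j) (z - w) + T j * norm (exp (- (norm (z - w))\<^sup>2) *\<^sub>R (u w - g z)) \<partial>lborel)"
    proof (rule integral_mono_AE)
      show "AE w in lborel. norm (heat (width j) (z - w) *\<^sub>R (u w - g z)) \<le>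
        e / 2 * heat (width j) (z - w) + T j * norm (exp (- (norm (z - w))\<^sup>2) *\<^sub>R (u w - g z))"
        using ae
      proof eventually_elim
        case (elim w)
        have pos: "0 \<le> heat (width j) (z - w)" by simp
        show ?case
        proof (cases "dist w z < R")
          case True
          then have "u w = g w" using elim R by (auto simp: dist_commute)
          moreover have "norm (g w - g z) \<le> e / 2" using r'(2)[of w] True R by (simp add: dist_norm)
          ultimately have "heat (width j) (z - w) * norm (u w - g z) \<le> heat (width j) (z - w) * (e / 2)"
            by (intro mult_left_mono) auto
          then have "norm (heat (width j) (z - w) *\<^sub>R (u w - g z)) \<le> e / 2 * heat (width j) (z - w)"
            by (simp add: mult.commute)
          also have "\<dots> \<le> e / 2 * heat (width j) (z - w) + T j * norm (exp (- (norm (z - w))\<^sup>2) *\<^sub>R (u w - g z))"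
            using T0[of j] by simp
          finally show ?thesis .
        next
          case False
          have "heat (width j) (z - w) \<le> T j * exp (- 4 * (norm (z - w))\<^sup>2)"
            unfolding T_def using False R by (intro heat_tail width_le) (auto simp: dist_norm norm_minus_commute)
          also have "\<dots> \<le> T j * exp (- (norm (z - w))\<^sup>2)"
            by (intro mult_left_mono T0) simp
          finally have "heat (width j) (z - w) * norm (u w - g z) \<le> T j * exp (- (norm (z - w))\<^sup>2) * norm (u w - g z)"
            by (rule mult_right_mono) simp
          then have "norm (heat (width j) (z - w) *\<^sub>R (u w - g z)) \<le> T j * norm (exp (- (norm (z - w))\<^sup>2) *\<^sub>R (u w - g z))"
            by (simp add: mult.assoc)
          also have "\<dots> \<le> e / 2 * heat (width j) (z - w) + T j * norm (exp (- (norm (z - w))\<^sup>2) *\<^sub>R (u w - g z))"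
            using e pos by simp
          finally show ?thesis .
        qed
      qed
    qed (intro integrable_norm id Bochner_Integration.integrable_add integrable_mult_right h diff)+
    also have "\<dots> = e / 2 + T j * K"
      unfolding K_def
      by (subst Bochner_Integration.integral_add)
         (rule integrable_mult_right, rule h, rule integrable_mult_right, rule integrable_norm[OF diff], simp only: integral_mult_right_zero h mult_1_right)
    finally show ?thesis .
  qed
  have "(\<lambda>j. e / 2 + T j * K) \<longlonglongrightarrow> e / 2 + 0 * K"
    unfolding T_def by (intro tendsto_intros tail_tendsto R)
  then have "eventually (\<lambda>j. e / 2 + T j * K < e) sequentially"
    by (rule order_tendstoD) (use e in simp)
  then show "eventually (\<lambda>j. dist (\<integral>w. heat (width j) (z - w) *\<^sub>R u w \<partial>lborel) (g z) < e) sequentially"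
    by eventually_elim (use main in \<open>auto simp: dist_norm intro: le_less_trans\<close>)
qed

section \<open>Difference quotients and square integrable derivatives\<close>

lemma partial_tendsto:
  fixes u :: "'a::euclidean_space \<Rightarrow> 'b::real_normed_vector"
  assumes "u differentiable (at z)"
  shows "((\<lambda>t. (1 / t) *\<^sub>R (u (z + t *\<^sub>R b) - u z)) \<longlongrightarrow> partial b u z) (at 0)"
proof -
  have "(u has_derivative frechet_derivative u (at z)) (at z)"
    using assms by (simp add: frechet_derivative_works)
  then have 2: "(u has_derivative frechet_derivative u (at z)) (at (z + 0 *\<^sub>R b))" by simp
  have 1: "((\<lambda>t. z + t *\<^sub>R b) has_derivative (\<lambda>t. t *\<^sub>R b)) (at 0)"
    by (auto intro!: derivative_eq_intros)
  have "((\<lambda>t. u (z + t *\<^sub>R b)) has_derivative (\<lambda>t. frechet_derivative u (at z) (t *\<^sub>R b))) (at 0)"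
    by (rule has_derivative_compose[OF 1 2])
  moreover have "frechet_derivative u (at z) (t *\<^sub>R b) = t *\<^sub>R partial b u z" for t
    using linear_scale[OF has_derivative_linear[OF 2]] by (simp add: partial_def)
  ultimately have "((\<lambda>t. u (z + t *\<^sub>R b)) has_derivative (\<lambda>t. t *\<^sub>R partial b u z)) (at 0)" by simp
  then have lim: "(\<lambda>t. norm (u (z + t *\<^sub>R b) - u z - t *\<^sub>R partial b u z) / norm t) \<midarrow>0\<rightarrow> 0"
    unfolding has_derivative_at by simp
  have "((\<lambda>t. norm ((1 / t) *\<^sub>R (u (z + t *\<^sub>R b) - u z) - partial b u z)) \<longlongrightarrow> 0) (at 0)"
  proof (rule Lim_transform_eventually[OF lim])
    show "\<forall>\<^sub>F t in at 0. norm (u (z + t *\<^sub>R b) - u z - t *\<^sub>R partial b u z) / norm t =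
        norm ((1 / t) *\<^sub>R (u (z + t *\<^sub>R b) - u z) - partial b u z)"
      unfolding eventually_at_filter
    proof (intro always_eventually allI impI)
      fix t :: real assume t: "t \<noteq> 0"
      have "(1 / t) *\<^sub>R (u (z + t *\<^sub>R b) - u z) - partial b u z = (1 / t) *\<^sub>R (u (z + t *\<^sub>R b) - u z - t *\<^sub>R partial b u z)"
        using t by (simp add: scaleR_diff_right)
      then show "norm (u (z + t *\<^sub>R b) - u z - t *\<^sub>R partial b u z) / norm t =
        norm ((1 / t) *\<^sub>R (u (z + t *\<^sub>R b) - u z) - partial b u z)" by simp
    qed
  qed
  then show ?thesis by (rule LIM_zero_cancel[OF tendsto_norm_zero_cancel])
qed

text \<open>The weight is a Schwartz function: up to a constant it is the transform of
  \<open>gaussian z (1 / 4)\<close>, since at time \<open>1 / 4\<close> the heat kernel has the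
  exponent \<open>- (norm (z - w))^2\<close>.\<close>

lemma gaussian_weight_integrable:
  fixes u :: "'a::euclidean_space \<Rightarrow> complex"
  assumes u: "\<And>f. schwartz f \<Longrightarrow> integrable lborel (\<lambda>x. u x * f x)" and [measurable]: "u \<in> borel_measurable borel"
  shows "integrable lborel (\<lambda>w. exp (- (norm (z - w))\<^sup>2) *\<^sub>R u w)"
proof -
  have "integrable lborel (\<lambda>w. u w * fourier (gaussian z (1 / 4)) w)"
    by (intro u schwartz_fourier schwartz_gaussian) simp
  then have "integrable lborel (\<lambda>w. norm (u w * fourier (gaussian z (1 / 4)) w))"
    by (rule integrable_norm)
  moreover have "norm (u w * fourier (gaussian z (1 / 4)) w) =
      (2 * pi) ^ DIM('a) / sqrt pi ^ DIM('a) * norm (exp (- (norm (z - w))\<^sup>2) *\<^sub>R u w)" for w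
  proof -
    have "fourier (gaussian z (1 / 4)) w = complex_of_real ((2 * pi) ^ DIM('a) / sqrt pi ^ DIM('a) * exp (- (norm (z - w))\<^sup>2))"
      by (subst fourier_gaussian) (simp_all add: heat_def)
    moreover have "0 \<le> (2 * pi) ^ DIM('a) / sqrt pi ^ DIM('a) * exp (- (norm (z - w))\<^sup>2)" by simp
    ultimately have "norm (fourier (gaussian z (1 / 4)) w) = (2 * pi) ^ DIM('a) / sqrt pi ^ DIM('a) * exp (- (norm (z - w))\<^sup>2)"
      by (simp only: norm_of_real abs_of_nonneg)
    then show ?thesis by (simp add: norm_mult)
  qed
  ultimately have i: "integrable lborel (\<lambda>w. (2 * pi) ^ DIM('a) / sqrt pi ^ DIM('a) * norm (exp (- (norm (z - w))\<^sup>2) *\<^sub>R u w))"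
    by simp
  have "integrable lborel (\<lambda>w. norm (exp (- (norm (z - w))\<^sup>2) *\<^sub>R u w))"
    using i by (subst (asm) integrable_mult_left_iff) simp
  then show ?thesis by (subst (asm) integrable_norm_iff) measurable
qed

lemma measurable_norm_square:
  fixes H :: "'a \<Rightarrow> complex"
  assumes [measurable]: "H \<in> borel_measurable M"
  shows "(\<lambda>x. ennreal ((norm (H x))\<^sup>2)) \<in> borel_measurable M"
  by measurable

text \<open>The heat regularizations \<open>Fd j\<close> of \<open>F\<close> are reflected
  transforms of the integrable functions \<open>G j\<close>, so Plancherel bounds them and their
  difference quotients by the Sobolev norm, uniformly in \<open>j\<close> and in the step
  \<open>t\<close>. Fatou in \<open>j\<close> replaces \<open>Fd j\<close> by \<open>g\<close> at
  the points of \<open>U\<close>, and Fatou in \<open>t\<close> turns difference quotients into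
  derivatives. The classical derivative of \<open>g\<close> is thus estimated directly, without weak
  derivatives of \<open>F\<close>.\<close>

lemma sobolev_interior:
  fixes F g :: "'a::euclidean_space \<Rightarrow> complex"
  assumes F: "in_sobolev s F" and s: "s \<ge> 1" and U: "open U"
    and ae: "AE x in lborel. x \<in> U \<longrightarrow> F x = g x"
    and diff: "\<And>x. x \<in> U \<Longrightarrow> g differentiable (at x)"
    and b: "b \<in> Basis"
  shows "(\<integral>\<^sup>+x. indicator U x * ennreal ((norm (g x))\<^sup>2) \<partial>lborel) < \<infinity>"
    and "(\<integral>\<^sup>+x. indicator U x * ennreal ((norm (partial b g x))\<^sup>2) \<partial>lborel) < \<infinity>"
proof -
  obtain Fh where rep: "represented_by (fourier_distr (fun_distr F)) Fh"
    and A: "integrable lborel (\<lambda>k. (1 + (norm k)\<^sup>2) powr s * (norm (Fh k))\<^sup>2)"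
    and temp: "tempered_function F"
    using F unfolding in_sobolev_def by blast
  have [measurable]: "F \<in> borel_measurable borel" "Fh \<in> borel_measurable borel"
    using rep temp unfolding represented_by_def tempered_function_def by auto
  have Fint: "integrable lborel (\<lambda>x. F x * f x)" if "schwartz f" for f
    using temp that unfolding represented_by_def tempered_function_def by (auto simp: has_bochner_integral_iff)
  have Fhint: "integrable lborel (\<lambda>x. Fh x * f x)"
    and Fheq: "(\<integral>x. Fh x * f x \<partial>lborel) = (\<integral>x. F x * fourier f x \<partial>lborel)" if "schwartz f" for f
    using rep that unfolding represented_by_def fourier_distr_def fun_distr_def by (auto simp: has_bochner_integral_iff)
  define Fd where "Fd = (\<lambda>j z. \<integral>w. heat (width j) (z - w) *\<^sub>R F w \<partial>lborel)"
  define G where "G = (\<lambda>j k. Fh k * gaussian 0 (width j) k)"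
  define c where "c = complex_of_real (1 / (2 * pi) ^ DIM('a))"
  have gm: "gaussian z d \<in> borel_measurable borel" if "d > 0" for z :: 'a and d
    using schwartz_gaussian[OF that] by (rule schwartz_measurable)
  have [measurable]: "gaussian 0 (width j) \<in> borel_measurable (borel :: 'a measure)" for j by (rule gm) simp
  have [measurable]: "G j \<in> borel_measurable borel" for j unfolding G_def by measurable
  have Gint: "integrable lborel (G j)" for j
    unfolding G_def by (intro Fhint schwartz_gaussian) simp
  have GF: "norm (G j k) \<le> norm (Fh k)" for j k
    unfolding G_def by (simp add: norm_mult norm_gaussian mult_left_le)
  have Fd: "Fd j z = c * fourier (G j) (- z)" for j z
  proof -
    have "fourier (G j) (- z) = (\<integral>k. Fh k * gaussian z (width j) k \<partial>lborel)"
      unfolding fourier_def G_def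
      by (rule Bochner_Integration.integral_cong[OF refl])
         (simp add: gaussian_def exp_diff exp_minus inner_commute field_simps)
    also have "\<dots> = (\<integral>x. F x * fourier (gaussian z (width j)) x \<partial>lborel)"
      by (intro Fheq schwartz_gaussian) simp
    also have "\<dots> = (\<integral>x. complex_of_real ((2 * pi) ^ DIM('a)) * (heat (width j) (z - x) *\<^sub>R F x) \<partial>lborel)"
      by (simp add: fourier_gaussian scaleR_conv_of_real mult_ac)
    also have "\<dots> = complex_of_real ((2 * pi) ^ DIM('a)) * Fd j z"
      unfolding Fd_def by (rule integral_mult_right_zero)
    finally show ?thesis unfolding c_def by simp
  qed
  define K where "K = ennreal ((norm c)\<^sup>2) * (ennreal ((2 * pi) ^ DIM('a)) * (\<integral>\<^sup>+k. ennreal ((1 + (norm k)\<^sup>2) * (norm (Fh k))\<^sup>2) \<partial>lborel))"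
  have K: "K < \<infinity>"
  proof -
    have "(\<integral>\<^sup>+k. ennreal ((1 + (norm k)\<^sup>2) * (norm (Fh k))\<^sup>2) \<partial>lborel) \<le> (\<integral>\<^sup>+k. ennreal ((1 + (norm k)\<^sup>2) powr s * (norm (Fh k))\<^sup>2) \<partial>lborel)"
    proof (intro nn_integral_mono ennreal_leI mult_right_mono)
      fix k :: 'a
      have "(1 + (norm k)\<^sup>2) powr 1 \<le> (1 + (norm k)\<^sup>2) powr s" by (rule powr_mono[OF s]) simp
      then show "1 + (norm k)\<^sup>2 \<le> (1 + (norm k)\<^sup>2) powr s" by (simp add: add_pos_nonneg)
    qed simp
    also have "\<dots> < \<infinity>" using A by (simp add: integrable_iff_bounded abs_mult)
    finally show ?thesis unfolding K_def by (simp add: ennreal_mult_less_top)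
  qed
  \<comment> \<open>The estimate for a general Fourier multiplier \<open>m\<close>: the constant 1
    and the symbols of difference quotients are the instances. The bound \<open>B\<close>, which may
    depend on the step, only gives integrability; the constant \<open>K\<close> comes from the
    second bound on \<open>m\<close>, which is uniform in the step.\<close>
  have bound: "(\<integral>\<^sup>+z. ennreal ((norm (c * fourier (\<lambda>k. m k * G j k) (- z)))\<^sup>2) \<partial>lborel) \<le> K"
    if [measurable]: "m \<in> borel_measurable borel" and m: "\<And>k. norm (m k) \<le> B" "\<And>k. (norm (m k))\<^sup>2 \<le> 1 + (norm k)\<^sup>2" for m B j
  proof -
    have int: "integrable lborel (\<lambda>k. m k * G j k)"
    proof (rule Bochner_Integration.integrable_bound)
      show "integrable lborel (\<lambda>k. B * norm (G j k))" by (intro integrable_mult_right integrable_norm Gint)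
      have "0 \<le> B" using order_trans[OF norm_ge_zero m(1)] .
      then show "AE k in lborel. norm (m k * G j k) \<le> norm (B * norm (G j k))"
        by (intro AE_I2) (simp add: norm_mult mult_right_mono m)
    qed measurable
    have "(\<integral>\<^sup>+z. ennreal ((norm (c * fourier (\<lambda>k. m k * G j k) (- z)))\<^sup>2) \<partial>lborel) =
        ennreal ((norm c)\<^sup>2) * (\<integral>\<^sup>+z. ennreal ((norm (fourier (\<lambda>k. m k * G j k) (- z)))\<^sup>2) \<partial>lborel)"
      by (subst nn_integral_cmult[symmetric]) (auto simp: norm_mult power_mult_distrib ennreal_mult)
    also have "(\<integral>\<^sup>+z. ennreal ((norm (fourier (\<lambda>k. m k * G j k) (- z)))\<^sup>2) \<partial>lborel) = (\<integral>\<^sup>+z. ennreal ((norm (fourier (\<lambda>k. m k * G j k) z))\<^sup>2) \<partial>lborel)"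
      by (rule nn_integral_reflect) measurable
    also have "\<dots> \<le> ennreal ((2 * pi) ^ DIM('a)) * (\<integral>\<^sup>+k. ennreal ((norm (m k * G j k))\<^sup>2) \<partial>lborel)"
      by (rule plancherel_le[OF int])
    also have "(\<integral>\<^sup>+k. ennreal ((norm (m k * G j k))\<^sup>2) \<partial>lborel) \<le> (\<integral>\<^sup>+k. ennreal ((1 + (norm k)\<^sup>2) * (norm (Fh k))\<^sup>2) \<partial>lborel)"
      by (intro nn_integral_mono ennreal_leI)
         (auto simp: norm_mult power_mult_distrib intro!: mult_mono m power_mono GF)
    finally show ?thesis unfolding K_def by (simp add: mult_left_mono)
  qed
  have approx: "(\<lambda>j. Fd j z) \<longlonglongrightarrow> g z" if z: "z \<in> U" for z
  proof -
    obtain r where r: "r > 0" "ball z r \<subseteq> U" using U z by (meson open_contains_ball)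
    show ?thesis unfolding Fd_def
    proof (rule heat_approx[of F z r g])
      show "integrable lborel (\<lambda>w. exp (- (norm (z - w))\<^sup>2) *\<^sub>R F w)"
        by (rule gaussian_weight_integrable[OF Fint]) auto
      show "AE w in lborel. w \<in> ball z r \<longrightarrow> F w = g w" using ae r by (auto elim!: eventually_mono)
      show "isCont g z" using diff[OF z] by (rule differentiable_imp_continuous_within)
    qed (use r in auto)
  qed
  have Fdm [measurable]: "Fd j \<in> borel_measurable borel" for j unfolding Fd[abs_def] by measurable
  have [measurable]: "U \<in> sets borel" using U by simp
  have "(\<integral>\<^sup>+x. indicator U x * ennreal ((norm (g x))\<^sup>2) \<partial>lborel) \<le> K"
  proof (rule nn_integral_le_of_tendsto)
    let ?g = "\<lambda>j x. indicator U x * ennreal ((norm (Fd j x))\<^sup>2)"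
    show "?g j \<in> borel_measurable lborel" for j by measurable
    show "(\<integral>\<^sup>+x. ?g j x \<partial>lborel) \<le> K" for j
    proof -
      have "(\<integral>\<^sup>+x. ?g j x \<partial>lborel) \<le> (\<integral>\<^sup>+z. ennreal ((norm (c * fourier (\<lambda>k. 1 * G j k) (- z)))\<^sup>2) \<partial>lborel)"
        by (intro nn_integral_mono) (auto simp: Fd split: split_indicator)
      also have "\<dots> \<le> K" by (rule bound[of _ 1]) auto
      finally show ?thesis .
    qed
    have "(\<lambda>j. ?g j x) \<longlonglongrightarrow> indicator U x * ennreal ((norm (g x))\<^sup>2)" for x
    proof (cases "x \<in> U")
      case True
      then show ?thesis using approx[OF True] by (auto intro!: tendsto_ennrealI tendsto_intros)
    qed simp
    then show "AE x in lborel. (\<lambda>j. ?g j x) \<longlonglongrightarrow> indicator U x * ennreal ((norm (g x))\<^sup>2)" by simp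
  qed
  then show "(\<integral>\<^sup>+x. indicator U x * ennreal ((norm (g x))\<^sup>2) \<partial>lborel) < \<infinity>" using K by (rule le_less_trans)
  \<comment> \<open>Difference quotients are compared only where the translate stays in
    \<open>U\<close>; since \<open>U\<close> is open, each of its points lies in \<open>V t\<close>
    for all small \<open>t\<close>.\<close>
  define V where "V = (\<lambda>t. U \<inter> (\<lambda>z. z + t *\<^sub>R b) -` U)"
  have Vopen: "open (V t)" for t
    unfolding V_def by (intro open_Int U open_vimage continuous_intros)
  have contU: "continuous_on U g"
    by (auto intro!: continuous_at_imp_continuous_on differentiable_imp_continuous_within diff)
  have Vm [measurable]: "V t \<in> sets borel" for t using Vopen by simp
  have dq: "(\<integral>\<^sup>+x. indicator (V t) x * ennreal ((norm ((1 / t) *\<^sub>R (g (x + t *\<^sub>R b) - g x)))\<^sup>2) \<partial>lborel) \<le> K"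
    if t: "t \<noteq> 0" for t
  proof (rule nn_integral_le_of_tendsto)
    let ?g = "\<lambda>j x. indicator (V t) x * ennreal ((norm ((1 / t) *\<^sub>R (Fd j (x + t *\<^sub>R b) - Fd j x)))\<^sup>2)"
    show "?g j \<in> borel_measurable lborel" for j by measurable
    show "(\<integral>\<^sup>+x. ?g j x \<partial>lborel) \<le> K" for j
    proof -
      \<comment> \<open>The symbol of the difference quotient. It is bounded by
        \<open>norm k\<close> for every step \<open>t\<close>, and for each fixed \<open>t\<close>
        by a constant.\<close>
      define m where "m = (\<lambda>k. complex_of_real (1 / t) * (iexp (t * (k \<bullet> b)) - 1))"
      have int2: "integrable lborel (\<lambda>k. exp (- (\<i> * complex_of_real (y \<bullet> k))) * G j k)" for y
        by (rule integrable_fourier[OF Gint])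
      have diffq: "(1 / t) *\<^sub>R (Fd j (x + t *\<^sub>R b) - Fd j x) = c * fourier (\<lambda>k. m k * G j k) (- x)" for x
      proof -
        have "fourier (\<lambda>k. m k * G j k) (- x) = (\<integral>k. complex_of_real (1 / t) * (exp (- (\<i> * complex_of_real (- (x + t *\<^sub>R b) \<bullet> k))) * G j k
            - exp (- (\<i> * complex_of_real (- x \<bullet> k))) * G j k) \<partial>lborel)"
          unfolding fourier_def
          by (rule Bochner_Integration.integral_cong[OF refl])
             (simp add: m_def inner_add_left inner_commute[of b] exp_add algebra_simps)
        also have "\<dots> = complex_of_real (1 / t) * (fourier (G j) (- (x + t *\<^sub>R b)) - fourier (G j) (- x))"
          unfolding fourier_def integral_mult_right_zero Bochner_Integration.integral_diff[OF int2 int2] ..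
        finally have fq: "fourier (\<lambda>k. m k * G j k) (- x) = complex_of_real (1 / t) * (fourier (G j) (- (x + t *\<^sub>R b)) - fourier (G j) (- x))" .
        show ?thesis unfolding Fd fq by (simp only: scaleR_conv_of_real right_diff_distrib mult.left_commute)
      qed
      have mb: "norm (m k) \<le> norm k" for k
      proof -
        have "norm (iexp (t * (k \<bullet> b)) - 1) \<le> \<bar>t * (k \<bullet> b)\<bar>"
          using iexp_approx1[of "t * (k \<bullet> b)" 0] by simp
        also have "\<dots> \<le> \<bar>t\<bar> * norm k"
          unfolding abs_mult by (intro mult_left_mono Basis_le_norm b) simp
        finally show ?thesis unfolding m_def using t by (simp add: norm_mult norm_divide field_simps)
      qed
      have mB: "norm (m k) \<le> norm (1 / t) * 2" for k
      proof -
        have "norm (iexp (t * (k \<bullet> b)) - 1) \<le> norm (iexp (t * (k \<bullet> b))) + norm (1::complex)" by (rule norm_triangle_ineq4)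
        also have "\<dots> = 2" by simp
        finally show ?thesis unfolding m_def norm_mult norm_of_real real_norm_def by (intro mult_left_mono) auto
      qed
      have "(\<integral>\<^sup>+x. ?g j x \<partial>lborel) \<le> (\<integral>\<^sup>+z. ennreal ((norm (c * fourier (\<lambda>k. m k * G j k) (- z)))\<^sup>2) \<partial>lborel)"
        by (intro nn_integral_mono) (auto simp: diffq[symmetric] split: split_indicator)
      also have "\<dots> \<le> K"
      proof (rule bound[OF _ mB])
        show "m \<in> borel_measurable borel" unfolding m_def by measurable
        show "(norm (m k))\<^sup>2 \<le> 1 + (norm k)\<^sup>2" for k
        proof -
          have "(norm (m k))\<^sup>2 \<le> (norm k)\<^sup>2" by (rule power_mono[OF mb]) simp
          then show ?thesis by linarith
        qed
      qed
      finally show ?thesis .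
    qed
    have "(\<lambda>j. ?g j x) \<longlonglongrightarrow> indicator (V t) x * ennreal ((norm ((1 / t) *\<^sub>R (g (x + t *\<^sub>R b) - g x)))\<^sup>2)" for x
    proof (cases "x \<in> V t")
      case True
      then have "x \<in> U" "x + t *\<^sub>R b \<in> U" by (auto simp: V_def)
      with True t show ?thesis by (auto intro!: tendsto_ennrealI tendsto_intros approx)
    qed simp
    then show "AE x in lborel. (\<lambda>j. ?g j x) \<longlonglongrightarrow> indicator (V t) x * ennreal ((norm ((1 / t) *\<^sub>R (g (x + t *\<^sub>R b) - g x)))\<^sup>2)" by simp
  qed
  let ?t = "\<lambda>n. inverse (real (Suc n))"
  have "(\<integral>\<^sup>+x. indicator U x * ennreal ((norm (partial b g x))\<^sup>2) \<partial>lborel) \<le> K"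
  proof (rule nn_integral_le_of_tendsto)
    let ?g = "\<lambda>n x. indicator (V (?t n)) x * ennreal ((norm ((1 / ?t n) *\<^sub>R (g (x + ?t n *\<^sub>R b) - g x)))\<^sup>2)"
    show "(\<integral>\<^sup>+x. ?g n x \<partial>lborel) \<le> K" for n by (rule dq) simp
    show "?g n \<in> borel_measurable lborel" for n
    proof -
      have "continuous_on (V (?t n)) (\<lambda>x. (1 / ?t n) *\<^sub>R (g (x + ?t n *\<^sub>R b) - g x))"
        by (intro continuous_intros continuous_on_compose2[OF contU]) (auto simp: V_def)
      then have m: "(\<lambda>x. indicator (V (?t n)) x *\<^sub>R ((1 / ?t n) *\<^sub>R (g (x + ?t n *\<^sub>R b) - g x))) \<in> borel_measurable borel"
        (is "?H \<in> _")
        by (intro borel_measurable_continuous_on_indicator) auto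
      have eq: "?g n = (\<lambda>x. ennreal ((norm (?H x))\<^sup>2))"
        by (auto simp: fun_eq_iff split: split_indicator)
      have "?H \<in> borel_measurable lborel" using m by (simp only: measurable_lborel1 measurable_lborel2)
      from measurable_norm_square[OF this] show ?thesis unfolding eq .
    qed
    have "(\<lambda>n. ?g n x) \<longlonglongrightarrow> indicator U x * ennreal ((norm (partial b g x))\<^sup>2)" for x
    proof (cases "x \<in> U")
      case False
      then show ?thesis by (simp add: V_def)
    next
      case True
      have t0: "filterlim ?t (at 0) sequentially"
        unfolding filterlim_at using LIMSEQ_inverse_real_of_nat by (simp del: of_nat_Suc)
      have "((\<lambda>t. x + t *\<^sub>R b) \<longlongrightarrow> x + 0 *\<^sub>R b) (at 0)" by (intro tendsto_intros)
      then have "eventually (\<lambda>t. x + t *\<^sub>R b \<in> U) (at 0)"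
        using U True by (auto dest: topological_tendstoD)
      then have ev: "eventually (\<lambda>n. x + ?t n *\<^sub>R b \<in> U) sequentially"
        using t0 by (auto simp: filterlim_iff)
      have lim: "(\<lambda>n. ennreal ((norm ((1 / ?t n) *\<^sub>R (g (x + ?t n *\<^sub>R b) - g x)))\<^sup>2)) \<longlonglongrightarrow> ennreal ((norm (partial b g x))\<^sup>2)"
        by (intro tendsto_ennrealI tendsto_intros filterlim_compose[OF partial_tendsto[OF diff[OF True]] t0])
      have "(\<lambda>n. ?g n x) \<longlonglongrightarrow> ennreal ((norm (partial b g x))\<^sup>2)"
        by (rule Lim_transform_eventually[OF lim]) (use ev True in \<open>auto elim!: eventually_mono simp: V_def\<close>)
      then show ?thesis using True by simp
    qed
    then show "AE x in lborel. (\<lambda>n. ?g n x) \<longlonglongrightarrow> indicator U x * ennreal ((norm (partial b g x))\<^sup>2)" by simp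
  qed
  then show "(\<integral>\<^sup>+x. indicator U x * ennreal ((norm (partial b g x))\<^sup>2) \<partial>lborel) < \<infinity>" using K by (rule le_less_trans)
qed


section \<open>Weak gradients\<close>

lemma compact_support_weight_integrable:
  fixes h :: "'a::euclidean_space \<Rightarrow> complex"
  assumes h: "integrable lborel h" and R: "\<forall>x. norm x > R \<longrightarrow> h x = 0"
  shows "integrable lborel (\<lambda>x. (1 + norm x) ^ N *\<^sub>R h x)"
proof (rule Bochner_Integration.integrable_bound)
  have [measurable]: "h \<in> borel_measurable borel" using h by auto
  show "integrable lborel (\<lambda>x. (1 + \<bar>R\<bar>) ^ N * norm (h x))" by (intro integrable_mult_right integrable_norm h)
  have "(1 + norm x) ^ N * norm (h x) \<le> (1 + \<bar>R\<bar>) ^ N * norm (h x)" for x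
  proof (cases "norm x > R")
    case False
    then show ?thesis by (intro mult_right_mono power_mono) auto
  qed (simp add: R)
  then show "AE x in lborel. norm ((1 + norm x) ^ N *\<^sub>R h x) \<le> norm ((1 + \<bar>R\<bar>) ^ N * norm (h x))"
    by (intro AE_I2) (simp add: abs_mult)
  show "(\<lambda>x. (1 + norm x) ^ N *\<^sub>R h x) \<in> borel_measurable lborel" by measurable
qed

text \<open>Compact support makes all moments finite. These transforms are therefore smooth with
  bounded derivatives, and each derivative is again the transform of a compactly supported
  function.\<close>

definition compact_transforms :: "('a::euclidean_space \<Rightarrow> complex) set" where
  "compact_transforms = fourier ` {h. integrable lborel h \<and> (\<exists>R. \<forall>x. norm x > R \<longrightarrow> h x = 0)}"

lemma multiplier_class_compact_transforms: "multiplier_class compact_transforms"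
  unfolding multiplier_class_def
proof
  fix m :: "'a \<Rightarrow> complex" assume "m \<in> compact_transforms"
  then obtain h R where h: "integrable lborel h" and R: "\<forall>x. norm x > R \<longrightarrow> h x = 0" and m: "m = fourier h"
    unfolding compact_transforms_def by auto
  note w = compact_support_weight_integrable[OF h R]
  have "partial b m \<in> compact_transforms" if b: "b \<in> Basis" for b
  proof -
    have "integrable lborel (\<lambda>x. - \<i> * complex_of_real (x \<bullet> b) * h x)"
    proof (rule Bochner_Integration.integrable_bound[OF w[of 1]])
      show "(\<lambda>x. - \<i> * complex_of_real (x \<bullet> b) * h x) \<in> borel_measurable lborel"
        using borel_measurable_integrable[OF h] by measurable
      have "\<bar>x \<bullet> b\<bar> * norm (h x) \<le> (1 + norm x) * norm (h x)" for x
        using Basis_le_norm[OF b, of x] by (intro mult_right_mono) auto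
      then show "AE x in lborel. norm (- \<i> * complex_of_real (x \<bullet> b) * h x) \<le> norm ((1 + norm x) ^ 1 *\<^sub>R h x)"
        by (intro AE_I2) (simp add: norm_mult)
        qed
    then have "(\<lambda>x. - \<i> * complex_of_real (x \<bullet> b) * h x) \<in> {h. integrable lborel h \<and> (\<exists>R. \<forall>x. norm x > R \<longrightarrow> h x = 0)}"
      using R by auto
    then show ?thesis
      unfolding m partial_fourier[OF h w[of 2]] compact_transforms_def by (rule imageI)
  qed
  moreover have "poly_bounded m"
    unfolding poly_bounded_def m using norm_fourier_le[OF h] by (intro exI[of _ "\<integral>x. norm (h x) \<partial>lborel"] exI[of _ 0]) simp
  ultimately show "(\<forall>x. m differentiable (at x)) \<and> poly_bounded m \<and> (\<forall>b\<in>Basis. partial b m \<in> compact_transforms)"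
    unfolding m using fourier_differentiable[OF h w[of 2]] by auto
qed

section \<open>Heat regularization of test functions\<close>

definition heat_conv :: "real \<Rightarrow> ('a::euclidean_space \<Rightarrow> complex) \<Rightarrow> 'a \<Rightarrow> complex" where
  "heat_conv d g x = (\<integral>w. heat d (x - w) *\<^sub>R g w \<partial>lborel)"

text \<open>Only the forward transform is at hand, so the convolution is written as a transform of a
  transform at the price of reflecting \<open>g\<close>. In this form the Schwartz property and the
  derivatives of \<open>heat_conv\<close> become statements about multipliers of a Gaussian.\<close>

lemma heat_conv_eq_fourier:
  fixes g :: "'a::euclidean_space \<Rightarrow> complex"
  assumes g: "integrable lborel g" and d: "d > 0"
  shows "heat_conv d g x = complex_of_real (1 / (2 * pi) ^ DIM('a)) * fourier (\<lambda>k. fourier (\<lambda>w. g (- w)) k * gaussian 0 d k) x"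
proof -
  have [measurable]: "g \<in> borel_measurable borel" using g by auto
  have g': "integrable lborel (\<lambda>w. g (- w))" using g by (simp add: integrable_reflect_iff)
  have flip: "heat d (- x + w) = heat d (x - w)" for w
    using heat_minus[of d "x - w"] by simp
  have "fourier (\<lambda>k. fourier (\<lambda>w. g (- w)) k * gaussian 0 d k) x = (\<integral>k. fourier (\<lambda>w. g (- w)) k * gaussian (- x) d k \<partial>lborel)"
    unfolding fourier_def[of "\<lambda>k. fourier (\<lambda>w. g (- w)) k * gaussian 0 d k"]
    by (rule Bochner_Integration.integral_cong[OF refl])
       (simp add: gaussian_def exp_diff exp_minus inner_commute field_simps)
  also have "\<dots> = (\<integral>w. g (- w) * fourier (gaussian (- x) d) w \<partial>lborel)"
    by (intro integral_fourier_swap g' schwartz_integrable schwartz_gaussian d)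
  also have "\<dots> = (\<integral>w. g (- w) * complex_of_real ((2 * pi) ^ DIM('a) * heat d (- x - w)) \<partial>lborel)"
    by (simp only: fourier_gaussian[OF d])
  also have "\<dots> = (\<integral>w. g w * complex_of_real ((2 * pi) ^ DIM('a) * heat d (- x + w)) \<partial>lborel)"
    using integral_reflect[of "\<lambda>w. g w * complex_of_real ((2 * pi) ^ DIM('a) * heat d (- x + w))"] by simp
  also have "\<dots> = (\<integral>w. complex_of_real ((2 * pi) ^ DIM('a)) * (heat d (x - w) *\<^sub>R g w) \<partial>lborel)"
    by (simp only: flip scaleR_conv_of_real of_real_mult mult_ac)
  also have "\<dots> = complex_of_real ((2 * pi) ^ DIM('a)) * heat_conv d g x"
    unfolding heat_conv_def by (rule integral_mult_right_zero)
  finally show ?thesis by simp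
qed

lemma
  fixes g :: "'a::euclidean_space \<Rightarrow> complex"
  assumes g: "integrable lborel g" and R: "\<forall>x. norm x > R \<longrightarrow> g x = 0" and d: "d > 0"
  shows schwartz_heat_conv: "schwartz (heat_conv d g)"
    and schwartz_heat_conv_symbol: "schwartz (\<lambda>k. fourier (\<lambda>w. g (- w)) k * gaussian 0 d k)"
proof -
  have g': "integrable lborel (\<lambda>w. g (- w))" using g by (subst integrable_reflect_iff) auto
  have "fourier (\<lambda>w. g (- w)) \<in> compact_transforms"
    unfolding compact_transforms_def using g' R by (intro imageI CollectI conjI exI[of _ R]) auto
  then show *: "schwartz (\<lambda>k. fourier (\<lambda>w. g (- w)) k * gaussian 0 d k)"
    by (intro schwartz_mult[OF multiplier_class_compact_transforms] schwartz_gaussian d)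
  have eq: "heat_conv d g = (\<lambda>x. complex_of_real (1 / (2 * pi) ^ DIM('a)) * fourier (\<lambda>k. fourier (\<lambda>w. g (- w)) k * gaussian 0 d k) x)"
    by (rule ext) (rule heat_conv_eq_fourier[OF g d])
  show "schwartz (heat_conv d g)"
    by (subst eq) (rule schwartz_scale[OF schwartz_fourier[OF *]])
qed

lemma compact_support_integrable:
  fixes g :: "'a::euclidean_space \<Rightarrow> 'b::{banach, second_countable_topology}"
  assumes "continuous_on UNIV g" "\<forall>x. norm x > R \<longrightarrow> g x = 0"
  shows "integrable lborel g"
proof -
  have "integrable lborel (\<lambda>x. indicator (cball 0 R) x *\<^sub>R g x)"
    by (rule borel_integrable_compact[OF compact_cball continuous_on_subset[OF assms(1) subset_UNIV]])
  moreover have "(\<lambda>x. indicator (cball 0 R) x *\<^sub>R g x) = g"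
  proof
    show "indicator (cball 0 R) x *\<^sub>R g x = g x" for x
      using spec[OF assms(2), of x] by (cases "norm x \<le> R") auto
  qed
  ultimately show ?thesis by simp
qed

lemma compact_support_bounded:
  fixes g :: "'a::euclidean_space \<Rightarrow> 'b::real_normed_vector"
  assumes "continuous_on UNIV g" "\<forall>x. norm x > R \<longrightarrow> g x = 0"
  obtains M where "M \<ge> 0" "\<And>x. norm (g x) \<le> M"
proof -
  have "bounded (g ` cball 0 R)"
    by (intro compact_imp_bounded compact_continuous_image continuous_on_subset[OF assms(1)]) auto
  then obtain M where "\<forall>y\<in>g ` cball 0 R. norm y \<le> M" unfolding bounded_iff by blast
  then have M: "\<And>x. norm x \<le> R \<Longrightarrow> norm (g x) \<le> M" by auto
  have "norm (g x) \<le> \<bar>M\<bar>" for x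
    using M[of x] spec[OF assms(2), of x] by (cases "norm x \<le> R") auto
  then show thesis using that[of "\<bar>M\<bar>"] by auto
qed

lemma partial_reflect:
  assumes "g differentiable (at (- x))"
  shows "partial b (\<lambda>w. g (- w)) x = - partial b g (- x)"
proof -
  have 1: "(uminus has_derivative uminus) (at x)" by (auto intro!: derivative_eq_intros)
  have 2: "(g has_derivative frechet_derivative g (at (- x))) (at (- x))"
    using assms by (simp add: frechet_derivative_works)
  show ?thesis
    using partial_eq[OF has_derivative_compose[OF 1 2], of b] linear_neg[OF has_derivative_linear[OF 2]]
    by (simp add: partial_def)
qed

lemma partial_outside:
  fixes g :: "'a::euclidean_space \<Rightarrow> 'b::real_normed_vector"
  assumes R: "\<forall>x. norm x > R \<longrightarrow> g x = 0"
  shows "\<forall>x. norm x > R \<longrightarrow> partial b g x = 0"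
proof (intro allI impI)
  fix x :: 'a assume x: "norm x > R"
  have "open {x::'a. norm x > R}" by (intro open_Collect_less continuous_intros)
  then have "(g has_derivative (\<lambda>h. 0)) (at x)"
    by (rule has_derivative_transform_within_open[OF has_derivative_const[of 0]]) (use R x in auto)
  then show "partial b g x = 0" by (rule partial_eq)
qed

text \<open>Both sides are transforms of a symbol times a Gaussian. Differentiating outside
  multiplies the symbol by a coordinate, and so does differentiating \<open>g\<close>, by
  \<open>fourier_partial\<close>; the reflection accounts for the sign.\<close>

lemma partial_heat_conv:
  fixes g :: "'a::euclidean_space \<Rightarrow> complex"
  assumes diff: "\<And>x. g differentiable (at x)" and cont: "continuous_on UNIV (partial b g)"
    and R: "\<forall>x. norm x > R \<longrightarrow> g x = 0" and d: "d > 0"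
  shows "partial b (heat_conv d g) = heat_conv d (partial b g)"
proof
  fix x
  have g: "integrable lborel g"
    using compact_support_integrable[OF differentiable_imp_continuous_UNIV[OF diff] R] .
  have pR: "\<forall>x. norm x > R \<longrightarrow> partial b g x = 0" by (rule partial_outside[OF R])
  have pg: "integrable lborel (partial b g)" by (rule compact_support_integrable[OF cont pR])
  have refl: "partial b (\<lambda>w. g (- w)) = (\<lambda>w. - partial b g (- w))"
    by (rule ext) (rule partial_reflect[OF diff])
  let ?S = "\<lambda>k. fourier (\<lambda>w. g (- w)) k * gaussian 0 d k"
  let ?c = "complex_of_real (1 / (2 * pi) ^ DIM('a))"
  have S: "schwartz ?S" by (rule schwartz_heat_conv_symbol[OF g R d])
  have sym: "- \<i> * complex_of_real (k \<bullet> b) * fourier (\<lambda>w. g (- w)) k = fourier (\<lambda>w. partial b g (- w)) k" for k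
  proof -
    have "fourier (partial b (\<lambda>w. g (- w))) k = \<i> * complex_of_real (k \<bullet> b) * fourier (\<lambda>w. g (- w)) k"
    proof (rule fourier_partial)
      show "(\<lambda>w. g (- w)) differentiable at x" for x
        using differentiable_chain_at[of uminus x g] diff by (auto simp: o_def)
      show "continuous_on UNIV (partial b (\<lambda>w. g (- w)))"
        unfolding refl by (intro continuous_intros continuous_on_compose2[OF cont]) auto
      show "integrable lborel (\<lambda>w. g (- w))" using g by (subst integrable_reflect_iff) auto
      have "integrable lborel (\<lambda>w. partial b g (- w))" using pg by (subst integrable_reflect_iff) auto
      then show "integrable lborel (partial b (\<lambda>w. g (- w)))" unfolding refl by simp
    qed
    moreover have "fourier (partial b (\<lambda>w. g (- w))) k = - fourier (\<lambda>w. partial b g (- w)) k"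
      unfolding refl fourier_def by simp
    ultimately show ?thesis by (simp add: algebra_simps) (metis add.inverse_inverse)
  qed
  have "partial b (heat_conv d g) x = partial b (\<lambda>x. ?c * fourier ?S x) x"
    by (simp only: heat_conv_eq_fourier[OF g d, abs_def])
  also have "\<dots> = ?c * partial b (fourier ?S) x"
    by (subst partial_mult)
       (auto simp: partial_const intro: schwartz_differentiable schwartz_fourier S)
  also have "\<dots> = ?c * fourier (\<lambda>k. - \<i> * complex_of_real (k \<bullet> b) * ?S k) x"
    by (simp only: partial_fourier_schwartz[OF S])
  also have "\<dots> = ?c * fourier (\<lambda>k. fourier (\<lambda>w. partial b g (- w)) k * gaussian 0 d k) x"
    unfolding sym[symmetric] by (simp only: mult.assoc)
  also have "\<dots> = heat_conv d (partial b g) x"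
    by (rule heat_conv_eq_fourier[OF pg d, symmetric])
  finally show "partial b (heat_conv d g) x = heat_conv d (partial b g) x" .
qed

text \<open>A Gaussian majorant uniform in \<open>j\<close> can be integrated against any tempered
  function. For \<open>norm x \<le> 2 * R' + 2\<close> the unit mass of the kernel suffices. Beyond
  that radius every \<open>w\<close> in the support has distance at least 1 and at least
  \<open>norm x / 2\<close> from \<open>x\<close>, so that the factor
  \<open>exp (- 4 * (norm (x - w))^2)\<close> of \<open>heat_tail\<close> is at most
  \<open>exp (- (norm x)^2)\<close>.\<close>

lemma heat_conv_dominated:
  fixes g :: "'a::euclidean_space \<Rightarrow> complex"
  assumes cont: "continuous_on UNIV g" and R: "\<forall>x. norm x > R \<longrightarrow> g x = 0"
  obtains C where "\<And>j x. norm (heat_conv (width j) g x) \<le> C * exp (- (norm x)\<^sup>2)"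
proof -
  define R' where "R' = \<bar>R\<bar>"
  have R': "R' \<ge> 0" "\<forall>x. norm x > R' \<longrightarrow> g x = 0" using R by (auto simp: R'_def)
  have g: "integrable lborel g" by (rule compact_support_integrable[OF cont R])
  have [measurable]: "g \<in> borel_measurable borel" using g by auto
  obtain M where M: "M \<ge> 0" "\<And>x. norm (g x) \<le> M" using compact_support_bounded[OF cont R] by metis
  define T where "T = (\<lambda>j. exp (- 1\<^sup>2 / (8 * width j)) / sqrt (4 * pi * width j) ^ DIM('a))"
  have "T \<longlonglongrightarrow> 0" unfolding T_def by (rule tail_tendsto) simp
  then have "Bseq T" by (intro convergent_imp_Bseq) (auto simp: convergent_def)
  then obtain B where B: "\<And>j. norm (T j) \<le> B" by (auto simp: Bseq_def)
  have B0: "B \<ge> 0" using order_trans[OF norm_ge_zero B] .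
  define I where "I = (\<integral>w. norm (g w) \<partial>lborel)"
  have I0: "I \<ge> 0" unfolding I_def by simp
  define C where "C = M * exp ((2 * R' + 2)\<^sup>2) + B * I"
  have le: "norm (heat_conv (width j) g x) \<le> (\<integral>w. heat (width j) (x - w) * norm (g w) \<partial>lborel)" for j x
    unfolding heat_conv_def by (rule order_trans[OF integral_norm_bound]) simp
  have hb: "integrable lborel (\<lambda>w. heat (width j) (x - w))" "(\<integral>w. heat (width j) (x - w) \<partial>lborel) = 1" for j x
    using has_bochner_integral_heat_diff[of "width j" x] by (auto simp: has_bochner_integral_iff)
  have hg: "integrable lborel (\<lambda>w. heat (width j) (x - w) * norm (g w))" for j x
  proof (rule Bochner_Integration.integrable_bound)
    show "integrable lborel (\<lambda>w. heat (width j) (x - w) * M)" by (intro integrable_mult_left hb)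
    show "AE w in lborel. norm (heat (width j) (x - w) * norm (g w)) \<le> norm (heat (width j) (x - w) * M)"
      using M by (intro AE_I2) (simp add: abs_mult mult_left_mono)
  qed measurable
  show thesis
  proof (rule that[of C])
    fix j and x :: 'a
    show "norm (heat_conv (width j) g x) \<le> C * exp (- (norm x)\<^sup>2)"
    proof (cases "norm x \<le> 2 * R' + 2")
      case True
      have "(\<integral>w. heat (width j) (x - w) * norm (g w) \<partial>lborel) \<le> (\<integral>w. heat (width j) (x - w) * M \<partial>lborel)"
        by (intro integral_mono hg integrable_mult_left hb mult_left_mono M) simp
      also have "\<dots> = M" by (simp add: hb)
      also have "M \<le> M * (exp ((2 * R' + 2)\<^sup>2) * exp (- (norm x)\<^sup>2))"
      proof -
        have "(norm x)\<^sup>2 \<le> (2 * R' + 2)\<^sup>2" using True by (intro power_mono) auto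
        then have "1 \<le> exp ((2 * R' + 2)\<^sup>2) * exp (- (norm x)\<^sup>2)" unfolding exp_add[symmetric] by simp
        then show ?thesis using M(1) by (simp add: mult_le_cancel_left1)
      qed
      also have "\<dots> \<le> C * exp (- (norm x)\<^sup>2)"
        unfolding C_def using B0 I0 by (simp add: algebra_simps)
      finally show ?thesis using le[of j x] by linarith
    next
      case False
      have pt: "heat (width j) (x - w) * norm (g w) \<le> (B * exp (- (norm x)\<^sup>2)) * norm (g w)" for w
      proof (cases "norm w > R'")
        case True
        then show ?thesis using R' by simp
      next
        case w: False
        have tri: "norm x - norm w \<le> norm (x - w)" by (rule norm_triangle_ineq2)
        have "heat (width j) (x - w) \<le> T j * exp (- 4 * (norm (x - w))\<^sup>2)"
          unfolding T_def by (rule heat_tail[OF width_pos width_le]) (use tri w False R' in auto)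
        also have "\<dots> \<le> B * exp (- (norm x)\<^sup>2)"
        proof (rule mult_mono)
          show "T j \<le> B" using B[of j] by simp
          have "norm x / 2 \<le> norm (x - w)" using tri w False R' by simp
          then have "(norm x / 2)\<^sup>2 \<le> (norm (x - w))\<^sup>2" by (intro power_mono) auto
          then show "exp (- 4 * (norm (x - w))\<^sup>2) \<le> exp (- (norm x)\<^sup>2)" by (simp add: power_divide)
        qed (use B0 in auto)
        finally show ?thesis by (rule mult_right_mono) simp
      qed
      have "(\<integral>w. heat (width j) (x - w) * norm (g w) \<partial>lborel) \<le> (\<integral>w. (B * exp (- (norm x)\<^sup>2)) * norm (g w) \<partial>lborel)"
        by (intro integral_mono hg integrable_mult_right integrable_norm g pt)
      also have "\<dots> = B * I * exp (- (norm x)\<^sup>2)" unfolding I_def by simp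
      also have "\<dots> \<le> C * exp (- (norm x)\<^sup>2)"
        unfolding C_def using M(1) by (intro mult_right_mono) auto
      finally show ?thesis using le[of j x] by linarith
    qed
  qed
qed

lemma heat_conv_tendsto:
  fixes g :: "'a::euclidean_space \<Rightarrow> complex"
  assumes cont: "continuous_on UNIV g" and R: "\<forall>x. norm x > R \<longrightarrow> g x = 0"
  shows "(\<lambda>j. heat_conv (width j) g x) \<longlonglongrightarrow> g x"
  unfolding heat_conv_def
proof (rule heat_approx[where r = 1])
  have g: "integrable lborel g" by (rule compact_support_integrable[OF cont R])
  show [measurable]: "g \<in> borel_measurable borel" using g by auto
  show "integrable lborel (\<lambda>w. exp (- (norm (x - w))\<^sup>2) *\<^sub>R g w)"
    by (rule Bochner_Integration.integrable_bound[OF g]) (auto intro!: AE_I2 mult_left_le_one_le)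
  show "isCont g x" using cont by (simp add: continuous_on_eq_continuous_at)
qed auto

lemma integral_heat_conv_tendsto:
  fixes u g :: "'a::euclidean_space \<Rightarrow> complex"
  assumes u: "\<forall>f. schwartz f \<longrightarrow> integrable lborel (\<lambda>x. u x * f x)" and [measurable]: "u \<in> borel_measurable borel"
    and cont: "continuous_on UNIV g" and R: "\<forall>x. norm x > R \<longrightarrow> g x = 0"
  shows "(\<lambda>j. \<integral>x. u x * heat_conv (width j) g x \<partial>lborel) \<longlonglongrightarrow> (\<integral>x. u x * g x \<partial>lborel)"
proof -
  have g: "integrable lborel g" by (rule compact_support_integrable[OF cont R])
  have [measurable]: "g \<in> borel_measurable borel" using g by auto
  have [measurable]: "heat_conv (width j) g \<in> borel_measurable borel" for j
    by (rule schwartz_measurable[OF schwartz_heat_conv[OF g R]]) simp_all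
  obtain C where C: "\<And>j x. norm (heat_conv (width j) g x) \<le> C * exp (- (norm x)\<^sup>2)"
    using heat_conv_dominated[OF cont R] by metis
  show ?thesis
  proof (rule integral_dominated_convergence[where w = "\<lambda>x. C * norm (u x * gaussian 0 1 x)"])
    show "integrable lborel (\<lambda>x. C * norm (u x * gaussian 0 1 x))"
      using u by (intro integrable_mult_right integrable_norm) (simp add: schwartz_gaussian)
    show "AE x in lborel. (\<lambda>j. u x * heat_conv (width j) g x) \<longlonglongrightarrow> u x * g x"
      by (intro AE_I2 tendsto_intros heat_conv_tendsto[OF cont R])
    show "AE x in lborel. norm (u x * heat_conv (width j) g x) \<le> C * norm (u x * gaussian 0 1 x)" for j
    proof (rule AE_I2)
      fix x
      have "norm (u x * heat_conv (width j) g x) \<le> norm (u x) * (C * exp (- (norm x)\<^sup>2))"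
        unfolding norm_mult by (intro mult_left_mono C) simp
      also have "\<dots> = C * norm (u x * gaussian 0 1 x)" by (simp add: norm_mult norm_gaussian)
      finally show "norm (u x * heat_conv (width j) g x) \<le> C * norm (u x * gaussian 0 1 x)" .
    qed
    have "u \<in> borel_measurable lborel" "g \<in> borel_measurable lborel" by simp_all
    then show "(\<lambda>x. u x * g x) \<in> borel_measurable lborel" by (rule borel_measurable_times)
    have "heat_conv (width j) g \<in> borel_measurable lborel" for j by simp
    with \<open>u \<in> borel_measurable lborel\<close> show "(\<lambda>x. u x * heat_conv (width j) g x) \<in> borel_measurable lborel" for j
      by (intro borel_measurable_times)
  qed
qed

text \<open>The surface is only continuously differentiable, so a mode restricted to it is a
  \<open>C^1\<close> test function and not a Schwartz function. Heat regularization makes it one and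
  commutes with the derivative; the limit is taken under both integrals by means of the Gaussian
  majorant.\<close>

lemma weak_partial_C1:
  fixes q p g :: "'a::euclidean_space \<Rightarrow> complex"
  assumes q: "\<forall>f. schwartz f \<longrightarrow> integrable lborel (\<lambda>x. q x * f x)" and qm: "q \<in> borel_measurable borel"
    and p: "\<forall>f. schwartz f \<longrightarrow> integrable lborel (\<lambda>x. p x * f x)" and pm: "p \<in> borel_measurable borel"
    and weak: "\<And>f. schwartz f \<Longrightarrow> (\<integral>x. p x * f x \<partial>lborel) = - (\<integral>x. q x * partial b f x \<partial>lborel)"
    and diff: "\<And>x. g differentiable (at x)" and cont: "continuous_on UNIV (partial b g)"
    and R: "\<forall>x. norm x > R \<longrightarrow> g x = 0"
  shows "(\<integral>x. p x * g x \<partial>lborel) = - (\<integral>x. q x * partial b g x \<partial>lborel)"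
proof -
  have gc: "continuous_on UNIV g" by (rule differentiable_imp_continuous_UNIV[OF diff])
  have g: "integrable lborel g" by (rule compact_support_integrable[OF gc R])
  have lim1: "(\<lambda>j. \<integral>x. p x * heat_conv (width j) g x \<partial>lborel) \<longlonglongrightarrow> (\<integral>x. p x * g x \<partial>lborel)"
    by (rule integral_heat_conv_tendsto[OF p pm gc R])
  have "(\<lambda>j. \<integral>x. q x * heat_conv (width j) (partial b g) x \<partial>lborel) \<longlonglongrightarrow> (\<integral>x. q x * partial b g x \<partial>lborel)"
    by (rule integral_heat_conv_tendsto[OF q qm cont partial_outside[OF R]])
  then have lim2: "(\<lambda>j. - (\<integral>x. q x * heat_conv (width j) (partial b g) x \<partial>lborel)) \<longlonglongrightarrow> - (\<integral>x. q x * partial b g x \<partial>lborel)"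
    by (rule tendsto_minus)
  have eq: "(\<integral>x. p x * heat_conv (width j) g x \<partial>lborel) = - (\<integral>x. q x * heat_conv (width j) (partial b g) x \<partial>lborel)" for j
    unfolding weak[OF schwartz_heat_conv[OF g R width_pos]] partial_heat_conv[OF diff cont R width_pos] ..
  show ?thesis using LIMSEQ_unique[OF lim1[unfolded eq] lim2] .
qed


section \<open>The Fourier symbol of the flat interface\<close>

definition cosh_root :: "complex \<Rightarrow> complex" where
  "cosh_root z = cosh (csqrt z)"

definition sinhc_root :: "complex \<Rightarrow> complex" where
  "sinhc_root z = (if z = 0 then 1 else sinh (csqrt z) / csqrt z)"

text \<open>As \<open>cosh\<close> is even, only even powers of \<open>csqrt z\<close> occur: the
  choice of the root drops out and a power series in \<open>z\<close> remains.\<close>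

lemma cosh_root_sums: "(\<lambda>n. (1 / fact (2 * n)) * (z - 0) ^ n) sums cosh_root z"
proof -
  have "(\<lambda>n. if even (2 * n) then csqrt z ^ (2 * n) /\<^sub>R fact (2 * n) else 0) sums cosh (csqrt z)"
    by (subst sums_mono_reindex[of "\<lambda>n. 2 * n" "\<lambda>n. if even n then csqrt z ^ n /\<^sub>R fact n else 0"])
       (auto intro!: strict_monoI cosh_converges elim!: evenE)
  moreover have "(if even (2 * n) then csqrt z ^ (2 * n) /\<^sub>R fact (2 * n) else 0) = (1 / fact (2 * n)) * (z - 0) ^ n" for n
    by (simp only: power_mult power2_csqrt) (simp add: scaleR_conv_of_real divide_inverse)
  ultimately show ?thesis by (simp only: cosh_root_def)
qed

text \<open>As \<open>sinh\<close> is odd, division by the root again leaves powers of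
  \<open>z\<close>. The value 1 prescribed at \<open>z = 0\<close> is the constant coefficient, so
  the function is entire.\<close>

lemma sinhc_root_sums: "(\<lambda>n. (1 / fact (2 * n + 1)) * (z - 0) ^ n) sums sinhc_root z"
proof (cases "z = 0")
  case True
  have "(\<lambda>n. (1 / fact (2 * n + 1)) * (0 - 0) ^ n) sums (1 / fact (2 * 0 + 1) :: complex)"
    using powser_sums_zero[of "\<lambda>n. 1 / fact (2 * n + 1) :: complex"] by simp
  then show ?thesis using True by (simp add: sinhc_root_def)
next
  case False
  have "(\<lambda>n. if even (2 * n + 1) then 0 else csqrt z ^ (2 * n + 1) /\<^sub>R fact (2 * n + 1)) sums sinh (csqrt z)"
    by (subst sums_mono_reindex[of "\<lambda>n. 2 * n + 1" "\<lambda>n. if even n then 0 else csqrt z ^ n /\<^sub>R fact n"])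
       (auto intro!: strict_monoI sinh_converges elim!: oddE)
  then have "(\<lambda>n. csqrt z ^ (2 * n + 1) /\<^sub>R fact (2 * n + 1) / csqrt z) sums (sinh (csqrt z) / csqrt z)"
    by (intro sums_divide) simp
  moreover have "csqrt z ^ (2 * n + 1) /\<^sub>R fact (2 * n + 1) / csqrt z = (1 / fact (2 * n + 1)) * (z - 0) ^ n" for n
    using False by (simp only: power_add power_mult power2_csqrt power_one_right)
      (simp add: scaleR_conv_of_real divide_inverse del: fact_Suc)
  ultimately show ?thesis using False by (simp add: sinhc_root_def del: fact_Suc)
qed

lemma holomorphic_roots: "cosh_root holomorphic_on UNIV" "sinhc_root holomorphic_on UNIV"
proof -
  have hol: "cosh_root holomorphic_on ball 0 (norm z + 1)" "sinhc_root holomorphic_on ball 0 (norm z + 1)" for z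
    by (rule power_series_holomorphic[OF cosh_root_sums] power_series_holomorphic[OF sinhc_root_sums])+
  have "cosh_root field_differentiable at z" "sinhc_root field_differentiable at z" for z
    using holomorphic_on_imp_differentiable_at[OF hol(1) open_ball, of z z]
      holomorphic_on_imp_differentiable_at[OF hol(2) open_ball, of z z] by simp_all
  then show "cosh_root holomorphic_on UNIV" "sinhc_root holomorphic_on UNIV"
    by (simp_all add: holomorphic_on_def)
qed

text \<open>All zeros are of the form \<open>- ((n + 1 / 2) * pi)^2\<close> and lie below
  \<open>- 9 / 4\<close>, by the crude bound \<open>pi > 3\<close>; they stay clear of the half
  plane.\<close>

lemma cosh_root_nonzero:
  assumes "Re z > -1"
  shows "cosh_root z \<noteq> 0"
proof
  assume "cosh_root z = 0"
  then have "cos (\<i> * csqrt z) = 0" by (simp add: cosh_root_def cosh_conv_cos)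
  then obtain n :: int where n: "\<i> * csqrt z = complex_of_real (n * pi) + of_real pi / 2"
    by (auto simp: cos_eq_0)
  define r where "r = (n + 1 / 2) * pi"
  have "\<i> * csqrt z = complex_of_real r" using n by (simp add: r_def algebra_simps)
  then have "(\<i> * csqrt z)\<^sup>2 = complex_of_real (r\<^sup>2)" by simp
  then have "- z = complex_of_real (r\<^sup>2)" by (simp add: power_mult_distrib)
  then have "- (- z) = - complex_of_real (r\<^sup>2)" by (rule arg_cong)
  then have "z = complex_of_real (- (r\<^sup>2))" by simp
  then have "r\<^sup>2 < 1" using assms by simp
  moreover have "\<bar>real_of_int n + 1 / 2\<bar> \<ge> 1 / 2"
  proof (cases "n \<ge> 0")
    case True then have "real_of_int n \<ge> 0" by simp then show ?thesis by simp
  next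
    case False then have "real_of_int n \<le> -1" by simp then show ?thesis by simp
  qed
  then have "1 / 2 * 3 \<le> \<bar>r\<bar>"
    unfolding r_def abs_mult using pi_gt3 by (intro mult_mono) auto
  then have "(1 / 2 * 3)\<^sup>2 \<le> r\<^sup>2" by (metis abs_ge_zero power2_abs power_mono zero_le_divide_1_iff zero_le_mult_iff zero_le_numeral)
  then have "1 < r\<^sup>2" by (simp add: power2_eq_square)
  ultimately show False by simp
qed

text \<open>The symbol \<open>norm k * tanh (norm k * h)\<close> is a function of \<open>(norm k)\<^sup>2\<close> which extends holomorphically
  and boundedly to a half plane, so that Cauchy's estimate bounds all its derivatives.\<close>

definition tanhc_root :: "complex \<Rightarrow> complex" where
  "tanhc_root z = sinhc_root z / cosh_root z"

abbreviation right_region :: "complex set" where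
  "right_region \<equiv> {z. Re z > -1}"

lemma open_right_region: "open right_region"
  by (rule open_halfspace_Re_gt)

lemma holomorphic_tanhc_root: "tanhc_root holomorphic_on right_region"
  unfolding tanhc_root_def[abs_def]
  by (intro holomorphic_intros holomorphic_on_subset[OF holomorphic_roots(1)] holomorphic_on_subset[OF holomorphic_roots(2)])
     (auto simp: cosh_root_nonzero)

text \<open>Near the origin this is compactness. If \<open>norm z > 5\<close>, the root
  \<open>w\<close> satisfies \<open>Re w \<ge> 1\<close>, because
  \<open>2 * (Re w)^2 = norm z + Re z\<close>. Then \<open>exp (Re w)\<close> outweighs
  \<open>exp (- Re w)\<close> by a factor 3, so the modulus of \<open>sinh w\<close> is at most
  twice that of \<open>cosh w\<close>.\<close>

lemma tanhc_root_bounded: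
  obtains M where "\<And>z. Re z \<ge> - 1 / 2 \<Longrightarrow> norm (tanhc_root z) \<le> M"
proof -
  let ?K = "cball 0 5 \<inter> {z. Re z \<ge> - 1 / 2}"
  have "compact ?K" by (intro compact_Int_closed compact_cball closed_halfspace_Re_ge)
  moreover have "continuous_on ?K tanhc_root"
    by (rule holomorphic_on_imp_continuous_on[OF holomorphic_on_subset[OF holomorphic_tanhc_root]]) auto
  ultimately have "bounded (tanhc_root ` ?K)" by (intro compact_imp_bounded compact_continuous_image)
  then obtain M where M: "\<forall>y\<in>tanhc_root ` ?K. norm y \<le> M" unfolding bounded_iff by blast
  have "norm (tanhc_root z) \<le> max M 2" if z: "Re z \<ge> - 1 / 2" for z
  proof (cases "norm z \<le> 5")
    case True
    then have "z \<in> ?K" using z by simp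
    then show ?thesis using M by (intro max.coboundedI1) blast
  next
    case False
    define w where "w = csqrt z"
    have zw: "z = w\<^sup>2" by (simp add: w_def)
    have a0: "Re w \<ge> 0" unfolding w_def using csqrt_principal[of z] by auto
    have "(norm w)\<^sup>2 = norm z" by (simp add: zw norm_power)
    then have n: "(Re w)\<^sup>2 + (Im w)\<^sup>2 > 5" using False by (simp add: cmod_power2)
    have "(Re w)\<^sup>2 - (Im w)\<^sup>2 \<ge> - 1 / 2" using z by (simp add: zw Re_power2)
    with n have "(Re w)\<^sup>2 \<ge> 1\<^sup>2" by simp
    then have a: "Re w \<ge> 1" using a0 by (rule power2_le_imp_le)
    have nw: "norm w \<ge> 1" using a complex_Re_le_cmod[of w] by linarith
    have c: "norm (cosh w) \<ge> (exp (Re w) - exp (- Re w)) / 2"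
    proof -
      have "exp (Re w) - exp (- Re w) = norm (exp w) - norm (- exp (- w))" by simp
      also have "\<dots> \<le> norm (exp w - (- exp (- w)))" by (rule norm_triangle_ineq2)
      also have "\<dots> = 2 * norm (cosh w)" by (simp add: cosh_field_def norm_divide)
      finally show ?thesis by simp
    qed
    have s: "norm (sinh w) \<le> (exp (Re w) + exp (- Re w)) / 2"
    proof -
      have "2 * norm (sinh w) = norm (exp w - exp (- w))" by (simp add: sinh_field_def norm_divide)
      also have "\<dots> \<le> norm (exp w) + norm (exp (- w))" by (rule norm_triangle_ineq4)
      finally show ?thesis by simp
    qed
    have e4: "exp (2 * Re w) \<ge> 3" using exp_ge_add_one_self[of "2 * Re w"] a by linarith
    have e5: "exp (Re w) \<ge> 3 * exp (- Re w)"
    proof -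
      have "3 * exp (- Re w) \<le> exp (2 * Re w) * exp (- Re w)" using e4 by (intro mult_right_mono) auto
      then show ?thesis by (simp add: exp_add[symmetric])
    qed
    have sc: "norm (sinh w) \<le> 2 * norm (cosh w)"
    proof -
      define E e where "E = exp (Re w)" and "e = exp (- Re w)"
      have "norm (sinh w) \<le> (E + e) / 2" using s by (simp only: E_def e_def)
      also have "\<dots> \<le> 2 * ((E - e) / 2)" using e5[folded E_def e_def] by simp
      also have "\<dots> \<le> 2 * norm (cosh w)" using c by (simp only: E_def e_def mult_left_mono)
      finally show ?thesis .
    qed
    have "w \<noteq> 0" using nw by auto
    moreover have "cosh w \<noteq> 0" using cosh_root_nonzero[of z] z by (simp add: cosh_root_def w_def)
    moreover have "norm (tanhc_root z) = norm (sinh w) / (norm w * norm (cosh w))"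
    proof -
      have "z \<noteq> 0" using \<open>w \<noteq> 0\<close> zw by simp
      then show ?thesis
        by (simp add: tanhc_root_def sinhc_root_def cosh_root_def flip: w_def) (simp add: norm_divide norm_mult)
    qed
    moreover have "norm (sinh w) \<le> 2 * (norm w * norm (cosh w))"
      using sc mult_right_mono[OF nw, of "norm (cosh w)"] by simp
    ultimately have "norm (tanhc_root z) \<le> 2" by (simp add: pos_divide_le_eq)
    then show ?thesis by simp
  qed
  then show thesis using that by blast
qed

lemma tanhc_root_deriv_bounded:
  "\<exists>C. \<forall>s\<ge>0. norm ((deriv ^^ j) tanhc_root (complex_of_real s)) \<le> C"
proof -
  obtain M where M: "\<And>z. Re z \<ge> - 1 / 2 \<Longrightarrow> norm (tanhc_root z) \<le> M" using tanhc_root_bounded by metis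
  have "norm ((deriv ^^ j) tanhc_root (complex_of_real s)) \<le> fact j * M / (1 / 2) ^ j" if s: "s \<ge> 0" for s
  proof (rule Cauchy_inequality)
    have sub: "Re z \<ge> - 1 / 2" if "z \<in> cball (complex_of_real s) (1 / 2)" for z
      using that abs_Re_le_cmod[of "complex_of_real s - z"] s by (auto simp: dist_norm)
    have "cball (complex_of_real s) (1 / 2) \<subseteq> right_region" using sub by force
    then show "tanhc_root holomorphic_on ball (complex_of_real s) (1 / 2)" "continuous_on (cball (complex_of_real s) (1 / 2)) tanhc_root"
      using holomorphic_on_subset[OF holomorphic_tanhc_root] ball_subset_cball
      by (blast intro: holomorphic_on_imp_continuous_on)+
    show "norm (tanhc_root x) \<le> M" if "norm (complex_of_real s - x) = 1 / 2" for x
      using that by (intro M sub) (simp add: dist_norm)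
  qed simp
  then show ?thesis by blast
qed

lemma tanhc_root_real:
  assumes "r > 0"
  shows "tanhc_root (complex_of_real (r\<^sup>2)) = complex_of_real (tanh r / r)"
proof -
  have "csqrt (complex_of_real (r\<^sup>2)) = complex_of_real r"
    using assms by (simp add: csqrt_of_real_nonneg del: of_real_power)
  moreover have "sinh (complex_of_real r) = complex_of_real (sinh r)" "cosh (complex_of_real r) = complex_of_real (cosh r)"
    by (simp_all add: sinh_def cosh_def scaleR_conv_of_real exp_of_real[symmetric])
  ultimately show ?thesis using assms
    unfolding tanhc_root_def sinhc_root_def cosh_root_def
    by (simp add: tanh_def mult.commute)
qed

text \<open>Polynomial combinations of radial functions whose profiles \<open>t j\<close> are meant
  to be successive derivatives of each other: a partial derivative replaces the profile
  \<open>j\<close> by \<open>Suc j\<close> and creates one coordinate, so the class is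
  stable.\<close>

inductive_set radial_class :: "(nat \<Rightarrow> real \<Rightarrow> complex) \<Rightarrow> ('a::euclidean_space \<Rightarrow> complex) set" for t where
  base: "(\<lambda>x. t j ((norm x)\<^sup>2)) \<in> radial_class t"
| coord: "u \<in> radial_class t \<Longrightarrow> b \<in> Basis \<Longrightarrow> (\<lambda>x. complex_of_real (x \<bullet> b) * u x) \<in> radial_class t"
| scale: "u \<in> radial_class t \<Longrightarrow> (\<lambda>x. c * u x) \<in> radial_class t"
| add: "u \<in> radial_class t \<Longrightarrow> v \<in> radial_class t \<Longrightarrow> (\<lambda>x. u x + v x) \<in> radial_class t"

lemma multiplier_class_radial_class:
  fixes t :: "nat \<Rightarrow> real \<Rightarrow> complex"
  assumes der: "\<And>j s. s \<ge> 0 \<Longrightarrow> (t j has_vector_derivative t (Suc j) s) (at s)"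
    and bd: "\<And>j. \<exists>C. \<forall>s\<ge>0. norm (t j s) \<le> C"
  shows "multiplier_class (radial_class t :: ('a::euclidean_space \<Rightarrow> complex) set)"
proof -
  have "(\<forall>x. u differentiable (at x)) \<and> poly_bounded u \<and> (\<forall>b\<in>Basis. partial b u \<in> radial_class t)"
    if "u \<in> radial_class t" for u :: "'a \<Rightarrow> complex"
    using that
  proof induction
    case (base j)
    have d: "((\<lambda>x. t j ((norm x)\<^sup>2)) has_derivative (\<lambda>h. (2 * (x \<bullet> h)) *\<^sub>R t (Suc j) ((norm x)\<^sup>2))) (at x)" for x :: 'a
    proof -
      have 1: "((\<lambda>x. (norm x)\<^sup>2) has_derivative (\<lambda>h. 2 * (x \<bullet> h))) (at x)"
        unfolding power2_norm_eq_inner by (auto intro!: derivative_eq_intros simp: inner_commute)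
      have 2: "(t j has_derivative (\<lambda>s. s *\<^sub>R t (Suc j) ((norm x)\<^sup>2))) (at ((norm x)\<^sup>2))"
        using der[of "(norm x)\<^sup>2" j] unfolding has_vector_derivative_def by simp
      show ?thesis using has_derivative_compose[OF 1 2] .
    qed
    have "partial b (\<lambda>x. t j ((norm x)\<^sup>2)) = (\<lambda>x. 2 * (complex_of_real (x \<bullet> b) * t (Suc j) ((norm x)\<^sup>2)))" for b :: 'a
      by (rule ext) (simp add: partial_eq[OF d] scaleR_conv_of_real mult.assoc)
    moreover have "(\<lambda>x. 2 * (complex_of_real (x \<bullet> b) * t (Suc j) ((norm x)\<^sup>2))) \<in> radial_class t" if "b \<in> Basis" for b :: 'a
      using that by (intro radial_class.intros)
    moreover have "poly_bounded (\<lambda>x::'a. t j ((norm x)\<^sup>2))"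
    proof -
      obtain C where "\<forall>s\<ge>0. norm (t j s) \<le> C" using bd by blast
      then show ?thesis unfolding poly_bounded_def by (intro exI[of _ C] exI[of _ 0]) simp
    qed
    moreover have "(\<lambda>x. t j ((norm x)\<^sup>2)) differentiable (at x)" for x :: 'a
      using d unfolding differentiable_def by blast
    ultimately show ?case by simp
  next
    case (coord u c)
    then have d: "u differentiable (at x)" for x by blast
    have "partial b (\<lambda>x. complex_of_real (x \<bullet> c) * u x) = (\<lambda>x. complex_of_real (x \<bullet> c) * partial b u x + complex_of_real (b \<bullet> c) * u x)" for b
      by (rule ext) (simp add: partial_mult[OF differentiable_coord d] partial_coord)
    then show ?case using d coord by (auto intro!: differentiable_mult differentiable_coord
      radial_class.add radial_class.coord radial_class.scale poly_bounded_mult poly_bounded_coord)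
  next
    case (scale u c)
    then have d: "u differentiable (at x)" for x by blast
    have "partial b (\<lambda>x. c * u x) = (\<lambda>x. c * partial b u x)" for b
      by (rule ext) (simp add: partial_mult[OF differentiable_const d] partial_const)
    then show ?case using d scale by (auto intro!: differentiable_mult
      radial_class.scale poly_bounded_mult poly_bounded_const)
  next
    case (add u v)
    then have d: "u differentiable (at x)" "v differentiable (at x)" for x by blast+
    have "partial b (\<lambda>x. u x + v x) = (\<lambda>x. partial b u x + partial b v x)" for b
      by (rule ext) (simp add: partial_add[OF d])
    then show ?case using d add by (auto intro!: differentiable_add radial_class.add poly_bounded_add)
  qed
  then show ?thesis unfolding multiplier_class_def by blast
qed

text \<open>The function \<open>tanh (norm k * h) / norm k\<close>, extended by the value
  \<open>h\<close> at \<open>k = 0\<close>. Written through the squared norm it is visibly smooth at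
  the origin.\<close>

definition tanhc :: "real \<Rightarrow> 'a::euclidean_space \<Rightarrow> complex" where
  "tanhc h k = complex_of_real h * tanhc_root (complex_of_real ((h * norm k)\<^sup>2))"

lemma tanhc_eq:
  assumes "h > 0" "k \<noteq> 0"
  shows "tanhc h k = complex_of_real (tanh (norm k * h) / norm k)"
  using assms tanhc_root_real[of "h * norm k"] by (simp add: tanhc_def mult.commute)

lemma tanhc_multiplier:
  obtains M where "multiplier_class M" "(tanhc h :: 'a::euclidean_space \<Rightarrow> complex) \<in> M"
proof
  \<comment> \<open>Successive derivatives of the profile with respect to the squared wave number;
    every differentiation contributes a factor \<open>h^2\<close>.\<close>
  define t where "t = (\<lambda>j s. complex_of_real h * (complex_of_real ((h\<^sup>2) ^ j) * (deriv ^^ j) tanhc_root (complex_of_real (h\<^sup>2 * s))))"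
  have "(t j has_vector_derivative t (Suc j) s) (at s)" if s: "s \<ge> 0" for j s
  proof -
    have "complex_of_real (h\<^sup>2 * s) \<in> right_region"
    proof -
      have "0 \<le> h\<^sup>2 * s" using s by simp
      then have "- 1 < h\<^sup>2 * s" by linarith
      then show ?thesis by simp
    qed
    then have "((deriv ^^ j) tanhc_root has_field_derivative (deriv ^^ Suc j) tanhc_root (complex_of_real (h\<^sup>2 * s))) (at (complex_of_real (h\<^sup>2 * s)))"
      by (rule has_field_derivative_higher_deriv[OF holomorphic_tanhc_root open_right_region])
    moreover have "((\<lambda>s. complex_of_real (h\<^sup>2 * s)) has_vector_derivative complex_of_real (h\<^sup>2)) (at s)"
      by (auto intro!: derivative_eq_intros simp: has_vector_derivative_def scaleR_conv_of_real)
    ultimately have "((\<lambda>s. (deriv ^^ j) tanhc_root (complex_of_real (h\<^sup>2 * s))) has_vector_derivative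
        complex_of_real (h\<^sup>2) * (deriv ^^ Suc j) tanhc_root (complex_of_real (h\<^sup>2 * s))) (at s)"
      using field_vector_diff_chain_at[of "\<lambda>s. complex_of_real (h\<^sup>2 * s)" _ s] by (simp add: o_def)
    then have "((\<lambda>s. complex_of_real h * (complex_of_real ((h\<^sup>2) ^ j) * (deriv ^^ j) tanhc_root (complex_of_real (h\<^sup>2 * s)))) has_vector_derivative
        complex_of_real h * (complex_of_real ((h\<^sup>2) ^ j) * (complex_of_real (h\<^sup>2) * (deriv ^^ Suc j) tanhc_root (complex_of_real (h\<^sup>2 * s))))) (at s)"
      by (intro has_vector_derivative_mult_right)
    then show ?thesis unfolding t_def by (simp add: mult_ac)
  qed
  moreover have "\<exists>C. \<forall>s\<ge>0. norm (t j s) \<le> C" for j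
  proof -
    obtain C where C: "\<forall>s\<ge>0. norm ((deriv ^^ j) tanhc_root (complex_of_real s)) \<le> C" using tanhc_root_deriv_bounded by blast
    have "norm (t j s) \<le> \<bar>h\<bar> * ((h\<^sup>2) ^ j * C)" if "s \<ge> 0" for s
    proof -
      have "norm ((deriv ^^ j) tanhc_root (complex_of_real (h\<^sup>2 * s))) \<le> C" using C that by (simp del: of_real_mult of_real_power)
      then have "\<bar>h\<bar> * ((h\<^sup>2) ^ j * norm ((deriv ^^ j) tanhc_root (complex_of_real (h\<^sup>2 * s)))) \<le> \<bar>h\<bar> * ((h\<^sup>2) ^ j * C)"
        by (intro mult_left_mono) auto
      then show ?thesis unfolding t_def norm_mult norm_of_real abs_of_nonneg[OF zero_le_power[OF zero_le_power2]] .
    qed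
    then show ?thesis by blast
  qed
  ultimately show "multiplier_class (radial_class t :: ('a \<Rightarrow> complex) set)"
    by (intro multiplier_class_radial_class) auto
  have "(\<lambda>x::'a. t 0 ((norm x)\<^sup>2)) \<in> radial_class t" by (rule radial_class.base)
  moreover have "(\<lambda>x::'a. t 0 ((norm x)\<^sup>2)) = tanhc h"
    by (simp add: t_def tanhc_def fun_eq_iff power_mult_distrib)
  ultimately show "tanhc h \<in> (radial_class t :: ('a \<Rightarrow> complex) set)" by simp
qed

section \<open>The operator of the flat interface applied to the data\<close>

lemma continuous_fourier:
  fixes f :: "'a::euclidean_space \<Rightarrow> complex"
  assumes f: "integrable lborel f"
  shows "continuous_on UNIV (fourier f)"
  unfolding continuous_on_eq_continuous_at[OF open_UNIV]
proof
  fix k :: 'a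
  have [measurable]: "f \<in> borel_measurable borel" using f by auto
  show "isCont (fourier f) k"
    unfolding continuous_at_sequentially
  proof (intro allI impI)
    fix X assume X: "X \<longlonglongrightarrow> k"
    show "(fourier f \<circ> X) \<longlonglongrightarrow> fourier f k"
      unfolding fourier_def o_def
    proof (rule integral_dominated_convergence[where w = "\<lambda>x. norm (f x)"])
      show "AE x in lborel. (\<lambda>i. exp (- (\<i> * complex_of_real (X i \<bullet> x))) * f x) \<longlonglongrightarrow> exp (- (\<i> * complex_of_real (k \<bullet> x))) * f x"
        by (intro AE_I2 tendsto_intros X)
    qed (use f in \<open>auto simp: norm_mult\<close>)
  qed
qed

text \<open>The symbol \<open>norm k * tanh (norm k * h)\<close> is \<open>tanhc h k\<close> times
  the sum of the squares of the coordinates of \<open>k\<close>. One coordinate of each square turns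
  the transform of \<open>q\<close> into \<open>- i\<close> times that of a component of its
  gradient, and the latter is a continuous function.\<close>

definition fourier_flux :: "real \<Rightarrow> ('a::euclidean_space \<Rightarrow> 'a) \<Rightarrow> 'a \<Rightarrow> complex" where
  "fourier_flux h g k = - \<i> * tanhc h k * (\<Sum>b\<in>Basis. complex_of_real (k \<bullet> b) * fourier (\<lambda>x. complex_of_real (g x \<bullet> b)) k)"

lemma continuous_fourier_flux:
  assumes g: "\<And>b. b \<in> Basis \<Longrightarrow> integrable lborel (\<lambda>x. complex_of_real (g x \<bullet> b))"
  shows "continuous_on UNIV (fourier_flux h g)"
proof -
  obtain M where M: "multiplier_class M" "(tanhc h :: 'a \<Rightarrow> complex) \<in> M" by (rule tanhc_multiplier)
  then have "continuous_on UNIV (tanhc h :: 'a \<Rightarrow> complex)"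
    unfolding multiplier_class_def by (intro differentiable_imp_continuous_UNIV) auto
  then show ?thesis
    unfolding fourier_flux_def[abs_def] by (intro continuous_intros continuous_fourier g)
qed

text \<open>The symbol times a test function is a sum over \<open>b\<close> of
  \<open>k \<bullet> b\<close> times the Schwartz function \<open>F b\<close>. That coordinate
  becomes a derivative of \<open>fourier (F b)\<close>, which the weak gradient moves onto
  \<open>q\<close>; self-adjointness then moves the transform from \<open>F b\<close> onto the
  gradient.\<close>

lemma represented_by_fourier_flux:
  fixes q :: "'a::euclidean_space \<Rightarrow> real"
  assumes h: "h > 0" and q: "tempered_function (\<lambda>x. complex_of_real (q x))"
    and grad: "distr_gradient q g"
    and g: "\<And>b. b \<in> Basis \<Longrightarrow> integrable lborel (\<lambda>x. complex_of_real (g x \<bullet> b))"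
  shows "represented_by (mult_distr (\<lambda>k. norm k * tanh (norm k * h))
      (fourier_distr (fun_distr (\<lambda>x. complex_of_real (q x))))) (fourier_flux h g)"
  unfolding represented_by_def
proof (intro conjI allI impI)
  have cont: "continuous_on UNIV (fourier_flux h g)" by (rule continuous_fourier_flux[OF g])
  then show "fourier_flux h g \<in> borel_measurable lborel" by (simp add: borel_measurable_continuous_onI)
  fix f :: "'a \<Rightarrow> complex" assume f: "schwartz f"
  obtain M where M: "multiplier_class M" "(tanhc h :: 'a \<Rightarrow> complex) \<in> M" by (rule tanhc_multiplier)
  have Tf: "schwartz (\<lambda>k. tanhc h k * f k)" by (rule schwartz_mult[OF M f])
  define F where "F = (\<lambda>b k. complex_of_real (k \<bullet> b) * (tanhc h k * f k))"
  have F: "schwartz (F b)" if "b \<in> Basis" for b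
    unfolding F_def by (rule schwartz_coord[OF Tf that])
  have qint: "integrable lborel (\<lambda>x. complex_of_real (q x) * u x)" if "schwartz u" for u
    using q that unfolding tempered_function_def represented_by_def by (auto simp: has_bochner_integral_iff)
  have weak: "has_bochner_integral lborel (\<lambda>x. complex_of_real (g x \<bullet> b) * u x) (- (\<integral>x. complex_of_real (q x) * partial b u x \<partial>lborel))"
    if "b \<in> Basis" "schwartz u" for b u
    using grad that unfolding distr_gradient_def represented_by_def partial_distr_def fun_distr_def by auto
  let ?G = "\<lambda>b x. complex_of_real (g x \<bullet> b)"
  have swap: "integrable lborel (\<lambda>k. fourier (?G b) k * F b k)"
     "- \<i> * (\<integral>k. fourier (?G b) k * F b k \<partial>lborel) = (\<integral>x. complex_of_real (q x) * fourier (\<lambda>k. complex_of_real (k \<bullet> b) * F b k) x \<partial>lborel)"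
    if b: "b \<in> Basis" for b
  proof -
    have [measurable]: "?G b \<in> borel_measurable borel" using g[OF b] by (simp add: borel_measurable_integrable)
    have Fm [measurable]: "F b \<in> borel_measurable borel" by (rule schwartz_measurable[OF F[OF b]])
    show "integrable lborel (\<lambda>k. fourier (?G b) k * F b k)"
    proof (rule Bochner_Integration.integrable_bound)
      let ?B = "\<integral>x. norm (?G b x) \<partial>lborel"
      show "integrable lborel (\<lambda>k. ?B * norm (F b k))"
        by (intro integrable_mult_right integrable_norm schwartz_integrable F b)
      show "AE k in lborel. norm (fourier (?G b) k * F b k) \<le> norm (?B * norm (F b k))"
      proof (rule AE_I2)
        fix k
        have "norm (fourier (?G b) k * F b k) \<le> ?B * norm (F b k)"
          unfolding norm_mult by (intro mult_right_mono norm_fourier_le g b) simp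
        also have "\<dots> \<le> norm (?B * norm (F b k))" by (simp only: real_norm_def abs_ge_self)
        finally show "norm (fourier (?G b) k * F b k) \<le> norm (?B * norm (F b k))" .
      qed
    qed measurable
    have "(\<integral>k. fourier (?G b) k * F b k \<partial>lborel) = (\<integral>x. ?G b x * fourier (F b) x \<partial>lborel)"
      by (rule integral_fourier_swap[OF g[OF b] schwartz_integrable[OF F[OF b]]])
    also have "\<dots> = - (\<integral>x. complex_of_real (q x) * partial b (fourier (F b)) x \<partial>lborel)"
      using weak[OF b schwartz_fourier[OF F[OF b]]] by (simp add: has_bochner_integral_iff)
    also have "partial b (fourier (F b)) = fourier (\<lambda>k. - \<i> * complex_of_real (k \<bullet> b) * F b k)"
      by (rule partial_fourier_schwartz[OF F[OF b]])
    also have "\<dots> = (\<lambda>x. - \<i> * fourier (\<lambda>k. complex_of_real (k \<bullet> b) * F b k) x)"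
      unfolding fourier_def
      by (subst integral_mult_right_zero[symmetric]) (simp add: mult_ac)
    also have "(\<integral>x. complex_of_real (q x) * (- \<i> * fourier (\<lambda>k. complex_of_real (k \<bullet> b) * F b k) x) \<partial>lborel) =
        - \<i> * (\<integral>x. complex_of_real (q x) * fourier (\<lambda>k. complex_of_real (k \<bullet> b) * F b k) x \<partial>lborel)"
      by (subst integral_mult_right_zero[symmetric]) (simp add: mult_ac)
    finally show "- \<i> * (\<integral>k. fourier (?G b) k * F b k \<partial>lborel) = (\<integral>x. complex_of_real (q x) * fourier (\<lambda>k. complex_of_real (k \<bullet> b) * F b k) x \<partial>lborel)"
      by (simp add: mult.assoc[symmetric])
  qed
  have flux: "fourier_flux h g k * f k = - \<i> * (\<Sum>b\<in>Basis. fourier (?G b) k * F b k)" for k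
    unfolding fourier_flux_def F_def by (simp add: sum_distrib_left sum_distrib_right mult_ac)
  have sym: "complex_of_real (norm k * tanh (norm k * h)) * f k = (\<Sum>b\<in>Basis. complex_of_real (k \<bullet> b) * F b k)" for k
  proof (cases "k = 0")
    case False
    have "(\<Sum>b\<in>Basis. complex_of_real (k \<bullet> b) * F b k) = complex_of_real (\<Sum>b\<in>Basis. (k \<bullet> b) * (k \<bullet> b)) * (tanhc h k * f k)"
      unfolding F_def by (simp add: sum_distrib_right mult.assoc)
    also have "(\<Sum>b\<in>Basis. (k \<bullet> b) * (k \<bullet> b)) = (norm k)\<^sup>2"
      by (simp add: power2_norm_eq_inner euclidean_inner[symmetric])
    finally show ?thesis
      using False by (simp add: tanhc_eq[OF h] power2_eq_square field_simps)
  qed (simp add: F_def)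
  have kF: "schwartz (\<lambda>k. complex_of_real (k \<bullet> b) * F b k)" if "b \<in> Basis" for b
    by (rule schwartz_coord[OF F[OF that] that])
  have "fourier (\<lambda>k. complex_of_real (norm k * tanh (norm k * h)) * f k) x =
      (\<Sum>b\<in>Basis. fourier (\<lambda>k. complex_of_real (k \<bullet> b) * F b k) x)" for x
    unfolding sym fourier_def sum_distrib_left
    by (rule Bochner_Integration.integral_sum) (intro integrable_fourier schwartz_integrable kF)
  then have "(\<integral>x. complex_of_real (q x) * fourier (\<lambda>k. complex_of_real (norm k * tanh (norm k * h)) * f k) x \<partial>lborel) =
      (\<integral>x. (\<Sum>b\<in>Basis. complex_of_real (q x) * fourier (\<lambda>k. complex_of_real (k \<bullet> b) * F b k) x) \<partial>lborel)"
    by (simp add: sum_distrib_left)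
  also have "\<dots> = (\<Sum>b\<in>Basis. \<integral>x. complex_of_real (q x) * fourier (\<lambda>k. complex_of_real (k \<bullet> b) * F b k) x \<partial>lborel)"
    by (rule Bochner_Integration.integral_sum) (intro qint schwartz_fourier kF)
  also have "\<dots> = (\<Sum>b\<in>Basis. - \<i> * (\<integral>k. fourier (?G b) k * F b k \<partial>lborel))"
    by (rule sum.cong[OF refl]) (rule swap(2)[symmetric])
  also have "\<dots> = - \<i> * (\<Sum>b\<in>Basis. (\<integral>k. fourier (?G b) k * F b k \<partial>lborel))"
    by (rule sum_distrib_left[symmetric])
  finally have total: "(\<integral>x. complex_of_real (q x) * fourier (\<lambda>k. complex_of_real (norm k * tanh (norm k * h)) * f k) x \<partial>lborel) =
      - \<i> * (\<Sum>b\<in>Basis. (\<integral>k. fourier (?G b) k * F b k \<partial>lborel))" .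
  have "has_bochner_integral lborel (\<lambda>k. - \<i> * (\<Sum>b\<in>Basis. fourier (?G b) k * F b k)) (- \<i> * (\<Sum>b\<in>Basis. (\<integral>k. fourier (?G b) k * F b k \<partial>lborel)))"
    by (intro has_bochner_integral_mult_right has_bochner_integral_sum has_bochner_integral_integrable swap(1))
  then show "has_bochner_integral lborel (\<lambda>k. fourier_flux h g k * f k)
      (mult_distr (\<lambda>k. norm k * tanh (norm k * h)) (fourier_distr (fun_distr (\<lambda>x. complex_of_real (q x)))) f)"
    unfolding flux mult_distr_def fourier_distr_def fun_distr_def total .
qed


section \<open>Level surfaces of the fluid\<close>

lemma DERIV_partial_line:
  fixes u :: "'a::euclidean_space \<Rightarrow> real"
  assumes "u differentiable (at (z + t *\<^sub>R b))"
  shows "((\<lambda>t. u (z + t *\<^sub>R b)) has_real_derivative partial b u (z + t *\<^sub>R b)) (at t)"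
proof -
  have 2: "(u has_derivative frechet_derivative u (at (z + t *\<^sub>R b))) (at (z + t *\<^sub>R b))"
    using assms by (simp add: frechet_derivative_works)
  have 1: "((\<lambda>t. z + t *\<^sub>R b) has_derivative (\<lambda>t. t *\<^sub>R b)) (at t)"
    by (auto intro!: derivative_eq_intros)
  have "(\<lambda>s. frechet_derivative u (at (z + t *\<^sub>R b)) (s *\<^sub>R b)) = (*) (partial b u (z + t *\<^sub>R b))"
    using linear_scale[OF has_derivative_linear[OF 2]] by (simp add: partial_def fun_eq_iff mult.commute)
  then show ?thesis
    using has_derivative_compose[OF 1 2] unfolding has_field_derivative_def by simp
qed

lemma Ck_onD:
  assumes C: "Ck_on k U f" and U: "open U"
  shows Ck_on_differentiable: "0 < k \<Longrightarrow> x \<in> U \<Longrightarrow> f differentiable (at x)"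
    and Ck_on_partial_continuous: "1 \<le> k \<Longrightarrow> c \<in> Basis \<Longrightarrow> continuous_on U (partial c f)"
    and Ck_on_partial_differentiable: "1 < k \<Longrightarrow> x \<in> U \<Longrightarrow> c \<in> Basis \<Longrightarrow> partial c f differentiable (at x)"
    and Ck_on_partial2_continuous: "2 \<le> k \<Longrightarrow> c \<in> Basis \<Longrightarrow> d \<in> Basis \<Longrightarrow> continuous_on U (partial d (partial c f))"
  using C[unfolded Ck_on_def, THEN spec, of "[]"] C[unfolded Ck_on_def, THEN spec, of "[c]"]
    C[unfolded Ck_on_def, THEN spec, of "[d, c]"] U
  by (auto simp: differentiable_on_eq_differentiable_at)

text \<open>The mean value theorem, applied twice to the second difference in either order.\<close>

lemma mixed_partials:
  fixes f :: "'a::euclidean_space \<Rightarrow> real"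
  assumes U: "open U" "x \<in> U" and C2: "Ck_on 2 U f" and ab: "a \<in> Basis" "b \<in> Basis"
  shows "partial a (partial b f) x = partial b (partial a f) x"
proof -
  note diff = Ck_on_differentiable[OF C2 U(1)] Ck_on_partial_differentiable[OF C2 U(1)]
  note cont = Ck_on_partial2_continuous[OF C2 U(1)]
  obtain r where r: "r > 0" "ball x r \<subseteq> U" using U by (meson open_contains_ball)
  have second: "\<exists>s t. 0 < s \<and> s < h \<and> 0 < t \<and> t < h \<and>
      f (x + h *\<^sub>R c + h *\<^sub>R d) - f (x + h *\<^sub>R c) - f (x + h *\<^sub>R d) + f x = h * h * partial d (partial c f) (x + s *\<^sub>R c + t *\<^sub>R d)"
    if cd: "c \<in> Basis" "d \<in> Basis" and h: "0 < h" "2 * h < r" for c d h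
  proof -
    have inU: "x + s *\<^sub>R c + t *\<^sub>R d \<in> U" if "0 \<le> s" "s \<le> h" "0 \<le> t" "t \<le> h" for s t
    proof -
      have "norm (s *\<^sub>R c + t *\<^sub>R d) \<le> s + t"
        using norm_triangle_ineq[of "s *\<^sub>R c" "t *\<^sub>R d"] cd that by simp
      moreover have "dist x (x + (s *\<^sub>R c + t *\<^sub>R d)) = norm (s *\<^sub>R c + t *\<^sub>R d)"
        by (metis add_diff_cancel_left' dist_commute dist_norm)
      ultimately have "x + (s *\<^sub>R c + t *\<^sub>R d) \<in> ball x r" using h that by simp
      then show ?thesis using r(2) by (auto simp: add.assoc)
    qed
    have inU1: "x + s *\<^sub>R c \<in> U" if "0 \<le> s" "s \<le> h" for s
      using inU[of s 0] that h by simp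
    let ?g = "\<lambda>s. f (x + s *\<^sub>R c + h *\<^sub>R d) - f (x + s *\<^sub>R c)"
    have "\<exists>s>0. s < h \<and> ?g h - ?g 0 = (h - 0) * (partial c f (x + s *\<^sub>R c + h *\<^sub>R d) - partial c f (x + s *\<^sub>R c))"
    proof (rule MVT2)
      fix s assume s: "0 \<le> s" "s \<le> h"
      have "((\<lambda>s. f ((x + h *\<^sub>R d) + s *\<^sub>R c)) has_real_derivative partial c f ((x + h *\<^sub>R d) + s *\<^sub>R c)) (at s)"
        using diff(1)[OF _ inU[OF s, of h]] h by (intro DERIV_partial_line) (simp add: add_ac)
      moreover have "((\<lambda>s. f (x + s *\<^sub>R c)) has_real_derivative partial c f (x + s *\<^sub>R c)) (at s)"
        using diff(1)[OF _ inU1[OF s]] by (intro DERIV_partial_line) simp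
      ultimately show "(?g has_real_derivative partial c f (x + s *\<^sub>R c + h *\<^sub>R d) - partial c f (x + s *\<^sub>R c)) (at s)"
        by (intro DERIV_diff) (simp_all add: add_ac)
    qed (use h in simp)
    then obtain s where s: "0 < s" "s < h" "?g h - ?g 0 = h * (partial c f (x + s *\<^sub>R c + h *\<^sub>R d) - partial c f (x + s *\<^sub>R c))"
      by auto
    have "\<exists>t>0. t < h \<and> partial c f (x + s *\<^sub>R c + h *\<^sub>R d) - partial c f (x + s *\<^sub>R c + 0 *\<^sub>R d) = (h - 0) * partial d (partial c f) (x + s *\<^sub>R c + t *\<^sub>R d)"
    proof (rule MVT2)
      fix t assume t: "0 \<le> t" "t \<le> h"
      show "((\<lambda>t. partial c f (x + s *\<^sub>R c + t *\<^sub>R d)) has_real_derivative partial d (partial c f) (x + s *\<^sub>R c + t *\<^sub>R d)) (at t)"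
        using inU[of s t] s t cd by (intro DERIV_partial_line diff) auto
    qed (use h in simp)
    then obtain t where t: "0 < t" "t < h" "partial c f (x + s *\<^sub>R c + h *\<^sub>R d) - partial c f (x + s *\<^sub>R c) = h * partial d (partial c f) (x + s *\<^sub>R c + t *\<^sub>R d)"
      by auto
    have "f (x + h *\<^sub>R c + h *\<^sub>R d) - f (x + h *\<^sub>R c) - f (x + h *\<^sub>R d) + f x = h * h * partial d (partial c f) (x + s *\<^sub>R c + t *\<^sub>R d)"
      using s(3) t(3) by simp
    then show ?thesis using s t by blast
  qed
  have close: "\<bar>partial a (partial b f) x - partial b (partial a f) x\<bar> \<le> e" if e: "e > 0" for e
  proof -
    have ev: "\<exists>d>0. \<forall>z. dist z x < d \<longrightarrow> \<bar>partial c (partial d' f) z - partial c (partial d' f) x\<bar> < e / 2"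
      if "c \<in> Basis" "d' \<in> Basis" for c d'
    proof -
      have "isCont (partial c (partial d' f)) x"
        using cont[OF _ that(2,1)] U by (simp add: continuous_on_eq_continuous_at)
      then show ?thesis using e unfolding continuous_at_eps_delta dist_real_def by (meson half_gt_zero)
    qed
    obtain d1 where d1: "d1 > 0" "\<And>z. dist z x < d1 \<Longrightarrow> \<bar>partial a (partial b f) z - partial a (partial b f) x\<bar> < e / 2"
      using ev[OF ab] by blast
    obtain d2 where d2: "d2 > 0" "\<And>z. dist z x < d2 \<Longrightarrow> \<bar>partial b (partial a f) z - partial b (partial a f) x\<bar> < e / 2"
      using ev[OF ab(2) ab(1)] by blast
    \<comment> \<open>The intermediate points move by less than \<open>h\<close> in each of two unit
      directions, hence by less than \<open>2 * h\<close>; a third of the minimum keeps them within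
      all three radii.\<close>
    define h where "h = Min {r, d1, d2} / 3"
    have h: "0 < h" "2 * h < r" "2 * h < d1" "2 * h < d2"
      using r d1 d2 by (auto simp: h_def min_def)
    have near: "dist (x + s *\<^sub>R c + t *\<^sub>R d) x < 2 * h" if "0 < s" "s < h" "0 < t" "t < h" "c \<in> Basis" "d \<in> Basis" for s t and c d :: 'a
      using norm_triangle_ineq[of "s *\<^sub>R c" "t *\<^sub>R d"] that by (simp add: dist_norm add.assoc)
    obtain s t where st: "0 < s" "s < h" "0 < t" "t < h"
      "f (x + h *\<^sub>R a + h *\<^sub>R b) - f (x + h *\<^sub>R a) - f (x + h *\<^sub>R b) + f x = h * h * partial b (partial a f) (x + s *\<^sub>R a + t *\<^sub>R b)"
      using second[OF ab h(1,2)] by blast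
    obtain s' t' where st': "0 < s'" "s' < h" "0 < t'" "t' < h"
      "f (x + h *\<^sub>R b + h *\<^sub>R a) - f (x + h *\<^sub>R b) - f (x + h *\<^sub>R a) + f x = h * h * partial a (partial b f) (x + s' *\<^sub>R b + t' *\<^sub>R a)"
      using second[OF ab(2,1) h(1,2)] by blast
    have "h * h * partial b (partial a f) (x + s *\<^sub>R a + t *\<^sub>R b) = h * h * partial a (partial b f) (x + s' *\<^sub>R b + t' *\<^sub>R a)"
    proof -
      have "x + h *\<^sub>R b + h *\<^sub>R a = x + h *\<^sub>R a + h *\<^sub>R b" by (simp add: add_ac)
      from st'(5)[unfolded this] st(5) show ?thesis by linarith
    qed
    then have eq: "partial b (partial a f) (x + s *\<^sub>R a + t *\<^sub>R b) = partial a (partial b f) (x + s' *\<^sub>R b + t' *\<^sub>R a)"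
      using h by simp
    have "\<bar>partial a (partial b f) (x + s' *\<^sub>R b + t' *\<^sub>R a) - partial a (partial b f) x\<bar> < e / 2"
      using near[OF st'(1-4) ab(2,1)] h by (intro d1) simp
    moreover have "\<bar>partial b (partial a f) (x + s *\<^sub>R a + t *\<^sub>R b) - partial b (partial a f) x\<bar> < e / 2"
      using near[OF st(1-4) ab] h by (intro d2) simp
    ultimately show ?thesis using eq by linarith
  qed
  have "\<bar>partial a (partial b f) x - partial b (partial a f) x\<bar> \<le> 0"
    by (rule field_le_epsilon) (simp add: close)
  then show ?thesis by simp
qed

lemma compose_real_partial:
  fixes f :: "'a::euclidean_space \<Rightarrow> real"
  assumes f: "f differentiable (at x)" and F: "(F has_real_derivative F') (at (f x))"
  shows "(\<lambda>x. complex_of_real (F (f x))) differentiable (at x)"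
    and "partial b (\<lambda>x. complex_of_real (F (f x))) x = complex_of_real (partial b f x * F')"
proof -
  have "(f has_derivative frechet_derivative f (at x)) (at x)" using f by (simp add: frechet_derivative_works)
  from DERIV_compose_FDERIV[OF F this]
  have "((\<lambda>x. complex_of_real (F (f x))) has_derivative (\<lambda>h. complex_of_real (frechet_derivative f (at x) h * F'))) (at x)"
    by (rule has_derivative_of_real)
  then show "(\<lambda>x. complex_of_real (F (f x))) differentiable (at x)"
    "partial b (\<lambda>x. complex_of_real (F (f x))) x = complex_of_real (partial b f x * F')"
    by (auto simp: differentiable_def partial_def dest: frechet_derivative_at[symmetric])
qed

text \<open>Bounding the elevation by half the depth keeps every fluid column between two positive
  constants, so that flattening the domain to a slab costs only bounded factors.\<close>

locale fluid =
  fixes h0 :: real and \<eta> :: "'a::euclidean_space \<Rightarrow> real" and \<phi> :: "'a \<times> real \<Rightarrow> real"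
  assumes h0: "h0 > 0" and C1: "Ck_on 1 UNIV \<eta>" and small: "\<And>x. \<bar>\<eta> x\<bar> \<le> h0 / 2"
    and harmonic: "harmonic_on (fluid_domain h0 \<eta>) \<phi>"
begin

abbreviation \<Omega> where "\<Omega> \<equiv> fluid_domain h0 \<eta>"

definition rho where "rho x = \<eta> x + h0"

text \<open>The level \<open>s\<close> interpolates between the bottom (\<open>s = 0\<close>) and the surface (\<open>s = 1\<close>).\<close>

definition pt where "pt s x = (x, - h0 + s * rho x)"

lemma rho_bounds: "h0 / 2 \<le> rho x" "rho x \<le> 2 * h0" "0 < rho x" "0 \<le> rho x"
  using small[of x] h0 unfolding rho_def by (auto simp: abs_le_iff)

lemma eta_differentiable: "\<eta> differentiable (at x)"
  using Ck_on_differentiable[OF C1 open_UNIV] by simp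

lemma eta_partial_continuous: "b \<in> Basis \<Longrightarrow> continuous_on UNIV (partial b \<eta>)"
  using Ck_on_partial_continuous[OF C1 open_UNIV] by simp

lemma eta_continuous: "continuous_on UNIV \<eta>"
  using eta_differentiable by (simp add: continuous_at_imp_continuous_on differentiable_imp_continuous_within)

lemma rho_continuous: "continuous_on UNIV rho"
  unfolding rho_def[abs_def] by (intro continuous_intros eta_continuous)

lemma rho_differentiable: "rho differentiable (at x)"
  unfolding rho_def[abs_def] by (intro derivative_intros eta_differentiable)

lemma partial_rho: "partial b rho x = partial b \<eta> x"
  unfolding rho_def[abs_def] using eta_differentiable[of x, unfolded frechet_derivative_works]
  by (intro partial_eq[THEN trans, of _ "frechet_derivative \<eta> (at x)"]) (auto simp: partial_def intro!: derivative_eq_intros)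

lemma open_domain: "open \<Omega>"
proof -
  have "continuous_on UNIV (\<lambda>z. \<eta> (fst z))"
    by (rule continuous_on_compose2[OF eta_continuous]) (auto intro!: continuous_intros)
  then have "open {z. - h0 < snd z \<and> snd z < \<eta> (fst z)}"
    by (intro open_Collect_conj open_Collect_less continuous_intros)
  moreover have "\<Omega> = {z. - h0 < snd z \<and> snd z < \<eta> (fst z)}"
    by (auto simp: fluid_domain_def)
  ultimately show ?thesis by simp
qed

lemma pt_in_domain: "0 < s \<Longrightarrow> s < 1 \<Longrightarrow> pt s x \<in> \<Omega>"
proof -
  assume s: "0 < s" "s < 1"
  have "s * rho x < 1 * rho x" using s rho_bounds[of x] by (intro mult_strict_right_mono) auto
  moreover have "0 < s * rho x" using s rho_bounds[of x] by simp
  ultimately show ?thesis unfolding pt_def fluid_domain_def by (simp add: rho_def)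
qed

lemma horizontal_Basis: "b \<in> Basis \<Longrightarrow> (b, 0::real) \<in> Basis"
  and vertical_Basis: "(0, 1::real) \<in> Basis"
  by (auto simp: Basis_prod_def)

lemma C2: "Ck_on 2 \<Omega> \<phi>"
  using harmonic unfolding harmonic_on_def by blast

lemma phi_differentiable: "z \<in> \<Omega> \<Longrightarrow> \<phi> differentiable (at z)"
  using Ck_on_differentiable[OF C2 open_domain] by simp

lemma phi_partial_differentiable: "z \<in> \<Omega> \<Longrightarrow> c \<in> Basis \<Longrightarrow> partial c \<phi> differentiable (at z)"
  using Ck_on_partial_differentiable[OF C2 open_domain] by simp

lemma phi_continuous: "continuous_on \<Omega> \<phi>"
  by (auto intro!: continuous_at_imp_continuous_on differentiable_imp_continuous_within phi_differentiable)

lemma phi_partial_continuous: "c \<in> Basis \<Longrightarrow> continuous_on \<Omega> (partial c \<phi>)"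
  by (auto intro!: continuous_at_imp_continuous_on differentiable_imp_continuous_within phi_partial_differentiable)

lemma phi_partial2_continuous: "c \<in> Basis \<Longrightarrow> d \<in> Basis \<Longrightarrow> continuous_on \<Omega> (partial d (partial c \<phi>))"
  using Ck_on_partial2_continuous[OF C2 open_domain] by simp

lemma laplace: "z \<in> \<Omega> \<Longrightarrow> (\<Sum>b\<in>Basis. partial (b, 0) (partial (b, 0) \<phi>) z) + partial (0, 1) (partial (0, 1) \<phi>) z = 0"
proof -
  assume "z \<in> \<Omega>"
  then have "(\<Sum>b\<in>Basis. partials [b, b] \<phi> z) = 0" using harmonic unfolding harmonic_on_def by blast
  moreover have "(\<Sum>b\<in>Basis. partials [b, b] \<phi> z) = (\<Sum>b\<in>Basis. partial (b, 0) (partial (b, 0) \<phi>) z) + partial (0, 1) (partial (0, 1) \<phi>) z"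
  proof -
    have "inj_on (\<lambda>b. (b, 0::real)) (Basis :: 'a set)" by (auto simp: inj_on_def)
    moreover have "(\<lambda>b. (b, 0::real)) ` (Basis :: 'a set) \<inter> {(0, 1)} = {}" by auto
    moreover have B: "(Basis :: ('a \<times> real) set) = (\<lambda>b. (b, 0)) ` Basis \<union> {(0, 1)}" by (auto simp: Basis_prod_def)
    ultimately show ?thesis
      unfolding B by (subst sum.union_disjoint) (simp_all add: sum.reindex)
  qed
  ultimately show ?thesis by simp
qed

lemma phi_mixed: "z \<in> \<Omega> \<Longrightarrow> b \<in> Basis \<Longrightarrow> partial (b, 0) (partial (0, 1) \<phi>) z = partial (0, 1) (partial (b, 0) \<phi>) z"
  by (rule mixed_partials[OF open_domain _ C2 horizontal_Basis vertical_Basis])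

text \<open>The chain rule in flattened coordinates. Moving horizontally along the level
  \<open>s\<close> means climbing with slope \<open>s * partial b \<eta> x\<close>; moving in
  \<open>s\<close> means climbing at the rate \<open>rho x\<close>.\<close>

lemma pullback:
  fixes F :: "'a \<times> real \<Rightarrow> real"
  assumes F: "F differentiable (at (pt s x))"
  shows pullback_differentiable: "(\<lambda>x. complex_of_real (F (pt s x))) differentiable (at x)"
    and pullback_partial: "partial b (\<lambda>x. complex_of_real (F (pt s x))) x =
      complex_of_real (partial (b, 0) F (pt s x)) + complex_of_real s * complex_of_real (partial b \<eta> x) * complex_of_real (partial (0, 1) F (pt s x))"
    and pullback_vertical: "((\<lambda>s. complex_of_real (F (pt s x))) has_vector_derivative
      complex_of_real (rho x) * complex_of_real (partial (0, 1) F (pt s x))) (at s)"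
proof -
  let ?F = "frechet_derivative F (at (pt s x))"
  let ?e = "frechet_derivative \<eta> (at x)"
  have dF: "(F has_derivative ?F) (at (pt s x))" using F by (simp add: frechet_derivative_works)
  have de: "(\<eta> has_derivative ?e) (at x)" using eta_differentiable by (simp add: frechet_derivative_works)
  have lin: "linear ?F" using dF by (rule has_derivative_linear)
  have split: "?F (h, r) = ?F (h, 0) + r * ?F (0, 1)" for h r
  proof -
    have "?F (h, r) = ?F ((h, 0) + r *\<^sub>R (0, 1))" by simp
    then show ?thesis unfolding linear_add[OF lin] linear_scale[OF lin] by simp
  qed
  have "((\<lambda>x. pt s x) has_derivative (\<lambda>h. (h, s * ?e h))) (at x)"
    unfolding pt_def rho_def by (auto intro!: derivative_eq_intros de)
  from has_derivative_of_real[OF has_derivative_compose[OF this dF]]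
  have D: "((\<lambda>x. complex_of_real (F (pt s x))) has_derivative (\<lambda>h. complex_of_real (?F (h, s * ?e h)))) (at x)" .
  then show "(\<lambda>x. complex_of_real (F (pt s x))) differentiable (at x)" unfolding differentiable_def by blast
  show "partial b (\<lambda>x. complex_of_real (F (pt s x))) x =
      complex_of_real (partial (b, 0) F (pt s x)) + complex_of_real s * complex_of_real (partial b \<eta> x) * complex_of_real (partial (0, 1) F (pt s x))"
    unfolding partial_eq[OF D] by (subst split) (simp add: partial_def)
  have "((\<lambda>s. pt s x) has_derivative (\<lambda>h. (0, h * rho x))) (at s)"
    unfolding pt_def by (auto intro!: derivative_eq_intros)
  from has_derivative_of_real[OF has_derivative_compose[OF this dF]]
  have "((\<lambda>s. complex_of_real (F (pt s x))) has_derivative (\<lambda>h. complex_of_real (?F (0, h * rho x)))) (at s)" .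
  moreover have "complex_of_real (?F (0, h * rho x)) = h *\<^sub>R (complex_of_real (rho x) * complex_of_real (partial (0, 1) F (pt s x)))" for h
    by (subst split) (use linear_0[OF lin] in \<open>simp add: partial_def scaleR_conv_of_real zero_prod_def\<close>)
  ultimately show "((\<lambda>s. complex_of_real (F (pt s x))) has_vector_derivative
      complex_of_real (rho x) * complex_of_real (partial (0, 1) F (pt s x))) (at s)"
    unfolding has_vector_derivative_def by simp
qed

lemma pullback_continuous:
  assumes "continuous_on \<Omega> F"
  shows "continuous_on ({0<..<1} \<times> UNIV) (\<lambda>(s, x). F (pt s x))"
proof -
  have "continuous_on ({0<..<1} \<times> UNIV) (\<lambda>(s, x). pt s x)"
    unfolding pt_def split_beta
    by (intro continuous_intros continuous_on_compose2[OF rho_continuous]) auto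
  moreover have "(\<lambda>(s, x). pt s x) ` ({0<..<1} \<times> UNIV) \<subseteq> \<Omega>" by (auto intro: pt_in_domain)
  ultimately have "continuous_on ({0<..<1} \<times> UNIV) (\<lambda>z. F ((\<lambda>(s, x). pt s x) z))"
    by (rule continuous_on_compose2[OF assms])
  then show ?thesis by (simp add: split_beta)
qed

end


section \<open>Green's identity for a single mode\<close>

lemma integral_by_parts:
  fixes u v :: "'a::euclidean_space \<Rightarrow> complex"
  assumes u: "\<And>x. u differentiable (at x)" "continuous_on UNIV (partial b u)" "\<forall>x. norm x > R \<longrightarrow> u x = 0"
    and v: "\<And>x. v differentiable (at x)" "continuous_on UNIV (partial b v)"
  shows "(\<integral>x. u x * partial b v x \<partial>lborel) = - (\<integral>x. partial b u x * v x \<partial>lborel)"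
proof -
  have p: "partial b (\<lambda>x. u x * v x) = (\<lambda>x. u x * partial b v x + partial b u x * v x)"
    by (rule ext) (rule partial_mult[OF u(1) v(1)])
  note c = differentiable_imp_continuous_UNIV[OF u(1)] differentiable_imp_continuous_UNIV[OF v(1)]
  note pR = partial_outside[OF u(3), of b]
  have i1: "integrable lborel (\<lambda>x. u x * partial b v x)"
    by (rule compact_support_integrable[where R = R]) (use u c v in \<open>auto intro!: continuous_intros\<close>)
  have i2: "integrable lborel (\<lambda>x. partial b u x * v x)"
    by (rule compact_support_integrable[where R = R]) (use u c v pR in \<open>auto intro!: continuous_intros\<close>)
  have "(\<integral>x. partial b (\<lambda>x. u x * v x) x \<partial>lborel) = 0"
  proof (rule integral_partial_eq_0)
    show "(\<lambda>x. u x * v x) differentiable at x" for x by (intro differentiable_mult u v)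
    show "continuous_on UNIV (partial b (\<lambda>x. u x * v x))" unfolding p by (intro continuous_intros u v c)
    show "integrable lborel (\<lambda>x. u x * v x)"
      by (rule compact_support_integrable[where R = R]) (use u c in \<open>auto intro!: continuous_intros\<close>)
    show "integrable lborel (partial b (\<lambda>x. u x * v x))" unfolding p by (intro Bochner_Integration.integrable_add i1 i2)
  qed
  then show ?thesis unfolding p Bochner_Integration.integral_add[OF i1 i2] by (simp add: eq_neg_iff_add_eq_0)
qed

lemma continuous_on_section:
  assumes "continuous_on ({0<..<1} \<times> UNIV) (\<lambda>(s::real, x). f s x)" "0 < s" "s < 1"
  shows "continuous_on UNIV (f s)"
proof -
  have "continuous_on UNIV (\<lambda>x. (\<lambda>(s, x). f s x) (s, x))"
    by (rule continuous_on_compose2[OF assms(1)]) (use assms(2,3) in \<open>auto intro!: continuous_intros\<close>)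
  then show ?thesis by simp
qed

lemma continuous_on_section2:
  assumes "continuous_on ({0<..<1} \<times> UNIV) (\<lambda>(s::real, x). f s x)" "S \<subseteq> {0<..<1}"
  shows "continuous_on S (\<lambda>s. f s x)"
proof -
  have "continuous_on S (\<lambda>s. (\<lambda>(s, x). f s x) (s, x))"
    by (rule continuous_on_compose2[OF assms(1)]) (use assms(2) in \<open>auto intro!: continuous_intros\<close>)
  then show ?thesis by simp
qed

text \<open>On the level \<open>s\<close>, \<open>C\<close> is the restriction of the harmonic function \<open>exp (- i k x) cosh (|k| (y + h0))\<close>, whose
  normal derivative vanishes at the bottom, and \<open>(norm k)\<^sup>2 * S\<close> that of its vertical derivative. Green's identity
  pairs it with the potential.\<close>

locale fluid_mode = fluid +
  fixes k :: "'a::euclidean_space"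
  assumes k: "k \<noteq> 0"
begin

definition wave where "wave x = exp (- (\<i> * complex_of_real (k \<bullet> x)))"
definition C where "C s x = wave x * complex_of_real (cosh (norm k * (s * rho x)))"
definition S where "S s x = wave x * complex_of_real (sinh (norm k * (s * rho x)) / norm k)"
definition ik where "ik b = \<i> * complex_of_real (k \<bullet> b)"
definition r where "r x = complex_of_real (rho x)"
definition e where "e b x = complex_of_real (partial b \<eta> x)"
definition G where "G c s x = complex_of_real (partial c \<phi> (pt s x))"
definition G2 where "G2 d c s x = complex_of_real (partial d (partial c \<phi>) (pt s x))"

abbreviation V :: "'a \<times> real" where "V \<equiv> (0, 1)"

lemma ik_square_sum: "(\<Sum>b\<in>Basis. ik b * ik b) = - complex_of_real ((norm k)\<^sup>2)"
proof -
  have "(norm k)\<^sup>2 = (\<Sum>b\<in>Basis. (k \<bullet> b) * (k \<bullet> b))"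
    by (simp add: power2_norm_eq_inner euclidean_inner[symmetric])
  moreover have "ik b * ik b = - complex_of_real ((k \<bullet> b) * (k \<bullet> b))" for b
    unfolding ik_def by (simp add: algebra_simps)
  ultimately show ?thesis by (simp add: sum_negf)
qed

lemma wave_differentiable: "wave differentiable (at x)"
  unfolding wave_def[abs_def] by (rule differentiable_iexp_inner)

lemma partial_wave: "partial b wave x = - ik b * wave x"
  unfolding wave_def[abs_def] ik_def by (simp add: partial_eq[OF has_derivative_iexp_inner])

lemma wave_continuous: "continuous_on A wave"
  unfolding wave_def[abs_def] by (intro continuous_intros)

lemma norm_wave [simp]: "norm (wave x) = 1"
  unfolding wave_def by simp

lemma C_differentiable: "C s differentiable (at x)"
  and partial_C: "partial b (C s) x = - ik b * C s x + complex_of_real ((norm k)\<^sup>2) * complex_of_real s * e b x * S s x"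
proof -
  have 1: "((\<lambda>r. cosh (norm k * (s * r))) has_real_derivative sinh (norm k * (s * rho x)) * (norm k * s)) (at (rho x))"
    by (auto intro!: derivative_eq_intros)
  note d = compose_real_partial[OF rho_differentiable 1]
  show "C s differentiable (at x)"
    unfolding C_def[abs_def] by (intro differentiable_mult wave_differentiable d)
  show "partial b (C s) x = - ik b * C s x + complex_of_real ((norm k)\<^sup>2) * complex_of_real s * e b x * S s x"
    unfolding C_def[abs_def] partial_mult[OF wave_differentiable d(1)] d(2) partial_wave
    using k by (simp add: S_def e_def partial_rho power2_eq_square algebra_simps)
qed

lemma S_differentiable: "S s differentiable (at x)"
  and partial_S: "partial b (S s) x = - ik b * S s x + complex_of_real s * e b x * C s x"
proof -
  have 1: "((\<lambda>r. sinh (norm k * (s * r)) / norm k) has_real_derivative cosh (norm k * (s * rho x)) * s) (at (rho x))"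
    using k by (auto intro!: derivative_eq_intros)
  note d = compose_real_partial[OF rho_differentiable 1]
  show "S s differentiable (at x)"
    unfolding S_def[abs_def] by (intro differentiable_mult wave_differentiable d)
  show "partial b (S s) x = - ik b * S s x + complex_of_real s * e b x * C s x"
    unfolding S_def[abs_def] partial_mult[OF wave_differentiable d(1)] d(2) partial_wave
    using k by (simp add: C_def e_def partial_rho algebra_simps)
qed

lemma C_vertical: "((\<lambda>s. C s x) has_vector_derivative complex_of_real ((norm k)\<^sup>2) * r x * S s x) (at s)"
proof -
  have "((\<lambda>s. cosh (norm k * (s * rho x))) has_real_derivative sinh (norm k * (s * rho x)) * (norm k * rho x)) (at s)"
    by (auto intro!: derivative_eq_intros)
  then have "((\<lambda>s. complex_of_real (cosh (norm k * (s * rho x)))) has_vector_derivative complex_of_real (sinh (norm k * (s * rho x)) * (norm k * rho x))) (at s)"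
    by (intro has_vector_derivative_of_real) (simp add: has_real_derivative_iff_has_vector_derivative)
  from has_vector_derivative_mult_right[OF this, of "wave x"] show ?thesis
    unfolding C_def S_def r_def using k by (simp add: power2_eq_square mult_ac)
qed

lemma S_vertical: "((\<lambda>s. S s x) has_vector_derivative r x * C s x) (at s)"
proof -
  have "((\<lambda>s. sinh (norm k * (s * rho x)) / norm k) has_real_derivative cosh (norm k * (s * rho x)) * rho x) (at s)"
    using k by (auto intro!: derivative_eq_intros)
  then have "((\<lambda>s. complex_of_real (sinh (norm k * (s * rho x)) / norm k)) has_vector_derivative complex_of_real (cosh (norm k * (s * rho x)) * rho x)) (at s)"
    by (intro has_vector_derivative_of_real) (simp add: has_real_derivative_iff_has_vector_derivative)
  from has_vector_derivative_mult_right[OF this, of "wave x"] show ?thesis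
    unfolding C_def S_def r_def by (simp add: mult_ac)
qed

lemma cont_CS: "continuous_on A (\<lambda>(s, x). C s x)" "continuous_on A (\<lambda>(s, x). S s x)"
  unfolding C_def S_def split_beta using k
  by (auto intro!: continuous_intros continuous_on_compose2[OF rho_continuous] continuous_on_compose2[OF wave_continuous[of UNIV]])

lemma cont_re: "continuous_on A (\<lambda>(s, x). r x)" "b \<in> Basis \<Longrightarrow> continuous_on A (\<lambda>(s, x). e b x)"
  unfolding r_def e_def split_beta
  by (auto intro!: continuous_intros continuous_on_compose2[OF rho_continuous] continuous_on_compose2[OF eta_partial_continuous])

lemma cont_G: "c \<in> Basis \<Longrightarrow> continuous_on ({0<..<1} \<times> UNIV) (\<lambda>(s, x). G c s x)"
  and cont_G2: "c \<in> Basis \<Longrightarrow> d \<in> Basis \<Longrightarrow> continuous_on ({0<..<1} \<times> UNIV) (\<lambda>(s, x). G2 d c s x)"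
  using pullback_continuous[OF phi_partial_continuous] pullback_continuous[OF phi_partial2_continuous]
  unfolding G_def G2_def split_beta by (auto intro!: continuous_on_of_real)

text \<open>The flux, along the normal \<open>(- s * grad \<eta>, 1)\<close>, of the field with
  horizontal components \<open>C \<phi>_b - ik_b S \<phi>_y\<close> and vertical component
  \<open>C \<phi>_y + sum ik_b S \<phi>_b\<close>. It differs from the integrand of Green's identity
  by a tangential divergence: on the level, the normal derivative of the mode is the sum of the
  derivatives of \<open>ik b * S\<close>, so it can be traded for tangential derivatives of the
  potential. Only the gradient of the potential is controlled globally, which makes this form the
  useful one.\<close>

definition flux where
  "flux s x = C s x * (G V s x - complex_of_real s * (\<Sum>b\<in>Basis. e b x * G (b, 0) s x))
    + (\<Sum>b\<in>Basis. ik b * S s x * (G (b, 0) s x + complex_of_real s * e b x * G V s x))"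

definition flux' where
  "flux' s x = complex_of_real ((norm k)\<^sup>2) * r x * S s x * (G V s x - complex_of_real s * (\<Sum>b\<in>Basis. e b x * G (b, 0) s x))
    + C s x * (r x * G2 V V s x - (\<Sum>b\<in>Basis. e b x * G (b, 0) s x) - complex_of_real s * (\<Sum>b\<in>Basis. e b x * (r x * G2 V (b, 0) s x)))
    + (\<Sum>b\<in>Basis. ik b * (r x * C s x * (G (b, 0) s x + complex_of_real s * e b x * G V s x)
        + S s x * (r x * G2 V (b, 0) s x + (e b x * G V s x + complex_of_real s * e b x * (r x * G2 V V s x)))))"

text \<open>The horizontal components of the same field times the Jacobian \<open>rho\<close> of the
  flattening (the Piola transform). The absence of sources in the fluid then becomes a conservation
  law between \<open>flux\<close> and \<open>X\<close>.\<close>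

definition X where "X b s x = r x * (C s x * G (b, 0) s x - ik b * S s x * G V s x)"

definition X' where
  "X' b s x = e b x * (C s x * G (b, 0) s x - ik b * S s x * G V s x)
    + r x * ((- ik b * C s x + complex_of_real ((norm k)\<^sup>2) * complex_of_real s * e b x * S s x) * G (b, 0) s x
      + C s x * (G2 (b, 0) (b, 0) s x + complex_of_real s * e b x * G2 V (b, 0) s x)
      - ik b * ((- ik b * S s x + complex_of_real s * e b x * C s x) * G V s x
        + S s x * (G2 (b, 0) V s x + complex_of_real s * e b x * G2 V V s x)))"

lemma flux_derivative:
  assumes s: "0 < s" "s < 1"
  shows "((\<lambda>s. flux s x) has_vector_derivative flux' s x) (at s)"
proof -
  have dG: "((\<lambda>s. G c s x) has_vector_derivative r x * G2 V c s x) (at s)" if "c \<in> Basis" for c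
    unfolding G_def G2_def r_def by (rule pullback_vertical[OF phi_partial_differentiable[OF pt_in_domain[OF s] that]])
  note dV = dG[OF vertical_Basis] and dH = dG[OF horizontal_Basis]
  have ds: "((\<lambda>s. complex_of_real s) has_vector_derivative 1) (at s)"
    by (auto intro!: derivative_eq_intros simp: has_vector_derivative_def scaleR_conv_of_real)
  show ?thesis
    unfolding flux_def flux'_def
    apply (rule has_vector_derivative_eq_rhs)
     apply (rule derivative_intros has_vector_derivative_sum C_vertical S_vertical dV dH ds has_vector_derivative_mult_right has_vector_derivative_mult | assumption)+
    apply (simp add: algebra_simps sum.distrib sum_distrib_left)
    done
qed

lemma X_differentiable:
  assumes s: "0 < s" "s < 1" and b: "b \<in> Basis"
  shows "X b s differentiable (at x)" and "partial b (X b s) x = X' b s x"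
proof -
  have dG: "G c s differentiable (at x)" and pG: "partial b (G c s) x = G2 (b, 0) c s x + complex_of_real s * e b x * G2 V c s x"
    if "c \<in> Basis" for c
  proof -
    have z: "partial c \<phi> differentiable (at (pt s x))"
      by (rule phi_partial_differentiable[OF pt_in_domain[OF s] that])
    show "G c s differentiable (at x)" "partial b (G c s) x = G2 (b, 0) c s x + complex_of_real s * e b x * G2 V c s x"
      using pullback_differentiable[OF z] pullback_partial[OF z, of b]
      unfolding G_def[abs_def] G2_def e_def by auto
  qed
  have dr: "r differentiable (at x)" and pr: "partial b r x = e b x"
    using compose_real_partial(1)[OF rho_differentiable DERIV_ident, of x] compose_real_partial(2)[OF rho_differentiable DERIV_ident, where x = x and b = b]
    unfolding r_def[abs_def] e_def partial_rho by auto
  note d = dG[OF horizontal_Basis[OF b]] dG[OF vertical_Basis] dr C_differentiable[of s x] S_differentiable[of s x]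
  have X_eq: "X b s = (\<lambda>x. r x * (C s x * G (b, 0) s x + (- ik b) * (S s x * G V s x)))"
    unfolding X_def by (simp add: algebra_simps)
  note dd = differentiable_mult[OF d(4) d(1)] differentiable_mult[OF d(5) d(2)]
  note ddd = differentiable_mult[OF differentiable_const dd(2), of "- ik b"]
  note dX = differentiable_add[OF dd(1) ddd]
  show "X b s differentiable (at x)" unfolding X_eq by (intro differentiable_mult dr dX)
  show "partial b (X b s) x = X' b s x"
    unfolding X_eq X'_def partial_mult[OF dr dX] partial_add[OF dd(1) ddd] partial_mult[OF d(4) d(1)]
      partial_mult[OF differentiable_const dd(2)] partial_mult[OF d(5) d(2)] partial_const
      pr partial_C partial_S pG[OF horizontal_Basis[OF b]] pG[OF vertical_Basis]
    by (simp add: algebra_simps)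
qed

text \<open>Once the mixed derivatives are identified, two groups remain: \<open>C\<close> times the
  Laplacian of the potential, and the vertical derivative of the potential times \<open>S\<close>
  times \<open>(norm k)^2\<close> plus the sum of the squares of \<open>ik b\<close>. The first
  vanishes by harmonicity of the potential, the second by that of the mode.\<close>

lemma divergence_free:
  assumes s: "0 < s" "s < 1"
  shows "flux' s x + (\<Sum>b\<in>Basis. X' b s x) = 0"
proof -
  let ?K = "complex_of_real ((norm k)\<^sup>2)" and ?s = "complex_of_real s"
  have mixed: "G2 (b, 0) V s x = G2 V (b, 0) s x" if "b \<in> Basis" for b
    unfolding G2_def phi_mixed[OF pt_in_domain[OF s] that] ..
  have lap: "G2 V V s x = - (\<Sum>b\<in>Basis. G2 (b, 0) (b, 0) s x)"
    using laplace[OF pt_in_domain[OF s, of x]] unfolding G2_def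
    by (simp add: add_eq_0_iff2 flip: of_real_sum of_real_minus)
  have flux'_eq: "flux' s x = ?K * r x * S s x * G V s x + C s x * r x * G2 V V s x + (\<Sum>b\<in>Basis.
      - (?K * r x * S s x * ?s * e b x * G (b, 0) s x) - C s x * e b x * G (b, 0) s x - C s x * ?s * e b x * r x * G2 V (b, 0) s x
      + ik b * (r x * C s x * (G (b, 0) s x + ?s * e b x * G V s x)
        + S s x * (r x * G2 V (b, 0) s x + (e b x * G V s x + ?s * e b x * (r x * G2 V V s x)))))"
    unfolding flux'_def by (simp add: algebra_simps sum.distrib sum_distrib_left sum_subtractf sum_negf)
  have "(- (?K * r x * S s x * ?s * e b x * G (b, 0) s x) - C s x * e b x * G (b, 0) s x - C s x * ?s * e b x * r x * G2 V (b, 0) s x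
      + ik b * (r x * C s x * (G (b, 0) s x + ?s * e b x * G V s x)
        + S s x * (r x * G2 V (b, 0) s x + (e b x * G V s x + ?s * e b x * (r x * G2 V V s x))))) + X' b s x =
      C s x * r x * G2 (b, 0) (b, 0) s x + ik b * ik b * (r x * S s x * G V s x)" if "b \<in> Basis" for b
    unfolding X'_def mixed[OF that] by (simp add: algebra_simps)
  then have "flux' s x + (\<Sum>b\<in>Basis. X' b s x) = ?K * r x * S s x * G V s x + C s x * r x * G2 V V s x +
      (\<Sum>b\<in>Basis. C s x * r x * G2 (b, 0) (b, 0) s x + ik b * ik b * (r x * S s x * G V s x))"
    unfolding flux'_eq add.assoc sum.distrib[symmetric] by simp
  also have "\<dots> = ?K * r x * S s x * G V s x + C s x * r x * (G2 V V s x + (\<Sum>b\<in>Basis. G2 (b, 0) (b, 0) s x))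
      + (\<Sum>b\<in>Basis. ik b * ik b) * (r x * S s x * G V s x)"
    by (simp add: sum.distrib sum_distrib_left sum_distrib_right algebra_simps)
  also have "\<dots> = 0" unfolding ik_square_sum lap by (simp add: algebra_simps)
  finally show ?thesis .
qed

lemma cont_flux': "continuous_on ({0<..<1} \<times> UNIV) (\<lambda>(s, x). flux' s x)"
  and cont_X: "b \<in> Basis \<Longrightarrow> continuous_on ({0<..<1} \<times> UNIV) (\<lambda>(s, x). X b s x)"
  and cont_X': "b \<in> Basis \<Longrightarrow> continuous_on ({0<..<1} \<times> UNIV) (\<lambda>(s, x). X' b s x)"
  and cont_flux: "continuous_on ({0<..<1} \<times> UNIV) (\<lambda>(s, x). flux s x)"
proof -
  note c = cont_CS[where A = "{0<..<1} \<times> UNIV", unfolded split_beta] cont_re[where A = "{0<..<1} \<times> UNIV", unfolded split_beta]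
    cont_G[OF horizontal_Basis, unfolded split_beta] cont_G[OF vertical_Basis, unfolded split_beta]
    cont_G2[OF horizontal_Basis horizontal_Basis, unfolded split_beta] cont_G2[OF horizontal_Basis vertical_Basis, unfolded split_beta]
    cont_G2[OF vertical_Basis horizontal_Basis, unfolded split_beta] cont_G2[OF vertical_Basis vertical_Basis, unfolded split_beta]
  show "continuous_on ({0<..<1} \<times> UNIV) (\<lambda>(s, x). flux' s x)"
    unfolding flux'_def split_beta by (intro continuous_intros c)
  show "continuous_on ({0<..<1} \<times> UNIV) (\<lambda>(s, x). flux s x)"
    unfolding flux_def split_beta by (intro continuous_intros c)
  show "continuous_on ({0<..<1} \<times> UNIV) (\<lambda>(s, x). X b s x)" if "b \<in> Basis"
    unfolding X_def split_beta using that by (intro continuous_intros c)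
  show "continuous_on ({0<..<1} \<times> UNIV) (\<lambda>(s, x). X' b s x)" if "b \<in> Basis"
    unfolding X'_def split_beta using that by (intro continuous_intros c)
qed

text \<open>The conservation law between two interior levels: the fundamental theorem in
  \<open>s\<close>, and integration by parts in \<open>x\<close>, where the cutoff confines
  everything to a compact set on which all functions are continuous. The remainder carries the
  gradient of the cutoff.\<close>

lemma flux_balance:
  fixes \<theta> :: "'a \<Rightarrow> complex"
  assumes \<theta>: "\<And>x. \<theta> differentiable (at x)" "\<And>b. b \<in> Basis \<Longrightarrow> continuous_on UNIV (partial b \<theta>)"
      "\<forall>x. norm x > R \<longrightarrow> \<theta> x = 0"
    and st: "0 < s" "s \<le> t" "t < 1"
  shows "(\<integral>x. \<theta> x * flux t x \<partial>lborel) - (\<integral>x. \<theta> x * flux s x \<partial>lborel) =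
    (\<integral>\<sigma>. indicator {s..t} \<sigma> *\<^sub>R (\<integral>x. (\<Sum>b\<in>Basis. partial b \<theta> x * X b \<sigma> x) \<partial>lborel) \<partial>lborel)"
proof -
  have \<theta>c: "continuous_on UNIV \<theta>" by (rule differentiable_imp_continuous_UNIV[OF \<theta>(1)])
  have sub: "{s..t} \<subseteq> {0<..<1}" using st by auto
  have FTC: "(\<integral>\<sigma>. indicator {s..t} \<sigma> *\<^sub>R flux' \<sigma> x \<partial>lborel) = flux t x - flux s x" for x
  proof (rule integral_FTC_Icc[OF st(2)])
    show "((\<lambda>s. flux s x) has_vector_derivative flux' \<sigma> x) (at \<sigma> within {s..t})" if "s \<le> \<sigma>" "\<sigma> \<le> t" for \<sigma>
      using that st by (intro has_vector_derivative_at_within[OF flux_derivative]) auto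
    show "continuous_on {s..t} (\<lambda>\<sigma>. flux' \<sigma> x)" by (rule continuous_on_section2[OF cont_flux' sub])
  qed
  have prodint: "integrable (lborel \<Otimes>\<^sub>M lborel) (\<lambda>(\<sigma>, x). indicator {s..t} \<sigma> *\<^sub>R (\<theta> x * flux' \<sigma> x))"
  proof -
    have "continuous_on ({s..t} \<times> cball 0 R) (\<lambda>z. \<theta> (snd z) * flux' (fst z) (snd z))"
      by (intro continuous_intros continuous_on_compose2[OF \<theta>c] continuous_on_subset[OF cont_flux'[unfolded split_beta]])
         (use sub in auto)
    then have "integrable lborel (\<lambda>z. indicator ({s..t} \<times> cball 0 R) z *\<^sub>R (\<theta> (snd z) * flux' (fst z) (snd z)))"
      by (intro borel_integrable_compact compact_Times) auto
    moreover have "indicator ({s..t} \<times> cball 0 R) z *\<^sub>R (\<theta> (snd z) * flux' (fst z) (snd z)) = (case z of (\<sigma>, x) \<Rightarrow> indicator {s..t} \<sigma> *\<^sub>R (\<theta> x * flux' \<sigma> x))" for z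
      using \<theta>(3) by (cases "norm (snd z) \<le> R") (auto simp: indicator_def split_beta mem_Times_iff)
    ultimately show ?thesis by (simp add: lborel_prod)
  qed
  have sect: "(\<integral>x. \<theta> x * flux' \<sigma> x \<partial>lborel) = (\<integral>x. (\<Sum>b\<in>Basis. partial b \<theta> x * X b \<sigma> x) \<partial>lborel)" if \<sigma>: "\<sigma> \<in> {s..t}" for \<sigma>
  proof -
    have s01: "0 < \<sigma>" "\<sigma> < 1" using sub \<sigma> by auto
    have pX: "partial b (X b \<sigma>) = X' b \<sigma>" if "b \<in> Basis" for b by (rule ext) (rule X_differentiable(2)[OF s01 that])
    have i: "integrable lborel (\<lambda>x. \<theta> x * X' b \<sigma> x)" "integrable lborel (\<lambda>x. partial b \<theta> x * X b \<sigma> x)" if "b \<in> Basis" for b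
      using \<theta>(3) partial_outside[OF \<theta>(3), of b]
      by (auto intro!: compact_support_integrable[where R = R] continuous_intros \<theta>c \<theta>(2) that
          continuous_on_section[OF cont_X' s01] continuous_on_section[OF cont_X s01])
    have "(\<integral>x. \<theta> x * flux' \<sigma> x \<partial>lborel) = (\<integral>x. - (\<Sum>b\<in>Basis. \<theta> x * X' b \<sigma> x) \<partial>lborel)"
      using divergence_free[OF s01] by (simp add: eq_neg_iff_add_eq_0[symmetric] sum_distrib_left)
    also have "\<dots> = - (\<Sum>b\<in>Basis. \<integral>x. \<theta> x * X' b \<sigma> x \<partial>lborel)"
      by (simp add: i)
    also have "\<dots> = (\<Sum>b\<in>Basis. \<integral>x. partial b \<theta> x * X b \<sigma> x \<partial>lborel)"
    proof -
      have "(\<integral>x. \<theta> x * X' b \<sigma> x \<partial>lborel) = - (\<integral>x. partial b \<theta> x * X b \<sigma> x \<partial>lborel)" if b: "b \<in> Basis" for b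
        using integral_by_parts[OF \<theta>(1) \<theta>(2)[OF b] \<theta>(3) X_differentiable(1)[OF s01 b]]
          continuous_on_section[OF cont_X'[OF b] s01] by (simp add: pX b)
      then show ?thesis by (simp add: sum_negf)
    qed
    also have "\<dots> = (\<integral>x. (\<Sum>b\<in>Basis. partial b \<theta> x * X b \<sigma> x) \<partial>lborel)"
      by (rule Bochner_Integration.integral_sum[symmetric]) (rule i)
    finally show ?thesis .
  qed
  have fi: "integrable lborel (\<lambda>x. \<theta> x * flux \<sigma> x)" if "0 < \<sigma>" "\<sigma> < 1" for \<sigma>
    using \<theta>(3) by (auto intro!: compact_support_integrable[where R = R] continuous_intros \<theta>c continuous_on_section[OF cont_flux that])
  have "(\<integral>x. \<theta> x * flux t x \<partial>lborel) - (\<integral>x. \<theta> x * flux s x \<partial>lborel) = (\<integral>x. \<theta> x * (flux t x - flux s x) \<partial>lborel)"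
    using st by (subst Bochner_Integration.integral_diff[symmetric]) (auto intro!: fi simp: right_diff_distrib)
  also have "\<dots> = (\<integral>x. (\<integral>\<sigma>. indicator {s..t} \<sigma> *\<^sub>R (\<theta> x * flux' \<sigma> x) \<partial>lborel) \<partial>lborel)"
    unfolding FTC[symmetric] by (subst integral_mult_right_zero[symmetric]) (simp add: mult_scaleR_right)
  also have "\<dots> = (\<integral>\<sigma>. (\<integral>x. indicator {s..t} \<sigma> *\<^sub>R (\<theta> x * flux' \<sigma> x) \<partial>lborel) \<partial>lborel)"
    using lborel_pair.Fubini_integral[OF prodint] by simp
  also have "\<dots> = (\<integral>\<sigma>. indicator {s..t} \<sigma> *\<^sub>R (\<integral>x. (\<Sum>b\<in>Basis. partial b \<theta> x * X b \<sigma> x) \<partial>lborel) \<partial>lborel)"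
    by (intro Bochner_Integration.integral_cong refl) (auto simp: sect split: split_indicator)
  finally show ?thesis .
qed

end


section \<open>Boundary limits\<close>

text \<open>Stated in \<open>ennreal\<close>, so that lines along which the variation is infinite
  need no separate treatment.\<close>

lemma variation_bound:
  fixes u v :: "real \<Rightarrow> complex"
  assumes der: "\<And>s. 0 < s \<Longrightarrow> s < 1 \<Longrightarrow> (u has_vector_derivative v s) (at s)"
    and cont: "continuous_on {0<..<1} v"
    and st: "0 < s" "s < 1" "0 < t" "t < 1"
  shows "ennreal (norm (u t - u s)) \<le> (\<integral>\<^sup>+\<sigma>. indicator {0<..<1} \<sigma> * ennreal (norm (v \<sigma>)) \<partial>lborel)"
proof -
  have main: "ennreal (norm (u b - u a)) \<le> (\<integral>\<^sup>+\<sigma>. indicator {0<..<1} \<sigma> * ennreal (norm (v \<sigma>)) \<partial>lborel)"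
    if ab: "0 < a" "a \<le> b" "b < 1" for a b
  proof -
    have sub: "{a..b} \<subseteq> {0<..<1}" using ab by auto
    have "has_bochner_integral lborel (\<lambda>\<sigma>. indicator {a..b} \<sigma> *\<^sub>R v \<sigma>) (u b - u a)"
      by (rule has_bochner_integral_FTC_Icc[OF ab(2)])
         (use ab sub in \<open>auto intro!: has_vector_derivative_at_within[OF der] continuous_on_subset[OF cont]\<close>)
    then have i: "integrable lborel (\<lambda>\<sigma>. indicator {a..b} \<sigma> *\<^sub>R v \<sigma>)" and eq: "u b - u a = (\<integral>\<sigma>. indicator {a..b} \<sigma> *\<^sub>R v \<sigma> \<partial>lborel)"
      by (auto simp: has_bochner_integral_iff)
    have "ennreal (norm (u b - u a)) \<le> (\<integral>\<^sup>+\<sigma>. ennreal (norm (indicator {a..b} \<sigma> *\<^sub>R v \<sigma>)) \<partial>lborel)"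
      unfolding eq by (rule integral_norm_bound_ennreal[OF i])
    also have "\<dots> \<le> (\<integral>\<^sup>+\<sigma>. indicator {0<..<1} \<sigma> * ennreal (norm (v \<sigma>)) \<partial>lborel)"
      using sub by (intro nn_integral_mono) (auto split: split_indicator)
    finally show ?thesis .
  qed
  show ?thesis
  proof (cases "s \<le> t")
    case True then show ?thesis using main[of s t] st by simp
  next
    case False then show ?thesis using main[of t s] st by (simp add: norm_minus_commute)
  qed
qed

text \<open>Square integrability of the gradient and of its vertical derivative over the whole
  fluid. The former finally absorbs the cutoff error; together they control the gradient along
  vertical lines up to the boundary.\<close>

locale fluid_energy = fluid +
  assumes energy: "c \<in> Basis \<Longrightarrow> (\<integral>\<^sup>+z. indicator (fluid_domain h0 \<eta>) z * ennreal ((partial c \<phi> z)\<^sup>2) \<partial>lborel) < \<infinity>"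
    and energy2: "c \<in> Basis \<Longrightarrow> (\<integral>\<^sup>+z. indicator (fluid_domain h0 \<eta>) z * ennreal ((partial (0, 1) (partial c \<phi>) z)\<^sup>2) \<partial>lborel) < \<infinity>"
begin

lemma measurable_slab:
  fixes f :: "real \<Rightarrow> 'a \<Rightarrow> 'b::{second_countable_topology, real_normed_vector}"
  assumes "continuous_on ({0<..<1} \<times> UNIV) (\<lambda>(s, x). f s x)"
  shows "(\<lambda>(s, x). indicator {0<..<1} s *\<^sub>R f s x) \<in> borel_measurable (borel \<Otimes>\<^sub>M borel)"
proof -
  have "open ({0<..<1::real} \<times> (UNIV :: 'a set))" by (intro open_Times) auto
  then have "(\<lambda>z. indicator ({0<..<1} \<times> UNIV) z *\<^sub>R (\<lambda>(s, x). f s x) z) \<in> borel_measurable borel"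
    by (intro borel_measurable_continuous_on_indicator assms) simp
  moreover have "(\<lambda>z. indicator ({0<..<1} \<times> UNIV) z *\<^sub>R (\<lambda>(s, x). f s x) z) = (\<lambda>(s, x). indicator {0<..<1} s *\<^sub>R f s x)"
    by (auto simp: fun_eq_iff split: split_indicator)
  ultimately show ?thesis by (simp add: borel_prod)
qed

lemma measurable_slab_norm:
  fixes f :: "real \<Rightarrow> 'a \<Rightarrow> 'b::{second_countable_topology, real_normed_vector}"
  assumes "continuous_on ({0<..<1} \<times> UNIV) (\<lambda>(s, x). f s x)"
  shows "(\<lambda>(s, x). indicator {0<..<1} s * ennreal (norm (f s x))) \<in> borel_measurable (borel \<Otimes>\<^sub>M borel)"
    and "(\<lambda>(x, s). indicator {0<..<1} s * ennreal (norm (f s x))) \<in> borel_measurable (borel \<Otimes>\<^sub>M borel)"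
proof -
  note m = measurable_slab[OF assms]
  have "(\<lambda>z. ennreal (norm ((\<lambda>(s, x). indicator {0<..<1} s *\<^sub>R f s x) z))) \<in> borel_measurable (borel \<Otimes>\<^sub>M borel)"
    using m by measurable
  moreover have eq: "(\<lambda>z. ennreal (norm ((\<lambda>(s, x). indicator {0<..<1} s *\<^sub>R f s x) z))) = (\<lambda>(s, x). indicator {0<..<1} s * ennreal (norm (f s x)))"
    by (auto simp: fun_eq_iff split: split_indicator)
  ultimately show 1: "(\<lambda>(s, x). indicator {0<..<1} s * ennreal (norm (f s x))) \<in> borel_measurable (borel \<Otimes>\<^sub>M borel)" by simp
  show "(\<lambda>(x, s). indicator {0<..<1} s * ennreal (norm (f s x))) \<in> borel_measurable (borel \<Otimes>\<^sub>M borel)"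
    using measurable_compose[OF measurable_pair_swap' 1] by (simp add: split_beta)
qed

text \<open>The flattening is affine on every vertical line, so Fubini and the one-dimensional
  substitution suffice.\<close>

lemma change_of_variables:
  fixes f :: "'a \<times> real \<Rightarrow> ennreal"
  assumes m: "(\<lambda>z. indicator (fluid_domain h0 \<eta>) z * f z) \<in> borel_measurable borel"
  shows "(\<integral>\<^sup>+x. (\<integral>\<^sup>+s. indicator {0<..<1} s * (ennreal (rho x) * f (pt s x)) \<partial>lborel) \<partial>lborel) =
    (\<integral>\<^sup>+z. indicator (fluid_domain h0 \<eta>) z * f z \<partial>lborel)"
proof -
  let ?F = "\<lambda>z. indicator (fluid_domain h0 \<eta>) z * f z"
  have [measurable]: "?F \<in> borel_measurable (borel \<Otimes>\<^sub>M borel)" using m by (simp add: borel_prod)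
  have "(\<integral>\<^sup>+z. ?F z \<partial>lborel) = (\<integral>\<^sup>+z. ?F z \<partial>(lborel \<Otimes>\<^sub>M lborel))" by (simp add: lborel_prod)
  also have "\<dots> = (\<integral>\<^sup>+x. \<integral>\<^sup>+y. ?F (x, y) \<partial>lborel \<partial>lborel)"
    by (rule lborel.nn_integral_fst[symmetric]) (use m in \<open>simp add: lborel_prod\<close>)
  also have "\<dots> = (\<integral>\<^sup>+x. (\<integral>\<^sup>+s. indicator {0<..<1} s * (ennreal (rho x) * f (pt s x)) \<partial>lborel) \<partial>lborel)"
  proof (rule nn_integral_cong)
    fix x
    have [measurable]: "(\<lambda>y. ?F (x, y)) \<in> borel_measurable borel" by measurable
    have "(\<integral>\<^sup>+y. ?F (x, y) \<partial>lborel) = ennreal \<bar>rho x\<bar> * (\<integral>\<^sup>+s. ?F (x, - h0 + rho x * s) \<partial>lborel)"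
      using rho_bounds[of x] by (intro nn_integral_real_affine) auto
    also have "\<dots> = (\<integral>\<^sup>+s. ennreal \<bar>rho x\<bar> * ?F (x, - h0 + rho x * s) \<partial>lborel)"
      by (rule nn_integral_cmult[symmetric]) measurable
    also have "\<dots> = (\<integral>\<^sup>+s. indicator {0<..<1} s * (ennreal (rho x) * f (pt s x)) \<partial>lborel)"
    proof (rule nn_integral_cong)
      fix s
      have p: "(x, - h0 + rho x * s) = pt s x" by (simp add: pt_def mult.commute)
      have "pt s x \<in> fluid_domain h0 \<eta> \<longleftrightarrow> 0 < s \<and> s < 1"
      proof
        assume "pt s x \<in> fluid_domain h0 \<eta>"
        then have "- h0 < - h0 + s * rho x" "- h0 + s * rho x < \<eta> x" by (auto simp: pt_def fluid_domain_def)
        then have "0 < s * rho x" "s * rho x < rho x" using rho_def[of x] by linarith+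
        then show "0 < s \<and> s < 1"
          using rho_bounds(3)[of x] mult_less_cancel_right_pos[of "rho x" s 1] by (simp add: zero_less_mult_iff)
      qed (auto intro: pt_in_domain)
      then show "ennreal \<bar>rho x\<bar> * ?F (x, - h0 + rho x * s) = indicator {0<..<1} s * (ennreal (rho x) * f (pt s x))"
        unfolding p using rho_bounds[of x] by (auto simp: mult_ac split: split_indicator)
    qed
    finally show "(\<integral>\<^sup>+y. ?F (x, y) \<partial>lborel) = \<dots>" .
  qed
  finally show ?thesis by simp
qed

text \<open>Mean plus total variation along the vertical line through \<open>x\<close>: the
  one-dimensional Sobolev bound for the supremum on that line.\<close>

definition majorant :: "'a \<times> real \<Rightarrow> 'a \<Rightarrow> ennreal" where
  "majorant c x = (\<integral>\<^sup>+s. indicator {0<..<1} s * ennreal (norm (partial c \<phi> (pt s x))) \<partial>lborel)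
    + (\<integral>\<^sup>+s. indicator {0<..<1} s * ennreal (norm (rho x * partial (0, 1) (partial c \<phi>) (pt s x))) \<partial>lborel)"

lemma cont_partial: "c \<in> Basis \<Longrightarrow> continuous_on ({0<..<1} \<times> UNIV) (\<lambda>(s, x). partial c \<phi> (pt s x))"
  by (rule pullback_continuous[OF phi_partial_continuous])

lemma cont_partial2:
  assumes "c \<in> Basis"
  shows "continuous_on ({0<..<1} \<times> UNIV) (\<lambda>(s, x). rho x * partial (0, 1) (partial c \<phi>) (pt s x))"
  using pullback_continuous[OF phi_partial2_continuous[OF assms vertical_Basis]]
  unfolding split_beta by (intro continuous_intros continuous_on_compose2[OF rho_continuous]) auto

lemma majorant_measurable:
  assumes "c \<in> Basis"
  shows "majorant c \<in> borel_measurable borel"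
proof -
  have "(\<lambda>x. \<integral>\<^sup>+s. indicator {0<..<1} s * ennreal (norm (partial c \<phi> (pt s x))) \<partial>lborel) \<in> borel_measurable borel"
    "(\<lambda>x. \<integral>\<^sup>+s. indicator {0<..<1} s * ennreal (norm (rho x * partial (0, 1) (partial c \<phi>) (pt s x))) \<partial>lborel) \<in> borel_measurable borel"
    using measurable_slab_norm(2)[OF cont_partial[OF assms]] measurable_slab_norm(2)[OF cont_partial2[OF assms]]
    by (auto intro!: lborel.borel_measurable_nn_integral simp: measurable_cong_sets[OF sets_pair_measure_cong[OF refl sets_lborel] refl])
  then show ?thesis unfolding majorant_def[abs_def] by measurable
qed

lemma le_majorant:
  assumes c: "c \<in> Basis" and s: "0 < s" "s < 1"
  shows "ennreal (norm (partial c \<phi> (pt s x))) \<le> majorant c x"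
proof -
  let ?u = "\<lambda>s. complex_of_real (partial c \<phi> (pt s x))"
  let ?v = "\<lambda>s. complex_of_real (rho x * partial (0, 1) (partial c \<phi>) (pt s x))"
  let ?I = "\<integral>\<^sup>+\<sigma>. indicator {0<..<1} \<sigma> * ennreal (norm (rho x * partial (0, 1) (partial c \<phi>) (pt \<sigma> x))) \<partial>lborel"
  have [measurable]: "(\<lambda>t. indicator {0<..<1} t * ennreal \<bar>partial c \<phi> (pt t x)\<bar>) \<in> borel_measurable borel"
    using measurable_compose[OF measurable_Pair2' measurable_slab_norm(1)[OF cont_partial[OF c]], of x]
    by (simp add: split_beta)
  have var: "ennreal (norm (?u s - ?u t)) \<le> ?I" if t: "0 < t" "t < 1" for t
  proof -
    have "continuous_on {0<..<1} (\<lambda>s. rho x * partial (0, 1) (partial c \<phi>) (pt s x))"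
      by (rule continuous_on_section2[OF cont_partial2[OF c]]) simp
    then have "continuous_on {0<..<1} ?v" by (intro continuous_on_of_real)
    then have "ennreal (norm (?u s - ?u t)) \<le> (\<integral>\<^sup>+\<sigma>. indicator {0<..<1} \<sigma> * ennreal (norm (?v \<sigma>)) \<partial>lborel)"
      using t s by (intro variation_bound) (auto intro!: pullback_vertical phi_partial_differentiable pt_in_domain c)
    then show ?thesis by (simp only: norm_of_real real_norm_def)
  qed
  \<comment> \<open>The value at \<open>s\<close> differs from the value at any other
    \<open>t\<close> by at most the variation; averaging over \<open>t\<close> in the unit interval
    turns the latter value into the mean.\<close>
  have "ennreal (norm (partial c \<phi> (pt s x))) = (\<integral>\<^sup>+t. indicator {0<..<1::real} t * ennreal (norm (partial c \<phi> (pt s x))) \<partial>lborel)"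
    by (subst nn_integral_multc) auto
  also have "\<dots> \<le> (\<integral>\<^sup>+t. indicator {0<..<1} t * ennreal (norm (partial c \<phi> (pt t x))) + indicator {0<..<1} t * ?I \<partial>lborel)"
  proof (rule nn_integral_mono)
    fix t :: real
    show "indicator {0<..<1} t * ennreal (norm (partial c \<phi> (pt s x))) \<le> indicator {0<..<1} t * ennreal (norm (partial c \<phi> (pt t x))) + indicator {0<..<1} t * ?I"
    proof (cases "0 < t \<and> t < 1")
      case True
      have "norm (partial c \<phi> (pt s x)) \<le> norm (partial c \<phi> (pt t x)) + norm (?u s - ?u t)"
        unfolding of_real_diff[symmetric] norm_of_real by simp
      then have "ennreal (norm (partial c \<phi> (pt s x))) \<le> ennreal (norm (partial c \<phi> (pt t x))) + ennreal (norm (?u s - ?u t))"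
        by (subst ennreal_plus[symmetric]) (auto intro: ennreal_leI simp del: ennreal_plus)
      also have "\<dots> \<le> ennreal (norm (partial c \<phi> (pt t x))) + ?I"
        using var True by (intro add_left_mono) auto
      finally show ?thesis using True by simp
    qed simp
  qed
  also have "\<dots> = majorant c x"
    unfolding majorant_def by (subst nn_integral_add) (auto simp: nn_integral_multc)
  finally show ?thesis .
qed

text \<open>By \<open>\<bar>d\<bar> \<le> 1 + d^2\<close> and the lower bound on \<open>rho\<close>,
  the majorant is estimated by the two energies plus a constant. The constant confines the estimate
  to balls.\<close>

lemma majorant_locally_integrable:
  assumes c: "c \<in> Basis"
  shows "(\<integral>\<^sup>+x. indicator (cball 0 R) x * majorant c x \<partial>lborel) < \<infinity>"
proof -
  let ?D1 = "\<lambda>s x. partial c \<phi> (pt s x)" and ?D2 = "\<lambda>s x. partial (0, 1) (partial c \<phi>) (pt s x)"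
  let ?I = "\<lambda>s. indicator {0<..<1::real} s :: ennreal"
  have sq: "(\<lambda>z. indicator (fluid_domain h0 \<eta>) z * ennreal ((F z)\<^sup>2)) \<in> borel_measurable borel"
    if "continuous_on (fluid_domain h0 \<eta>) F" for F :: "'a \<times> real \<Rightarrow> real"
  proof -
    have "(\<lambda>z. indicator (fluid_domain h0 \<eta>) z *\<^sub>R F z) \<in> borel_measurable borel"
      using open_domain by (intro borel_measurable_continuous_on_indicator that) simp
    then have "(\<lambda>z. ennreal ((indicator (fluid_domain h0 \<eta>) z *\<^sub>R F z)\<^sup>2)) \<in> borel_measurable borel" by measurable
    moreover have eq: "(\<lambda>z. ennreal ((indicator (fluid_domain h0 \<eta>) z *\<^sub>R F z)\<^sup>2)) = (\<lambda>z. indicator (fluid_domain h0 \<eta>) z * ennreal ((F z)\<^sup>2))"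
      by (auto simp: fun_eq_iff split: split_indicator)
    ultimately show ?thesis by (simp only: eq)
  qed
  have E1: "(\<integral>\<^sup>+x. \<integral>\<^sup>+s. ?I s * (ennreal (rho x) * ennreal ((?D1 s x)\<^sup>2)) \<partial>lborel \<partial>lborel) < \<infinity>"
    using change_of_variables[OF sq[OF phi_partial_continuous[OF c]]] energy[OF c] by simp
  have E2: "(\<integral>\<^sup>+x. \<integral>\<^sup>+s. ?I s * (ennreal (rho x) * ennreal ((?D2 s x)\<^sup>2)) \<partial>lborel \<partial>lborel) < \<infinity>"
    using change_of_variables[OF sq[OF phi_partial2_continuous[OF c vertical_Basis]]] energy2[OF c] by simp
  have meas: "(\<lambda>(x, s). ?I s * ennreal (norm (sqrt (rho x) * F s x) ^ 2)) \<in> borel_measurable (borel \<Otimes>\<^sub>M borel)"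
    if "continuous_on ({0<..<1} \<times> UNIV) (\<lambda>(s, x). F s x)" for F :: "real \<Rightarrow> 'a \<Rightarrow> real"
  proof -
    have "continuous_on ({0<..<1} \<times> UNIV) (\<lambda>(s, x). (sqrt (rho x) * F s x)\<^sup>2)"
      using that unfolding split_beta
      by (intro continuous_intros continuous_on_compose2[OF rho_continuous]) auto
    from measurable_slab_norm(2)[OF this] show ?thesis by simp
  qed
  have rsq: "ennreal (norm (sqrt (rho x) * F) ^ 2) = ennreal (rho x) * ennreal (F\<^sup>2)" for x F
    using rho_bounds[of x] by (simp add: power_mult_distrib ennreal_mult)
  note [measurable] = meas[OF pullback_continuous[OF phi_partial_continuous[OF c]], unfolded rsq]
    meas[OF pullback_continuous[OF phi_partial2_continuous[OF c vertical_Basis]], unfolded rsq]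
    measurable_slab_norm(2)[OF cont_partial[OF c]] measurable_slab_norm(2)[OF cont_partial2[OF c]]
  have [measurable]: "(\<lambda>s. ?I s * ennreal \<bar>?D1 s x\<bar>) \<in> borel_measurable borel"
      "(\<lambda>s. ?I s * ennreal \<bar>rho x * ?D2 s x\<bar>) \<in> borel_measurable borel" for x
    using measurable_compose[OF measurable_Pair2' measurable_slab_norm(1)[OF cont_partial[OF c]], of x]
      measurable_compose[OF measurable_Pair2' measurable_slab_norm(1)[OF cont_partial2[OF c]], of x]
    by (simp_all add: split_beta)
  have [measurable]: "(\<lambda>x. \<integral>\<^sup>+s. ?I s * (ennreal (rho x) * ennreal ((?D1 s x)\<^sup>2)) \<partial>lborel) \<in> borel_measurable borel"
      "(\<lambda>x. \<integral>\<^sup>+s. ?I s * (ennreal (rho x) * ennreal ((?D2 s x)\<^sup>2)) \<partial>lborel) \<in> borel_measurable borel"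
      "cball (0::'a) R \<in> sets borel"
    using meas[OF pullback_continuous[OF phi_partial_continuous[OF c]], unfolded rsq]
      meas[OF pullback_continuous[OF phi_partial2_continuous[OF c vertical_Basis]], unfolded rsq]
    by (auto intro!: lborel.borel_measurable_nn_integral simp: measurable_cong_sets[OF sets_pair_measure_cong[OF refl sets_lborel] refl])
  have pt: "norm d1 + norm (rho x * d2) \<le> (1 + 2 * h0) + (2 / h0 * (rho x * d1\<^sup>2) + rho x * d2\<^sup>2)" for x d1 d2
  proof -
    have a: "\<bar>d\<bar> \<le> 1 + d\<^sup>2" for d :: real
      using power2_sum[of "\<bar>d\<bar>" "-1"] zero_le_power2[of "\<bar>d\<bar> - 1"] abs_ge_zero[of d] by (simp add: power2_diff)
    have "1 * d1\<^sup>2 \<le> (2 / h0 * rho x) * d1\<^sup>2"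
      using rho_bounds(1)[of x] h0 by (intro mult_right_mono) (auto simp: field_simps)
    moreover have "rho x * \<bar>d2\<bar> \<le> rho x * (1 + d2\<^sup>2)" by (intro mult_left_mono a rho_bounds)
    ultimately show ?thesis using a[of d1] rho_bounds[of x] by (simp add: abs_mult algebra_simps)
  qed
  have "(\<integral>\<^sup>+x. indicator (cball 0 R) x * majorant c x \<partial>lborel) =
      (\<integral>\<^sup>+x. \<integral>\<^sup>+s. indicator (cball 0 R) x * (?I s * ennreal (norm (?D1 s x)) + ?I s * ennreal (norm (rho x * ?D2 s x))) \<partial>lborel \<partial>lborel)"
    unfolding majorant_def by (intro nn_integral_cong) (subst nn_integral_cmult, measurable, subst nn_integral_add, auto)
  also have "\<dots> \<le> (\<integral>\<^sup>+x. \<integral>\<^sup>+s. ennreal (1 + 2 * h0) * (indicator (cball 0 R) x * ?I s) + (ennreal (2 / h0) * (?I s * (ennreal (rho x) * ennreal ((?D1 s x)\<^sup>2))) + ?I s * (ennreal (rho x) * ennreal ((?D2 s x)\<^sup>2))) \<partial>lborel \<partial>lborel)"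
  proof (intro nn_integral_mono)
    fix x :: 'a and s :: real
    have "ennreal (norm (?D1 s x)) + ennreal (norm (rho x * ?D2 s x)) \<le> ennreal (1 + 2 * h0) + (ennreal (2 / h0) * (ennreal (rho x) * ennreal ((?D1 s x)\<^sup>2)) + ennreal (rho x) * ennreal ((?D2 s x)\<^sup>2))"
      using ennreal_leI[OF pt[of "?D1 s x" x "?D2 s x"]] h0 rho_bounds[of x]
      by (simp add: ennreal_plus[symmetric] ennreal_mult[symmetric] del: ennreal_plus)
    then show "indicator (cball 0 R) x * (?I s * ennreal (norm (?D1 s x)) + ?I s * ennreal (norm (rho x * ?D2 s x))) \<le>
      ennreal (1 + 2 * h0) * (indicator (cball 0 R) x * ?I s) + (ennreal (2 / h0) * (?I s * (ennreal (rho x) * ennreal ((?D1 s x)\<^sup>2))) + ?I s * (ennreal (rho x) * ennreal ((?D2 s x)\<^sup>2)))"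
      by (auto split: split_indicator)
  qed
  also have "\<dots> = ennreal (1 + 2 * h0) * (\<integral>\<^sup>+x. \<integral>\<^sup>+s. indicator (cball 0 R) (x::'a) * ?I s \<partial>lborel \<partial>lborel)
      + (ennreal (2 / h0) * (\<integral>\<^sup>+x. \<integral>\<^sup>+s. ?I s * (ennreal (rho x) * ennreal ((?D1 s x)\<^sup>2)) \<partial>lborel \<partial>lborel)
      + (\<integral>\<^sup>+x. \<integral>\<^sup>+s. ?I s * (ennreal (rho x) * ennreal ((?D2 s x)\<^sup>2)) \<partial>lborel \<partial>lborel))"
    by (simp add: nn_integral_add nn_integral_cmult)
  also have "\<dots> < \<infinity>"
  proof -
    have "(\<integral>\<^sup>+x. \<integral>\<^sup>+s. indicator (cball 0 R) (x::'a) * ?I s \<partial>lborel \<partial>lborel) = emeasure lborel (cball (0::'a) R)"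
      by (simp add: nn_integral_cmult)
    also have "\<dots> < \<infinity>" by (rule emeasure_bounded_finite) simp
    finally show ?thesis using E1 E2 by (simp add: ennreal_mult_less_top)
  qed
  finally show ?thesis .
qed

lemma AE_majorant_finite: "AE x in lborel. \<forall>c\<in>Basis. majorant c x < \<infinity>"
proof -
  have "AE x in lborel. majorant c x < \<infinity>" if c: "c \<in> Basis" for c
  proof -
    have "AE x in lborel. \<forall>n. indicator (cball 0 (real n)) x * majorant c x \<noteq> \<infinity>"
      unfolding AE_all_countable
    proof
      fix n :: nat
      have [measurable]: "majorant c \<in> borel_measurable borel" "cball (0::'a) (real n) \<in> sets borel"
        using majorant_measurable[OF c] by simp_all
      show "AE x in lborel. indicator (cball 0 (real n)) x * majorant c x \<noteq> \<infinity>"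
        using majorant_locally_integrable[OF c, of "real n"] by (intro nn_integral_PInf_AE) auto
    qed
    then show ?thesis
    proof eventually_elim
      case (elim x)
      obtain n :: nat where "norm x \<le> real n" using real_arch_simple by blast
      then show ?case using spec[OF elim, of n] by (simp add: top.not_eq_extremum)
    qed
  qed
  then show ?thesis by (intro AE_finite_allI) auto
qed

text \<open>Where the majorant is infinite, \<open>enn2real\<close> yields 0 and the bound is
  meaningless. This happens only on a null set, and \<open>le_bound\<close> assumes
  finiteness.\<close>

definition bound where "bound c x = enn2real (majorant c x)"

lemma bound_nonneg [simp]: "0 \<le> bound c x"
  unfolding bound_def by simp

lemma bound_measurable: "c \<in> Basis \<Longrightarrow> bound c \<in> borel_measurable borel"
  unfolding bound_def[abs_def] by (intro measurable_compose[OF majorant_measurable]) auto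

lemma le_bound:
  assumes "c \<in> Basis" "0 < s" "s < 1" "majorant c x < \<infinity>"
  shows "norm (partial c \<phi> (pt s x)) \<le> bound c x"
proof -
  have "ennreal (norm (partial c \<phi> (pt s x))) \<le> ennreal (bound c x)"
    using le_majorant[OF assms(1-3), of x] assms(4) unfolding bound_def by simp
  then show ?thesis by (simp add: ennreal_le_iff)
qed

lemma bound_locally_integrable:
  assumes c: "c \<in> Basis"
  shows "integrable lborel (\<lambda>x. indicator (cball 0 R) x * bound c x)"
  unfolding integrable_iff_bounded
proof
  have [measurable]: "bound c \<in> borel_measurable borel" "cball (0::'a) R \<in> sets borel"
    using bound_measurable[OF c] by simp_all
  show "(\<lambda>x. indicator (cball 0 R) x * bound c x) \<in> borel_measurable lborel" by measurable
  have "(\<integral>\<^sup>+x. ennreal (norm (indicator (cball 0 R) x * bound c x)) \<partial>lborel) \<le> (\<integral>\<^sup>+x. indicator (cball 0 R) x * majorant c x \<partial>lborel)"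
    by (intro nn_integral_mono) (auto simp: bound_def ennreal_enn2real_if split: split_indicator)
  also have "\<dots> < \<infinity>" by (rule majorant_locally_integrable[OF c])
  finally show "(\<integral>\<^sup>+x. ennreal (norm (indicator (cball 0 R) x * bound c x)) \<partial>lborel) < \<infinity>" .
qed

end

section \<open>Limits of the boundary terms\<close>

lemma finite_continuous_bound:
  fixes f :: "'b \<Rightarrow> 'a::euclidean_space \<Rightarrow> 'c::real_normed_vector"
  assumes "finite A" and f: "\<And>b. b \<in> A \<Longrightarrow> continuous_on UNIV (f b)"
  obtains B where "B \<ge> 0" "\<And>b x. b \<in> A \<Longrightarrow> norm x \<le> R \<Longrightarrow> norm (f b x) \<le> B"
proof -
  have "\<exists>B. \<forall>x. norm x \<le> R \<longrightarrow> norm (f b x) \<le> B" if "b \<in> A" for b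
  proof -
    have "bounded (f b ` cball 0 R)"
      by (intro compact_imp_bounded compact_continuous_image continuous_on_subset[OF f[OF that]]) auto
    then obtain B where "\<forall>y\<in>f b ` cball 0 R. norm y \<le> B" unfolding bounded_iff by blast
    then have "\<forall>x. norm x \<le> R \<longrightarrow> norm (f b x) \<le> B" by simp
    then show ?thesis by blast
  qed
  then obtain B where B: "\<And>b x. b \<in> A \<Longrightarrow> norm x \<le> R \<Longrightarrow> norm (f b x) \<le> B b" by metis
  have "norm (f b x) \<le> (\<Sum>b\<in>A. \<bar>B b\<bar>)" if "b \<in> A" "norm x \<le> R" for b x
  proof -
    have "norm (f b x) \<le> \<bar>B b\<bar>" using B[OF that] by simp
    also have "\<dots> \<le> (\<Sum>b\<in>A. \<bar>B b\<bar>)" using that assms(1) by (intro member_le_sum) auto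
    finally show ?thesis .
  qed
  then show thesis using that[of "\<Sum>b\<in>A. \<bar>B b\<bar>"] by (simp add: sum_nonneg)
qed

lemma sum_Basis_prod:
  fixes f :: "'a::euclidean_space \<times> real \<Rightarrow> 'b::comm_monoid_add"
  shows "(\<Sum>c\<in>Basis. f c) = f (0, 1) + (\<Sum>b\<in>Basis. f (b, 0))"
proof -
  have "inj_on (\<lambda>b. (b, 0::real)) (Basis :: 'a set)" by (auto simp: inj_on_def)
  moreover have "(\<lambda>b. (b, 0::real)) ` (Basis :: 'a set) \<inter> {(0, 1)} = {}" by auto
  moreover have B: "(Basis :: ('a \<times> real) set) = (\<lambda>b. (b, 0)) ` Basis \<union> {(0, 1)}" by (auto simp: Basis_prod_def)
  ultimately show ?thesis
    unfolding B by (subst sum.union_disjoint) (simp_all add: sum.reindex add.commute)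
qed

lemma tendsto_zero_mult_bounded:
  fixes f g :: "nat \<Rightarrow> complex"
  assumes "f \<longlonglongrightarrow> 0" "\<And>n. norm (g n) \<le> B"
  shows "(\<lambda>n. f n * g n) \<longlonglongrightarrow> 0"
proof (rule Lim_null_comparison)
  show "\<forall>\<^sub>F n in sequentially. norm (f n * g n) \<le> norm (f n) * B"
    using assms(2) by (intro always_eventually) (auto simp: norm_mult intro!: mult_left_mono)
  show "(\<lambda>n. norm (f n) * B) \<longlonglongrightarrow> 0"
    using tendsto_mult_left_zero[OF tendsto_norm_zero[OF assms(1)], of B] .
qed

text \<open>Interior levels tending to the surface and, below, to the bottom; the offset 3 puts them
  inside the slab and in the right order from the start.\<close>

definition up :: "nat \<Rightarrow> real" where "up n = 1 - 1 / (real n + 3)"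
definition down :: "nat \<Rightarrow> real" where "down n = 1 / (real n + 3)"

lemma levels: "0 < up n" "up n < 1" "0 < down n" "down n < 1" "down n \<le> up n"
  unfolding up_def down_def by (auto simp: field_simps)

lemma up_tendsto: "up \<longlonglongrightarrow> 1" and down_tendsto: "down \<longlonglongrightarrow> 0"
  unfolding up_def[abs_def] down_def[abs_def] by real_asymp+

text \<open>The data at a frozen time, with the boundary conditions expanded into partial
  derivatives. The potential has the trace \<open>q\<close>, but its tangential derivative is tied
  to \<open>gq\<close> only through the weak gradient.\<close>

locale water_wave = fluid_energy h0 \<eta> \<phi> for h0 and \<eta> :: "'a::euclidean_space \<Rightarrow> real" and \<phi> +
  fixes \<eta>t q :: "'a \<Rightarrow> real" and gq :: "'a \<Rightarrow> 'a"
  assumes bottom: "AE x in lborel. ((\<lambda>y. partial (0, 1) \<phi> (x, y)) \<longlongrightarrow> 0) (at_right (- h0))"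
    and surface: "AE x in lborel. ((\<lambda>y. partial (0, 1) \<phi> (x, y) - (\<Sum>b\<in>Basis. partial b \<eta> x * partial (b, 0) \<phi> (x, y))) \<longlongrightarrow> \<eta>t x) (at_left (\<eta> x))"
    and trace: "AE x in lborel. ((\<lambda>y. \<phi> (x, y)) \<longlongrightarrow> q x) (at_left (\<eta> x))"
    and etat_integrable: "integrable lborel \<eta>t"
    and gq_integrable: "b \<in> Basis \<Longrightarrow> integrable lborel (\<lambda>x. complex_of_real (gq x \<bullet> b))"
    and q_tempered: "tempered_function (\<lambda>x. complex_of_real (q x))"
    and q_gradient: "distr_gradient q gq"
begin

lemma up_level: "filterlim (\<lambda>n. - h0 + up n * rho x) (at_left (\<eta> x)) sequentially"
  unfolding filterlim_at
proof
  have "up n * rho x < 1 * rho x" for n using levels rho_bounds[of x] by (intro mult_strict_right_mono) auto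
  then have "- h0 + up n * rho x < \<eta> x" for n unfolding rho_def by (smt (verit) mult_1)
  then show "\<forall>\<^sub>F n in sequentially. - h0 + up n * rho x \<in> {..<\<eta> x} \<and> - h0 + up n * rho x \<noteq> \<eta> x"
    by (intro always_eventually) (auto simp: less_imp_neq)
  have "(\<lambda>n. - h0 + up n * rho x) \<longlonglongrightarrow> - h0 + 1 * rho x" by (intro tendsto_intros up_tendsto)
  then show "(\<lambda>n. - h0 + up n * rho x) \<longlonglongrightarrow> \<eta> x" by (simp add: rho_def)
qed

lemma down_level: "filterlim (\<lambda>n. - h0 + down n * rho x) (at_right (- h0)) sequentially"
  unfolding filterlim_at
proof
  have "0 < down n * rho x" for n using levels rho_bounds[of x] by simp
  then show "\<forall>\<^sub>F n in sequentially. - h0 + down n * rho x \<in> {- h0<..} \<and> - h0 + down n * rho x \<noteq> - h0"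
    by (intro always_eventually) (auto simp: less_imp_neq[symmetric])
  have "(\<lambda>n. - h0 + down n * rho x) \<longlonglongrightarrow> - h0 + 0 * rho x" by (intro tendsto_intros down_tendsto)
  then show "(\<lambda>n. - h0 + down n * rho x) \<longlonglongrightarrow> - h0" by simp
qed

lemma q_integrable: "schwartz f \<Longrightarrow> integrable lborel (\<lambda>x. complex_of_real (q x) * f x)"
  and q_measurable: "(\<lambda>x. complex_of_real (q x)) \<in> borel_measurable borel"
  using q_tempered unfolding tempered_function_def represented_by_def by (auto simp: has_bochner_integral_iff)

lemma q_weak:
  assumes "b \<in> Basis" "schwartz f"
  shows "has_bochner_integral lborel (\<lambda>x. complex_of_real (gq x \<bullet> b) * f x) (- (\<integral>x. complex_of_real (q x) * partial b f x \<partial>lborel))"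
  using q_gradient assms unfolding distr_gradient_def represented_by_def partial_distr_def fun_distr_def by auto

text \<open>On the middle level the potential is continuous, hence locally integrable; the variation
  along the vertical line accounts for the difference to any other level.\<close>

lemma phi_bound:
  assumes s: "0 < s" "s < 1" and m: "majorant (0, 1) x < \<infinity>"
  shows "norm (\<phi> (pt s x)) \<le> norm (\<phi> (pt (1 / 2) x)) + 2 * h0 * bound (0, 1) x"
proof -
  let ?u = "\<lambda>s. complex_of_real (\<phi> (pt s x))"
  let ?v = "\<lambda>s. complex_of_real (rho x) * complex_of_real (partial (0, 1) \<phi> (pt s x))"
  have c: "continuous_on {0<..<1} (\<lambda>s. partial (0, 1) \<phi> (pt s x))"
    by (rule continuous_on_section2[OF cont_partial[OF vertical_Basis]]) simp
  have [measurable]: "(\<lambda>t. indicator {0<..<1} t * ennreal \<bar>partial (0, 1) \<phi> (pt t x)\<bar>) \<in> borel_measurable borel"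
    using measurable_compose[OF measurable_Pair2' measurable_slab_norm(1)[OF cont_partial[OF vertical_Basis]], of x]
    by (simp add: split_beta)
  have "ennreal (norm (?u s - ?u (1 / 2))) \<le> (\<integral>\<^sup>+\<sigma>. indicator {0<..<1} \<sigma> * ennreal (norm (?v \<sigma>)) \<partial>lborel)"
  proof (rule variation_bound[of ?u ?v "1 / 2" s])
    show "continuous_on {0<..<1} ?v" by (intro continuous_intros c)
    show "(?u has_vector_derivative ?v \<sigma>) (at \<sigma>)" if "0 < \<sigma>" "\<sigma> < 1" for \<sigma>
      by (rule pullback_vertical[OF phi_differentiable[OF pt_in_domain[OF that]]])
  qed (use s in auto)
  also have "\<dots> = (\<integral>\<^sup>+\<sigma>. ennreal (rho x) * (indicator {0<..<1} \<sigma> * ennreal \<bar>partial (0, 1) \<phi> (pt \<sigma> x)\<bar>) \<partial>lborel)"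
    using rho_bounds[of x] by (intro nn_integral_cong) (simp add: norm_mult ennreal_mult mult_ac)
  also have "\<dots> = ennreal (rho x) * (\<integral>\<^sup>+\<sigma>. indicator {0<..<1} \<sigma> * ennreal \<bar>partial (0, 1) \<phi> (pt \<sigma> x)\<bar> \<partial>lborel)"
    by (rule nn_integral_cmult) simp
  also have "\<dots> \<le> ennreal (2 * h0) * majorant (0, 1) x"
    unfolding majorant_def using rho_bounds[of x] by (intro mult_mono ennreal_leI) auto
  also have "\<dots> = ennreal (2 * h0 * bound (0, 1) x)"
    using m h0 by (simp add: bound_def ennreal_mult)
  finally have "norm (?u s - ?u (1 / 2)) \<le> 2 * h0 * bound (0, 1) x"
    using h0 by (simp add: ennreal_le_iff)
  then show ?thesis unfolding of_real_diff[symmetric] norm_of_real by simp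
qed

end

locale water_wave_mode = water_wave h0 \<eta> \<phi> \<eta>t q gq + fluid_mode h0 \<eta> \<phi> k
  for h0 and \<eta> :: "'a::euclidean_space \<Rightarrow> real" and \<phi> \<eta>t q gq k
begin

definition K where "K = cosh (norm k * (2 * h0))"

lemma K_nonneg [simp]: "0 \<le> K"
  unfolding K_def by simp

lemma norm_CS:
  assumes s: "0 \<le> s" "s \<le> 1"
  shows "norm (C s x) \<le> K" "norm (S s x) \<le> K / norm k"
proof -
  have "s * rho x \<le> 1 * (2 * h0)" using s rho_bounds[of x] by (intro mult_mono) auto
  then have le: "norm k * (s * rho x) \<le> norm k * (2 * h0)" by (intro mult_left_mono) auto
  have nn: "0 \<le> norm k * (s * rho x)" using s rho_bounds[of x] by simp
  have cosh_le: "cosh (norm k * (s * rho x)) \<le> K"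
    unfolding K_def using nn le h0 by (subst cosh_real_nonneg_le_iff) auto
  then show "norm (C s x) \<le> K" unfolding C_def by (simp add: norm_mult)
  have "\<bar>sinh (norm k * (s * rho x))\<bar> \<le> K"
    using cosh_le sinh_le_cosh_real[of "norm k * (s * rho x)"] nn by simp
  then show "norm (S s x) \<le> K / norm k" unfolding S_def by (simp add: norm_mult norm_divide divide_right_mono)
qed

lemma norm_ik: "b \<in> Basis \<Longrightarrow> norm (ik b) \<le> norm k"
  unfolding ik_def by (simp add: norm_mult Basis_le_norm)

lemma CS_tendsto:
  assumes "s \<longlonglongrightarrow> a"
  shows "(\<lambda>n. C (s n) x) \<longlonglongrightarrow> C a x" "(\<lambda>n. S (s n) x) \<longlonglongrightarrow> S a x"
  unfolding C_def S_def using k by (auto intro!: tendsto_intros assms)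

lemma CS_measurable [measurable]: "C s \<in> borel_measurable borel" "S s \<in> borel_measurable borel"
  by (intro borel_measurable_continuous_onI differentiable_imp_continuous_UNIV C_differentiable S_differentiable)+

lemma norm_G:
  assumes "c \<in> Basis" "0 < s" "s < 1" "majorant c x < \<infinity>"
  shows "norm (G c s x) \<le> bound c x"
  unfolding G_def norm_of_real using le_bound[OF assms] by simp

lemma e_measurable: "b \<in> Basis \<Longrightarrow> e b \<in> borel_measurable borel"
  unfolding e_def[abs_def]
  by (intro borel_measurable_continuous_onI continuous_on_of_real eta_partial_continuous)

lemma integrable_local:
  fixes f :: "'a \<Rightarrow> real"
  assumes "finite A" "A \<subseteq> Basis"
  shows "integrable lborel (\<lambda>x. indicator (cball 0 R) x * (c * (\<Sum>b\<in>A. bound b x)))"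
proof -
  have "integrable lborel (\<lambda>x. c * (\<Sum>b\<in>A. indicator (cball 0 R) x * bound b x))"
    using assms by (intro integrable_mult_right Bochner_Integration.integrable_sum bound_locally_integrable) auto
  then show ?thesis by (simp add: sum_distrib_left mult_ac)
qed

text \<open>Only limits along almost every vertical line are given, so the boundary terms converge by domination
  through the energy along such a line.\<close>

context
  fixes \<theta> :: "'a \<Rightarrow> complex" and R :: real
  assumes \<theta>: "\<And>x. \<theta> differentiable (at x)" "\<And>b. b \<in> Basis \<Longrightarrow> continuous_on UNIV (partial b \<theta>)"
      "\<forall>x. norm x > R \<longrightarrow> \<theta> x = 0"
begin

lemma \<theta>_cont: "continuous_on UNIV \<theta>"
  by (rule differentiable_imp_continuous_UNIV[OF \<theta>(1)])

lemma \<theta>_measurable: "\<theta> \<in> borel_measurable borel"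
  by (rule borel_measurable_continuous_onI[OF \<theta>_cont])

lemma slope_bound:
  obtains B where "B \<ge> 0" "\<And>b x. b \<in> Basis \<Longrightarrow> norm x \<le> R \<Longrightarrow> norm (e b x) \<le> B"
proof (rule finite_continuous_bound[of "Basis :: 'a set" e R])
  show "continuous_on UNIV (e b)" if "b \<in> Basis" for b
    unfolding e_def[abs_def] by (intro continuous_on_of_real eta_partial_continuous that)
qed auto

lemma surface_normal_limit:
  "(\<lambda>n. \<integral>x. \<theta> x * (C (up n) x * (G V (up n) x - complex_of_real (up n) * (\<Sum>b\<in>Basis. e b x * G (b, 0) (up n) x))) \<partial>lborel)
    \<longlonglongrightarrow> (\<integral>x. \<theta> x * (C 1 x * complex_of_real (\<eta>t x)) \<partial>lborel)"
proof -
  obtain M where M: "M \<ge> 0" "\<And>x. norm (\<theta> x) \<le> M" using compact_support_bounded[OF \<theta>_cont \<theta>(3)] by metis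
  obtain B where B: "B \<ge> 0" "\<And>b x. b \<in> Basis \<Longrightarrow> norm x \<le> R \<Longrightarrow> norm (e b x) \<le> B" using slope_bound by metis
  let ?f = "\<lambda>n x. \<theta> x * (C (up n) x * (G V (up n) x - complex_of_real (up n) * (\<Sum>b\<in>Basis. e b x * G (b, 0) (up n) x)))"
  let ?w = "\<lambda>x. indicator (cball 0 R) x * (M * K * (1 + B) * (\<Sum>c\<in>Basis. bound c x))"
  show ?thesis
  proof (rule integral_dominated_convergence[where w = ?w])
    have [measurable]: "\<theta> \<in> borel_measurable borel" by (rule \<theta>_measurable)
    have [measurable]: "\<eta>t \<in> borel_measurable borel" using etat_integrable by auto
    show "(\<lambda>x. \<theta> x * (C 1 x * complex_of_real (\<eta>t x))) \<in> borel_measurable lborel" by measurable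
    show "?f n \<in> borel_measurable lborel" for n
    proof -
      have [measurable]: "G c (up n) \<in> borel_measurable borel" if "c \<in> Basis" for c
        by (intro borel_measurable_continuous_onI continuous_on_section[OF cont_G[OF that]] levels)
      have [measurable]: "G V (up n) \<in> borel_measurable borel"
        by (intro borel_measurable_continuous_onI continuous_on_section[OF cont_G[OF vertical_Basis]] levels)
      have "(\<lambda>x. \<Sum>b\<in>Basis. e b x * G (b, 0) (up n) x) \<in> borel_measurable borel"
        by (intro borel_measurable_sum borel_measurable_times e_measurable
            borel_measurable_continuous_onI continuous_on_section[OF cont_G[OF horizontal_Basis]] levels)
      then show ?thesis by measurable
    qed
    show "integrable lborel ?w" by (rule integrable_local) auto
    show "AE x in lborel. norm (?f n x) \<le> ?w x" for n
      using AE_majorant_finite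
    proof eventually_elim
      case (elim x)
      show ?case
      proof (cases "norm x \<le> R")
        case False then show ?thesis using \<theta>(3) by simp
      next
        case True
        have GV: "norm (G V (up n) x) \<le> bound V x" using elim levels by (intro norm_G vertical_Basis) (auto intro: vertical_Basis)
        have "norm (complex_of_real (up n) * (\<Sum>b\<in>Basis. e b x * G (b, 0) (up n) x)) \<le> 1 * (\<Sum>b\<in>Basis. B * bound (b, 0) x)"
          unfolding norm_mult
        proof (rule mult_mono)
          show "norm (\<Sum>b\<in>Basis. e b x * G (b, 0) (up n) x) \<le> (\<Sum>b\<in>Basis. B * bound (b, 0) x)"
          proof (rule sum_norm_le)
            fix b :: 'a assume b: "b \<in> Basis"
            show "norm (e b x * G (b, 0) (up n) x) \<le> B * bound (b, 0) x"
              unfolding norm_mult using elim levels b True horizontal_Basis[OF b]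
              by (intro mult_mono B norm_G) auto
          qed
        qed (use levels[of n] in auto)
        also have "\<dots> = B * (\<Sum>b\<in>Basis. bound (b, 0) x)" by (simp add: sum_distrib_left)
        finally have "norm (G V (up n) x - complex_of_real (up n) * (\<Sum>b\<in>Basis. e b x * G (b, 0) (up n) x)) \<le> bound V x + B * (\<Sum>b\<in>Basis. bound (b, 0) x)"
          using GV norm_triangle_ineq4[of "G V (up n) x" "complex_of_real (up n) * (\<Sum>b\<in>Basis. e b x * G (b, 0) (up n) x)"] by linarith
        also have "\<dots> \<le> (1 + B) * (bound V x + (\<Sum>b\<in>Basis. bound (b, 0) x))"
          using B(1) by (simp add: algebra_simps sum_nonneg)
        also have "bound V x + (\<Sum>b\<in>Basis. bound (b, 0) x) = (\<Sum>c\<in>Basis. bound c x)"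
          by (simp add: sum_Basis_prod)
        finally have "norm (\<theta> x) * (norm (C (up n) x) * norm (G V (up n) x - complex_of_real (up n) * (\<Sum>b\<in>Basis. e b x * G (b, 0) (up n) x))) \<le> M * (K * ((1 + B) * (\<Sum>c\<in>Basis. bound c x)))"
          using M levels[of n] norm_CS[of "up n" x] by (intro mult_mono) auto
        then show ?thesis using True by (simp add: norm_mult mult.assoc)
      qed
    qed
    show "AE x in lborel. (\<lambda>n. ?f n x) \<longlonglongrightarrow> \<theta> x * (C 1 x * complex_of_real (\<eta>t x))"
      using AE_majorant_finite surface
    proof eventually_elim
      case (elim x)
      have "(\<lambda>n. partial V \<phi> (pt (up n) x) - (\<Sum>b\<in>Basis. partial b \<eta> x * partial (b, 0) \<phi> (pt (up n) x))) \<longlonglongrightarrow> \<eta>t x"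
        using filterlim_compose[OF elim(2) up_level] by (simp add: pt_def)
      then have 1: "(\<lambda>n. G V (up n) x - (\<Sum>b\<in>Basis. e b x * G (b, 0) (up n) x)) \<longlonglongrightarrow> complex_of_real (\<eta>t x)"
        by (drule_tac tendsto_of_real[where 'a = complex]) (simp add: G_def e_def)
      \<comment> \<open>The kinematic condition involves the full slope of the surface, whereas the
        level has the slope scaled by \<open>up n\<close>. The discrepancy is a vanishing factor
        times derivatives that stay bounded along the line.\<close>
      have 2: "(\<lambda>n. (1 - complex_of_real (up n)) * (\<Sum>b\<in>Basis. e b x * G (b, 0) (up n) x)) \<longlonglongrightarrow> 0"
      proof (rule tendsto_zero_mult_bounded)
        have "(\<lambda>n. 1 - complex_of_real (up n)) \<longlonglongrightarrow> 1 - complex_of_real 1" by (intro tendsto_intros up_tendsto)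
        then show "(\<lambda>n. 1 - complex_of_real (up n)) \<longlonglongrightarrow> 0" by simp
        show "norm (\<Sum>b\<in>Basis. e b x * G (b, 0) (up n) x) \<le> (\<Sum>b\<in>Basis. norm (e b x) * bound (b, 0) x)" for n
          by (rule sum_norm_le)
             (use elim levels in \<open>auto simp: norm_mult intro!: mult_left_mono norm_G horizontal_Basis bspec[OF elim(1)]\<close>)
      qed
      have "(\<lambda>n. (G V (up n) x - (\<Sum>b\<in>Basis. e b x * G (b, 0) (up n) x)) + (1 - complex_of_real (up n)) * (\<Sum>b\<in>Basis. e b x * G (b, 0) (up n) x)) \<longlonglongrightarrow> complex_of_real (\<eta>t x) + 0"
        by (intro tendsto_add 1 2)
      then have "(\<lambda>n. G V (up n) x - complex_of_real (up n) * (\<Sum>b\<in>Basis. e b x * G (b, 0) (up n) x)) \<longlonglongrightarrow> complex_of_real (\<eta>t x)"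
        by (simp add: algebra_simps)
      then show ?case by (intro tendsto_intros CS_tendsto up_tendsto)
    qed
  qed
qed

lemma partial_\<theta>S:
  "(\<lambda>x. \<theta> x * S s x) differentiable (at x)"
  "partial b (\<lambda>x. \<theta> x * S s x) = (\<lambda>x. \<theta> x * (- ik b * S s x + complex_of_real s * e b x * C s x) + partial b \<theta> x * S s x)"
  using partial_mult[OF \<theta>(1) S_differentiable, of b s] by (auto simp: fun_eq_iff partial_S intro!: differentiable_mult \<theta>(1) S_differentiable)

lemma cont_partial_\<theta>S: "b \<in> Basis \<Longrightarrow> continuous_on UNIV (partial b (\<lambda>x. \<theta> x * S s x))"
  unfolding partial_\<theta>S e_def
  by (intro continuous_intros \<theta>_cont \<theta>(2) continuous_on_of_real eta_partial_continuous
      differentiable_imp_continuous_UNIV[OF S_differentiable] differentiable_imp_continuous_UNIV[OF C_differentiable])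

text \<open>The tangential derivative of the potential has no prescribed pointwise limit. On an
  interior level it is integrated by parts onto the test function, the potential then converges to
  \<open>q\<close> under the integral, and at the surface the integration by parts is undone by the
  weak gradient, with a \<open>C^1\<close> test function.\<close>

lemma surface_tangential_limit:
  assumes b: "b \<in> Basis"
  shows "(\<lambda>n. \<integral>x. (\<theta> x * S (up n) x) * (G (b, 0) (up n) x + complex_of_real (up n) * e b x * G V (up n) x) \<partial>lborel)
    \<longlonglongrightarrow> (\<integral>x. complex_of_real (gq x \<bullet> b) * (\<theta> x * S 1 x) \<partial>lborel)"
proof -
  let ?q = "\<lambda>s x. complex_of_real (\<phi> (pt s x))"
  let ?D = "\<lambda>s x. \<theta> x * (- ik b * S s x + complex_of_real s * e b x * C s x) + partial b \<theta> x * S s x"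
  have sup: "\<forall>x. norm x > R \<longrightarrow> \<theta> x * S s x = 0" for s using \<theta>(3) by simp
  have parts: "(\<integral>x. (\<theta> x * S (up n) x) * (G (b, 0) (up n) x + complex_of_real (up n) * e b x * G V (up n) x) \<partial>lborel) =
      - (\<integral>x. ?D (up n) x * ?q (up n) x \<partial>lborel)" for n
  proof -
    note up = levels(1,2)[of n]
    have pq: "partial b (?q (up n)) = (\<lambda>x. G (b, 0) (up n) x + complex_of_real (up n) * e b x * G V (up n) x)"
      unfolding G_def e_def by (rule ext) (rule pullback_partial[OF phi_differentiable[OF pt_in_domain[OF up]]])
    have "continuous_on UNIV (\<lambda>x. G (b, 0) (up n) x + complex_of_real (up n) * e b x * G V (up n) x)"
      unfolding e_def by (intro continuous_intros continuous_on_of_real eta_partial_continuous b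
        continuous_on_section[OF cont_G[OF horizontal_Basis[OF b]] up] continuous_on_section[OF cont_G[OF vertical_Basis] up])
    then show ?thesis
      using integral_by_parts[where u = "\<lambda>x. \<theta> x * S (up n) x" and v = "?q (up n)" and b = b and R = R,
          OF partial_\<theta>S(1) cont_partial_\<theta>S[OF b] sup]
        pullback_differentiable[OF phi_differentiable[OF pt_in_domain[OF up]]]
      unfolding partial_\<theta>S(2) pq by simp
  qed
  obtain M where M: "M \<ge> 0" "\<And>x. norm (\<theta> x) \<le> M" using compact_support_bounded[OF \<theta>_cont \<theta>(3)] by metis
  obtain M' where M': "M' \<ge> 0" "\<And>x. norm (partial b \<theta> x) \<le> M'"
    using compact_support_bounded[OF \<theta>(2)[OF b] partial_outside[OF \<theta>(3)]] by metis
  obtain B where B: "B \<ge> 0" "\<And>b x. b \<in> Basis \<Longrightarrow> norm x \<le> R \<Longrightarrow> norm (e b x) \<le> B" using slope_bound by metis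
  define L where "L = M * (norm (ik b) * (K / norm k) + B * K) + M' * (K / norm k)"
  have L0: "L \<ge> 0" unfolding L_def using M M' B by simp
  have Dle: "norm (?D s x) \<le> L" if s: "0 \<le> s" "s \<le> 1" and x: "norm x \<le> R" for s x
  proof -
    have "norm (- ik b * S s x + complex_of_real s * e b x * C s x) \<le> norm (- ik b * S s x) + norm (complex_of_real s * e b x * C s x)"
      by (rule norm_triangle_ineq)
    also have "\<dots> \<le> norm (ik b) * (K / norm k) + (1 * B) * K"
      unfolding norm_mult norm_minus_cancel using norm_CS[OF s, of x] s B(1) B(2)[OF b x]
      by (intro add_mono mult_mono) auto
    finally have 1: "norm (- ik b * S s x + complex_of_real s * e b x * C s x) \<le> norm (ik b) * (K / norm k) + B * K" by simp
    have "norm (?D s x) \<le> norm (\<theta> x) * norm (- ik b * S s x + complex_of_real s * e b x * C s x) + norm (partial b \<theta> x) * norm (S s x)"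
      unfolding norm_mult[symmetric] by (rule norm_triangle_ineq)
    also have "\<dots> \<le> L"
      unfolding L_def using 1 norm_CS[OF s, of x] M M' by (intro add_mono mult_mono) auto
    finally show ?thesis .
  qed
  have Dout: "?D s x = 0" if "norm x > R" for s x
    using that \<theta>(3) partial_outside[OF \<theta>(3), of b] by simp
  let ?w = "\<lambda>x. L * (indicator (cball 0 R) x * norm (?q (1 / 2) x)) + L * (2 * h0) * (indicator (cball 0 R) x * bound V x)"
  have qc: "continuous_on UNIV (?q s)" if "0 < s" "s < 1" for s
    by (intro differentiable_imp_continuous_UNIV pullback_differentiable phi_differentiable pt_in_domain that)
  have "(\<lambda>n. \<integral>x. ?D (up n) x * ?q (up n) x \<partial>lborel) \<longlonglongrightarrow> (\<integral>x. ?D 1 x * complex_of_real (q x) \<partial>lborel)"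
  proof (rule integral_dominated_convergence[where w = ?w])
    have [measurable]: "\<theta> \<in> borel_measurable borel" "partial b \<theta> \<in> borel_measurable borel" "e b \<in> borel_measurable borel"
        "(\<lambda>x. complex_of_real (q x)) \<in> borel_measurable borel"
      using \<theta>_measurable borel_measurable_continuous_onI[OF \<theta>(2)[OF b]] e_measurable[OF b] q_measurable by auto
    have [measurable]: "?D s \<in> borel_measurable borel" for s by measurable
    show "(\<lambda>x. ?D 1 x * complex_of_real (q x)) \<in> borel_measurable lborel" by measurable
    have "?q (up n) \<in> borel_measurable borel" for n using qc[OF levels(1,2)] by (rule borel_measurable_continuous_onI)
    then show "(\<lambda>x. ?D (up n) x * ?q (up n) x) \<in> borel_measurable lborel" for n by measurable
    have "integrable lborel (\<lambda>x. indicator (cball 0 R) x *\<^sub>R norm (?q (1 / 2) x))"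
      by (intro borel_integrable_compact continuous_on_norm continuous_on_subset[OF qc]) auto
    then show "integrable lborel ?w"
      by (intro Bochner_Integration.integrable_add integrable_mult_right bound_locally_integrable vertical_Basis) auto
    show "AE x in lborel. norm (?D (up n) x * ?q (up n) x) \<le> ?w x" for n
      using AE_majorant_finite
    proof eventually_elim
      case (elim x)
      show ?case
      proof (cases "norm x \<le> R")
        case False
        then have "?D (up n) x = 0" by (intro Dout) simp
        then show ?thesis using False by simp
      next
        case True
        have "norm (?q (up n) x) \<le> norm (?q (1 / 2) x) + 2 * h0 * bound V x"
          unfolding norm_of_real using phi_bound[OF levels(1,2)[of n] bspec[OF elim vertical_Basis]] by simp
        then have "norm (?D (up n) x) * norm (?q (up n) x) \<le> L * (norm (?q (1 / 2) x) + 2 * h0 * bound V x)"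
          using levels[of n] L0 Dle[OF _ _ True, of "up n"] by (intro mult_mono) auto
        moreover have "?w x = L * (norm (?q (1 / 2) x) + 2 * h0 * bound V x)"
          using True by (simp add: distrib_left)
        ultimately show ?thesis by (simp only: norm_mult)
      qed
    qed
    show "AE x in lborel. (\<lambda>n. ?D (up n) x * ?q (up n) x) \<longlonglongrightarrow> ?D 1 x * complex_of_real (q x)"
      using trace
    proof eventually_elim
      case (elim x)
      have "(\<lambda>n. ?q (up n) x) \<longlonglongrightarrow> complex_of_real (q x)"
        using filterlim_compose[OF elim up_level] by (intro tendsto_of_real) (simp add: pt_def)
      moreover have "(\<lambda>n. ?D (up n) x) \<longlonglongrightarrow> \<theta> x * (- ik b * S 1 x + complex_of_real 1 * e b x * C 1 x) + partial b \<theta> x * S 1 x"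
        by (intro tendsto_intros CS_tendsto up_tendsto)
      ultimately show ?case by (intro tendsto_mult)
    qed
  qed
  then have "(\<lambda>n. - (\<integral>x. ?D (up n) x * ?q (up n) x \<partial>lborel)) \<longlonglongrightarrow> - (\<integral>x. ?D 1 x * complex_of_real (q x) \<partial>lborel)"
    by (rule tendsto_minus)
  moreover have "(\<integral>x. complex_of_real (gq x \<bullet> b) * (\<theta> x * S 1 x) \<partial>lborel) = - (\<integral>x. complex_of_real (q x) * partial b (\<lambda>x. \<theta> x * S 1 x) x \<partial>lborel)"
  proof (rule weak_partial_C1[OF _ q_measurable _ _ _ partial_\<theta>S(1) cont_partial_\<theta>S[OF b] sup])
    show "\<forall>f. schwartz f \<longrightarrow> integrable lborel (\<lambda>x. complex_of_real (q x) * f x)" using q_integrable by blast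
    show "\<forall>f. schwartz f \<longrightarrow> integrable lborel (\<lambda>x. complex_of_real (gq x \<bullet> b) * f x)"
      using q_weak[OF b] by (auto simp: has_bochner_integral_iff)
    show "(\<lambda>x. complex_of_real (gq x \<bullet> b)) \<in> borel_measurable borel" using gq_integrable[OF b] by auto
    show "(\<integral>x. complex_of_real (gq x \<bullet> b) * f x \<partial>lborel) = - (\<integral>x. complex_of_real (q x) * partial b f x \<partial>lborel)" if "schwartz f" for f
      using q_weak[OF b that] by (auto simp: has_bochner_integral_iff)
  qed
  ultimately show ?thesis unfolding parts partial_\<theta>S(2) by (simp add: mult.commute)
qed

text \<open>A trace at the bottom is known for the vertical derivative only. In \<open>flux\<close>
  every horizontal derivative is accompanied by \<open>s\<close> or by \<open>S\<close>, both of
  which vanish at the bottom, while these derivatives stay bounded along almost every line.\<close>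

lemma bottom_limit: "(\<lambda>n. \<integral>x. \<theta> x * flux (down n) x \<partial>lborel) \<longlonglongrightarrow> 0"
proof -
  obtain M where M: "M \<ge> 0" "\<And>x. norm (\<theta> x) \<le> M" using compact_support_bounded[OF \<theta>_cont \<theta>(3)] by metis
  obtain B where B: "B \<ge> 0" "\<And>b x. b \<in> Basis \<Longrightarrow> norm x \<le> R \<Longrightarrow> norm (e b x) \<le> B" using slope_bound by metis
  let ?\<Sigma> = "\<lambda>x. \<Sum>c\<in>Basis. bound c x"
  define L where "L = K * (1 + B) + (\<Sum>b\<in>(Basis::'a set). norm (ik b) * (K / norm k) * (1 + B))"
  have le\<Sigma>: "bound c x \<le> ?\<Sigma> x" if "c \<in> Basis" for c x
    using that by (intro member_le_sum) auto
  have fl: "norm (flux s x) \<le> L * ?\<Sigma> x"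
    if s: "0 < s" "s < 1" and x: "norm x \<le> R" and fin: "\<forall>c\<in>Basis. majorant c x < \<infinity>" for s x
  proof -
    have g: "norm (G c s x) \<le> bound c x" if "c \<in> Basis" for c using fin that s by (intro norm_G) auto
    have sB: "norm (complex_of_real s * e b x) \<le> B" if "b \<in> Basis" for b
      using mult_mono[of s 1 "norm (e b x)" B] B(1) B(2)[OF that x] s by (simp add: norm_mult)
    have 1: "norm (G V s x - complex_of_real s * (\<Sum>b\<in>Basis. e b x * G (b, 0) s x)) \<le> (1 + B) * ?\<Sigma> x"
    proof -
      have "norm (\<Sum>b\<in>Basis. complex_of_real s * e b x * G (b, 0) s x) \<le> (\<Sum>b\<in>Basis. B * bound (b, 0) x)"
        by (rule sum_norm_le) (use B(1) in \<open>auto simp: norm_mult[of "_ * _" "G _ _ _"] intro!: mult_mono sB g horizontal_Basis\<close>)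
      then have "norm (G V s x - complex_of_real s * (\<Sum>b\<in>Basis. e b x * G (b, 0) s x)) \<le> bound V x + B * (\<Sum>b\<in>Basis. bound (b, 0) x)"
        using g[OF vertical_Basis] norm_triangle_ineq4[of "G V s x" "complex_of_real s * (\<Sum>b\<in>Basis. e b x * G (b, 0) s x)"]
        by (simp add: sum_distrib_left mult.assoc)
      also have "\<dots> \<le> (1 + B) * ?\<Sigma> x"
        unfolding sum_Basis_prod using B(1) by (simp add: algebra_simps sum_nonneg)
      finally show ?thesis .
    qed
    have 2: "norm (G (b, 0) s x + complex_of_real s * e b x * G V s x) \<le> (1 + B) * ?\<Sigma> x" if b: "b \<in> Basis" for b
    proof -
      have "norm (G (b, 0) s x + complex_of_real s * e b x * G V s x) \<le> norm (G (b, 0) s x) + norm (complex_of_real s * e b x) * norm (G V s x)"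
        unfolding norm_mult[of "_ * _", symmetric] by (rule norm_triangle_ineq)
      also have "\<dots> \<le> ?\<Sigma> x + B * ?\<Sigma> x"
        using g[OF horizontal_Basis[OF b]] g[OF vertical_Basis] le\<Sigma>[OF horizontal_Basis[OF b], of x] le\<Sigma>[OF vertical_Basis, of x] B(1)
        by (intro add_mono mult_mono sB b) auto
      finally show ?thesis by (simp add: algebra_simps)
    qed
    have "norm (flux s x) \<le> norm (C s x) * norm (G V s x - complex_of_real s * (\<Sum>b\<in>Basis. e b x * G (b, 0) s x)) +
        (\<Sum>b\<in>Basis. norm (ik b) * norm (S s x) * norm (G (b, 0) s x + complex_of_real s * e b x * G V s x))"
      unfolding flux_def norm_mult[symmetric] by (intro norm_triangle_mono order_refl norm_sum)
    also have "\<dots> \<le> K * ((1 + B) * ?\<Sigma> x) + (\<Sum>b\<in>(Basis::'a set). norm (ik b) * (K / norm k) * ((1 + B) * ?\<Sigma> x))"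
      using norm_CS[of s x] s B(1) by (intro add_mono sum_mono mult_mono 1 2) (auto simp: sum_nonneg)
    also have "\<dots> = L * ?\<Sigma> x"
    proof -
      have "K * ((1 + B) * T) + (\<Sum>b\<in>(Basis::'a set). c b * ((1 + B) * T)) = (K * (1 + B) + (\<Sum>b\<in>Basis. c b * (1 + B))) * T" for T and c :: "'a \<Rightarrow> real"
        by (simp add: distrib_right sum_distrib_right mult.assoc)
      then show ?thesis unfolding L_def .
    qed
    finally show ?thesis .
  qed
  have "(\<lambda>n. \<integral>x. \<theta> x * flux (down n) x \<partial>lborel) \<longlonglongrightarrow> (\<integral>x. 0 \<partial>(lborel :: 'a measure))"
  proof (rule integral_dominated_convergence[where w = "\<lambda>x. indicator (cball 0 R) x * (M * L * ?\<Sigma> x)"])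
    have "(\<lambda>x. \<theta> x * flux (down n) x) \<in> borel_measurable borel" for n
      by (intro borel_measurable_continuous_onI continuous_intros \<theta>_cont continuous_on_section[OF cont_flux] levels)
    then show "(\<lambda>x. \<theta> x * flux (down n) x) \<in> borel_measurable lborel" for n by simp
    show "integrable lborel (\<lambda>x. indicator (cball 0 R) x * (M * L * ?\<Sigma> x))" by (rule integrable_local) auto
    show "AE x in lborel. norm (\<theta> x * flux (down n) x) \<le> indicator (cball 0 R) x * (M * L * ?\<Sigma> x)" for n
      using AE_majorant_finite
    proof eventually_elim
      case (elim x)
      show ?case
      proof (cases "norm x \<le> R")
        case True
        have "norm (\<theta> x) * norm (flux (down n) x) \<le> M * (L * ?\<Sigma> x)"
          using M fl[OF levels(3,4) True elim, of n] by (intro mult_mono) auto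
        then show ?thesis using True by (simp add: norm_mult)
      qed (use \<theta>(3) in simp)
    qed
    show "AE x in lborel. (\<lambda>n. \<theta> x * flux (down n) x) \<longlonglongrightarrow> 0"
      using AE_majorant_finite bottom
    proof eventually_elim
      case (elim x)
      have gV: "(\<lambda>n. G V (down n) x) \<longlonglongrightarrow> 0"
        using tendsto_of_real[OF filterlim_compose[OF elim(2) down_level], where 'a = complex] by (simp add: G_def pt_def)
      have d0: "(\<lambda>n. complex_of_real (down n)) \<longlonglongrightarrow> 0"
        using tendsto_of_real[OF down_tendsto, where 'a = complex] by simp
      have g: "norm (G c (down n) x) \<le> bound c x" if "c \<in> Basis" for c n using elim that levels by (intro norm_G) auto
      have gH: "(\<lambda>n. complex_of_real (down n) * G (b, 0) (down n) x) \<longlonglongrightarrow> 0" if "b \<in> Basis" for b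
        by (rule tendsto_zero_mult_bounded[OF d0 g[OF horizontal_Basis[OF that]]])
      have S0: "(\<lambda>n. S (down n) x) \<longlonglongrightarrow> 0"
        using CS_tendsto(2)[OF down_tendsto, of x] by (simp add: S_def)
      have SH: "(\<lambda>n. S (down n) x * G (b, 0) (down n) x) \<longlonglongrightarrow> 0" if "b \<in> Basis" for b
        by (rule tendsto_zero_mult_bounded[OF S0 g[OF horizontal_Basis[OF that]]])
      have eq: "flux s x = C s x * (G V s x - (\<Sum>b\<in>Basis. e b x * (complex_of_real s * G (b, 0) s x))) +
          (\<Sum>b\<in>Basis. ik b * (S s x * G (b, 0) s x + S s x * (complex_of_real s * e b x * G V s x)))" for s
        unfolding flux_def by (simp add: sum_distrib_left algebra_simps)
      have "(\<lambda>n. flux (down n) x) \<longlonglongrightarrow> C 0 x * (0 - (\<Sum>b\<in>(Basis::'a set). e b x * 0)) + (\<Sum>b\<in>(Basis::'a set). ik b * (0 + 0 * (0 * e b x * 0)))"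
        unfolding eq by (intro tendsto_intros CS_tendsto down_tendsto gV gH S0 SH d0)
      then have "(\<lambda>n. flux (down n) x) \<longlonglongrightarrow> 0" by simp
      then show ?case by (rule tendsto_mult_right_zero)
    qed
  qed simp
  then show ?thesis by simp
qed

end
end

section \<open>Green's identity up to the boundary, with a horizontal cutoff\<close>

context fluid_energy
begin

text \<open>A quantity free of the wave vector which, for a fixed cutoff radius, makes the exchange
  of integrals over position and wave vector legitimate. It is allowed to grow with
  \<open>R\<close>.\<close>

definition local_energy :: "real \<Rightarrow> ennreal" where
  "local_energy R = (\<Sum>b\<in>Basis. \<integral>\<^sup>+x. indicator (cball 0 R) x * (majorant (b, 0) x + majorant (0, 1) x) \<partial>lborel)"

lemma local_energy_finite: "local_energy R < \<infinity>"
proof -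
  have "(\<integral>\<^sup>+x. indicator (cball 0 R) x * (majorant (b, 0) x + majorant (0, 1) x) \<partial>lborel) < \<infinity>" if b: "b \<in> Basis" for b
  proof -
    have [measurable]: "majorant (b, 0) \<in> borel_measurable borel" "majorant (0, 1) \<in> borel_measurable borel" "cball (0::'a) R \<in> sets borel"
      using majorant_measurable[OF horizontal_Basis[OF b]] majorant_measurable[OF vertical_Basis] by simp_all
    have "(\<integral>\<^sup>+x. indicator (cball 0 R) x * (majorant (b, 0) x + majorant (0, 1) x) \<partial>lborel) =
        (\<integral>\<^sup>+x. indicator (cball 0 R) x * majorant (b, 0) x \<partial>lborel) + (\<integral>\<^sup>+x. indicator (cball 0 R) x * majorant (0, 1) x \<partial>lborel)"
      by (subst nn_integral_add[symmetric]) (auto simp: distrib_left)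
    also have "\<dots> < \<infinity>"
      using majorant_locally_integrable[OF horizontal_Basis[OF b], of R] majorant_locally_integrable[OF vertical_Basis, of R] by simp
    finally show ?thesis .
  qed
  then show ?thesis unfolding local_energy_def by (simp add: ennreal_sum_less_top)
qed

end

context water_wave_mode
begin

lemma norm_X:
  assumes s: "0 < s" "s < 1" and b: "b \<in> Basis"
  shows "norm (X b s x) \<le> 2 * h0 * K * (norm (partial (b, 0) \<phi> (pt s x)) + norm (partial V \<phi> (pt s x)))"
proof -
  \<comment> \<open>The factor \<open>1 / norm k\<close> in \<open>S\<close> is compensated by
    \<open>ik b\<close>, so the estimate depends on \<open>k\<close> only through \<open>K\<close>
    and does not degenerate at small wave vectors.\<close>
  have ikS: "norm (ik b) * norm (S s x) \<le> K"
    using mult_mono[OF norm_ik[OF b] norm_CS(2)[of s x]] s k by simp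
  have "norm (X b s x) = rho x * norm (C s x * G (b, 0) s x - ik b * S s x * G V s x)"
    unfolding X_def r_def using rho_bounds[of x] by (simp add: norm_mult)
  also have "\<dots> \<le> (2 * h0) * (K * norm (G (b, 0) s x) + K * norm (G V s x))"
  proof (intro mult_mono)
    have "norm (C s x * G (b, 0) s x - ik b * S s x * G V s x) \<le> norm (C s x) * norm (G (b, 0) s x) + norm (ik b) * norm (S s x) * norm (G V s x)"
      unfolding norm_mult[symmetric] by (rule norm_triangle_ineq4)
    also have "\<dots> \<le> K * norm (G (b, 0) s x) + K * norm (G V s x)"
      using norm_CS(1)[of s x] s ikS by (intro add_mono mult_right_mono) auto
    finally show "norm (C s x * G (b, 0) s x - ik b * S s x * G V s x) \<le> K * norm (G (b, 0) s x) + K * norm (G V s x)" .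
  qed (use rho_bounds[of x] h0 in auto)
  finally show ?thesis unfolding G_def norm_of_real by (simp add: algebra_simps)
qed

context
  fixes \<theta> :: "'a \<Rightarrow> complex" and R M :: real
  assumes \<theta>: "\<And>x. \<theta> differentiable (at x)" "\<And>b. b \<in> Basis \<Longrightarrow> continuous_on UNIV (partial b \<theta>)"
      "\<forall>x. norm x > R \<longrightarrow> \<theta> x = 0"
    and M: "\<And>b x. b \<in> Basis \<Longrightarrow> norm (partial b \<theta> x) \<le> M"
begin

definition H where "H = (\<lambda>(s, x). indicator {0<..<1} s *\<^sub>R (\<Sum>b\<in>Basis. partial b \<theta> x * X b s x))"

lemma H_measurable: "H \<in> borel_measurable (borel \<Otimes>\<^sub>M borel)"
proof -
  have "continuous_on ({0<..<1} \<times> UNIV) (\<lambda>z. \<Sum>b\<in>Basis. partial b \<theta> (snd z) * X b (fst z) (snd z))"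
    by (intro continuous_on_sum continuous_on_mult continuous_on_compose2[OF \<theta>(2)] cont_X[unfolded split_beta] continuous_on_snd continuous_on_id) auto
  then show ?thesis unfolding H_def by (intro measurable_slab) (simp add: split_beta)
qed

lemma nn_integral_H_le:
  "(\<integral>\<^sup>+z. ennreal (norm (H z)) \<partial>(lborel \<Otimes>\<^sub>M lborel)) \<le> ennreal (M * (2 * h0 * K)) * local_energy R"
proof -
  have M0: "M \<ge> 0" using order_trans[OF norm_ge_zero M[OF SOME_Basis]] .
  let ?g = "\<lambda>c s x. indicator {0<..<1::real} s * ennreal (norm (partial c \<phi> (pt s x)))"
  have [measurable]: "(\<lambda>s. ?g c s x) \<in> borel_measurable borel" if "c \<in> Basis" for c x
    using measurable_compose[OF measurable_Pair2' measurable_slab_norm(1)[OF cont_partial[OF that]], of x]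
    by (simp add: split_beta)
  note gm = this
  have Hm: "(\<lambda>z. ennreal (norm (H z))) \<in> borel_measurable (lborel \<Otimes>\<^sub>M lborel)"
    using H_measurable by (simp add: measurable_cong_sets[OF sets_pair_measure_cong[OF sets_lborel sets_lborel] refl])
  have "(\<integral>\<^sup>+z. ennreal (norm (H z)) \<partial>(lborel \<Otimes>\<^sub>M lborel)) = (\<integral>\<^sup>+x. \<integral>\<^sup>+s. ennreal (norm (H (s, x))) \<partial>lborel \<partial>lborel)"
    by (rule lborel_pair.nn_integral_snd[symmetric, OF Hm])
  also have "\<dots> \<le> (\<integral>\<^sup>+x. ennreal (M * (2 * h0 * K)) * (\<Sum>b\<in>Basis. indicator (cball 0 R) x * (majorant (b, 0) x + majorant V x)) \<partial>lborel)"
  proof (rule nn_integral_mono)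
    fix x
    show "(\<integral>\<^sup>+s. ennreal (norm (H (s, x))) \<partial>lborel) \<le> ennreal (M * (2 * h0 * K)) * (\<Sum>b\<in>Basis. indicator (cball 0 R) x * (majorant (b, 0) x + majorant V x))"
    proof (cases "norm x \<le> R")
      case False
      then have "H (s, x) = 0" for s using partial_outside[OF \<theta>(3)] by (simp add: H_def)
      then show ?thesis by simp
    next
      case True
      have "(\<integral>\<^sup>+s. ennreal (norm (H (s, x))) \<partial>lborel) \<le> (\<integral>\<^sup>+s. ennreal (M * (2 * h0 * K)) * (\<Sum>b\<in>Basis. ?g (b, 0) s x + ?g V s x) \<partial>lborel)"
      proof (rule nn_integral_mono)
        fix s :: real
        show "ennreal (norm (H (s, x))) \<le> ennreal (M * (2 * h0 * K)) * (\<Sum>b\<in>Basis. ?g (b, 0) s x + ?g V s x)"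
        proof (cases "0 < s \<and> s < 1")
          case True
          have "norm (H (s, x)) \<le> (\<Sum>b\<in>Basis. M * (2 * h0 * K * (norm (partial (b, 0) \<phi> (pt s x)) + norm (partial V \<phi> (pt s x)))))"
            unfolding H_def using True M0
            by (auto simp: norm_mult intro!: sum_norm_le mult_mono M norm_X[simplified])
          also have "\<dots> = (M * (2 * h0 * K)) * (\<Sum>b\<in>Basis. norm (partial (b, 0) \<phi> (pt s x)) + norm (partial V \<phi> (pt s x)))"
            by (simp add: sum_distrib_left mult.assoc)
          finally have "ennreal (norm (H (s, x))) \<le> ennreal ((M * (2 * h0 * K)) * (\<Sum>b\<in>Basis. norm (partial (b, 0) \<phi> (pt s x)) + norm (partial V \<phi> (pt s x))))"
            by (rule ennreal_leI)
          also have "\<dots> = ennreal (M * (2 * h0 * K)) * (\<Sum>b\<in>(Basis::'a set). ennreal (norm (partial (b, 0) \<phi> (pt s x))) + ennreal (norm (partial V \<phi> (pt s x))))"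
            using M0 h0 by (subst ennreal_mult) (auto simp: sum_ennreal[symmetric] sum_nonneg simp del: sum_ennreal)
          finally show ?thesis using True by simp
        qed (auto simp: H_def)
      qed
      also have "\<dots> = ennreal (M * (2 * h0 * K)) * (\<Sum>b\<in>Basis. (\<integral>\<^sup>+s. ?g (b, 0) s x \<partial>lborel) + (\<integral>\<^sup>+s. ?g V s x \<partial>lborel))"
        using gm[OF horizontal_Basis] gm[OF vertical_Basis]
        by (subst nn_integral_cmult) (auto simp: nn_integral_sum nn_integral_add)
      also have "\<dots> \<le> ennreal (M * (2 * h0 * K)) * (\<Sum>b\<in>Basis. indicator (cball 0 R) x * (majorant (b, 0) x + majorant V x))"
        using True by (intro mult_left_mono sum_mono) (auto simp: majorant_def intro!: add_mono)
      finally show ?thesis .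
    qed
  qed
  also have "\<dots> = ennreal (M * (2 * h0 * K)) * local_energy R"
  proof -
    have m: "majorant (b, 0) \<in> borel_measurable borel" if "b \<in> Basis" for b by (rule majorant_measurable[OF horizontal_Basis[OF that]])
    have mV [measurable]: "majorant V \<in> borel_measurable borel" by (rule majorant_measurable[OF vertical_Basis])
    have [measurable]: "cball (0::'a) R \<in> sets borel" by simp
    have s: "(\<lambda>x. indicator (cball 0 R) x * (majorant (b, 0) x + majorant V x)) \<in> borel_measurable lborel" if "b \<in> Basis" for b
      using m[OF that] by measurable
    have "(\<lambda>x. \<Sum>b\<in>Basis. indicator (cball 0 R) x * (majorant (b, 0) x + majorant V x)) \<in> borel_measurable lborel"
      by (intro borel_measurable_sum s)
    then show ?thesis
      unfolding local_energy_def by (subst nn_integral_cmult) (simp_all only: nn_integral_sum[OF s])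
  qed
  finally show ?thesis .
qed

lemma H_integrable: "integrable (lborel \<Otimes>\<^sub>M lborel) H"
proof (rule integrableI_bounded)
  show "H \<in> borel_measurable (lborel \<Otimes>\<^sub>M lborel)"
    using H_measurable by (simp add: measurable_cong_sets[OF sets_pair_measure_cong[OF sets_lborel sets_lborel] refl])
  show "(\<integral>\<^sup>+z. ennreal (norm (H z)) \<partial>(lborel \<Otimes>\<^sub>M lborel)) < \<infinity>"
    using le_less_trans[OF nn_integral_H_le] local_energy_finite[of R] by (simp add: ennreal_mult_less_top)
qed

text \<open>Both sides are limits of the flux balance between \<open>down n\<close> and
  \<open>up n\<close>: the boundary terms by the surface and bottom limits, the volume term by
  dominated convergence as the levels exhaust the open slab.\<close>

lemma cutoff_identity:
  "(\<integral>x. \<theta> x * (C 1 x * complex_of_real (\<eta>t x)) \<partial>lborel) + (\<Sum>b\<in>Basis. ik b * (\<integral>x. complex_of_real (gq x \<bullet> b) * (\<theta> x * S 1 x) \<partial>lborel)) =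
    (\<integral>z. H z \<partial>(lborel \<Otimes>\<^sub>M lborel))"
proof (rule LIMSEQ_unique)
  let ?n = "\<lambda>n x. \<theta> x * (C (up n) x * (G V (up n) x - complex_of_real (up n) * (\<Sum>b\<in>Basis. e b x * G (b, 0) (up n) x)))"
  let ?t = "\<lambda>n b x. (\<theta> x * S (up n) x) * (G (b, 0) (up n) x + complex_of_real (up n) * e b x * G V (up n) x)"
  note \<theta>c = differentiable_imp_continuous_UNIV[OF \<theta>(1)]
  have ci: "integrable lborel u" if "continuous_on UNIV u" "\<forall>x. norm x > R \<longrightarrow> u x = 0" for u :: "'a \<Rightarrow> complex"
    by (rule compact_support_integrable[OF that])
  have ec: "continuous_on UNIV (e b)" if "b \<in> Basis" for b
    unfolding e_def[abs_def] by (intro continuous_on_of_real eta_partial_continuous that)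
  have i1: "integrable lborel (?n n)" for n
    by (rule ci) (use \<theta>(3) in \<open>auto intro!: continuous_intros \<theta>c ec differentiable_imp_continuous_UNIV[OF C_differentiable]
        continuous_on_section[OF cont_G[OF horizontal_Basis]] continuous_on_section[OF cont_G[OF vertical_Basis]] levels\<close>)
  have i2: "integrable lborel (?t n b)" if "b \<in> Basis" for n b
    by (rule ci) (use \<theta>(3) that in \<open>auto intro!: continuous_intros \<theta>c ec differentiable_imp_continuous_UNIV[OF S_differentiable]
        continuous_on_section[OF cont_G[OF horizontal_Basis]] continuous_on_section[OF cont_G[OF vertical_Basis]] levels\<close>)
  have split: "(\<integral>x. \<theta> x * flux (up n) x \<partial>lborel) = (\<integral>x. ?n n x \<partial>lborel) + (\<Sum>b\<in>Basis. ik b * (\<integral>x. ?t n b x \<partial>lborel))" for n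
  proof -
    have "(\<integral>x. \<theta> x * flux (up n) x \<partial>lborel) = (\<integral>x. ?n n x + (\<Sum>b\<in>Basis. ik b * ?t n b x) \<partial>lborel)"
      unfolding flux_def by (intro Bochner_Integration.integral_cong refl) (simp add: distrib_left sum_distrib_left mult_ac)
    also have "\<dots> = (\<integral>x. ?n n x \<partial>lborel) + (\<integral>x. (\<Sum>b\<in>Basis. ik b * ?t n b x) \<partial>lborel)"
      by (intro Bochner_Integration.integral_add i1 Bochner_Integration.integrable_sum integrable_mult_right i2)
    also have "(\<integral>x. (\<Sum>b\<in>Basis. ik b * ?t n b x) \<partial>lborel) = (\<Sum>b\<in>Basis. \<integral>x. ik b * ?t n b x \<partial>lborel)"
      by (intro Bochner_Integration.integral_sum integrable_mult_right i2)
    also have "\<dots> = (\<Sum>b\<in>Basis. ik b * (\<integral>x. ?t n b x \<partial>lborel))"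
      by (simp only: integral_mult_right_zero)
    finally show ?thesis .
  qed
  have "(\<lambda>n. (\<integral>x. ?n n x \<partial>lborel) + (\<Sum>b\<in>Basis. ik b * (\<integral>x. ?t n b x \<partial>lborel)) - (\<integral>x. \<theta> x * flux (down n) x \<partial>lborel)) \<longlonglongrightarrow>
     (\<integral>x. \<theta> x * (C 1 x * complex_of_real (\<eta>t x)) \<partial>lborel) + (\<Sum>b\<in>Basis. ik b * (\<integral>x. complex_of_real (gq x \<bullet> b) * (\<theta> x * S 1 x) \<partial>lborel)) - 0"
    by (intro tendsto_diff tendsto_add tendsto_sum tendsto_mult tendsto_const surface_normal_limit[OF \<theta>]
        surface_tangential_limit[OF \<theta>] bottom_limit[OF \<theta>])
  then show "(\<lambda>n. (\<integral>x. \<theta> x * flux (up n) x \<partial>lborel) - (\<integral>x. \<theta> x * flux (down n) x \<partial>lborel)) \<longlonglongrightarrow>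
     (\<integral>x. \<theta> x * (C 1 x * complex_of_real (\<eta>t x)) \<partial>lborel) + (\<Sum>b\<in>Basis. ik b * (\<integral>x. complex_of_real (gq x \<bullet> b) * (\<theta> x * S 1 x) \<partial>lborel))"
    unfolding split by simp
  let ?T = "\<lambda>n z. indicator {down n..up n} (fst z) *\<^sub>R H z"
  have Tm: "?T n \<in> borel_measurable (lborel \<Otimes>\<^sub>M lborel)" for n
  proof -
    have [measurable]: "H \<in> borel_measurable (lborel \<Otimes>\<^sub>M lborel)" using H_integrable by auto
    show ?thesis by measurable
  qed
  have Ti: "integrable (lborel \<Otimes>\<^sub>M lborel) (?T n)" for n
    by (rule Bochner_Integration.integrable_bound[OF H_integrable Tm]) (auto split: split_indicator)
  have "(\<lambda>n. \<integral>z. ?T n z \<partial>(lborel \<Otimes>\<^sub>M lborel)) \<longlonglongrightarrow> (\<integral>z. H z \<partial>(lborel \<Otimes>\<^sub>M lborel))"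
  proof (rule integral_dominated_convergence[where w = "\<lambda>z. norm (H z)"])
    show "H \<in> borel_measurable (lborel \<Otimes>\<^sub>M lborel)" using H_integrable by auto
    show "AE z in lborel \<Otimes>\<^sub>M lborel. (\<lambda>n. ?T n z) \<longlonglongrightarrow> H z"
    proof (rule AE_I2)
      fix z :: "real \<times> 'a"
      show "(\<lambda>n. ?T n z) \<longlonglongrightarrow> H z"
      proof (cases "0 < fst z \<and> fst z < 1")
        case True
        have "\<forall>\<^sub>F n in sequentially. fst z < up n" "\<forall>\<^sub>F n in sequentially. down n < fst z"
          using True order_tendstoD(1)[OF up_tendsto, of "fst z"] order_tendstoD(2)[OF down_tendsto, of "fst z"] by auto
        then have "\<forall>\<^sub>F n in sequentially. ?T n z = H z" by eventually_elim simp
        then show ?thesis by (rule tendsto_eventually)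
      next
        case False
        then have "H z = 0" by (cases z) (auto simp: H_def)
        then show ?thesis by simp
      qed
    qed
    show "AE z in lborel \<Otimes>\<^sub>M lborel. norm (?T n z) \<le> norm (H z)" for n
      by (rule AE_I2) (auto split: split_indicator)
  qed (use Tm integrable_norm[OF H_integrable] in auto)
  moreover have "(\<integral>z. ?T n z \<partial>(lborel \<Otimes>\<^sub>M lborel)) = (\<integral>x. \<theta> x * flux (up n) x \<partial>lborel) - (\<integral>x. \<theta> x * flux (down n) x \<partial>lborel)" for n
  proof -
    have "(\<integral>z. ?T n z \<partial>(lborel \<Otimes>\<^sub>M lborel)) = (\<integral>s. \<integral>x. ?T n (s, x) \<partial>lborel \<partial>lborel)"
      by (rule lborel_pair.integral_fst'[OF Ti, symmetric])
    also have "\<dots> = (\<integral>s. indicator {down n..up n} s *\<^sub>R (\<integral>x. (\<Sum>b\<in>Basis. partial b \<theta> x * X b s x) \<partial>lborel) \<partial>lborel)"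
      using levels[of n] by (intro Bochner_Integration.integral_cong refl) (auto simp: H_def split: split_indicator)
    also have "\<dots> = (\<integral>x. \<theta> x * flux (up n) x \<partial>lborel) - (\<integral>x. \<theta> x * flux (down n) x \<partial>lborel)"
      by (rule flux_balance[OF \<theta> levels(3) levels(5) levels(2), symmetric])
    finally show ?thesis .
  qed
  ultimately show "(\<lambda>n. (\<integral>x. \<theta> x * flux (up n) x \<partial>lborel) - (\<integral>x. \<theta> x * flux (down n) x \<partial>lborel)) \<longlonglongrightarrow> (\<integral>z. H z \<partial>(lborel \<Otimes>\<^sub>M lborel))"
    by simp
qed

end
end


section \<open>Averaging over wave vectors\<close>

text \<open>The square of the positive part has no kink; in each case of signs the first-order error
  is at most \<open>h^2\<close>. This provides an explicit \<open>C^1\<close> cutoff.\<close>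

lemma DERIV_max_square: "((\<lambda>u. (max 0 u)\<^sup>2) has_real_derivative 2 * max 0 u) (at (u::real))"
proof -
  have le: "\<bar>(max 0 (u + h))\<^sup>2 - (max 0 u)\<^sup>2 - 2 * max 0 u * h\<bar> \<le> h\<^sup>2" for h
  proof -
    consider "0 \<le> u" "0 \<le> u + h" | "0 \<le> u" "u + h < 0" | "u < 0" "0 \<le> u + h" | "u < 0" "u + h < 0" by linarith
    then show ?thesis
    proof cases
      case 1 then show ?thesis by (simp add: max_def power2_eq_square algebra_simps)
    next
      case 2
      have "u * (u + 2 * h) = (u + h)\<^sup>2 - h\<^sup>2" by (simp add: power2_eq_square algebra_simps)
      then have "- h\<^sup>2 \<le> u * (u + 2 * h)" by simp
      moreover have "u * (u + 2 * h) \<le> 0" using 2 by (intro mult_nonneg_nonpos) auto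
      ultimately have "\<bar>u * (u + 2 * h)\<bar> \<le> h\<^sup>2" by (simp add: abs_of_nonpos)
      moreover have "(max 0 (u + h))\<^sup>2 - (max 0 u)\<^sup>2 - 2 * max 0 u * h = - (u * (u + 2 * h))"
        using 2 by (simp add: max_def power2_eq_square algebra_simps)
      ultimately show ?thesis by simp
    next
      case 3
      then have "(u + h)\<^sup>2 \<le> h\<^sup>2" by (intro power_mono) auto
      then show ?thesis using 3 by (simp add: max_def)
    next
      case 4 then show ?thesis by (simp add: max_def)
    qed
  qed
  have "(\<lambda>h. ((max 0 (u + h))\<^sup>2 - (max 0 u)\<^sup>2) / h - 2 * max 0 u) \<midarrow>0\<rightarrow> 0"
  proof (rule Lim_null_comparison)
    show "\<forall>\<^sub>F h in at 0. norm (((max 0 (u + h))\<^sup>2 - (max 0 u)\<^sup>2) / h - 2 * max 0 u) \<le> \<bar>h\<bar>"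
      unfolding eventually_at_filter
    proof (intro always_eventually allI impI)
      fix h :: real assume h: "h \<noteq> 0"
      have "((max 0 (u + h))\<^sup>2 - (max 0 u)\<^sup>2) / h - 2 * max 0 u = ((max 0 (u + h))\<^sup>2 - (max 0 u)\<^sup>2 - 2 * max 0 u * h) / h"
        using h by (simp add: diff_divide_distrib)
      then have "norm (((max 0 (u + h))\<^sup>2 - (max 0 u)\<^sup>2) / h - 2 * max 0 u) \<le> h\<^sup>2 / \<bar>h\<bar>"
        using le[of h] by (simp add: abs_divide divide_right_mono)
      also have "\<dots> = \<bar>h\<bar>" using h by (simp add: power2_eq_square divide_eq_eq abs_mult[symmetric])
      finally show "norm (((max 0 (u + h))\<^sup>2 - (max 0 u)\<^sup>2) / h - 2 * max 0 u) \<le> \<bar>h\<bar>" .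
    qed
    show "((\<lambda>h::real. \<bar>h\<bar>) \<longlongrightarrow> 0) (at 0)" by (intro tendsto_eq_intros) auto
  qed
  then show ?thesis unfolding DERIV_def by (rule LIM_zero_cancel)
qed

text \<open>One continuous derivative is what the balance law asks of a test function. The gradient
  is of size \<open>1 / R\<close>, the factor by which the error tends to zero.\<close>

definition cutoff :: "real \<Rightarrow> 'a::euclidean_space \<Rightarrow> complex" where
  "cutoff R x = complex_of_real ((max 0 (1 - (norm x)\<^sup>2 / R\<^sup>2))\<^sup>2)"

lemma cutoff_differentiable: "cutoff R differentiable (at x)"
  and partial_cutoff: "partial b (cutoff R) x = complex_of_real (- 2 * (x \<bullet> b) / R\<^sup>2 * (2 * max 0 (1 - (norm x)\<^sup>2 / R\<^sup>2)))"
proof -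
  have d: "((\<lambda>x::'a. 1 - (norm x)\<^sup>2 / R\<^sup>2) has_derivative (\<lambda>h. - 2 * (x \<bullet> h) / R\<^sup>2)) (at x)"
    unfolding power2_norm_eq_inner divide_inverse by (auto intro!: derivative_eq_intros simp: inner_commute)
  then have "(\<lambda>x::'a. 1 - (norm x)\<^sup>2 / R\<^sup>2) differentiable (at x)" unfolding differentiable_def by blast
  from compose_real_partial[OF this DERIV_max_square] show "cutoff R differentiable (at x)"
    "partial b (cutoff R) x = complex_of_real (- 2 * (x \<bullet> b) / R\<^sup>2 * (2 * max 0 (1 - (norm x)\<^sup>2 / R\<^sup>2)))"
    unfolding cutoff_def[abs_def] partial_eq[OF d] by auto
qed

lemma cutoff_partial_continuous: "continuous_on UNIV (partial b (cutoff R))"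
  unfolding partial_cutoff[abs_def] divide_inverse by (intro continuous_intros)

lemma cutoff_properties:
  fixes x :: "'a::euclidean_space"
  assumes R: "R > 0"
  shows cutoff_outside: "\<forall>x::'a. norm x > R \<longrightarrow> cutoff R x = 0"
    and norm_cutoff_le: "norm (cutoff R x) \<le> 1"
    and norm_partial_cutoff_le: "b \<in> Basis \<Longrightarrow> norm (partial b (cutoff R) x) \<le> 4 / R"
proof -
  have z: "max 0 (1 - (norm x)\<^sup>2 / R\<^sup>2) = 0" if "norm x > R" for x :: 'a
  proof -
    have "R\<^sup>2 \<le> (norm x)\<^sup>2" using that R by (intro power_mono) auto
    then show ?thesis using R by (simp add: max_def field_simps)
  qed
  then show "\<forall>x::'a. norm x > R \<longrightarrow> cutoff R x = 0" by (simp add: cutoff_def)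
  have m: "0 \<le> max 0 (1 - (norm x)\<^sup>2 / R\<^sup>2)" "max 0 (1 - (norm x)\<^sup>2 / R\<^sup>2) \<le> 1" by auto
  then show "norm (cutoff R x) \<le> 1" unfolding cutoff_def norm_of_real by (simp add: power_le_one)
  show "norm (partial b (cutoff R) x) \<le> 4 / R" if b: "b \<in> Basis"
  proof (cases "norm x > R")
    case True
    then show ?thesis using R unfolding partial_cutoff z[OF True] by simp
  next
    case False
    have "\<bar>x \<bullet> b\<bar> \<le> R" using Basis_le_norm[OF b, of x] False by simp
    then have "\<bar>x \<bullet> b\<bar> / R\<^sup>2 \<le> R / R\<^sup>2" using R by (intro divide_right_mono) auto
    also have "R / R\<^sup>2 = 1 / R" using R by (simp add: power2_eq_square)
    finally have "(\<bar>x \<bullet> b\<bar> / R\<^sup>2) * max 0 (1 - (norm x)\<^sup>2 / R\<^sup>2) \<le> (1 / R) * 1"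
      using m R by (intro mult_mono) auto
    then show ?thesis unfolding partial_cutoff norm_of_real by (simp add: abs_mult)
  qed
qed

lemma cutoff_tendsto: "(\<lambda>n. cutoff (real n + 1) x) \<longlonglongrightarrow> 1"
proof -
  have "(\<lambda>n. (norm x)\<^sup>2 / (real n + 1)\<^sup>2) \<longlonglongrightarrow> 0" by real_asymp
  then have "(\<lambda>n. complex_of_real ((max 0 (1 - (norm x)\<^sup>2 / (real n + 1)\<^sup>2))\<^sup>2)) \<longlonglongrightarrow> complex_of_real ((max 0 (1 - 0))\<^sup>2)"
    by (intro tendsto_intros)
  then show ?thesis unfolding cutoff_def by simp
qed

section \<open>Modes with the wave vector as a variable\<close>

definition mode_cosh :: "'a::euclidean_space \<Rightarrow> real \<Rightarrow> complex" where
  "mode_cosh k y = complex_of_real (cosh (norm k * y))"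

text \<open>The factor \<open>k \<bullet> b\<close> is kept with the quotient, so that the mode is
  bounded near the origin. At \<open>k = 0\<close> division by zero yields 0, in agreement with that
  factor.\<close>

definition mode_sinh :: "'a::euclidean_space \<Rightarrow> 'a \<Rightarrow> real \<Rightarrow> complex" where
  "mode_sinh b k y = \<i> * complex_of_real (k \<bullet> b) * complex_of_real (sinh (norm k * y) / norm k)"

lemma hyperbolic_measurable [measurable]:
  "(cosh :: real \<Rightarrow> real) \<in> borel_measurable borel" "(sinh :: real \<Rightarrow> real) \<in> borel_measurable borel"
  by (intro borel_measurable_continuous_onI continuous_intros)+

lemma mode_measurable [measurable]:
  "(\<lambda>(k, y). mode_cosh k y) \<in> borel_measurable (borel \<Otimes>\<^sub>M borel)"
  "(\<lambda>(k, y). mode_sinh b k y) \<in> borel_measurable (borel \<Otimes>\<^sub>M borel)"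
  unfolding mode_cosh_def mode_sinh_def by measurable

lemma norm_mode_le:
  assumes b: "b \<in> Basis" and k: "norm k \<le> r" and y: "0 \<le> y" "y \<le> Y"
  shows "norm (mode_cosh k y) \<le> cosh (r * Y)" "norm (mode_sinh b k y) \<le> cosh (r * Y)"
proof -
  have "norm k * y \<le> r * Y" using k y order_trans[OF norm_ge_zero k] by (intro mult_mono) auto
  moreover have nn: "0 \<le> norm k * y" using y by simp
  ultimately have c: "cosh (norm k * y) \<le> cosh (r * Y)" by (subst cosh_real_nonneg_le_iff) auto
  then show "norm (mode_cosh k y) \<le> cosh (r * Y)" unfolding mode_cosh_def by simp
  show "norm (mode_sinh b k y) \<le> cosh (r * Y)"
  proof (cases "k = 0")
    case False
    have "\<bar>k \<bullet> b\<bar> * (\<bar>sinh (norm k * y)\<bar> / norm k) \<le> norm k * (\<bar>sinh (norm k * y)\<bar> / norm k)"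
      using Basis_le_norm[OF b] by (intro mult_right_mono) auto
    also have "\<dots> = \<bar>sinh (norm k * y)\<bar>" using False by simp
    also have "\<dots> \<le> cosh (norm k * y)" using sinh_le_cosh_real[of "norm k * y"] nn by simp
    finally have "\<bar>k \<bullet> b\<bar> * (\<bar>sinh (norm k * y)\<bar> / norm k) \<le> cosh (r * Y)" using c by simp
    moreover have "norm (mode_sinh b k y) = \<bar>k \<bullet> b\<bar> * (\<bar>sinh (norm k * y)\<bar> / norm k)"
      unfolding mode_sinh_def norm_mult norm_of_real by simp
    ultimately show ?thesis by simp
  qed (simp add: mode_sinh_def)
qed

definition iwave :: "'a::euclidean_space \<Rightarrow> 'a \<Rightarrow> complex" where
  "iwave k x = exp (- (\<i> * complex_of_real (k \<bullet> x)))"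

lemma norm_iwave [simp]: "norm (iwave k x) = 1"
  unfolding iwave_def by simp

lemma iwave_measurable [measurable]: "(\<lambda>(k, x). iwave k x) \<in> borel_measurable (borel \<Otimes>\<^sub>M borel)"
  unfolding iwave_def by measurable

context water_wave
begin

text \<open>The integrand of the nonlocal equation with \<open>k\<close> as an argument instead of a
  locale parameter, so that joint measurability and integration in \<open>k\<close> make
  sense.\<close>

definition amplitude where
  "amplitude k x = iwave k x * (mode_cosh k (rho x) * complex_of_real (\<eta>t x)
    + (\<Sum>b\<in>Basis. mode_sinh b k (rho x) * complex_of_real (gq x \<bullet> b)))"

lemma rho_measurable [measurable]: "rho \<in> borel_measurable borel"
  by (rule borel_measurable_continuous_onI[OF rho_continuous])

lemma amplitude_measurable: "(\<lambda>(k, x). amplitude k x) \<in> borel_measurable (borel \<Otimes>\<^sub>M borel)"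
proof -
  have [measurable]: "\<eta>t \<in> borel_measurable borel" using etat_integrable by auto
  have [measurable]: "(\<lambda>z. \<Sum>b\<in>Basis. mode_sinh b (fst z) (rho (snd z)) * complex_of_real (gq (snd z) \<bullet> b)) \<in> borel_measurable (borel \<Otimes>\<^sub>M borel)"
  proof (rule borel_measurable_sum)
    fix b :: 'a assume b: "b \<in> Basis"
    have [measurable]: "(\<lambda>x. complex_of_real (gq x \<bullet> b)) \<in> borel_measurable borel" using gq_integrable[OF b] by auto
    show "(\<lambda>z. mode_sinh b (fst z) (rho (snd z)) * complex_of_real (gq (snd z) \<bullet> b)) \<in> borel_measurable (borel \<Otimes>\<^sub>M borel)"
      by measurable
  qed
  show ?thesis unfolding amplitude_def split_beta by measurable
qed

definition data_size where
  "data_size x = norm (\<eta>t x) + (\<Sum>b\<in>Basis. norm (complex_of_real (gq x \<bullet> b)))"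

lemma data_size_integrable: "integrable lborel data_size"
  unfolding data_size_def[abs_def]
  by (intro Bochner_Integration.integrable_add Bochner_Integration.integrable_sum integrable_norm etat_integrable gq_integrable)

lemma norm_amplitude_le:
  assumes "norm k \<le> r"
  shows "norm (amplitude k x) \<le> cosh (r * (2 * h0)) * data_size x"
proof -
  note b = norm_mode_le[OF _ assms rho_bounds(4) rho_bounds(2)]
  have "norm (amplitude k x) = norm (mode_cosh k (rho x) * complex_of_real (\<eta>t x)
    + (\<Sum>b\<in>Basis. mode_sinh b k (rho x) * complex_of_real (gq x \<bullet> b)))"
    unfolding amplitude_def by (simp add: norm_mult)
  also have "\<dots> \<le> norm (mode_cosh k (rho x)) * norm (\<eta>t x) + (\<Sum>b\<in>Basis. norm (mode_sinh b k (rho x)) * norm (complex_of_real (gq x \<bullet> b)))"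
    by (intro norm_triangle_mono order_trans[OF norm_sum]) (simp_all add: norm_mult)
  also have "\<dots> \<le> cosh (r * (2 * h0)) * norm (\<eta>t x) + (\<Sum>b\<in>Basis. cosh (r * (2 * h0)) * norm (complex_of_real (gq x \<bullet> b)))"
    using b(1)[OF SOME_Basis] b(2) by (intro add_mono sum_mono mult_right_mono) auto
  finally show ?thesis unfolding data_size_def by (simp add: distrib_left sum_distrib_left)
qed

lemma amplitude_integrable: "integrable lborel (amplitude k)"
proof (rule Bochner_Integration.integrable_bound[OF integrable_mult_right[OF data_size_integrable]])
  show "amplitude k \<in> borel_measurable lborel"
    using measurable_compose[OF measurable_Pair1' amplitude_measurable, of k] by simp
  show "AE x in lborel. norm (amplitude k x) \<le> norm (cosh (norm k * (2 * h0)) * data_size x)"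
    by (rule AE_I2, rule order_trans[OF norm_amplitude_le[OF order_refl]]) simp
qed

definition gradient_slab where
  "gradient_slab c z = indicator {0<..<1} (fst z) *\<^sub>R complex_of_real (partial c \<phi> (pt (fst z) (snd z)))"

lemma gradient_slab_measurable: "c \<in> Basis \<Longrightarrow> gradient_slab c \<in> borel_measurable (borel \<Otimes>\<^sub>M borel)"
proof -
  assume c: "c \<in> Basis"
  have "continuous_on ({0<..<1} \<times> UNIV) (\<lambda>(s, x). complex_of_real (partial c \<phi> (pt s x)))"
    using cont_partial[OF c] unfolding split_beta by (intro continuous_on_of_real)
  from measurable_slab[OF this] show ?thesis unfolding gradient_slab_def[abs_def] split_beta .
qed

text \<open>The volume error of the cutoff identity with its dependence on \<open>k\<close>
  isolated: the wave vector enters only through \<open>iwave\<close> times a mode, the factor which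
  averaging turns into a Fourier transform.\<close>

definition transport where
  "transport \<theta> k z = (\<Sum>b\<in>Basis. partial b \<theta> (snd z) * complex_of_real (rho (snd z)) *
    (gradient_slab (b, 0) z * (iwave k (snd z) * mode_cosh k (fst z * rho (snd z)))
     - gradient_slab (0, 1) z * (iwave k (snd z) * mode_sinh b k (fst z * rho (snd z)))))"

lemma transport_measurable:
  assumes "\<And>b. b \<in> Basis \<Longrightarrow> continuous_on UNIV (partial b \<theta>)"
  shows "(\<lambda>(k, z). transport \<theta> k z) \<in> borel_measurable (borel \<Otimes>\<^sub>M (borel \<Otimes>\<^sub>M borel))"
  unfolding transport_def split_beta
proof (rule borel_measurable_sum)
  fix b :: 'a assume b: "b \<in> Basis"
  have [measurable]: "partial b \<theta> \<in> borel_measurable borel" by (rule borel_measurable_continuous_onI[OF assms[OF b]])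
  have [measurable]: "gradient_slab (b, 0) \<in> borel_measurable (borel \<Otimes>\<^sub>M borel)" "gradient_slab (0, 1) \<in> borel_measurable (borel \<Otimes>\<^sub>M borel)"
    by (intro gradient_slab_measurable horizontal_Basis vertical_Basis b)+
  show "(\<lambda>x. partial b \<theta> (snd (snd x)) * complex_of_real (rho (snd (snd x))) *
          (gradient_slab (b, 0) (snd x) * (iwave (fst x) (snd (snd x)) * mode_cosh (fst x) (fst (snd x) * rho (snd (snd x)))) -
           gradient_slab (0, 1) (snd x) * (iwave (fst x) (snd (snd x)) * mode_sinh b (fst x) (fst (snd x) * rho (snd (snd x))))))
         \<in> borel_measurable (borel \<Otimes>\<^sub>M (borel \<Otimes>\<^sub>M borel))"
    by measurable
qed

text \<open>The identity for a fixed mode, rewritten with functions of both \<open>k\<close> and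
  position. The second bound is uniform over the nonzero wave vectors in a ball, as integration over
  \<open>k\<close> requires.\<close>

lemma mode_identity:
  assumes k: "k \<noteq> 0" "norm k \<le> r" and R: "R > 0"
  shows "(\<integral>x. cutoff R x * amplitude k x \<partial>lborel) = (\<integral>z. transport (cutoff R) k z \<partial>(lborel \<Otimes>\<^sub>M lborel))"
    and "(\<integral>\<^sup>+z. ennreal (norm (transport (cutoff R) k z)) \<partial>(lborel \<Otimes>\<^sub>M lborel)) \<le> ennreal (4 / R * (2 * h0 * cosh (r * (2 * h0)))) * local_energy R"
proof -
  interpret m: water_wave_mode h0 \<eta> \<phi> \<eta>t q gq k by unfold_locales (rule k)
  let ?\<theta> = "cutoff R :: 'a \<Rightarrow> complex"
  note \<theta> = cutoff_differentiable[of R] cutoff_partial_continuous[of _ R] cutoff_outside[OF R]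
  note M = norm_partial_cutoff_le[OF R]
  have C: "m.C s x = iwave k x * mode_cosh k (s * rho x)" for s x
    unfolding m.C_def m.wave_def iwave_def mode_cosh_def ..
  have S: "m.ik b * m.S s x = iwave k x * mode_sinh b k (s * rho x)" for b s x
    unfolding m.S_def m.ik_def m.wave_def iwave_def mode_sinh_def by (simp only: mult_ac)
  have Hd: "m.H ?\<theta> = (\<lambda>(s, x). indicator {0<..<1} s *\<^sub>R (\<Sum>b\<in>Basis. partial b ?\<theta> x * m.X b s x))"
    by (rule m.H_def[OF \<theta> M])
  have H: "m.H ?\<theta> = transport ?\<theta> k"
  proof
    fix z :: "real \<times> 'a"
    obtain s x where z: "z = (s, x)" by (cases z)
    show "m.H ?\<theta> z = transport ?\<theta> k z"
      unfolding Hd transport_def m.X_def z C S m.G_def m.r_def gradient_slab_def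
      by (auto simp: sum_distrib_left algebra_simps split: split_indicator)
  qed
  have amp: "amplitude k x = m.C 1 x * complex_of_real (\<eta>t x) + (\<Sum>b\<in>Basis. m.ik b * (complex_of_real (gq x \<bullet> b) * m.S 1 x))" for x
  proof -
    have Seq: "m.ik b * (complex_of_real (gq x \<bullet> b) * m.S 1 x) = iwave k x * (mode_sinh b k (rho x) * complex_of_real (gq x \<bullet> b))" for b
    proof -
      have "m.ik b * (complex_of_real (gq x \<bullet> b) * m.S 1 x) = (m.ik b * m.S 1 x) * complex_of_real (gq x \<bullet> b)"
        by (simp only: mult_ac)
      then show ?thesis unfolding S by (simp only: mult.assoc mult_1)
    qed
    show ?thesis unfolding amplitude_def C Seq by (simp only: distrib_left sum_distrib_left mult.assoc mult_1)
  qed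
  have bdd: "norm (?\<theta> x * m.C 1 x) \<le> 1 * m.K" "norm (?\<theta> x * m.S 1 x) \<le> 1 * (m.K / norm k)" for x
    unfolding norm_mult by (rule mult_mono; use norm_cutoff_le[OF R, of x] m.norm_CS[of 1 x] in simp)+
  have meas [measurable]: "?\<theta> \<in> borel_measurable borel"
    by (intro borel_measurable_continuous_onI differentiable_imp_continuous_UNIV cutoff_differentiable)
  have ib: "integrable lborel (\<lambda>x. u x * v x)"
    if u: "u \<in> borel_measurable borel" "\<And>x. norm (u x) \<le> B" and v: "integrable lborel v" for u v :: "'a \<Rightarrow> complex" and B
  proof (rule Bochner_Integration.integrable_bound)
    show "integrable lborel (\<lambda>x. B * norm (v x))" by (intro integrable_mult_right integrable_norm v)
    have [measurable]: "u \<in> borel_measurable borel" "v \<in> borel_measurable borel" using u v by auto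
    show "(\<lambda>x. u x * v x) \<in> borel_measurable lborel" by measurable
    show "AE x in lborel. norm (u x * v x) \<le> norm (B * norm (v x))"
      using u(2) order_trans[OF norm_ge_zero u(2)] by (intro AE_I2) (simp add: norm_mult mult_right_mono)
  qed
  have i1: "integrable lborel (\<lambda>x. (?\<theta> x * m.C 1 x) * complex_of_real (\<eta>t x))"
  proof (rule ib[OF _ bdd(1)])
    show "(\<lambda>x. ?\<theta> x * m.C 1 x) \<in> borel_measurable borel" by measurable
    show "integrable lborel (\<lambda>x. complex_of_real (\<eta>t x))" using etat_integrable by (rule integrable_of_real)
  qed
  have i2: "integrable lborel (\<lambda>x. (?\<theta> x * m.S 1 x) * complex_of_real (gq x \<bullet> b))" if "b \<in> Basis" for b
    by (rule ib[OF _ bdd(2) gq_integrable[OF that]]) measurable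
  have "(\<integral>x. ?\<theta> x * amplitude k x \<partial>lborel) = (\<integral>x. (?\<theta> x * m.C 1 x) * complex_of_real (\<eta>t x) + (\<Sum>b\<in>Basis. m.ik b * ((?\<theta> x * m.S 1 x) * complex_of_real (gq x \<bullet> b))) \<partial>lborel)"
    unfolding amp by (intro Bochner_Integration.integral_cong refl) (simp add: distrib_left sum_distrib_left mult_ac)
  also have "\<dots> = (\<integral>x. (?\<theta> x * m.C 1 x) * complex_of_real (\<eta>t x) \<partial>lborel) + (\<integral>x. (\<Sum>b\<in>Basis. m.ik b * ((?\<theta> x * m.S 1 x) * complex_of_real (gq x \<bullet> b))) \<partial>lborel)"
    by (intro Bochner_Integration.integral_add i1 Bochner_Integration.integrable_sum integrable_mult_right i2)
  also have "(\<integral>x. (\<Sum>b\<in>Basis. m.ik b * ((?\<theta> x * m.S 1 x) * complex_of_real (gq x \<bullet> b))) \<partial>lborel) = (\<Sum>b\<in>Basis. \<integral>x. m.ik b * ((?\<theta> x * m.S 1 x) * complex_of_real (gq x \<bullet> b)) \<partial>lborel)"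
    by (intro Bochner_Integration.integral_sum integrable_mult_right i2)
  also have "\<dots> = (\<Sum>b\<in>Basis. m.ik b * (\<integral>x. complex_of_real (gq x \<bullet> b) * (?\<theta> x * m.S 1 x) \<partial>lborel))"
    by (simp only: integral_mult_right_zero mult.commute[of "complex_of_real _" "_ * _"])
  finally show "(\<integral>x. ?\<theta> x * amplitude k x \<partial>lborel) = (\<integral>z. transport ?\<theta> k z \<partial>(lborel \<Otimes>\<^sub>M lborel))"
    using m.cutoff_identity[OF \<theta> M] unfolding H by (simp add: mult.assoc)
  have "m.K \<le> cosh (r * (2 * h0))"
    unfolding m.K_def using k(2) h0 order_trans[OF norm_ge_zero k(2)] by (subst cosh_real_nonneg_le_iff) auto
  then have "4 / R * (2 * h0 * m.K) \<le> 4 / R * (2 * h0 * cosh (r * (2 * h0)))"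
    using R h0 by (intro mult_left_mono) auto
  then show "(\<integral>\<^sup>+z. ennreal (norm (transport ?\<theta> k z)) \<partial>(lborel \<Otimes>\<^sub>M lborel)) \<le> ennreal (4 / R * (2 * h0 * cosh (r * (2 * h0)))) * local_energy R"
    using order_trans[OF m.nn_integral_H_le[OF \<theta> M] mult_right_mono[OF ennreal_leI]] unfolding H by simp
qed

end

lemma lborel_pair_measurable_iff:
  "f \<in> borel_measurable (lborel \<Otimes>\<^sub>M lborel) \<longleftrightarrow> f \<in> borel_measurable (borel \<Otimes>\<^sub>M borel)"
  by (simp add: measurable_cong_sets[OF sets_pair_measure_cong[OF sets_lborel sets_lborel] refl])

context water_wave
begin

text \<open>The average of the modes over \<open>B\<close> at the height \<open>y\<close> above the
  bottom. For fixed \<open>y\<close> it is a Fourier transform evaluated at the horizontal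
  position.\<close>

definition smeared where
  "smeared B m x y = fourier (\<lambda>k. indicator B k *\<^sub>R m k y) x"

lemma smeared_measurable:
  fixes m :: "'a \<Rightarrow> real \<Rightarrow> complex"
  assumes B [measurable]: "B \<in> sets borel" and m: "(\<lambda>(k, y). m k y) \<in> borel_measurable (borel \<Otimes>\<^sub>M borel)"
  shows "(\<lambda>(x, y). smeared B m x y) \<in> borel_measurable (borel \<Otimes>\<^sub>M borel)"
proof -
  let ?f = "\<lambda>p. exp (- (\<i> * complex_of_real (fst (fst p) \<bullet> snd p))) * (indicator B (snd p) *\<^sub>R m (snd p) (snd (fst p)))"
  have [measurable]: "(\<lambda>p. m (snd p) (snd (fst p))) \<in> borel_measurable (((borel :: 'a measure) \<Otimes>\<^sub>M borel) \<Otimes>\<^sub>M borel)"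
    using measurable_compose[OF _ m, of "\<lambda>p. (snd p, snd (fst p))" "((borel :: 'a measure) \<Otimes>\<^sub>M borel) \<Otimes>\<^sub>M borel"] by simp
  have f: "?f \<in> borel_measurable ((borel \<Otimes>\<^sub>M borel) \<Otimes>\<^sub>M borel)" by measurable
  have "(\<lambda>p. \<integral>k. ?f (p, k) \<partial>lborel) \<in> borel_measurable (borel \<Otimes>\<^sub>M borel)"
    by (rule lborel.borel_measurable_lebesgue_integral)
       (use f in \<open>simp add: split_beta measurable_cong_sets[OF sets_pair_measure_cong[OF refl sets_lborel] refl]\<close>)
  then show ?thesis unfolding smeared_def fourier_def by (simp add: split_beta)
qed

text \<open>Plancherel in the horizontal variable: averaging the modes over \<open>k\<close> produces a square integrable
  function, which absorbs the energy density as the cutoff is removed.\<close>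

lemma smeared_energy:
  fixes m :: "'a \<Rightarrow> real \<Rightarrow> complex"
  assumes B [measurable]: "B \<in> sets borel" and fin: "emeasure lborel B < \<infinity>"
    and m [measurable]: "(\<lambda>(k, y). m k y) \<in> borel_measurable (borel \<Otimes>\<^sub>M borel)"
    and L: "\<And>k y. k \<in> B \<Longrightarrow> 0 \<le> y \<Longrightarrow> y \<le> 2 * h0 \<Longrightarrow> norm (m k y) \<le> L"
  shows "(\<integral>\<^sup>+x. \<integral>\<^sup>+s. indicator {0<..<1} s * (ennreal (rho x) * ennreal ((norm (smeared B m x (s * rho x)))\<^sup>2)) \<partial>lborel \<partial>lborel) < \<infinity>"
proof -
  let ?P = "\<lambda>(x, y). ennreal ((norm (smeared B m x (y + h0)))\<^sup>2)"
  let ?O = "fluid_domain h0 \<eta>"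
  have Om [measurable]: "?O \<in> sets (borel \<Otimes>\<^sub>M borel)" using borel_open[OF open_domain] by (simp only: borel_prod)
  note [measurable] = smeared_measurable[OF B m]
  have Pm [measurable]: "?P \<in> borel_measurable (borel \<Otimes>\<^sub>M borel)"
    unfolding split_beta by measurable
  have PO: "(\<lambda>z. indicator ?O z * ?P z) \<in> borel_measurable (borel \<Otimes>\<^sub>M borel)" by measurable
  have sq: "(\<integral>\<^sup>+x. ennreal ((norm (smeared B m x y))\<^sup>2) \<partial>lborel) \<le> ennreal ((2 * pi) ^ DIM('a)) * (ennreal (L\<^sup>2) * emeasure lborel B)"
    if y: "0 \<le> y" "y \<le> 2 * h0" for y
  proof -
    have [measurable]: "(\<lambda>k. m k y) \<in> borel_measurable borel"
      using measurable_compose[OF measurable_Pair2' m, of y] by simp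
    have i: "integrable lborel (\<lambda>k. indicator B k *\<^sub>R m k y)"
    proof (rule Bochner_Integration.integrable_bound)
      show "integrable lborel (\<lambda>k. indicator B k *\<^sub>R L)" using fin by (intro integrable_scaleR_left integrable_real_indicator) auto
      show "AE k in lborel. norm (indicator B k *\<^sub>R m k y) \<le> norm (indicator B k *\<^sub>R L)"
        using L y by (intro AE_I2) (auto split: split_indicator intro: order_trans[OF _ abs_ge_self])
    qed measurable
    have "(\<integral>\<^sup>+x. ennreal ((norm (smeared B m x y))\<^sup>2) \<partial>lborel) \<le> ennreal ((2 * pi) ^ DIM('a)) * (\<integral>\<^sup>+k. ennreal ((norm (indicator B k *\<^sub>R m k y))\<^sup>2) \<partial>lborel)"
      unfolding smeared_def by (rule plancherel_le[OF i])
    also have "(\<integral>\<^sup>+k. ennreal ((norm (indicator B k *\<^sub>R m k y))\<^sup>2) \<partial>lborel) \<le> (\<integral>\<^sup>+k. ennreal (L\<^sup>2) * indicator B k \<partial>lborel)"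
      using L y by (intro nn_integral_mono) (auto split: split_indicator intro!: ennreal_leI power_mono)
    also have "\<dots> = ennreal (L\<^sup>2) * emeasure lborel B" by (simp add: nn_integral_cmult_indicator)
    finally show ?thesis by (simp add: mult_left_mono)
  qed
  \<comment> \<open>Plancherel acts on horizontal slices, whereas the levels \<open>s\<close> follow
    the surface. The integral is therefore carried back to physical coordinates, where
    \<open>y\<close> is constant on a slice; the slices then fill a strip of finite height.\<close>
  have "(\<integral>\<^sup>+x. \<integral>\<^sup>+s. indicator {0<..<1} s * (ennreal (rho x) * ennreal ((norm (smeared B m x (s * rho x)))\<^sup>2)) \<partial>lborel \<partial>lborel) =
      (\<integral>\<^sup>+x. \<integral>\<^sup>+s. indicator {0<..<1} s * (ennreal (rho x) * ?P (pt s x)) \<partial>lborel \<partial>lborel)"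
    by (simp add: pt_def)
  also have "\<dots> = (\<integral>\<^sup>+z. indicator ?O z * ?P z \<partial>lborel)"
    by (rule change_of_variables) (use PO in \<open>simp add: borel_prod\<close>)
  also have "\<dots> = (\<integral>\<^sup>+z. indicator ?O z * ?P z \<partial>(lborel \<Otimes>\<^sub>M lborel))" by (simp add: lborel_prod)
  also have "\<dots> = (\<integral>\<^sup>+y. \<integral>\<^sup>+x. indicator ?O (x, y) * ?P (x, y) \<partial>lborel \<partial>lborel)"
    by (rule lborel_pair.nn_integral_snd[symmetric]) (use PO in \<open>simp add: lborel_pair_measurable_iff\<close>)
  also have "\<dots> \<le> (\<integral>\<^sup>+y. ennreal ((2 * pi) ^ DIM('a)) * (ennreal (L\<^sup>2) * emeasure lborel B) * indicator {- h0..h0} y \<partial>lborel)"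
  proof (rule nn_integral_mono)
    fix y :: real
    show "(\<integral>\<^sup>+x. indicator ?O (x, y) * ?P (x, y) \<partial>lborel) \<le> ennreal ((2 * pi) ^ DIM('a)) * (ennreal (L\<^sup>2) * emeasure lborel B) * indicator {- h0..h0} y"
    proof (cases "- h0 \<le> y \<and> y \<le> h0")
      case True
      have "(\<integral>\<^sup>+x. indicator ?O (x, y) * ?P (x, y) \<partial>lborel) \<le> (\<integral>\<^sup>+x. ennreal ((norm (smeared B m x (y + h0)))\<^sup>2) \<partial>lborel)"
        by (intro nn_integral_mono) (auto split: split_indicator)
      also have "\<dots> \<le> ennreal ((2 * pi) ^ DIM('a)) * (ennreal (L\<^sup>2) * emeasure lborel B)"
        using True by (intro sq) auto
      finally show ?thesis using True by simp
    next
      case False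
      have "(x, y) \<notin> ?O" for x using False small[of x] h0 by (auto simp: fluid_domain_def)
      then show ?thesis by simp
    qed
  qed
  also have "\<dots> = ennreal ((2 * pi) ^ DIM('a)) * (ennreal (L\<^sup>2) * emeasure lborel B) * emeasure lborel {- h0..h0}"
    by (rule nn_integral_cmult_indicator) simp
  also have "\<dots> < \<infinity>" using fin h0 by (simp add: ennreal_mult_less_top)
  finally show ?thesis .
qed

section \<open>Averages over a bounded set of wave vectors\<close>

context
  fixes B :: "'a set" and r :: real
  assumes B [measurable]: "B \<in> sets borel" and Br: "\<And>k. k \<in> B \<Longrightarrow> k \<noteq> 0 \<and> norm k \<le> r"
begin

lemma B_finite: "emeasure lborel B < \<infinity>"
proof -
  have "bounded B" using Br unfolding bounded_iff by blast
  then show ?thesis by (rule emeasure_bounded_finite)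
qed

definition L where "L = cosh (r * (2 * h0))"

text \<open>A majorant of the averaged error apart from the factor \<open>4 / R\<close>. Both the
  squared gradient and the squared smeared modes, with the Jacobian \<open>rho\<close>, are
  integrable over the whole fluid, in contrast to the local energy.\<close>

definition mixed_density where
  "mixed_density z = ennreal (rho (snd z)) * (\<Sum>b\<in>Basis.
     ennreal ((norm (gradient_slab (b, 0) z))\<^sup>2 + indicator {0<..<1} (fst z) * (norm (smeared B mode_cosh (snd z) (fst z * rho (snd z))))\<^sup>2)
   + ennreal ((norm (gradient_slab (0, 1) z))\<^sup>2 + indicator {0<..<1} (fst z) * (norm (smeared B (mode_sinh b) (snd z) (fst z * rho (snd z))))\<^sup>2))"

lemma mixed_density_finite: "(\<integral>\<^sup>+z. mixed_density z \<partial>(lborel \<Otimes>\<^sub>M lborel)) < \<infinity>"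
proof -
  let ?I = "\<lambda>s::real. indicator {0<..<1} s :: ennreal"
  let ?g = "\<lambda>c (s, x). ennreal (rho x) * ennreal ((norm (gradient_slab c (s, x)))\<^sup>2)"
  let ?a = "\<lambda>m (s, x). ennreal (rho x) * ennreal (indicator {0<..<1} s * (norm (smeared B m x (s * rho x)))\<^sup>2)"
  have gm: "?g c \<in> borel_measurable (borel \<Otimes>\<^sub>M borel)" if "c \<in> Basis" for c
  proof -
    have [measurable]: "gradient_slab c \<in> borel_measurable (borel \<Otimes>\<^sub>M borel)" by (rule gradient_slab_measurable[OF that])
    show ?thesis unfolding split_beta prod.collapse by measurable
  qed
  have am: "?a m \<in> borel_measurable (borel \<Otimes>\<^sub>M borel)" if "(\<lambda>(k, y). m k y) \<in> borel_measurable (borel \<Otimes>\<^sub>M borel)" for m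
  proof -
    note [measurable] = smeared_measurable[OF B that]
    show ?thesis unfolding split_beta by measurable
  qed
  have gf: "(\<integral>\<^sup>+z. ?g c z \<partial>(lborel \<Otimes>\<^sub>M lborel)) < \<infinity>" if c: "c \<in> Basis" for c
  proof -
    have m: "(\<lambda>z. indicator (fluid_domain h0 \<eta>) z * ennreal ((partial c \<phi> z)\<^sup>2)) \<in> borel_measurable borel"
    proof -
      have "(\<lambda>z. indicator (fluid_domain h0 \<eta>) z *\<^sub>R partial c \<phi> z) \<in> borel_measurable borel"
        using open_domain by (intro borel_measurable_continuous_on_indicator phi_partial_continuous c) simp
      then have "(\<lambda>z. ennreal ((indicator (fluid_domain h0 \<eta>) z *\<^sub>R partial c \<phi> z)\<^sup>2)) \<in> borel_measurable borel" by measurable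
      moreover have eq: "(\<lambda>z. ennreal ((indicator (fluid_domain h0 \<eta>) z *\<^sub>R partial c \<phi> z)\<^sup>2)) = (\<lambda>z. indicator (fluid_domain h0 \<eta>) z * ennreal ((partial c \<phi> z)\<^sup>2))"
        by (auto simp: fun_eq_iff split: split_indicator)
      ultimately show ?thesis by (simp only: eq)
    qed
    have "(\<integral>\<^sup>+z. ?g c z \<partial>(lborel \<Otimes>\<^sub>M lborel)) = (\<integral>\<^sup>+x. \<integral>\<^sup>+s. ?g c (s, x) \<partial>lborel \<partial>lborel)"
      by (rule lborel_pair.nn_integral_snd[symmetric]) (use gm[OF c] in \<open>simp add: lborel_pair_measurable_iff\<close>)
    also have "\<dots> = (\<integral>\<^sup>+x. \<integral>\<^sup>+s. ?I s * (ennreal (rho x) * ennreal ((partial c \<phi> (pt s x))\<^sup>2)) \<partial>lborel \<partial>lborel)"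
      by (intro nn_integral_cong) (auto simp: gradient_slab_def split: split_indicator)
    also have "\<dots> < \<infinity>" using change_of_variables[OF m] energy[OF c] by simp
    finally show ?thesis .
  qed
  have af: "(\<integral>\<^sup>+z. ?a m z \<partial>(lborel \<Otimes>\<^sub>M lborel)) < \<infinity>"
    if m: "(\<lambda>(k, y). m k y) \<in> borel_measurable (borel \<Otimes>\<^sub>M borel)" and L: "\<And>k y. k \<in> B \<Longrightarrow> 0 \<le> y \<Longrightarrow> y \<le> 2 * h0 \<Longrightarrow> norm (m k y) \<le> L" for m
  proof -
    have "(\<integral>\<^sup>+z. ?a m z \<partial>(lborel \<Otimes>\<^sub>M lborel)) = (\<integral>\<^sup>+x. \<integral>\<^sup>+s. ?a m (s, x) \<partial>lborel \<partial>lborel)"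
      by (rule lborel_pair.nn_integral_snd[symmetric]) (use am[OF m] in \<open>simp add: lborel_pair_measurable_iff\<close>)
    also have "\<dots> = (\<integral>\<^sup>+x. \<integral>\<^sup>+s. ?I s * (ennreal (rho x) * ennreal ((norm (smeared B m x (s * rho x)))\<^sup>2)) \<partial>lborel \<partial>lborel)"
      by (intro nn_integral_cong) (auto split: split_indicator)
    also have "\<dots> < \<infinity>" by (rule smeared_energy[OF B B_finite m L])
    finally show ?thesis .
  qed
  note mL = norm_mode_le[where Y = "2 * h0", OF _ conjunct2[OF Br], folded L_def]
  have eq: "mixed_density z = (\<Sum>b\<in>Basis. (?g (b, 0) z + ?a mode_cosh z) + (?g (0, 1) z + ?a (mode_sinh b) z))" for z
    unfolding mixed_density_def
    by (simp add: split_beta sum_distrib_left distrib_left)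
  have "(\<integral>\<^sup>+z. mixed_density z \<partial>(lborel \<Otimes>\<^sub>M lborel)) = (\<Sum>b\<in>(Basis::'a set). \<integral>\<^sup>+z. (?g (b, 0) z + ?a mode_cosh z) + (?g (0, 1) z + ?a (mode_sinh b) z) \<partial>(lborel \<Otimes>\<^sub>M lborel))"
    unfolding eq
    by (intro nn_integral_sum borel_measurable_add)
       (use gm[OF horizontal_Basis] gm[OF vertical_Basis] am mode_measurable in \<open>simp_all add: lborel_pair_measurable_iff\<close>)
  also have "\<dots> < \<infinity>"
  proof -
    have "(\<integral>\<^sup>+z. (?g (b, 0) z + ?a mode_cosh z) + (?g (0, 1) z + ?a (mode_sinh b) z) \<partial>(lborel \<Otimes>\<^sub>M lborel)) < \<infinity>" if b: "b \<in> Basis" for b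
    proof -
      have c: "(\<integral>\<^sup>+z. ?a mode_cosh z \<partial>(lborel \<Otimes>\<^sub>M lborel)) < \<infinity>" "(\<integral>\<^sup>+z. ?a (mode_sinh b) z \<partial>(lborel \<Otimes>\<^sub>M lborel)) < \<infinity>"
        by (rule af[OF mode_measurable(1) mL(1)[OF b]]; assumption) (rule af[OF mode_measurable(2) mL(2)[OF b]]; assumption)
      have m: "?g (b, 0) \<in> borel_measurable (lborel \<Otimes>\<^sub>M lborel)" "?g (0, 1) \<in> borel_measurable (lborel \<Otimes>\<^sub>M lborel)"
          "?a mode_cosh \<in> borel_measurable (lborel \<Otimes>\<^sub>M lborel)" "?a (mode_sinh b) \<in> borel_measurable (lborel \<Otimes>\<^sub>M lborel)"
        using gm[OF horizontal_Basis[OF b]] gm[OF vertical_Basis] am[OF mode_measurable(1)] am[OF mode_measurable(2)]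
        by (simp_all only: lborel_pair_measurable_iff)
      show ?thesis
        using gf[OF horizontal_Basis[OF b]] gf[OF vertical_Basis] c
        by (simp only: nn_integral_add[OF borel_measurable_add[OF m(1) m(3)] borel_measurable_add[OF m(2) m(4)]]
            nn_integral_add[OF m(1) m(3)] nn_integral_add[OF m(2) m(4)] ennreal_add_less_top infinity_ennreal_def simp_thms)
    qed
    then show ?thesis by (auto simp only: ennreal_sum_less_top[OF finite_Basis] infinity_ennreal_def)
  qed
  finally show ?thesis .
qed

text \<open>Absolute convergence for a fixed radius, by the local energy. It justifies Fubini;
  smallness for large \<open>R\<close> is gained only after the exchange of integrals.\<close>

lemma transport_product_integrable:
  assumes R: "R > 0"
  shows "integrable (lborel \<Otimes>\<^sub>M lborel) (\<lambda>(k, z). indicator B k *\<^sub>R transport (cutoff R) k z)"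
proof (rule integrableI_bounded)
  have t [measurable]: "(\<lambda>(k, z). transport (cutoff R) k z) \<in> borel_measurable (borel \<Otimes>\<^sub>M (borel \<Otimes>\<^sub>M borel))"
    by (rule transport_measurable[OF cutoff_partial_continuous])
  have m: "(\<lambda>(k, z). indicator B k *\<^sub>R transport (cutoff R) k z) \<in> borel_measurable (borel \<Otimes>\<^sub>M (borel \<Otimes>\<^sub>M borel))"
    unfolding split_beta by measurable
  then show lm: "(\<lambda>(k, z). indicator B k *\<^sub>R transport (cutoff R) k z) \<in> borel_measurable (lborel \<Otimes>\<^sub>M lborel)"
    by (simp add: lborel_pair_measurable_iff borel_prod)
  let ?c = "ennreal (4 / R * (2 * h0 * cosh (r * (2 * h0)))) * local_energy R"
  have "(\<integral>\<^sup>+p. ennreal (norm (case p of (k, z) \<Rightarrow> indicator B k *\<^sub>R transport (cutoff R) k z)) \<partial>(lborel \<Otimes>\<^sub>M lborel)) =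
      (\<integral>\<^sup>+k. \<integral>\<^sup>+z. ennreal (norm (indicator B k *\<^sub>R transport (cutoff R) k z)) \<partial>lborel \<partial>lborel)"
    using lm by (subst lborel.nn_integral_fst[symmetric]) simp_all
  also have "\<dots> \<le> (\<integral>\<^sup>+k. ?c * indicator B k \<partial>lborel)"
  proof (rule nn_integral_mono)
    fix k
    show "(\<integral>\<^sup>+z. ennreal (norm (indicator B k *\<^sub>R transport (cutoff R) k z)) \<partial>lborel) \<le> ?c * indicator B k"
    proof (cases "k \<in> B")
      case True
      then show ?thesis using mode_identity(2)[of k r R] Br[OF True] R by (simp add: lborel_prod)
    qed simp
  qed
  also have "\<dots> = ?c * emeasure lborel B" by (rule nn_integral_cmult_indicator) simp
  also have "\<dots> < \<infinity>" using B_finite local_energy_finite[of R] by (simp add: ennreal_mult_less_top)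
  finally show "(\<integral>\<^sup>+p. ennreal (norm (case p of (k, z) \<Rightarrow> indicator B k *\<^sub>R transport (cutoff R) k z)) \<partial>(lborel \<Otimes>\<^sub>M lborel)) < \<infinity>" .
qed

text \<open>Integrating over \<open>B\<close> first replaces each mode by its smeared form. The
  products with the gradient are then split by \<open>a * b \<le> a^2 + b^2\<close> into square
  integrable pieces, and the gradient of the cutoff contributes \<open>4 / R\<close>.\<close>

lemma smeared_transport_le:
  assumes R: "R > 0"
  shows "ennreal (norm (\<integral>k. indicator B k *\<^sub>R transport (cutoff R) k z \<partial>lborel)) \<le> ennreal (4 / R) * mixed_density z"
proof -
  obtain s x where z: "z = (s, x)" by (cases z)
  let ?y = "s * rho x"
  show ?thesis
  proof (cases "0 < s \<and> s < 1")
    case False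
    then have "gradient_slab c z = 0" for c by (auto simp: gradient_slab_def z)
    then show ?thesis by (simp add: transport_def)
  next
    case True
    have "s * rho x \<le> 1 * (2 * h0)" using True rho_bounds[of x] by (intro mult_mono) auto
    then have y: "0 \<le> ?y" "?y \<le> 2 * h0" using True rho_bounds[of x] by auto
    have mi: "integrable lborel (\<lambda>k. indicator B k *\<^sub>R (iwave k x * m k ?y))"
      if m: "(\<lambda>(k, y). m k y) \<in> borel_measurable (borel \<Otimes>\<^sub>M borel)" and mb: "\<And>k. k \<in> B \<Longrightarrow> norm (m k ?y) \<le> L" for m
    proof (rule Bochner_Integration.integrable_bound)
      have [measurable]: "(\<lambda>k. m k ?y) \<in> borel_measurable borel" "(\<lambda>k. iwave k x) \<in> borel_measurable borel"
        using measurable_compose[OF measurable_Pair2' m, of ?y] measurable_compose[OF measurable_Pair2' iwave_measurable, of x] by simp_all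
      show "(\<lambda>k. indicator B k *\<^sub>R (iwave k x * m k ?y)) \<in> borel_measurable lborel" by measurable
      show "integrable lborel (\<lambda>k. indicator B k *\<^sub>R L)" using B_finite by (intro integrable_scaleR_left integrable_real_indicator) auto
      show "AE k in lborel. norm (indicator B k *\<^sub>R (iwave k x * m k ?y)) \<le> norm (indicator B k *\<^sub>R L)"
        using mb by (intro AE_I2) (auto simp: norm_mult split: split_indicator intro: order_trans[OF _ abs_ge_self])
    qed
    note mL = norm_mode_le[OF _ conjunct2[OF Br] y, folded L_def]
    have ms: "(\<integral>k. indicator B k *\<^sub>R (iwave k x * m k ?y) \<partial>lborel) = smeared B m x ?y" for m
      unfolding smeared_def fourier_def iwave_def by (simp add: inner_commute)
    let ?p = "\<lambda>b. partial b (cutoff R) x * complex_of_real (rho x)"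
    let ?c = "\<lambda>k. indicator B k *\<^sub>R (iwave k x * mode_cosh k ?y)" and ?s = "\<lambda>b k. indicator B k *\<^sub>R (iwave k x * mode_sinh b k ?y)"
    have ic: "integrable lborel ?c" by (rule mi[OF mode_measurable(1) mL(1)[OF SOME_Basis]])
    have ish: "integrable lborel (?s b)" if "b \<in> Basis" for b by (rule mi[OF mode_measurable(2) mL(2)[OF that]])
    have "(\<integral>k. indicator B k *\<^sub>R transport (cutoff R) k z \<partial>lborel) =
        (\<integral>k. (\<Sum>b\<in>Basis. ?p b * (gradient_slab (b, 0) z * ?c k - gradient_slab (0, 1) z * ?s b k)) \<partial>lborel)"
      unfolding transport_def z
      by (intro Bochner_Integration.integral_cong refl) (simp add: scaleR_sum_right scaleR_conv_of_real right_diff_distrib sum_distrib_left mult_ac)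
    also have "\<dots> = (\<Sum>b\<in>Basis. \<integral>k. ?p b * (gradient_slab (b, 0) z * ?c k - gradient_slab (0, 1) z * ?s b k) \<partial>lborel)"
      by (intro Bochner_Integration.integral_sum integrable_mult_right Bochner_Integration.integrable_diff ic ish)
    also have "\<dots> = (\<Sum>b\<in>Basis. ?p b * (gradient_slab (b, 0) z * smeared B mode_cosh x ?y - gradient_slab (0, 1) z * smeared B (mode_sinh b) x ?y))"
    proof (rule sum.cong[OF refl])
      fix b :: 'a assume b: "b \<in> Basis"
      show "(\<integral>k. ?p b * (gradient_slab (b, 0) z * ?c k - gradient_slab (0, 1) z * ?s b k) \<partial>lborel) = ?p b * (gradient_slab (b, 0) z * smeared B mode_cosh x ?y - gradient_slab (0, 1) z * smeared B (mode_sinh b) x ?y)"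
        unfolding integral_mult_right_zero Bochner_Integration.integral_diff[OF integrable_mult_right[OF ic] integrable_mult_right[OF ish[OF b]]] ms ..
    qed
    finally have eq: "(\<integral>k. indicator B k *\<^sub>R transport (cutoff R) k z \<partial>lborel) = \<dots>" .
    have am: "a * b \<le> a\<^sup>2 + b\<^sup>2" if "0 \<le> a" "0 \<le> b" for a b :: real
    proof -
      have "0 \<le> a * b" using that by simp
      then show ?thesis using sum_squares_bound[of a b] by linarith
    qed
    have "norm (\<integral>k. indicator B k *\<^sub>R transport (cutoff R) k z \<partial>lborel) \<le> (\<Sum>b\<in>Basis. (4 / R * rho x) *
        (((norm (gradient_slab (b, 0) z))\<^sup>2 + (norm (smeared B mode_cosh x ?y))\<^sup>2) + ((norm (gradient_slab (0, 1) z))\<^sup>2 + (norm (smeared B (mode_sinh b) x ?y))\<^sup>2)))"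
      unfolding eq
    proof (rule sum_norm_le)
      fix b :: 'a assume b: "b \<in> Basis"
      have "norm (gradient_slab (b, 0) z * smeared B mode_cosh x ?y - gradient_slab (0, 1) z * smeared B (mode_sinh b) x ?y) \<le>
          norm (gradient_slab (b, 0) z) * norm (smeared B mode_cosh x ?y) + norm (gradient_slab (0, 1) z) * norm (smeared B (mode_sinh b) x ?y)"
        unfolding norm_mult[symmetric] by (rule norm_triangle_ineq4)
      also have "\<dots> \<le> ((norm (gradient_slab (b, 0) z))\<^sup>2 + (norm (smeared B mode_cosh x ?y))\<^sup>2) + ((norm (gradient_slab (0, 1) z))\<^sup>2 + (norm (smeared B (mode_sinh b) x ?y))\<^sup>2)"
        by (intro add_mono am) auto
      finally show "norm (?p b * (gradient_slab (b, 0) z * smeared B mode_cosh x ?y - gradient_slab (0, 1) z * smeared B (mode_sinh b) x ?y)) \<le> (4 / R * rho x) *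
        (((norm (gradient_slab (b, 0) z))\<^sup>2 + (norm (smeared B mode_cosh x ?y))\<^sup>2) + ((norm (gradient_slab (0, 1) z))\<^sup>2 + (norm (smeared B (mode_sinh b) x ?y))\<^sup>2))"
        unfolding norm_mult[of "?p b"] norm_mult[of "partial b (cutoff R) x"] norm_of_real
        using norm_partial_cutoff_le[OF R b, of x] rho_bounds[of x] R by (intro mult_mono) auto
    qed
    also have "\<dots> = (4 / R) * (rho x * (\<Sum>b\<in>Basis. ((norm (gradient_slab (b, 0) z))\<^sup>2 + (norm (smeared B mode_cosh x ?y))\<^sup>2) + ((norm (gradient_slab (0, 1) z))\<^sup>2 + (norm (smeared B (mode_sinh b) x ?y))\<^sup>2)))"
      by (simp only: sum_distrib_left mult.assoc)
    finally have "ennreal (norm (\<integral>k. indicator B k *\<^sub>R transport (cutoff R) k z \<partial>lborel)) \<le> ennreal \<dots>" by (rule ennreal_leI)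
    also have "\<dots> = ennreal (4 / R) * mixed_density z"
    proof -
      have "mixed_density z = ennreal (rho x) * ennreal (\<Sum>b\<in>Basis. ((norm (gradient_slab (b, 0) z))\<^sup>2 + (norm (smeared B mode_cosh x ?y))\<^sup>2) + ((norm (gradient_slab (0, 1) z))\<^sup>2 + (norm (smeared B (mode_sinh b) x ?y))\<^sup>2))"
        unfolding mixed_density_def using True by (simp add: z sum_ennreal[symmetric] del: sum_ennreal)
      then show ?thesis using R rho_bounds[of x] by (simp only: ennreal_mult'' ennreal_mult' sum_nonneg add_nonneg_nonneg zero_le_power2 mult_nonneg_nonneg divide_nonneg_pos zero_le_numeral less_imp_le)
    qed
    finally show ?thesis .
  qed
qed

text \<open>The data are integrable, so on one side of the averaged identity the cutoff is removed
  by dominated convergence. On the other side the error is at most \<open>4 / R\<close> times the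
  finite integral of \<open>mixed_density\<close>, hence tends to zero.\<close>

lemma average_amplitude: "(\<integral>k. indicator B k *\<^sub>R (\<integral>x. amplitude k x \<partial>lborel) \<partial>lborel) = 0"
proof -
  let ?A = "\<lambda>(k, x). indicator B k *\<^sub>R amplitude k x"
  let ?R = "\<lambda>n. real n + 1"
  let ?An = "\<lambda>n (k, x). cutoff (?R n) x * (indicator B k *\<^sub>R amplitude k x)"
  note [measurable] = amplitude_measurable
  have Am: "?A \<in> borel_measurable (lborel \<Otimes>\<^sub>M lborel)"
    unfolding lborel_pair_measurable_iff split_beta by measurable
  have Ai: "integrable (lborel \<Otimes>\<^sub>M lborel) ?A"
  proof (rule lborel_pair.Fubini_integrable[OF Am])
    have le: "(\<integral>x. norm (?A (k, x)) \<partial>lborel) \<le> indicator B k * (L * (\<integral>x. data_size x \<partial>lborel))" for k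
    proof (cases "k \<in> B")
      case True
      have "(\<integral>x. norm (amplitude k x) \<partial>lborel) \<le> (\<integral>x. L * data_size x \<partial>lborel)"
        unfolding L_def using Br[OF True]
        by (intro integral_mono integrable_norm amplitude_integrable integrable_mult_right data_size_integrable norm_amplitude_le) auto
      then show ?thesis using True by simp
    qed simp
    have [measurable]: "(\<lambda>k. \<integral>x. norm (?A (k, x)) \<partial>lborel) \<in> borel_measurable lborel"
      using Am by (intro lborel.borel_measurable_lebesgue_integral) (simp add: split_beta measurable_cong_sets[OF sets_pair_measure_cong[OF sets_lborel refl] refl])
    show "integrable lborel (\<lambda>k. \<integral>x. norm (?A (k, x)) \<partial>lborel)"
    proof (rule Bochner_Integration.integrable_bound)
      show "integrable lborel (\<lambda>k. indicator B k * (L * (\<integral>x. data_size x \<partial>lborel)))"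
        using B_finite by (intro integrable_mult_left integrable_real_indicator) auto
      show "AE k in lborel. norm (\<integral>x. norm (?A (k, x)) \<partial>lborel) \<le> norm (indicator B k * (L * (\<integral>x. data_size x \<partial>lborel)))"
        using order_trans[OF le abs_ge_self] by (intro AE_I2) simp
    qed measurable
    show "AE k in lborel. integrable lborel (\<lambda>x. ?A (k, x))"
      by (intro AE_I2) (simp add: amplitude_integrable)
  qed
  have Anm: "?An n \<in> borel_measurable (lborel \<Otimes>\<^sub>M lborel)" for n
  proof -
    have [measurable]: "(cutoff (?R n) :: 'a \<Rightarrow> complex) \<in> borel_measurable borel"
      by (intro borel_measurable_continuous_onI differentiable_imp_continuous_UNIV cutoff_differentiable)
    show ?thesis unfolding lborel_pair_measurable_iff split_beta by measurable
  qed
  have An_le: "norm (?An n p) \<le> norm (?A p)" for n p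
    unfolding split_beta norm_mult using norm_cutoff_le[of "?R n" "snd p"] by (intro mult_left_le_one_le) auto
  have Ani: "integrable (lborel \<Otimes>\<^sub>M lborel) (?An n)" for n
    by (rule Bochner_Integration.integrable_bound[OF Ai Anm]) (intro AE_I2 An_le)
  have lim: "(\<lambda>n. \<integral>p. ?An n p \<partial>(lborel \<Otimes>\<^sub>M lborel)) \<longlonglongrightarrow> (\<integral>p. ?A p \<partial>(lborel \<Otimes>\<^sub>M lborel))"
  proof (rule integral_dominated_convergence[where w = "\<lambda>p. norm (?A p)"])
    show "AE p in lborel \<Otimes>\<^sub>M lborel. (\<lambda>n. ?An n p) \<longlonglongrightarrow> ?A p"
    proof (rule AE_I2)
      fix p
      have "(\<lambda>n. cutoff (?R n) (snd p) * ?A p) \<longlonglongrightarrow> 1 * ?A p" by (intro tendsto_intros cutoff_tendsto)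
      then show "(\<lambda>n. ?An n p) \<longlonglongrightarrow> ?A p" by (simp add: split_beta)
    qed
  qed (use Am Anm Ai An_le in auto)
  have small_n: "ennreal (norm (\<integral>p. ?An n p \<partial>(lborel \<Otimes>\<^sub>M lborel))) \<le> ennreal (4 / ?R n) * (\<integral>\<^sup>+z. mixed_density z \<partial>(lborel \<Otimes>\<^sub>M lborel))" for n
  proof -
    have Rn: "?R n > 0" by simp
    note Ti = transport_product_integrable[OF Rn]
    have "(\<integral>p. ?An n p \<partial>(lborel \<Otimes>\<^sub>M lborel)) = (\<integral>k. \<integral>x. ?An n (k, x) \<partial>lborel \<partial>lborel)"
      by (rule lborel_pair.integral_fst'[OF Ani, symmetric])
    also have "\<dots> = (\<integral>k. \<integral>z. indicator B k *\<^sub>R transport (cutoff (?R n)) k z \<partial>lborel \<partial>lborel)"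
    proof (intro Bochner_Integration.integral_cong refl)
      fix k
      show "(\<integral>x. ?An n (k, x) \<partial>lborel) = (\<integral>z. indicator B k *\<^sub>R transport (cutoff (?R n)) k z \<partial>lborel)"
      proof (cases "k \<in> B")
        case True
        then show ?thesis using mode_identity(1)[of k r "?R n"] Br[OF True] by (simp add: lborel_prod)
      qed simp
    qed
    also have "\<dots> = (\<integral>z. \<integral>k. indicator B k *\<^sub>R transport (cutoff (?R n)) k z \<partial>lborel \<partial>lborel)"
      using lborel_pair.Fubini_integral[OF Ti] by simp
    finally have eq: "(\<integral>p. ?An n p \<partial>(lborel \<Otimes>\<^sub>M lborel)) = \<dots>" .
    have "ennreal (norm (\<integral>p. ?An n p \<partial>(lborel \<Otimes>\<^sub>M lborel))) \<le> (\<integral>\<^sup>+z. ennreal (norm (\<integral>k. indicator B k *\<^sub>R transport (cutoff (?R n)) k z \<partial>lborel)) \<partial>lborel)"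
      unfolding eq by (intro integral_norm_bound_ennreal lborel_pair.integrable_snd[OF Ti])
    also have "\<dots> \<le> (\<integral>\<^sup>+z. ennreal (4 / ?R n) * mixed_density z \<partial>lborel)"
      by (intro nn_integral_mono smeared_transport_le Rn)
    also have "\<dots> \<le> ennreal (4 / ?R n) * (\<integral>\<^sup>+z. mixed_density z \<partial>(lborel \<Otimes>\<^sub>M lborel))"
    proof -
      have "mixed_density \<in> borel_measurable (lborel \<Otimes>\<^sub>M lborel)"
      proof -
        have [measurable]: "gradient_slab (0, 1) \<in> borel_measurable (borel \<Otimes>\<^sub>M borel)" by (rule gradient_slab_measurable[OF vertical_Basis])
        note [measurable] = smeared_measurable[OF B mode_measurable(1)] smeared_measurable[OF B mode_measurable(2)]
        have "(\<lambda>z. \<Sum>b\<in>Basis.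
            ennreal ((norm (gradient_slab (b, 0) z))\<^sup>2 + indicator {0<..<1} (fst z) * (norm (smeared B mode_cosh (snd z) (fst z * rho (snd z))))\<^sup>2)
          + ennreal ((norm (gradient_slab (0, 1) z))\<^sup>2 + indicator {0<..<1} (fst z) * (norm (smeared B (mode_sinh b) (snd z) (fst z * rho (snd z))))\<^sup>2)) \<in> borel_measurable (borel \<Otimes>\<^sub>M borel)"
        proof (rule borel_measurable_sum)
          fix b :: 'a assume b: "b \<in> Basis"
          have [measurable]: "gradient_slab (b, 0) \<in> borel_measurable (borel \<Otimes>\<^sub>M borel)" by (rule gradient_slab_measurable[OF horizontal_Basis[OF b]])
          show "(\<lambda>z. ennreal ((norm (gradient_slab (b, 0) z))\<^sup>2 + indicator {0<..<1} (fst z) * (norm (smeared B mode_cosh (snd z) (fst z * rho (snd z))))\<^sup>2)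
            + ennreal ((norm (gradient_slab (0, 1) z))\<^sup>2 + indicator {0<..<1} (fst z) * (norm (smeared B (mode_sinh b) (snd z) (fst z * rho (snd z))))\<^sup>2)) \<in> borel_measurable (borel \<Otimes>\<^sub>M borel)"
            by measurable
        qed
        then show ?thesis unfolding mixed_density_def[abs_def] lborel_pair_measurable_iff by measurable
      qed
      then show ?thesis by (simp add: lborel_prod nn_integral_cmult)
    qed
    finally show ?thesis .
  qed
  have "(\<lambda>n. \<integral>p. ?An n p \<partial>(lborel \<Otimes>\<^sub>M lborel)) \<longlonglongrightarrow> 0"
  proof (rule Lim_null_comparison)
    define D where "D = enn2real (\<integral>\<^sup>+z. mixed_density z \<partial>(lborel \<Otimes>\<^sub>M lborel))"
    have D: "(\<integral>\<^sup>+z. mixed_density z \<partial>(lborel \<Otimes>\<^sub>M lborel)) = ennreal D" "D \<ge> 0"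
      using mixed_density_finite by (simp_all add: D_def)
    show "\<forall>\<^sub>F n in sequentially. norm (\<integral>p. ?An n p \<partial>(lborel \<Otimes>\<^sub>M lborel)) \<le> 4 / ?R n * D"
    proof (intro always_eventually allI)
      fix n
      have "ennreal (norm (\<integral>p. ?An n p \<partial>(lborel \<Otimes>\<^sub>M lborel))) \<le> ennreal (4 / ?R n) * ennreal D"
        by (rule small_n[unfolded D(1)])
      also have "\<dots> = ennreal (4 / ?R n * D)" using D(2) by (intro ennreal_mult[symmetric]) auto
      finally show "norm (\<integral>p. ?An n p \<partial>(lborel \<Otimes>\<^sub>M lborel)) \<le> 4 / ?R n * D"
        by (rule ennreal_le_iff[THEN iffD1, rotated]) (use D(2) in auto)
    qed
    have "(\<lambda>n. 4 / ?R n) \<longlonglongrightarrow> 0" by real_asymp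
    then show "(\<lambda>n. 4 / ?R n * D) \<longlonglongrightarrow> 0" by (rule tendsto_mult_left_zero)
  qed
  from LIMSEQ_unique[OF lim this] have "(\<integral>p. ?A p \<partial>(lborel \<Otimes>\<^sub>M lborel)) = 0" .
  then show ?thesis using lborel_pair.integral_fst'[OF Ai] by simp
qed

end
end


section \<open>The dispersion estimate\<close>

lemma hyperbolic_diff_le:
  fixes u v M :: real
  assumes u: "0 \<le> u" "u \<le> M" and v: "0 \<le> v" "v \<le> M"
  shows "\<bar>cosh u - cosh v\<bar> \<le> exp M * \<bar>u - v\<bar>" "\<bar>sinh u - sinh v\<bar> \<le> exp M * \<bar>u - v\<bar>"
proof -
  have c: "cosh x \<le> exp M" if "x \<in> {0..M}" for x :: real
  proof -
    have "cosh x \<le> (exp x + exp x) / 2" unfolding cosh_field_def using that by (intro divide_right_mono add_left_mono) auto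
    also have "\<dots> \<le> exp M" using that by simp
    finally show ?thesis .
  qed
  have s: "\<bar>sinh x\<bar> \<le> exp M" if "x \<in> {0..M}" for x :: real
    using c[OF that] sinh_le_cosh_real[of x] that by simp
  show "\<bar>cosh u - cosh v\<bar> \<le> exp M * \<bar>u - v\<bar>"
    unfolding real_norm_def[symmetric]
    by (rule field_differentiable_bound[of "{0..M}" cosh sinh]) (use s u v in \<open>auto intro!: derivative_eq_intros\<close>)
  show "\<bar>sinh u - sinh v\<bar> \<le> exp M * \<bar>u - v\<bar>"
    unfolding real_norm_def[symmetric]
    by (rule field_differentiable_bound[of "{0..M}" sinh cosh]) (use c u v in \<open>auto intro!: derivative_eq_intros\<close>)
qed

text \<open>A closed set of full measure is the whole space. This gives the pointwise bound on the
  elevation, and it carries the final estimate to the exceptional wave vectors, the origin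
  included.\<close>

lemma AE_le_continuous:
  fixes f g :: "'a::euclidean_space \<Rightarrow> real"
  assumes "continuous_on UNIV f" "continuous_on UNIV g" and ae: "AE x in lborel. f x \<le> g x"
  shows "f x \<le> g x"
proof -
  have "closed {x. f x \<le> g x}" by (rule closed_Collect_le[OF assms(1,2)])
  moreover have "AE x in lebesgue. x \<in> {x. f x \<le> g x}" using AE_completion[OF ae] by simp
  ultimately show ?thesis using mem_closed_if_AE_lebesgue by blast
qed

section \<open>Vanishing of the amplitude and comparison with the flat depth\<close>

context water_wave
begin

definition total where "total k = (\<integral>x. amplitude k x \<partial>lborel)"

lemma total_measurable: "total \<in> borel_measurable borel"
  using lborel.borel_measurable_lebesgue_integral[of "\<lambda>k x. amplitude k x" borel] amplitude_measurable
  unfolding total_def[abs_def]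
  by (simp add: measurable_cong_sets[OF sets_pair_measure_cong[OF refl sets_lborel] refl])

text \<open>The set of averaging may depend on the amplitude. It is taken to be the part of the ball
  where \<open>Re (u * total k)\<close> is positive; a nonnegative function with integral zero
  vanishes almost everywhere, so this part is a null set.\<close>

lemma total_AE_le:
  assumes u: "norm u = 1"
  shows "AE k in lborel. k \<noteq> 0 \<and> norm k \<le> r \<longrightarrow> Re (u * total k) \<le> 0"
proof -
  define B where "B = {k. k \<noteq> 0 \<and> norm k \<le> r \<and> Re (u * total k) > 0}"
  note [measurable] = total_measurable
  have B [measurable]: "B \<in> sets borel" unfolding B_def by measurable
  have fin: "emeasure lborel B < \<infinity>"
    by (intro emeasure_bounded_finite bounded_subset[OF bounded_cball[of 0 r]]) (auto simp: B_def)
  have i: "integrable lborel (\<lambda>k. indicator B k *\<^sub>R total k)"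
  proof (rule Bochner_Integration.integrable_bound)
    let ?c = "cosh (r * (2 * h0)) * (\<integral>x. data_size x \<partial>lborel)"
    show "integrable lborel (\<lambda>k. indicator B k *\<^sub>R ?c)" using fin by (intro integrable_scaleR_left integrable_real_indicator) auto
    have "norm (total k) \<le> ?c" if "k \<in> B" for k
    proof -
      have "norm (total k) \<le> (\<integral>x. cosh (r * (2 * h0)) * data_size x \<partial>lborel)"
        unfolding total_def
        by (intro Bochner_Integration.integral_norm_bound_integral amplitude_integrable integrable_mult_right data_size_integrable norm_amplitude_le)
           (use that in \<open>auto simp: B_def\<close>)
      then show ?thesis by simp
    qed
    then show "AE k in lborel. norm (indicator B k *\<^sub>R total k) \<le> norm (indicator B k *\<^sub>R ?c)"
      by (intro AE_I2) (auto split: split_indicator intro: order_trans[OF _ abs_ge_self])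
  qed measurable
  have "(\<integral>k. Re (u * (indicator B k *\<^sub>R total k)) \<partial>lborel) = Re (u * (\<integral>k. indicator B k *\<^sub>R total k \<partial>lborel))"
    by (simp only: integral_Re[OF integrable_mult_right[OF i]] integral_mult_right_zero)
  also have "\<dots> = 0"
  proof -
    have "(\<integral>k. indicator B k *\<^sub>R total k \<partial>lborel) = 0"
      unfolding total_def by (rule average_amplitude[OF B, of r]) (simp add: B_def)
    then show ?thesis by simp
  qed
  finally have "(\<integral>k. Re (u * (indicator B k *\<^sub>R total k)) \<partial>lborel) = 0" .
  moreover have "AE k in lborel. 0 \<le> Re (u * (indicator B k *\<^sub>R total k))"
    by (intro AE_I2) (simp add: B_def indicator_def)
  ultimately have "AE k in lborel. Re (u * (indicator B k *\<^sub>R total k)) = 0"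
    by (rule integral_nonneg_eq_0_iff_AE[OF integrable_Re[OF integrable_mult_right[OF i]], THEN iffD1, rotated])
  then show ?thesis
  proof eventually_elim
    case (elim k)
    then show ?case by (cases "k \<in> B") (auto simp: B_def)
  qed
qed

text \<open>The four rotations bound the real and the imaginary part from both sides, and countably
  many radii reach every wave vector.\<close>

lemma total_AE: "AE k in lborel. total k = 0"
proof -
  have "AE k in lborel. \<forall>n::nat. \<forall>u\<in>{1, -1, \<i>, - \<i>}. k \<noteq> 0 \<and> norm k \<le> real n \<longrightarrow> Re (u * total k) \<le> 0"
    unfolding AE_all_countable by (intro allI AE_finite_allI total_AE_le) auto
  moreover have "AE k in lborel. k \<noteq> (0::'a)" by (rule AE_lborel_singleton)
  ultimately show ?thesis
  proof eventually_elim
    case (elim k)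
    obtain n where "norm k \<le> real n" using real_arch_simple by blast
    with elim have "Re (u * total k) \<le> 0" if "u \<in> {1, -1, \<i>, - \<i>}" for u using that by blast
    from this[of 1] this[of "-1"] this[of \<i>] this[of "- \<i>"] show ?case by (simp add: complex_eq_iff)
  qed
qed

lemma iwave_integrable:
  assumes f: "integrable lborel f"
  shows "integrable lborel (\<lambda>x. iwave k x * f x)"
proof (rule Bochner_Integration.integrable_bound[OF f])
  have [measurable]: "f \<in> borel_measurable borel" "iwave k \<in> borel_measurable borel"
    using f measurable_compose[OF measurable_Pair1' iwave_measurable, of k] by auto
  show "(\<lambda>x. iwave k x * f x) \<in> borel_measurable lborel" by measurable
qed (simp add: norm_mult)

text \<open>With the depth frozen at \<open>h0\<close> the hyperbolic factors leave the integral.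
  Taking out \<open>mode_cosh k h0\<close> leaves the quotient of \<open>sinh\<close> by
  \<open>cosh\<close>, which is where the hyperbolic tangent of the symbol arises.\<close>

lemma flat_amplitude:
  assumes k: "k \<noteq> 0"
  defines "A \<equiv> (\<lambda>x. iwave k x * (mode_cosh k h0 * complex_of_real (\<eta>t x)
      + (\<Sum>b\<in>Basis. mode_sinh b k h0 * complex_of_real (gq x \<bullet> b))))"
  shows "integrable lborel A"
    and "(\<integral>x. A x \<partial>lborel) = mode_cosh k h0 * (fourier (\<lambda>x. complex_of_real (\<eta>t x)) k - fourier_flux h0 gq k)"
proof -
  have A: "A = (\<lambda>x. mode_cosh k h0 * (iwave k x * complex_of_real (\<eta>t x))
      + (\<Sum>b\<in>Basis. mode_sinh b k h0 * (iwave k x * complex_of_real (gq x \<bullet> b))))"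
    unfolding A_def by (simp add: fun_eq_iff distrib_left sum_distrib_left mult_ac)
  have e: "integrable lborel (\<lambda>x. iwave k x * complex_of_real (\<eta>t x))"
    by (intro iwave_integrable integrable_of_real etat_integrable)
  have g: "integrable lborel (\<lambda>x. iwave k x * complex_of_real (gq x \<bullet> b))" if "b \<in> Basis" for b
    by (intro iwave_integrable gq_integrable that)
  show "integrable lborel A"
    unfolding A by (intro Bochner_Integration.integrable_add Bochner_Integration.integrable_sum integrable_mult_right e g)
  have c: "cosh (norm k * h0) \<noteq> 0" using cosh_real_pos[of "norm k * h0"] by linarith
  have s: "mode_sinh b k h0 = mode_cosh k h0 * (\<i> * complex_of_real (k \<bullet> b) * tanhc h0 k)" for b
    unfolding mode_sinh_def mode_cosh_def tanhc_eq[OF h0 k] tanh_def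
    using c by (simp add: divide_simps)
  have "(\<integral>x. A x \<partial>lborel) = mode_cosh k h0 * (\<integral>x. iwave k x * complex_of_real (\<eta>t x) \<partial>lborel)
      + (\<Sum>b\<in>Basis. mode_sinh b k h0 * (\<integral>x. iwave k x * complex_of_real (gq x \<bullet> b) \<partial>lborel))"
    unfolding A
    using g
    by (simp only: Bochner_Integration.integral_add[OF integrable_mult_right[OF e] Bochner_Integration.integrable_sum[OF integrable_mult_right]]
        Bochner_Integration.integral_sum[OF integrable_mult_right] integral_mult_right_zero)
  also have "\<dots> = mode_cosh k h0 * (fourier (\<lambda>x. complex_of_real (\<eta>t x)) k - fourier_flux h0 gq k)"
  proof -
    have "(\<Sum>b\<in>Basis. mode_sinh b k h0 * J b) = mode_cosh k h0 * (\<i> * tanhc h0 k * (\<Sum>b\<in>Basis. complex_of_real (k \<bullet> b) * J b))" for J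
      unfolding s by (simp add: sum_distrib_left mult_ac)
    then have "mode_cosh k h0 * a + (\<Sum>b\<in>Basis. mode_sinh b k h0 * J b) = mode_cosh k h0 * (a - (- \<i> * tanhc h0 k * (\<Sum>b\<in>Basis. complex_of_real (k \<bullet> b) * J b)))" for a J
      by (simp only: distrib_left mult_minus_left diff_minus_eq_add)
    then show ?thesis unfolding fourier_flux_def fourier_def iwave_def .
  qed
  finally show "(\<integral>x. A x \<partial>lborel) = \<dots>" .
qed

lemma flat_amplitude_diff_le:
  assumes \<epsilon>: "0 \<le> \<epsilon>" "\<epsilon> \<le> 1" and eta: "\<bar>\<eta> x\<bar> \<le> \<epsilon>" and k: "k \<noteq> 0"
  shows "norm (iwave k x * (mode_cosh k h0 * complex_of_real (\<eta>t x)
      + (\<Sum>b\<in>Basis. mode_sinh b k h0 * complex_of_real (gq x \<bullet> b))) - amplitude k x)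
    \<le> exp (norm k * (h0 + 1)) * (norm k * \<epsilon>) * (norm (\<eta>t x) + norm (gq x))"
proof -
  let ?M = "norm k * (h0 + 1)" and ?u = "norm k * h0" and ?v = "norm k * rho x"
  let ?e = "exp ?M * (norm k * \<epsilon>)"
  \<comment> \<open>Both arguments are at most \<open>norm k * (h0 + 1)\<close> because
    \<open>\<epsilon> \<le> 1\<close>; hence the exponent in the final constant.\<close>
  have uv: "0 \<le> ?u" "?u \<le> ?M" "0 \<le> ?v" "?v \<le> ?M"
    using h0 rho_bounds[of x] eta \<epsilon> by (auto simp: rho_def intro!: mult_left_mono)
  have "\<bar>?u - ?v\<bar> = norm k * \<bar>\<eta> x\<bar>" by (simp add: rho_def abs_mult flip: right_diff_distrib)
  also have "\<dots> \<le> norm k * \<epsilon>" using eta by (intro mult_left_mono) auto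
  finally have "exp ?M * \<bar>?u - ?v\<bar> \<le> ?e" by simp
  then have d: "\<bar>cosh ?u - cosh ?v\<bar> \<le> ?e" "\<bar>sinh ?u - sinh ?v\<bar> \<le> ?e"
    using hyperbolic_diff_le[OF uv] by (blast intro: order_trans)+
  \<comment> \<open>The components are recombined into \<open>k \<bullet> gq x\<close> before
    estimating, so that Cauchy-Schwarz yields the full norm of the gradient without a dimensional
    factor.\<close>
  have "(\<Sum>b\<in>Basis. complex_of_real (k \<bullet> b) * complex_of_real (gq x \<bullet> b)) = complex_of_real (k \<bullet> gq x)"
    unfolding euclidean_inner[of k "gq x"] by simp
  from this[symmetric] have s: "(\<Sum>b\<in>Basis. mode_sinh b k y * complex_of_real (gq x \<bullet> b)) = \<i> * complex_of_real (sinh (norm k * y) / norm k) * complex_of_real (k \<bullet> gq x)" for y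
    by (simp only: sum_distrib_left mode_sinh_def mult_ac)
  have "norm (iwave k x * (mode_cosh k h0 * complex_of_real (\<eta>t x)
      + (\<Sum>b\<in>Basis. mode_sinh b k h0 * complex_of_real (gq x \<bullet> b))) - amplitude k x) =
      norm (complex_of_real ((cosh ?u - cosh ?v) * \<eta>t x) + \<i> * complex_of_real ((sinh ?u - sinh ?v) * ((k \<bullet> gq x) / norm k)))"
  proof -
    have "iwave k x * (mode_cosh k h0 * complex_of_real (\<eta>t x)
      + (\<Sum>b\<in>Basis. mode_sinh b k h0 * complex_of_real (gq x \<bullet> b))) - amplitude k x =
      iwave k x * (complex_of_real ((cosh ?u - cosh ?v) * \<eta>t x) + \<i> * complex_of_real ((sinh ?u - sinh ?v) * ((k \<bullet> gq x) / norm k)))"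
      unfolding amplitude_def s mode_cosh_def by (simp add: algebra_simps diff_divide_distrib)
    then show ?thesis by (simp only: norm_mult norm_iwave mult_1)
  qed
  also have "\<dots> \<le> \<bar>cosh ?u - cosh ?v\<bar> * norm (\<eta>t x) + \<bar>sinh ?u - sinh ?v\<bar> * \<bar>(k \<bullet> gq x) / norm k\<bar>"
    by (rule order_trans[OF norm_triangle_ineq]) (simp only: norm_mult norm_of_real norm_ii mult_1 abs_mult real_norm_def order_refl)
  also have "\<dots> \<le> ?e * norm (\<eta>t x) + ?e * norm (gq x)"
  proof -
    have "\<bar>(k \<bullet> gq x) / norm k\<bar> \<le> norm (gq x)"
      using Cauchy_Schwarz_ineq2[of k "gq x"] k by (simp add: divide_le_eq mult.commute)
    then show ?thesis using \<epsilon> by (intro add_mono mult_mono d order_refl) auto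
  qed
  finally show ?thesis by (simp add: distrib_left)
qed

lemma dispersion_estimate:
  assumes \<epsilon>: "0 \<le> \<epsilon>" "\<epsilon> \<le> 1" and eta: "\<And>x. \<bar>\<eta> x\<bar> \<le> \<epsilon>"
    and etat: "(\<integral>x. norm (\<eta>t x) \<partial>lborel) \<le> \<epsilon>"
    and g: "integrable lborel gq" "(\<integral>x. norm (gq x) \<partial>lborel) \<le> \<epsilon>"
  shows "norm (fourier (\<lambda>x. complex_of_real (\<eta>t x)) k - fourier_flux h0 gq k) \<le> 2 * norm k * exp (norm k * (h0 + 1)) * \<epsilon>\<^sup>2"
proof (rule AE_le_continuous[where f = "\<lambda>k. norm (fourier (\<lambda>x. complex_of_real (\<eta>t x)) k - fourier_flux h0 gq k)" and x = k
      and g = "\<lambda>k. 2 * norm k * exp (norm k * (h0 + 1)) * \<epsilon>\<^sup>2"])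
  show "continuous_on UNIV (\<lambda>k. norm (fourier (\<lambda>x. complex_of_real (\<eta>t x)) k - fourier_flux h0 gq k))"
    by (intro continuous_intros continuous_fourier continuous_fourier_flux integrable_of_real etat_integrable gq_integrable)
  show "continuous_on UNIV (\<lambda>k::'a. 2 * norm k * exp (norm k * (h0 + 1)) * \<epsilon>\<^sup>2)"
    by (intro continuous_intros)
  show "AE k in lborel. norm (fourier (\<lambda>x. complex_of_real (\<eta>t x)) k - fourier_flux h0 gq k) \<le> 2 * norm k * exp (norm k * (h0 + 1)) * \<epsilon>\<^sup>2"
    using total_AE AE_lborel_singleton[of 0]
  proof eventually_elim
    case (elim k)
    let ?d = "fourier (\<lambda>x. complex_of_real (\<eta>t x)) k - fourier_flux h0 gq k"
    let ?A = "\<lambda>x. iwave k x * (mode_cosh k h0 * complex_of_real (\<eta>t x)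
      + (\<Sum>b\<in>Basis. mode_sinh b k h0 * complex_of_real (gq x \<bullet> b)))"
    let ?K = "exp (norm k * (h0 + 1)) * (norm k * \<epsilon>)"
    have K: "?K \<ge> 0" using \<epsilon> by simp
    \<comment> \<open>As \<open>cosh\<close> is at least 1, passing from the flat amplitude to the
      difference of the transforms costs nothing.\<close>
    have "norm ?d \<le> cosh (norm k * h0) * norm ?d"
      using mult_right_mono[OF cosh_real_ge_1[of "norm k * h0"], of "norm ?d"] by simp
    also have "\<dots> = norm (\<integral>x. ?A x \<partial>lborel)"
      unfolding flat_amplitude(2)[OF elim(2)] by (simp add: norm_mult mode_cosh_def)
    also have "\<dots> = norm (\<integral>x. ?A x - amplitude k x \<partial>lborel)"
      using elim(1) by (simp add: Bochner_Integration.integral_diff[OF flat_amplitude(1)[OF elim(2)] amplitude_integrable] total_def)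
    also have "\<dots> \<le> (\<integral>x. ?K * (norm (\<eta>t x) + norm (gq x)) \<partial>lborel)"
      by (intro Bochner_Integration.integral_norm_bound_integral Bochner_Integration.integrable_diff flat_amplitude(1) amplitude_integrable
          integrable_mult_right Bochner_Integration.integrable_add integrable_norm etat_integrable g(1) flat_amplitude_diff_le \<epsilon> eta elim(2))
    also have "\<dots> = ?K * ((\<integral>x. norm (\<eta>t x) \<partial>lborel) + (\<integral>x. norm (gq x) \<partial>lborel))"
      using etat_integrable g(1) by simp
    also have "\<dots> \<le> ?K * (\<epsilon> + \<epsilon>)" using etat g(2) K by (intro mult_left_mono add_mono)
    also have "\<dots> = 2 * norm k * exp (norm k * (h0 + 1)) * \<epsilon>\<^sup>2" by (simp add: power2_eq_square)
    finally show ?case .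
  qed
qed

end

section \<open>From norms and boundary values to the standing assumptions\<close>

lemma L1_norm_lessD:
  fixes f :: "'a::euclidean_space \<Rightarrow> 'b::{banach, second_countable_topology}"
  assumes "f \<in> borel_measurable lborel" "L1_norm f < ennreal \<epsilon>" "0 \<le> \<epsilon>"
  shows "integrable lborel f" "(\<integral>x. norm (f x) \<partial>lborel) \<le> \<epsilon>"
proof -
  show i: "integrable lborel f"
    using assms unfolding L1_norm_def by (intro integrableI_bounded) (auto intro: less_trans)
  have "ennreal (\<integral>x. norm (f x) \<partial>lborel) \<le> ennreal \<epsilon>"
    using assms(2) nn_integral_eq_integral[OF integrable_norm[OF i]] unfolding L1_norm_def by simp
  then show "(\<integral>x. norm (f x) \<partial>lborel) \<le> \<epsilon>" using assms(3) by (simp add: ennreal_le_iff)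
qed

text \<open>Continuity of the elevation upgrades the essential bound to one at every point, as the
  flattening of the domain demands.\<close>

lemma Linf_norm_lessD:
  fixes f :: "'a::euclidean_space \<Rightarrow> real"
  assumes "continuous_on UNIV f" "Linf_norm f < ennreal \<epsilon>" "0 \<le> \<epsilon>"
  shows "\<bar>f x\<bar> \<le> \<epsilon>"
proof (rule AE_le_continuous[where f = "\<lambda>x. \<bar>f x\<bar>" and g = "\<lambda>_. \<epsilon>"])
  show "AE x in lborel. \<bar>f x\<bar> \<le> \<epsilon>"
    using esssup_AE[where M = lborel and f = "\<lambda>x. ennreal (norm (f x))"]
  proof eventually_elim
    case (elim x)
    then have "ennreal \<bar>f x\<bar> \<le> ennreal \<epsilon>" using assms(2) unfolding Linf_norm_def by simp
    then show ?case using assms(3) by (simp add: ennreal_le_iff)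
  qed
qed (intro continuous_intros assms)+

lemma grad_inner_Basis: "b \<in> Basis \<Longrightarrow> grad f x \<bullet> b = partial b f x"
  unfolding grad_def by (simp add: inner_sum_left_Basis)

lemma grad_inner:
  "grad f z \<bullet> v = (\<Sum>c\<in>Basis. partial c f z * (v \<bullet> c))"
  unfolding grad_def by (simp only: inner_sum_left inner_scaleR_left inner_commute[of v])

text \<open>Each component of the gradient is smooth in the fluid and agrees there almost everywhere
  with a Sobolev function on the whole space, so \<open>sobolev_interior\<close> supplies the two
  energy bounds. The bottom normal points downwards, so the vanishing normal derivative is that of
  the vertical derivative up to sign.\<close>

lemma water_waveI:
  assumes h0: "h0 > 0" and C1: "Ck_on 1 UNIV \<eta>" and small: "\<And>x. \<bar>\<eta> x\<bar> \<le> h0 / 2"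
    and bvp: "water_wave_bvp h0 \<eta> \<eta>t \<phi> q"
    and sobolev: "\<forall>b\<in>Basis. in_sobolev_on s (fluid_domain h0 \<eta>) (\<lambda>z. complex_of_real (grad \<phi> z \<bullet> b))" "s \<ge> 1"
    and data: "integrable lborel \<eta>t" "integrable lborel gq"
      "tempered_function (\<lambda>x. complex_of_real (q x))" "distr_gradient q gq"
  shows "water_wave h0 \<eta> \<phi> \<eta>t q gq"
proof -
  interpret fluid h0 \<eta> \<phi> using h0 C1 small bvp by unfold_locales (auto simp: water_wave_bvp_def)
  have E: "(\<integral>\<^sup>+z. indicator (fluid_domain h0 \<eta>) z * ennreal ((partial c \<phi> z)\<^sup>2) \<partial>lborel) < \<infinity>"
      "(\<integral>\<^sup>+z. indicator (fluid_domain h0 \<eta>) z * ennreal ((partial (0, 1) (partial c \<phi>) z)\<^sup>2) \<partial>lborel) < \<infinity>"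
    if c: "c \<in> Basis" for c
  proof -
    let ?g = "\<lambda>z. complex_of_real (partial c \<phi> z)"
    obtain F where F: "in_sobolev s F" "AE z in lborel. z \<in> fluid_domain h0 \<eta> \<longrightarrow> F z = ?g z"
      using sobolev(1)[rule_format, OF c] unfolding in_sobolev_on_def grad_inner_Basis[OF c] by blast
    have d: "?g differentiable (at z)" "partial (0, 1) ?g z = complex_of_real (partial (0, 1) (partial c \<phi>) z)"
      if "z \<in> fluid_domain h0 \<eta>" for z
      using compose_real_partial[OF phi_partial_differentiable[OF that c] DERIV_ident] by auto
    note si = sobolev_interior[OF F(1) sobolev(2) open_domain F(2) d(1) vertical_Basis]
    show "(\<integral>\<^sup>+z. indicator (fluid_domain h0 \<eta>) z * ennreal ((partial c \<phi> z)\<^sup>2) \<partial>lborel) < \<infinity>"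
      using si(1) by simp
    have "(\<integral>\<^sup>+z. indicator (fluid_domain h0 \<eta>) z * ennreal ((partial (0, 1) (partial c \<phi>) z)\<^sup>2) \<partial>lborel)
      = (\<integral>\<^sup>+z. indicator (fluid_domain h0 \<eta>) z * ennreal ((norm (partial (0, 1) ?g z))\<^sup>2) \<partial>lborel)"
      by (intro nn_integral_cong) (auto simp: d split: split_indicator)
    then show "(\<integral>\<^sup>+z. indicator (fluid_domain h0 \<eta>) z * ennreal ((partial (0, 1) (partial c \<phi>) z)\<^sup>2) \<partial>lborel) < \<infinity>"
      using si(2) by simp
  qed
  have n: "grad \<phi> z \<bullet> normal_bottom = - partial (0, 1) \<phi> z" for z
    unfolding grad_inner sum_Basis_prod normal_bottom_def by simp
  have ns: "grad \<phi> z \<bullet> normal_surface \<eta> x = partial (0, 1) \<phi> z - (\<Sum>b\<in>Basis. partial b \<eta> x * partial (b, 0) \<phi> z)" for z x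
    unfolding grad_inner sum_Basis_prod normal_surface_def by (simp add: grad_inner_Basis sum_negf mult.commute)
  note b = bvp[unfolded water_wave_bvp_def bottom_trace_def surface_trace_def n ns fst_conv]
  have bottom: "AE x in lborel. ((\<lambda>y. partial (0, 1) \<phi> (x, y)) \<longlongrightarrow> 0) (at_right (- h0))"
    using b[THEN conjunct2, THEN conjunct1] by (subst (asm) tendsto_minus_cancel_left[symmetric]) simp
  show ?thesis
    by unfold_locales
       (use E bottom b data in \<open>auto intro!: integrable_of_real integrable_inner_left\<close>)
qed

text \<open>The symbol times the transform of \<open>q\<close> is a priori a distribution.
  \<open>Q\<close> is its continuous representative, unique because continuous functions with equal
  pairings coincide; through it the estimate acquires a meaning at every single \<open>k\<close>.
  The threshold and the function \<open>C\<close> are chosen before the wave, so the estimate is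
  uniform over all solutions at all times.\<close>

theorem proposition4:
  fixes n :: nat and h0 s1 s2 :: real
  assumes "n \<ge> 2" and "CARD('m::finite) = n - 1" and "h0 > 0"
    and "s1 \<ge> real n / 2" and "s2 > real n - 1 / 2"
  shows "\<forall>c>0. \<exists>\<epsilon>0>0. \<exists>C :: real ^ 'm \<Rightarrow> real. \<forall>\<epsilon>. 0 < \<epsilon> \<and> \<epsilon> < \<epsilon>0 \<longrightarrow>
    (\<forall>(\<eta> :: real ^ 'm \<Rightarrow> real \<Rightarrow> real) (\<phi> :: (real ^ 'm) \<times> real \<Rightarrow> real \<Rightarrow> real)
      (q :: real ^ 'm \<Rightarrow> real \<Rightarrow> real) (t :: real)
      (\<eta>t :: real ^ 'm \<Rightarrow> real) (gq :: real ^ 'm \<Rightarrow> real ^ 'm).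
        (\<forall>x. \<eta> x t > - h0) \<and>
        Ck_on 1 UNIV (\<lambda>x. \<eta> x t) \<and>
        \<eta>t \<in> borel_measurable lborel \<and>
        (AE x in lborel. ((\<lambda>\<tau>. \<eta> x \<tau>) has_real_derivative \<eta>t x) (at t)) \<and>
        water_wave_bvp h0 (\<lambda>x. \<eta> x t) \<eta>t (\<lambda>z. \<phi> z t) (\<lambda>x. q x t) \<and>
        tempered_function (\<lambda>x. complex_of_real (q x t)) \<and>
        gq \<in> borel_measurable lborel \<and>
        distr_gradient (\<lambda>x. q x t) gq \<and>
        (\<forall>b\<in>Basis. in_sobolev_on s1 (fluid_domain h0 (\<lambda>x. \<eta> x t))
           (\<lambda>z. complex_of_real (grad (\<lambda>w. \<phi> w t) z \<bullet> b))) \<and>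
        in_sobolev s2 (\<lambda>x. complex_of_real (\<eta> x t)) \<and>
        max (L1_norm \<eta>t) (max (Linf_norm (\<lambda>x. \<eta> x t)) (L1_norm gq)) < ennreal \<epsilon>
      \<longrightarrow> (\<exists>Q :: real ^ 'm \<Rightarrow> complex.
        continuous_on UNIV Q \<and>
        represented_by
          (mult_distr (\<lambda>k. norm k * tanh (norm k * h0))
            (fourier_distr (fun_distr (\<lambda>x. complex_of_real (q x t))))) Q \<and>
        (\<forall>k. norm k < c / \<epsilon> \<longrightarrow>
          norm (fourier (\<lambda>x. complex_of_real (\<eta>t x)) k - Q k) \<le> C k * \<epsilon>\<^sup>2)))"
\<comment> \<open>In the threshold, 1 yields the exponent \<open>h0 + 1\<close> and
  \<open>h0 / 2\<close> the bound on the elevation in \<open>fluid\<close>. In the constant, the 2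
  collects two \<open>L^1\<close> norms, and \<open>norm k * exp (norm k * (h0 + 1))\<close> comes
  from the mean value estimate for \<open>cosh\<close> and \<open>sinh\<close>.\<close>
proof (intro allI impI exI[of _ "min 1 (h0 / 2)"] exI[of _ "\<lambda>k. 2 * norm k * exp (norm k * (h0 + 1))"] conjI; (elim conjE)?)
  show "0 < min 1 (h0 / 2)" using assms(3) by simp
next
  fix c \<epsilon> :: real and \<eta> :: "real ^ 'm \<Rightarrow> real \<Rightarrow> real" and \<phi> :: "(real ^ 'm) \<times> real \<Rightarrow> real \<Rightarrow> real"
    and q :: "real ^ 'm \<Rightarrow> real \<Rightarrow> real" and t :: real and \<eta>t :: "real ^ 'm \<Rightarrow> real" and gq :: "real ^ 'm \<Rightarrow> real ^ 'm"
  assume \<epsilon>: "0 < \<epsilon>" "\<epsilon> < min 1 (h0 / 2)"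
    and C1: "Ck_on 1 UNIV (\<lambda>x. \<eta> x t)" and mt: "\<eta>t \<in> borel_measurable lborel"
    and bvp: "water_wave_bvp h0 (\<lambda>x. \<eta> x t) \<eta>t (\<lambda>z. \<phi> z t) (\<lambda>x. q x t)"
    and q: "tempered_function (\<lambda>x. complex_of_real (q x t))"
    and mg: "gq \<in> borel_measurable lborel" and dg: "distr_gradient (\<lambda>x. q x t) gq"
    and sob: "\<forall>b\<in>Basis. in_sobolev_on s1 (fluid_domain h0 (\<lambda>x. \<eta> x t)) (\<lambda>z. complex_of_real (grad (\<lambda>w. \<phi> w t) z \<bullet> b))"
    and norms: "max (L1_norm \<eta>t) (max (Linf_norm (\<lambda>x. \<eta> x t)) (L1_norm gq)) < ennreal \<epsilon>"
  \<comment> \<open>From \<open>n \<ge> 2\<close>; for \<open>n = 2\<close> the hypothesis on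
    \<open>s1\<close> gives exactly the one derivative of the gradient that
    \<open>sobolev_interior\<close> asks for.\<close>
  have s1: "s1 \<ge> 1" using assms(1,4) by linarith
  have "continuous_on UNIV (\<lambda>x. \<eta> x t)" using C1[unfolded Ck_on_def, THEN spec, of "[]"] by simp
  then have eta: "\<bar>\<eta> x t\<bar> \<le> \<epsilon>" for x using norms \<epsilon> by (intro Linf_norm_lessD[where f = "\<lambda>x. \<eta> x t"]) auto
  have et: "integrable lborel \<eta>t" "(\<integral>x. norm (\<eta>t x) \<partial>lborel) \<le> \<epsilon>"
    using L1_norm_lessD[OF mt, of \<epsilon>] norms \<epsilon> by auto
  have g: "integrable lborel gq" "(\<integral>x. norm (gq x) \<partial>lborel) \<le> \<epsilon>"
    using L1_norm_lessD[OF mg, of \<epsilon>] norms \<epsilon> by auto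
  interpret water_wave h0 "\<lambda>x. \<eta> x t" "\<lambda>z. \<phi> z t" \<eta>t "\<lambda>x. q x t" gq
    using \<epsilon> by (intro water_waveI[OF assms(3) C1 _ bvp sob s1 et(1) g(1) q dg] order_trans[OF eta]) simp
  have "norm (fourier (\<lambda>x. complex_of_real (\<eta>t x)) k - fourier_flux h0 gq k) \<le> 2 * norm k * exp (norm k * (h0 + 1)) * \<epsilon>\<^sup>2" for k
    using \<epsilon> by (intro dispersion_estimate eta et g) auto
  then show "\<exists>Q :: real ^ 'm \<Rightarrow> complex. continuous_on UNIV Q \<and>
      represented_by (mult_distr (\<lambda>k. norm k * tanh (norm k * h0))
          (fourier_distr (fun_distr (\<lambda>x. complex_of_real (q x t))))) Q \<and>
      (\<forall>k. norm k < c / \<epsilon> \<longrightarrow> norm (fourier (\<lambda>x. complex_of_real (\<eta>t x)) k - Q k) \<le> 2 * norm k * exp (norm k * (h0 + 1)) * \<epsilon>\<^sup>2)"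
    using continuous_fourier_flux[OF gq_integrable] represented_by_fourier_flux[OF assms(3) q dg gq_integrable] by blast
qed

end
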